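(* A subcategory $\mathcal{T}$ of $\mathcal{C}_2$ is cluster tilting if and only if its indecomposable objects correspond to a triangulation of the completed $\infty$-gon containing a fountain at some $a\in\mathbb{Z}$.
   Context: Let $R=\mathbb{C}[x,y]/(x^2)$, graded with $\deg x=1$, $\deg y=-1$; $M(j)_n=M_{j+n}$. $\mathcal{C}_2$ is the Frobenius category of finitely generated $\mathbb{Z}$-graded maximal Cohen–Macaulay $R$-modules with degree-preserving morphisms. An arc of the completed $\infty$-gon is $(a,b)$ with $a\in\mathbb{Z}\cup\{-\infty\}$, $b\in\mathbb{Z}$, $a<b$; indecomposables correspond to arcs via $(x,y^k)(j)\leftrightarrow(-j-k,1-j)$ ($k\ge0$, $(x,y^0)=R$) and $\mathbb{C}[y](j)=(R/(x))(j)\leftrightarrow(-\infty,-j)$. Arcs $(a,b),(c,d)$ cross if $a<c<b<d$ or $c<a<d<b$; a triangulation is a maximal set of pairwise non-crossing arcs. A right fountain at $a$ is $\{(a,b_i)\}_{i\in\mathbb{N}}$ with $(b_i)$ strictly increasing, a left fountain at $a$ is $\{(b_i,a)\}_{i\in\mathbb{N}}$ with $(b_i)$ strictly decreasing, a fountain at $a$ is the union of both. Subcategories are full, additive, closed under isomorphisms and summands. $\mathcal{T}$ is cluster tilting if it is functorially finite and $\{M\in\mathcal{C}_2\mid\mathrm{Ext}^1(\mathcal{T},M)=0\}=\mathcal{T}=\{M\in\mathcal{C}_2\mid\mathrm{Ext}^1(M,\mathcal{T})=0\}$. *)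

theory Defs
  imports "Jordan_Normal_Form.Matrix"
begin

section \<open>Z-graded modules over R = C[x,y]/(x^2), deg x = 1, deg y = -1\<close>

text \<open>A graded R-module with finite-dimensional graded pieces is given by
  dimensions gdim n of M_n (identified with C^(gdim n)), the action of x
  as linear maps M_n -> M_(n+1) and the action of y as maps M_n -> M_(n-1).
  Every finitely generated graded R-module has finite-dimensional graded
  pieces (each R_n has dimension at most 2), so up to isomorphism every object
  of C_2 is represented; all notions below are isomorphism invariant.\<close>

record gmod =
  gdim :: "int \<Rightarrow> nat"
  xact :: "int \<Rightarrow> complex mat"
  yact :: "int \<Rightarrow> complex mat"

definition wf_gmod :: "gmod \<Rightarrow> bool" where
  "wf_gmod M \<longleftrightarrow>
     (\<forall>n. xact M n \<in> carrier_mat (gdim M (n+1)) (gdim M n)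
        \<and> yact M n \<in> carrier_mat (gdim M (n-1)) (gdim M n)
        \<and> xact M (n+1) * xact M n = 0\<^sub>m (gdim M (n+2)) (gdim M n)
        \<and> xact M (n-1) * yact M n = yact M (n+1) * xact M n)"

fun yiter :: "gmod \<Rightarrow> nat \<Rightarrow> int \<Rightarrow> complex vec \<Rightarrow> complex vec" where
  "yiter M 0 n v = v"
| "yiter M (Suc b) n v = yact M (n - int b) *\<^sub>v yiter M b n v"

definition mono_act :: "gmod \<Rightarrow> bool \<Rightarrow> nat \<Rightarrow> int \<Rightarrow> complex vec \<Rightarrow> complex vec" where
  "mono_act M e b n v = (if e then xact M (n - int b) *\<^sub>v yiter M b n v else yiter M b n v)"

definition mono_deg :: "bool \<Rightarrow> nat \<Rightarrow> int \<Rightarrow> int" where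
  "mono_deg e b n = n - int b + (if e then 1 else 0)"

text \<open>Finitely generated: there is a finite set G of homogeneous elements
  (pairs (degree, element)) such that every homogeneous element is a C-linear
  combination of monomials applied to elements of G (R is spanned over C by
  the monomials y^b and x y^b).\<close>
definition fin_gen :: "gmod \<Rightarrow> bool" where
  "fin_gen M \<longleftrightarrow> (\<exists>G. finite G \<and> (\<forall>(n,v)\<in>G. v \<in> carrier_vec (gdim M n)) \<and>
     (\<forall>m. \<forall>w \<in> carrier_vec (gdim M m).
        \<exists>ts :: (complex \<times> (int \<times> complex vec) \<times> bool \<times> nat) list.
          (\<forall>(c,(n,v),e,b) \<in> set ts. (n,v) \<in> G \<and> mono_deg e b n = m) \<and>
          w = foldr (\<lambda>(c,(n,v),e,b) acc. c \<cdot>\<^sub>v mono_act M e b n v + acc) ts (0\<^sub>v (gdim M m))))"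

text \<open>Maximal Cohen-Macaulay: R has Krull dimension 1 and unique graded maximal
  ideal m = (x,y); M is MCM iff depth M \<ge> 1 (or M = 0), i.e.
  Hom_R(k(j), M) = 0 for all j: no nonzero homogeneous element is annihilated
  by both x and y.\<close>
definition mcm :: "gmod \<Rightarrow> bool" where
  "mcm M \<longleftrightarrow> (\<forall>n. \<forall>v \<in> carrier_vec (gdim M n).
      xact M n *\<^sub>v v = 0\<^sub>v (gdim M (n+1)) \<and> yact M n *\<^sub>v v = 0\<^sub>v (gdim M (n-1))
      \<longrightarrow> v = 0\<^sub>v (gdim M n))"

definition C2 :: "gmod set" where
  "C2 = {M. wf_gmod M \<and> fin_gen M \<and> mcm M}"

definition is_hom :: "gmod \<Rightarrow> gmod \<Rightarrow> (int \<Rightarrow> complex mat) \<Rightarrow> bool" where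
  "is_hom M N f \<longleftrightarrow>
     (\<forall>n. f n \<in> carrier_mat (gdim N n) (gdim M n)
        \<and> f (n+1) * xact M n = xact N n * f n
        \<and> f (n-1) * yact M n = yact N n * f n)"

definition hcomp :: "(int \<Rightarrow> complex mat) \<Rightarrow> (int \<Rightarrow> complex mat) \<Rightarrow> (int \<Rightarrow> complex mat)" where
  "hcomp g f = (\<lambda>n. g n * f n)"

definition hid :: "gmod \<Rightarrow> (int \<Rightarrow> complex mat)" where
  "hid M = (\<lambda>n. 1\<^sub>m (gdim M n))"

definition iso :: "gmod \<Rightarrow> gmod \<Rightarrow> bool" where
  "iso M N \<longleftrightarrow> (\<exists>f g. is_hom M N f \<and> is_hom N M g \<and>
      hcomp g f = hid M \<and> hcomp f g = hid N)"

definition dsum :: "gmod \<Rightarrow> gmod \<Rightarrow> gmod" where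
  "dsum A B = \<lparr> gdim = (\<lambda>n. gdim A n + gdim B n),
     xact = (\<lambda>n. four_block_mat (xact A n) (0\<^sub>m (gdim A (n+1)) (gdim B n))
                                (0\<^sub>m (gdim B (n+1)) (gdim A n)) (xact B n)),
     yact = (\<lambda>n. four_block_mat (yact A n) (0\<^sub>m (gdim A (n-1)) (gdim B n))
                                (0\<^sub>m (gdim B (n-1)) (gdim A n)) (yact B n)) \<rparr>"

definition zero_gmod :: gmod where
  "zero_gmod = \<lparr> gdim = (\<lambda>n. 0), xact = (\<lambda>n. 0\<^sub>m 0 0), yact = (\<lambda>n. 0\<^sub>m 0 0) \<rparr>"

definition ses :: "gmod \<Rightarrow> gmod \<Rightarrow> gmod \<Rightarrow> (int \<Rightarrow> complex mat) \<Rightarrow> (int \<Rightarrow> complex mat) \<Rightarrow> bool" where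
  "ses B E A i p \<longleftrightarrow> is_hom B E i \<and> is_hom E A p \<and>
     (\<forall>n. (\<forall>v \<in> carrier_vec (gdim B n). i n *\<^sub>v v = 0\<^sub>v (gdim E n) \<longrightarrow> v = 0\<^sub>v (gdim B n))
        \<and> (\<forall>w \<in> carrier_vec (gdim A n). \<exists>u \<in> carrier_vec (gdim E n). p n *\<^sub>v u = w)
        \<and> (\<forall>u \<in> carrier_vec (gdim E n). p n *\<^sub>v u = 0\<^sub>v (gdim A n) \<longleftrightarrow>
              (\<exists>v \<in> carrier_vec (gdim B n). u = i n *\<^sub>v v)))"

definition ext1_zero :: "gmod \<Rightarrow> gmod \<Rightarrow> bool" where
  "ext1_zero A B \<longleftrightarrow> (\<forall>E i p. E \<in> C2 \<and> ses B E A i p \<longrightarrow>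
      (\<exists>s. is_hom A E s \<and> hcomp p s = hid A))"

definition subcat :: "gmod set \<Rightarrow> bool" where
  "subcat T \<longleftrightarrow> T \<subseteq> C2 \<and> zero_gmod \<in> T
     \<and> (\<forall>M N. M \<in> T \<and> N \<in> C2 \<and> iso M N \<longrightarrow> N \<in> T)
     \<and> (\<forall>M N. M \<in> T \<and> N \<in> T \<longrightarrow> dsum M N \<in> T)
     \<and> (\<forall>M A B. M \<in> T \<and> A \<in> C2 \<and> B \<in> C2 \<and> iso M (dsum A B) \<longrightarrow> A \<in> T)"

definition contrav_finite :: "gmod set \<Rightarrow> bool" where
  "contrav_finite T \<longleftrightarrow> (\<forall>M \<in> C2. \<exists>X f. X \<in> T \<and> is_hom X M f \<and>
      (\<forall>Y g. Y \<in> T \<and> is_hom Y M g \<longrightarrow> (\<exists>h. is_hom Y X h \<and> hcomp f h = g)))"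

definition cov_finite :: "gmod set \<Rightarrow> bool" where
  "cov_finite T \<longleftrightarrow> (\<forall>M \<in> C2. \<exists>X f. X \<in> T \<and> is_hom M X f \<and>
      (\<forall>Y g. Y \<in> T \<and> is_hom M Y g \<longrightarrow> (\<exists>h. is_hom X Y h \<and> hcomp h f = g)))"

definition funct_finite :: "gmod set \<Rightarrow> bool" where
  "funct_finite T \<longleftrightarrow> contrav_finite T \<and> cov_finite T"

definition cluster_tilting :: "gmod set \<Rightarrow> bool" where
  "cluster_tilting T \<longleftrightarrow> funct_finite T \<and>
     {M \<in> C2. \<forall>X \<in> T. ext1_zero X M} = T \<and>
     T = {M \<in> C2. \<forall>X \<in> T. ext1_zero M X}"

definition shift :: "int \<Rightarrow> gmod \<Rightarrow> gmod" where
  "shift j M = \<lparr> gdim = (\<lambda>n. gdim M (j+n)), xact = (\<lambda>n. xact M (j+n)),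
                 yact = (\<lambda>n. yact M (j+n)) \<rparr>"

text \<open>The ideal (x,y^k) of R: degree-n basis is x y^(1-n) (if n \<le> 1, index 0)
  followed by y^(-n) (if n \<le> -k, index 1). For k = 0 this is R itself.\<close>
definition ideal_dim :: "nat \<Rightarrow> int \<Rightarrow> nat" where
  "ideal_dim k n = (if n \<le> 1 then 1 else 0) + (if n \<le> - int k then 1 else 0)"

definition ideal_mod :: "nat \<Rightarrow> gmod" where
  "ideal_mod k = \<lparr> gdim = ideal_dim k,
     xact = (\<lambda>n. mat (ideal_dim k (n+1)) (ideal_dim k n) (\<lambda>(i,j). if i = 0 \<and> j = 1 then 1 else 0)),
     yact = (\<lambda>n. mat (ideal_dim k (n-1)) (ideal_dim k n) (\<lambda>(i,j). if i = j then 1 else 0)) \<rparr>"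

text \<open>C[y] = R/(x): degree-n basis y^(-n) for n \<le> 0.\<close>
definition cy_mod :: gmod where
  "cy_mod = \<lparr> gdim = (\<lambda>n. if n \<le> 0 then 1 else 0),
     xact = (\<lambda>n. 0\<^sub>m (if n + 1 \<le> 0 then 1 else 0) (if n \<le> 0 then 1 else 0)),
     yact = (\<lambda>n. mat (if n - 1 \<le> 0 then 1 else 0) (if n \<le> 0 then 1 else 0) (\<lambda>(i,j). if i = j then 1 else 0)) \<rparr>"

datatype ext_int = NegInf | Fin int

fun ext_less :: "ext_int \<Rightarrow> ext_int \<Rightarrow> bool" where
  "ext_less NegInf NegInf = False"
| "ext_less NegInf (Fin _) = True"
| "ext_less (Fin _) NegInf = False"
| "ext_less (Fin a) (Fin b) = (a < b)"

type_synonym arc = "ext_int \<times> int"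

definition is_arc :: "arc \<Rightarrow> bool" where
  "is_arc \<alpha> \<longleftrightarrow> ext_less (fst \<alpha>) (Fin (snd \<alpha>))"

definition arcs_cross :: "arc \<Rightarrow> arc \<Rightarrow> bool" where
  "arcs_cross \<alpha> \<beta> \<longleftrightarrow> (case \<alpha> of (a,b) \<Rightarrow> case \<beta> of (c,d) \<Rightarrow>
      (ext_less a c \<and> ext_less c (Fin b) \<and> b < d) \<or>
      (ext_less c a \<and> ext_less a (Fin d) \<and> d < b))"

definition triangulation :: "arc set \<Rightarrow> bool" where
  "triangulation S \<longleftrightarrow> (\<forall>\<alpha>\<in>S. is_arc \<alpha>) \<and>
     (\<forall>\<alpha>\<in>S. \<forall>\<beta>\<in>S. \<not> arcs_cross \<alpha> \<beta>) \<and>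
     (\<forall>\<alpha>. is_arc \<alpha> \<and> (\<forall>\<beta>\<in>S. \<not> arcs_cross \<alpha> \<beta>) \<longrightarrow> \<alpha> \<in> S)"

definition has_fountain_at :: "arc set \<Rightarrow> int \<Rightarrow> bool" where
  "has_fountain_at S a \<longleftrightarrow>
     (\<exists>b :: nat \<Rightarrow> int. strict_mono b \<and> (\<forall>i. (Fin a, b i) \<in> S)) \<and>
     (\<exists>c :: nat \<Rightarrow> ext_int. (\<forall>i. ext_less (c (Suc i)) (c i)) \<and> (\<forall>i. (c i, a) \<in> S))"

text \<open>The indecomposable object of C_2 corresponding to an arc:
  (x,y^k)(j) <-> (-j-k, 1-j) and C[y](j) <-> (-\<infinity>, -j).\<close>
fun module_of_arc :: "arc \<Rightarrow> gmod" where
  "module_of_arc (Fin a, b) = shift (1 - b) (ideal_mod (nat (b - 1 - a)))"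
| "module_of_arc (NegInf, b) = shift (- b) cy_mod"

definition arcs_of :: "gmod set \<Rightarrow> arc set" where
  "arcs_of T = {\<alpha>. is_arc \<alpha> \<and> module_of_arc \<alpha> \<in> T}"

end

theory Submission
  imports Defs
begin

text \<open>
  Since \<open>y\<close> is injective on a maximal Cohen-Macaulay module and bijective in low degrees, such a module
  is a finite-dimensional space (the colimit along \<open>y\<close>) with a finite filtration and a nilpotent
  operator \<open>X\<close> of square zero raising the filtration by one. Splitting off suitable
  subspaces \<open>\<langle>v, X v\<rangle>\<close> or \<open>\<langle>v\<rangle>\<close> shows that it is a direct sum of arc modules.

  Over \<open>\<complex>[y]\<close> all extensions split, so \<open>Ext\<^sup>1\<close> is the space of cocycles \<open>A \<rightarrow> B(1)\<close> modulo coboundaries.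
  For arc modules this is nonzero exactly if the arcs cross, or both are infinite and \<open>b < d\<close> for
  their right ends. Hence a cluster tilting subcategory corresponds to a triangulation with at most
  one infinite arc.

  If it had no infinite arc, a right approximation of \<open>(-\<infinity>, 0)\<close> would bound the right ends of the
  arcs \<open>(p, q)\<close> with \<open>p \<le> 0\<close>, while every \<open>(-\<infinity>, b)\<close> would have to be crossed: a contradiction. If
  \<open>(-\<infinity>, a)\<close> is its infinite arc, every other \<open>(-\<infinity>, b)\<close> must be crossed, which forces a
  fountain at \<open>a\<close>. Conversely, a fountain at \<open>a\<close> excludes all infinite arcs except \<open>(-\<infinity>, a)\<close>, and
  approximations exist since each set of relevant arcs is either served by \<open>(-\<infinity>, a)\<close>,
  finite, or bounded so that Dickson's lemma applies.
\<close>

section \<open>Linear algebra\<close>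

text \<open>Ext is replaced by the cocycle condition \<open>vanish\<close> because that condition is
  natural and additive in both arguments, so it has to be computed for pairs of arcs only. The
  splitting over C[y] behind it is itself read off from the decomposition, arc modules being free
  over C[y] on one or two generators. The obstacle is an asymmetry. Two infinite arcs never cross,
  but for \<open>b < d\<close> the generator of \<open>(-\<infinity>, b)\<close> can be sent to the
  multiple of the generator of \<open>(-\<infinity>, d)\<close> one degree higher, and this cocycle
  is no coboundary, since \<open>x\<close> is zero on both modules; in the other direction there is
  no such multiple. Cluster tilting is thus maximality for \<open>bad\<close>, from the left and
  from the right, whereas a triangulation is maximal for crossing, and the fountain reconciles the
  two. To show that an infinite arc other than \<open>(-\<infinity>, a)\<close> is crossed, the side
  to test is the one on which \<open>(-\<infinity>, a)\<close> is no obstruction: what obstructs is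
  then a finite arc, and applied at the end of an outermost arc at \<open>a\<close> it contradicts
  the choice of that arc.\<close>

lemma mat_assoc: "dim_col A = dim_row B \<Longrightarrow> dim_col B = dim_row C \<Longrightarrow> (A * B) * C = A * (B * C :: 'a :: semiring_0 mat)"
  by (rule assoc_mult_mat) auto

lemma mat_vec_assoc:
  "dim_col A = dim_row B \<Longrightarrow> dim_col B = dim_vec v \<Longrightarrow> (A * B) *\<^sub>v v = A *\<^sub>v (B *\<^sub>v v :: 'a :: semiring_0 vec)"
  by (rule assoc_mult_mat_vec) auto

lemma mat_eq_on_vecsI:
  fixes A B :: "'a :: semiring_1 mat"
  assumes "A \<in> carrier_mat nr nc" "B \<in> carrier_mat nr nc"
    and "\<And>v. v \<in> carrier_vec nc \<Longrightarrow> A *\<^sub>v v = B *\<^sub>v v"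
  shows "A = B"
proof (rule eq_matI)
  fix i j assume ij: "i < dim_row B" "j < dim_col B"
  have "A *\<^sub>v unit_vec nc j = B *\<^sub>v unit_vec nc j" by (rule assms(3)) simp
  then have "(A *\<^sub>v unit_vec nc j) $ i = (B *\<^sub>v unit_vec nc j) $ i" by simp
  then show "A $$ (i,j) = B $$ (i,j)" using ij assms(1,2) by (auto simp: scalar_prod_right_unit)
qed (use assms in auto)

lemma inverse_mats_imp_same_dim:
  fixes A B :: "complex mat"
  assumes A: "A \<in> carrier_mat n m" and B: "B \<in> carrier_mat m n"
    and AB: "A * B = 1\<^sub>m n" and BA: "B * A = 1\<^sub>m m"
  shows "n = m"
proof -
  have "of_nat n = (\<Sum>i<n. (A * B) $$ (i,i))" unfolding AB by simp
  also have "\<dots> = (\<Sum>i<n. \<Sum>j<m. A $$ (i,j) * B $$ (j,i))"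
    using A B by (intro sum.cong) (auto simp: scalar_prod_def atLeast0LessThan)
  also have "\<dots> = (\<Sum>j<m. \<Sum>i<n. B $$ (j,i) * A $$ (i,j))"
    by (subst sum.swap) (simp add: mult.commute)
  also have "\<dots> = (\<Sum>j<m. (B * A) $$ (j,j))"
    using A B by (intro sum.cong) (auto simp: scalar_prod_def atLeast0LessThan)
  also have "\<dots> = of_nat m" unfolding BA by simp
  finally show ?thesis by (metis of_nat_eq_iff)
qed

lemma mat_right_inverse_of_surj:
  fixes A :: "'a :: semiring_1 mat"
  assumes A: "A \<in> carrier_mat n m"
    and surj: "\<And>w. w \<in> carrier_vec n \<Longrightarrow> \<exists>v \<in> carrier_vec m. A *\<^sub>v v = w"
  shows "\<exists>B \<in> carrier_mat m n. A * B = 1\<^sub>m n"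
proof -
  obtain f where f: "\<And>i. f i \<in> carrier_vec m \<and> A *\<^sub>v f i = unit_vec n i"
    using surj[OF unit_vec_carrier] by metis
  define B where "B = mat_of_cols m (map f [0..<n])"
  have B: "B \<in> carrier_mat m n" unfolding B_def by auto
  have "A * B = 1\<^sub>m n"
  proof (rule eq_matI)
    fix i j assume "i < dim_row (1\<^sub>m n)" "j < dim_col (1\<^sub>m n)"
    then have ij: "i < n" "j < n" by auto
    have "(A * B) $$ (i,j) = row A i \<bullet> col B j" using ij A B by auto
    also have "col B j = f j" unfolding B_def using ij f by (subst col_mat_of_cols) auto
    also have "row A i \<bullet> f j = (A *\<^sub>v f j) $ i" using ij A by auto
    also have "\<dots> = 1\<^sub>m n $$ (i,j)" using f ij by auto
    finally show "(A * B) $$ (i,j) = 1\<^sub>m n $$ (i,j)" .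
  qed (use A B in auto)
  with B show ?thesis by blast
qed

text \<open>Surjectivity gives a right inverse, injectivity makes it two-sided, and the trace
  argument then shows that the matrix is square.\<close>

lemma mat_inverse_of_bij:
  fixes A :: "complex mat"
  assumes A: "A \<in> carrier_mat n m"
    and inj: "\<And>v. v \<in> carrier_vec m \<Longrightarrow> A *\<^sub>v v = 0\<^sub>v n \<Longrightarrow> v = 0\<^sub>v m"
    and surj: "\<And>w. w \<in> carrier_vec n \<Longrightarrow> \<exists>v \<in> carrier_vec m. A *\<^sub>v v = w"
  shows "n = m" "\<exists>B \<in> carrier_mat m n. A * B = 1\<^sub>m n \<and> B * A = 1\<^sub>m m"
proof -
  obtain B where B: "B \<in> carrier_mat m n" "A * B = 1\<^sub>m n"
    using mat_right_inverse_of_surj[OF A surj] by blast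
  have "B * A = 1\<^sub>m m"
  proof (rule mat_eq_on_vecsI)
    fix v :: "complex vec" assume v: "v \<in> carrier_vec m"
    have "A *\<^sub>v (B * A *\<^sub>v v - v) = A *\<^sub>v (B * A *\<^sub>v v) - A *\<^sub>v v"
      by (rule mult_minus_distrib_mat_vec) (use A B v in auto)
    also have "A *\<^sub>v (B * A *\<^sub>v v) = (A * B) *\<^sub>v (A *\<^sub>v v)"
      using A B v by (subst (1 2) mat_vec_assoc) auto
    also have "\<dots> = A *\<^sub>v v" using B A v by (subst B(2)) auto
    finally have "A *\<^sub>v (B * A *\<^sub>v v - v) = 0\<^sub>v n" using A v by auto
    moreover have "B * A *\<^sub>v v - v \<in> carrier_vec m" using A B v by auto
    ultimately have z: "B * A *\<^sub>v v - v = 0\<^sub>v m" using inj by blast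
    have "B * A *\<^sub>v v = v"
    proof (rule eq_vecI)
      fix i assume i: "i < dim_vec v"
      have "(B * A *\<^sub>v v - v) $ i = 0" unfolding z using i v by auto
      then show "(B * A *\<^sub>v v) $ i = v $ i" using i v A B by auto
    qed (use A B v in auto)
    then show "B * A *\<^sub>v v = 1\<^sub>m m *\<^sub>v v" using v by auto
  qed (use A B in auto)
  then show "\<exists>B \<in> carrier_mat m n. A * B = 1\<^sub>m n \<and> B * A = 1\<^sub>m m" "n = m"
    using B A inverse_mats_imp_same_dim[OF A B(1) B(2)] by auto
qed

text \<open>By induction on the number of vectors: a functional that fails to vanish on the new vector
  is corrected by one that separates the projected vector from the remaining ones.\<close>
lemma separating_functional_list:
  fixes v :: "'a :: field vec"
  assumes "set ws \<subseteq> carrier_vec n" "v \<in> carrier_vec n" "v \<notin> S" "0\<^sub>v n \<in> S"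
    and "\<And>c w u. w \<in> set ws \<Longrightarrow> u \<in> S \<Longrightarrow> c \<cdot>\<^sub>v w + u \<in> S"
  shows "\<exists>l \<in> carrier_vec n. l \<bullet> v = 1 \<and> (\<forall>w \<in> set ws. l \<bullet> w = 0)"
  using assms
proof (induction ws arbitrary: v)
  case Nil
  have "v \<noteq> 0\<^sub>v n" using Nil by auto
  then obtain i where i: "i < n" "v $ i \<noteq> 0" using Nil(2) by (auto simp: vec_eq_iff)
  have "(inverse (v $ i) \<cdot>\<^sub>v unit_vec n i) \<bullet> v = 1" using i Nil(2) by simp
  then show ?case by (intro bexI[of _ "inverse (v $ i) \<cdot>\<^sub>v unit_vec n i"]) auto
next
  case (Cons w ws)
  have w: "w \<in> carrier_vec n" and ws: "set ws \<subseteq> carrier_vec n" using Cons.prems by auto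
  have "\<exists>l \<in> carrier_vec n. l \<bullet> v = 1 \<and> (\<forall>w \<in> set ws. l \<bullet> w = 0)"
    by (rule Cons.IH) (use Cons.prems in auto)
  then obtain l where l: "l \<in> carrier_vec n" "l \<bullet> v = 1" "\<forall>w \<in> set ws. l \<bullet> w = 0" by blast
  show ?case
  proof (cases "l \<bullet> w = 0")
    case True then show ?thesis using l by auto
  next
    case False
    define c where "c = inverse (l \<bullet> w)"
    define v' where "v' = v - c \<cdot>\<^sub>v w"
    have v': "v' \<in> carrier_vec n" unfolding v'_def using Cons.prems w by auto
    have "v' \<notin> S"
    proof
      assume "v' \<in> S"
      then have "c \<cdot>\<^sub>v w + v' \<in> S" using Cons.prems(5) by simp
      moreover have "c \<cdot>\<^sub>v w + v' = v" unfolding v'_def using w Cons.prems(2)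
        by (intro eq_vecI) auto
      ultimately show False using Cons.prems(3) by simp
    qed
    then have "\<exists>l \<in> carrier_vec n. l \<bullet> v' = 1 \<and> (\<forall>w \<in> set ws. l \<bullet> w = 0)"
      by (intro Cons.IH) (use Cons.prems v' in auto)
    then obtain m where m: "m \<in> carrier_vec n" "m \<bullet> v' = 1" "\<forall>w \<in> set ws. m \<bullet> w = 0" by blast
    define k where "k = m - (c * (m \<bullet> w)) \<cdot>\<^sub>v l"
    have k: "k \<bullet> u = m \<bullet> u - c * (m \<bullet> w) * (l \<bullet> u)" if "u \<in> carrier_vec n" for u
      unfolding k_def using m l that by (subst minus_scalar_prod_distrib) auto
    have "m \<bullet> v' = m \<bullet> v - c * (m \<bullet> w)"
      unfolding v'_def using m w Cons.prems(2) by (subst scalar_prod_minus_distrib) auto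
    then have "k \<bullet> v = 1" using k[OF Cons.prems(2)] l m(2) by simp
    moreover have "k \<bullet> w = 0" using k[OF w] False unfolding c_def by simp
    moreover have "k \<bullet> u = 0" if "u \<in> set ws" for u using k[of u] that ws l(3) m(3) by auto
    ultimately show ?thesis using l m by (intro bexI[of _ k]) (auto simp: k_def)
  qed
qed

text \<open>A functional that vanishes on the columns of \<open>A\<close> vanishes on its whole
  image. Functionals of this kind on the colimit later define the retractions onto arc
  modules.\<close>

lemma separating_functional:
  fixes v :: "'a :: field vec"
  assumes A: "A \<in> carrier_mat n m" and v: "v \<in> carrier_vec n"
    and nv: "\<And>u. u \<in> carrier_vec m \<Longrightarrow> v \<noteq> A *\<^sub>v u"
  shows "\<exists>l \<in> carrier_vec n. l \<bullet> v = 1 \<and> (\<forall>u \<in> carrier_vec m. l \<bullet> (A *\<^sub>v u) = 0)"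
proof -
  let ?S = "{A *\<^sub>v u | u. u \<in> carrier_vec m}"
  have "\<exists>l \<in> carrier_vec n. l \<bullet> v = 1 \<and> (\<forall>w \<in> set (cols A). l \<bullet> w = 0)"
  proof (rule separating_functional_list[where S = ?S])
    show "set (cols A) \<subseteq> carrier_vec n" using cols_dim[of A] A by auto
    show "v \<notin> ?S" using nv by auto
    have "0\<^sub>v n = A *\<^sub>v 0\<^sub>v m" using A by auto
    then show "0\<^sub>v n \<in> ?S" by auto
  next
    fix c w u assume "w \<in> set (cols A)" "u \<in> ?S"
    then obtain j u' where j: "j < m" "w = col A j" and u: "u' \<in> carrier_vec m" "u = A *\<^sub>v u'"
      using A by (auto simp: cols_def)
    have "col A j = A *\<^sub>v unit_vec m j" using j A by (intro eq_vecI) auto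
    then have "c \<cdot>\<^sub>v w + u = A *\<^sub>v (c \<cdot>\<^sub>v unit_vec m j + u')"
      using A u j by (simp add: mult_add_distrib_mat_vec[OF A] mult_mat_vec[OF A])
    then show "c \<cdot>\<^sub>v w + u \<in> ?S" using u by (intro CollectI exI[of _ "c \<cdot>\<^sub>v unit_vec m j + u'"]) auto
  qed (use v in auto)
  then obtain l where l: "l \<in> carrier_vec n" "l \<bullet> v = 1" "\<forall>w \<in> set (cols A). l \<bullet> w = 0" by blast
  have "l \<bullet> (A *\<^sub>v u) = 0" if u: "u \<in> carrier_vec m" for u
  proof -
    have "transpose_mat A *\<^sub>v l = 0\<^sub>v m"
    proof (rule eq_vecI)
      fix i assume "i < dim_vec (0\<^sub>v m)"
      then have i: "i < m" by simp
      have "(transpose_mat A *\<^sub>v l) $ i = col A i \<bullet> l" using i A by auto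
      also have "\<dots> = l \<bullet> col A i" using A l by (intro comm_scalar_prod) auto
      also have "\<dots> = 0" using l(3) i A by (auto simp: cols_def)
      finally show "(transpose_mat A *\<^sub>v l) $ i = 0\<^sub>v m $ i" using i by simp
    qed (use A in auto)
    then show ?thesis using transpose_vec_mult_scalar[OF A u l(1)] u l A by auto
  qed
  with l show ?thesis by blast
qed

text \<open>Columns are treated one at a time: as long as the idempotent \<open>E - A * B\<close> does not
  kill the next unit vector, the pair \<open>(A, B)\<close> is enlarged by a rank one summand.\<close>
lemma idempotent_factorization:
  fixes E :: "'a :: field mat"
  assumes E: "E \<in> carrier_mat n n" and idem: "E * E = E"
  shows "\<exists>r A B. A \<in> carrier_mat n r \<and> B \<in> carrier_mat r n \<and> A * B = E \<and> B * A = 1\<^sub>m r"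
proof -
  have "\<exists>r A B. A \<in> carrier_mat n r \<and> B \<in> carrier_mat r n \<and> B * A = 1\<^sub>m r \<and> E * A = A \<and> B * E = B
     \<and> (\<forall>j<k. \<forall>i<n. (A * B) $$ (i,j) = E $$ (i,j))" if "k \<le> n" for k
    using that
  proof (induction k)
    case 0
    show ?case using E by (intro exI[of _ 0] exI[of _ "0\<^sub>m n 0"] exI[of _ "0\<^sub>m 0 n"]) auto
  next
    case (Suc k)
    then obtain r A B where A: "A \<in> carrier_mat n r" and B: "B \<in> carrier_mat r n"
      and BA: "B * A = 1\<^sub>m r" and EA: "E * A = A" and BE: "B * E = B"
      and AB: "\<forall>j<k. \<forall>i<n. (A * B) $$ (i,j) = E $$ (i,j)" by auto
    have k: "k < n" using Suc by simp
    define F where "F = E - A * B"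
    have F: "F \<in> carrier_mat n n" unfolding F_def using A B by auto
    have FA: "F * A = 0\<^sub>m n r"
      unfolding F_def using A B E BA EA by (subst minus_mult_distrib_mat) auto
    have "B * (A * B) = B" using A B BA by (subst mat_assoc[symmetric]) auto
    then have BF: "B * F = 0\<^sub>m r n"
      unfolding F_def using A B E BE by (subst mult_minus_distrib_mat) auto
    have "E * (A * B) = A * B" using A B E EA by (subst mat_assoc[symmetric]) auto
    then have EF: "E * F = F"
      unfolding F_def using A B E idem by (subst mult_minus_distrib_mat) auto
    have "(A * B) * E = A * B" using A B E BE by (subst mat_assoc) auto
    then have FE: "F * E = F"
      unfolding F_def using A B E idem by (subst minus_mult_distrib_mat) auto
    have "F * (A * B) = 0\<^sub>m n n" using FA A B F by (subst mat_assoc[symmetric]) auto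
    then have "F * (E - A * B) = F"
      using F A B E FE by (subst mult_minus_distrib_mat[OF F]) auto
    then have FF: "F * F = F" unfolding F_def[symmetric] .
    define v where "v = F *\<^sub>v unit_vec n k"
    show ?case
    proof (cases "v = 0\<^sub>v n")
      case True
      have "(A * B) $$ (i,k) = E $$ (i,k)" if "i < n" for i
      proof -
        have "v $ i = E $$ (i,k) - (A * B) $$ (i,k)" unfolding v_def F_def using that k A B E
          by (simp add: scalar_prod_right_unit)
        then show ?thesis using True that by simp
      qed
      then show ?thesis using A B BA EA BE AB
        by (intro exI[of _ r] exI[of _ A] exI[of _ B]) (auto simp: less_Suc_eq)
    next
      case False
      have vc: "v \<in> carrier_vec n" unfolding v_def using F by auto
      obtain i0 where i0: "i0 < n" "v $ i0 \<noteq> 0" using False vc by (auto simp: vec_eq_iff)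
      define V where "V = mat n 1 (\<lambda>(i,j). v $ i)"
      \<comment> \<open>\<open>U\<close> reads off the coordinate \<open>i0\<close> and normalises
        it. Composing with \<open>F\<close> keeps the value 1 on \<open>V\<close>, which
        \<open>F\<close> fixes, and makes the row kill \<open>A\<close>.\<close>
      define U where "U = mat 1 n (\<lambda>(i,j). if j = i0 then inverse (v $ i0) else 0)"
      define e where "e = mat n 1 (\<lambda>(i,j). if i = k then 1 else (0 :: 'a))"
      have c: "V \<in> carrier_mat n 1" "U \<in> carrier_mat 1 n" "e \<in> carrier_mat n 1"
        unfolding V_def U_def e_def by auto
      have Ve: "V = F * e"
        unfolding V_def v_def e_def using F k
        by (intro eq_matI) (auto simp: scalar_prod_def if_distrib cong: if_cong)
      have UV: "U * V = 1\<^sub>m 1"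
        unfolding U_def V_def using i0
        by (intro eq_matI) (auto simp: scalar_prod_def if_distrib if_distribR cong: if_cong)
      define L where "L = U * F"
      have L: "L \<in> carrier_mat 1 n" unfolding L_def using c F by auto
      have FV: "F * V = V" unfolding Ve using F c FF by (subst mat_assoc[symmetric]) auto
      have LV: "L * V = 1\<^sub>m 1" unfolding L_def using F c FV UV by (subst mat_assoc) auto
      have LA: "L * A = 0\<^sub>m 1 r" unfolding L_def using F c FA A by (subst mat_assoc) auto
      have BV: "B * V = 0\<^sub>m r 1" unfolding Ve using F c BF B by (subst mat_assoc[symmetric]) auto
      have EV: "E * V = V" unfolding Ve using F c EF E by (subst mat_assoc[symmetric]) auto
      have LE: "L * E = L" unfolding L_def using F c FE E by (subst mat_assoc) auto
      define A' where "A' = four_block_mat A V (0\<^sub>m 0 r) (0\<^sub>m 0 1)"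
      define B' where "B' = four_block_mat B (0\<^sub>m r 0) L (0\<^sub>m 1 0)"
      have A': "A' \<in> carrier_mat n (r + 1)" unfolding A'_def using A c by auto
      have B': "B' \<in> carrier_mat (r + 1) n" unfolding B'_def using B L by auto
      have B'A': "B' * A' = 1\<^sub>m (r + 1)"
        unfolding A'_def B'_def
        by (subst mult_four_block_mat[of _ r n _ 0 _ 1 _ _ r _ 1]) (use A B c L BA BV LA LV in auto)
      have A'B': "A' * B' = A * B + V * L"
      proof -
        have "A' * B' = four_block_mat (A * B + V * L) (0\<^sub>m n 0) (0\<^sub>m 0 n) (0\<^sub>m 0 0)"
          unfolding A'_def B'_def
          by (subst mult_four_block_mat[of _ n r _ 1 _ 0 _ _ n _ 0])
            (use A B c L in \<open>auto intro!: cong_four_block_mat eq_matI\<close>)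
        also have "\<dots> = A * B + V * L" by (rule eq_matI) (use A B c L in auto)
        finally show ?thesis .
      qed
      have EA': "E * A' = A'"
      proof -
        have "E = four_block_mat E (0\<^sub>m n 0) (0\<^sub>m 0 n) (0\<^sub>m 0 0)" by (rule eq_matI) (use E in auto)
        then have "E * A' = four_block_mat E (0\<^sub>m n 0) (0\<^sub>m 0 n) (0\<^sub>m 0 0) * A'" by simp
        also have "\<dots> = A'" unfolding A'_def
          by (subst mult_four_block_mat[of _ n n _ 0 _ 0 _ _ r _ 1])
            (use A E c EA EV in \<open>auto intro!: cong_four_block_mat eq_matI\<close>)
        finally show ?thesis .
      qed
      have BE': "B' * E = B'"
      proof -
        have "E = four_block_mat E (0\<^sub>m n 0) (0\<^sub>m 0 n) (0\<^sub>m 0 0)" by (rule eq_matI) (use E in auto)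
        then have "B' * E = B' * four_block_mat E (0\<^sub>m n 0) (0\<^sub>m 0 n) (0\<^sub>m 0 0)" by simp
        also have "\<dots> = B'" unfolding B'_def
          by (subst mult_four_block_mat[of _ r n _ 0 _ 1 _ _ n _ 0])
            (use B E L BE LE in \<open>auto intro!: cong_four_block_mat eq_matI\<close>)
        finally show ?thesis .
      qed
      have Fij: "F $$ (i,j) = E $$ (i,j) - (A * B) $$ (i,j)" if "i < n" "j < n" for i j
        unfolding F_def using that A B E by auto
      have VL: "(V * L) $$ (i,j) = v $ i * L $$ (0,j)" if "i < n" "j < n" for i j
        using that c L by (auto simp: V_def scalar_prod_def)
      have Lj: "L $$ (0,j) = inverse (v $ i0) * F $$ (i0,j)" if "j < n" for j
        unfolding L_def U_def using that F i0
        by (auto simp: scalar_prod_def if_distrib if_distribR cong: if_cong)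
      have vi: "v $ i = F $$ (i,k)" if "i < n" for i unfolding v_def using that F k by auto
      \<comment> \<open>The columns of \<open>F\<close> before \<open>k\<close> vanish, so the new
        summand leaves them alone; column \<open>k\<close> of \<open>V * L\<close> is that of
        \<open>F\<close>.\<close>
      have "(A' * B') $$ (i,j) = E $$ (i,j)" if "j < Suc k" "i < n" for i j
      proof -
        have jn: "j < n" using that k by simp
        have "(A' * B') $$ (i,j) = (A * B) $$ (i,j) + v $ i * L $$ (0,j)"
          unfolding A'B' using that jn A B c L VL by auto
        also have "\<dots> = E $$ (i,j)"
        proof (cases "j = k")
          case True then show ?thesis using vi that jn Lj i0 Fij[of i k] by auto
        next
          case False
          then have "j < k" using that by simp
          then have "(A * B) $$ (i,j) = E $$ (i,j)" "F $$ (i0,j) = 0" using AB that Fij[of i0 j] i0 jn by auto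
          then show ?thesis using Lj[OF jn] by simp
        qed
        finally show ?thesis .
      qed
      then show ?thesis using A' B' B'A' EA' BE' by blast
    qed
  qed
  from this[of n] obtain r A B where *: "A \<in> carrier_mat n r" "B \<in> carrier_mat r n" "B * A = 1\<^sub>m r"
     "\<forall>j<n. \<forall>i<n. (A * B) $$ (i,j) = E $$ (i,j)" by auto
  then have "A * B = E" using E by (intro eq_matI) auto
  with * show ?thesis by blast
qed

section \<open>Homomorphisms and biproducts\<close>

definition fam :: "gmod \<Rightarrow> gmod \<Rightarrow> (int \<Rightarrow> complex mat) \<Rightarrow> bool" where
  "fam M N f \<longleftrightarrow> (\<forall>n. f n \<in> carrier_mat (gdim N n) (gdim M n))"

text \<open>The maps that are linear over C[y] only: sections of extensions and cochains live here,
  and their failure to commute with \<open>x\<close> is what is measured.\<close>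

definition yhom :: "gmod \<Rightarrow> gmod \<Rightarrow> (int \<Rightarrow> complex mat) \<Rightarrow> bool" where
  "yhom M N f \<longleftrightarrow> fam M N f \<and> (\<forall>n. f (n-1) * yact M n = yact N n * f n)"

definition hadd :: "(int \<Rightarrow> complex mat) \<Rightarrow> (int \<Rightarrow> complex mat) \<Rightarrow> (int \<Rightarrow> complex mat)" where
  "hadd f g = (\<lambda>n. f n + g n)"

definition hsm :: "complex \<Rightarrow> (int \<Rightarrow> complex mat) \<Rightarrow> (int \<Rightarrow> complex mat)" where
  "hsm c f = (\<lambda>n. c \<cdot>\<^sub>m f n)"

definition hzero :: "gmod \<Rightarrow> gmod \<Rightarrow> (int \<Rightarrow> complex mat)" where
  "hzero M N = (\<lambda>n. 0\<^sub>m (gdim N n) (gdim M n))"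

section \<open>Composition and linear combination of graded maps\<close>

lemma mat_distrib_left: "dim_col A = dim_row B \<Longrightarrow> dim_row B = dim_row C \<Longrightarrow> dim_col B = dim_col C
  \<Longrightarrow> A * (B + C) = A * B + A * (C :: 'a :: semiring_0 mat)"
  by (rule mult_add_distrib_mat) auto

lemma mat_distrib_right: "dim_col A = dim_row C \<Longrightarrow> dim_row A = dim_row B \<Longrightarrow> dim_col A = dim_col B
  \<Longrightarrow> (A + B) * C = A * C + B * (C :: 'a :: semiring_0 mat)"
  by (rule add_mult_distrib_mat) auto

lemma mat_smult_left: "dim_col A = dim_row B \<Longrightarrow> (k \<cdot>\<^sub>m A) * B = k \<cdot>\<^sub>m (A * B :: 'a :: comm_semiring_0 mat)"
  by (rule mult_smult_assoc_mat) auto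

lemma mat_smult_right: "dim_col A = dim_row B \<Longrightarrow> A * (k \<cdot>\<^sub>m B) = k \<cdot>\<^sub>m (A * B :: 'a :: comm_semiring_0 mat)"
  by (rule mult_smult_distrib) auto

lemma famD: "fam M N f \<Longrightarrow> f n \<in> carrier_mat (gdim N n) (gdim M n)" by (simp add: fam_def)
lemma fam_dims: "fam M N f \<Longrightarrow> dim_row (f n) = gdim N n" "fam M N f \<Longrightarrow> dim_col (f n) = gdim M n"
  by (auto simp: fam_def)

lemma wf_gmodD:
  assumes "wf_gmod M"
  shows "xact M n \<in> carrier_mat (gdim M (n+1)) (gdim M n)" "yact M n \<in> carrier_mat (gdim M (n-1)) (gdim M n)"
    "xact M (n+1) * xact M n = 0\<^sub>m (gdim M (n+2)) (gdim M n)"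
    "xact M (n-1) * yact M n = yact M (n+1) * xact M n"
  using assms by (auto simp: wf_gmod_def)

lemma wf_gmod_dims:
  assumes "wf_gmod M"
  shows "dim_row (xact M n) = gdim M (n+1)" "dim_col (xact M n) = gdim M n"
    "dim_row (yact M n) = gdim M (n-1)" "dim_col (yact M n) = gdim M n"
  using wf_gmodD(1,2)[OF assms, of n] by auto

lemma yhomD: "yhom M N f \<Longrightarrow> fam M N f" "yhom M N f \<Longrightarrow> f (n-1) * yact M n = yact N n * f n"
  by (auto simp: yhom_def)

lemma is_homD: "is_hom M N f \<Longrightarrow> fam M N f" "is_hom M N f \<Longrightarrow> f (n+1) * xact M n = xact N n * f n"
  "is_hom M N f \<Longrightarrow> f (n-1) * yact M n = yact N n * f n" "is_hom M N f \<Longrightarrow> yhom M N f"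
  by (auto simp: is_hom_def fam_def yhom_def)

lemma is_homI: "yhom M N f \<Longrightarrow> (\<And>n. f (n+1) * xact M n = xact N n * f n) \<Longrightarrow> is_hom M N f"
  by (auto simp: is_hom_def fam_def yhom_def)

lemma fam_hcomp: "fam M N f \<Longrightarrow> fam N P g \<Longrightarrow> fam M P (hcomp g f)"
  unfolding fam_def hcomp_def by (meson mult_carrier_mat)
lemma fam_hadd: "fam M N f \<Longrightarrow> fam M N g \<Longrightarrow> fam M N (hadd f g)"
  by (auto simp: fam_def hadd_def)
lemma fam_hsm: "fam M N f \<Longrightarrow> fam M N (hsm c f)"
  by (auto simp: fam_def hsm_def)
lemma fam_hzero: "fam M N (hzero M N)"
  by (auto simp: fam_def hzero_def)
lemma fam_hid: "fam M M (hid M)"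
  by (auto simp: fam_def hid_def)

lemma hcomp_assoc:
  assumes "fam M N f" "fam N P g" "fam P Q h"
  shows "hcomp h (hcomp g f) = hcomp (hcomp h g) f"
  unfolding hcomp_def by (rule ext) (simp add: mat_assoc fam_dims[OF assms(1)] fam_dims[OF assms(2)] fam_dims[OF assms(3)])

lemma hcomp_hadd_left: "fam M N f \<Longrightarrow> fam N P g \<Longrightarrow> fam N P g' \<Longrightarrow> hcomp (hadd g g') f = hadd (hcomp g f) (hcomp g' f)"
  unfolding hcomp_def hadd_def by (rule ext) (simp add: mat_distrib_right fam_dims)
lemma hcomp_hadd_right: "fam M N f \<Longrightarrow> fam M N f' \<Longrightarrow> fam N P g \<Longrightarrow> hcomp g (hadd f f') = hadd (hcomp g f) (hcomp g f')"
  unfolding hcomp_def hadd_def by (rule ext) (simp add: mat_distrib_left fam_dims)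
lemma hcomp_hsm_left: "fam M N f \<Longrightarrow> fam N P g \<Longrightarrow> hcomp (hsm c g) f = hsm c (hcomp g f)"
  unfolding hcomp_def hsm_def by (rule ext) (simp add: mat_smult_left fam_dims)
lemma hcomp_hsm_right: "fam M N f \<Longrightarrow> fam N P g \<Longrightarrow> hcomp g (hsm c f) = hsm c (hcomp g f)"
  unfolding hcomp_def hsm_def by (rule ext) (simp add: mat_smult_right fam_dims)
lemma hcomp_hid_left: "fam M N f \<Longrightarrow> hcomp (hid N) f = f"
  unfolding hcomp_def hid_def fam_def by (rule ext) (meson left_mult_one_mat)
lemma hcomp_hid_right: "fam M N f \<Longrightarrow> hcomp f (hid M) = f"
  unfolding hcomp_def hid_def fam_def by (rule ext) (meson right_mult_one_mat)
lemma hcomp_hzero_left: "fam M N f \<Longrightarrow> hcomp (hzero N P) f = hzero M P"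
  unfolding hcomp_def hzero_def fam_def by (rule ext) (meson left_mult_zero_mat)
lemma hcomp_hzero_right: "fam N P f \<Longrightarrow> hcomp f (hzero M N) = hzero M P"
  unfolding hcomp_def hzero_def fam_def by (rule ext) (meson right_mult_zero_mat)
lemma hadd_hzero_right: "fam M N f \<Longrightarrow> hadd f (hzero M N) = f"
  unfolding hadd_def hzero_def fam_def by (rule ext) (meson right_add_zero_mat)
lemma hadd_hzero_left: "fam M N f \<Longrightarrow> hadd (hzero M N) f = f"
  unfolding hadd_def hzero_def fam_def by (rule ext) (meson left_add_zero_mat)
lemma hadd_comm: "fam M N f \<Longrightarrow> fam M N g \<Longrightarrow> hadd f g = hadd g f"
  unfolding hadd_def fam_def by (rule ext) (meson comm_add_mat)

lemma yhom_hcomp: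
  assumes "wf_gmod M" "wf_gmod N" "wf_gmod P" "yhom M N f" "yhom N P g"
  shows "yhom M P (hcomp g f)"
proof -
  note d = fam_dims[OF yhomD(1)[OF assms(4)]] fam_dims[OF yhomD(1)[OF assms(5)]]
    wf_gmod_dims[OF assms(1)] wf_gmod_dims[OF assms(2)] wf_gmod_dims[OF assms(3)]
  have "(g (n-1) * f (n-1)) * yact M n = yact P n * (g n * f n)" for n
  proof -
    have "(g (n-1) * f (n-1)) * yact M n = g (n-1) * (yact N n * f n)"
      using yhomD(2)[OF assms(4)] by (simp add: mat_assoc d)
    also have "\<dots> = (yact P n * g n) * f n"
      using yhomD(2)[OF assms(5)] by (simp add: mat_assoc[symmetric] d)
    finally show ?thesis by (simp add: mat_assoc d)
  qed
  then show ?thesis using fam_hcomp assms yhomD(1) unfolding yhom_def hcomp_def[symmetric]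
    by (auto simp: hcomp_def)
qed

lemma is_hom_hcomp:
  assumes "wf_gmod M" "wf_gmod N" "wf_gmod P" "is_hom M N f" "is_hom N P g"
  shows "is_hom M P (hcomp g f)"
proof (rule is_homI)
  note d = fam_dims[OF is_homD(1)[OF assms(4)]] fam_dims[OF is_homD(1)[OF assms(5)]]
    wf_gmod_dims[OF assms(1)] wf_gmod_dims[OF assms(2)] wf_gmod_dims[OF assms(3)]
  fix n
  have "(g (n+1) * f (n+1)) * xact M n = g (n+1) * (xact N n * f n)"
    using is_homD(2)[OF assms(4)] by (simp add: mat_assoc d)
  also have "\<dots> = (xact P n * g n) * f n"
    using is_homD(2)[OF assms(5)] by (simp add: mat_assoc[symmetric] d)
  finally show "hcomp g f (n+1) * xact M n = xact P n * hcomp g f n" by (simp add: mat_assoc d hcomp_def)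
qed (rule yhom_hcomp[OF assms(1-3) is_homD(4)[OF assms(4)] is_homD(4)[OF assms(5)]])

lemma yhom_hadd:
  assumes "wf_gmod M" "wf_gmod N" "yhom M N f" "yhom M N g"
  shows "yhom M N (hadd f g)"
  unfolding yhom_def
  using assms yhomD(2)[OF assms(3)] yhomD(2)[OF assms(4)]
  by (auto simp: fam_hadd[unfolded hadd_def] yhomD hadd_def mat_distrib_left mat_distrib_right wf_gmod_dims
      fam_dims[OF yhomD(1)[OF assms(3)]] fam_dims[OF yhomD(1)[OF assms(4)]])

lemma is_hom_hadd:
  assumes "wf_gmod M" "wf_gmod N" "is_hom M N f" "is_hom M N g"
  shows "is_hom M N (hadd f g)"
proof (rule is_homI[OF yhom_hadd])
  show "hadd f g (n + 1) * xact M n = xact N n * hadd f g n" for n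
    using assms is_homD(2)[OF assms(3)] is_homD(2)[OF assms(4)]
    by (auto simp: hadd_def mat_distrib_left mat_distrib_right wf_gmod_dims
      fam_dims[OF is_homD(1)[OF assms(3)]] fam_dims[OF is_homD(1)[OF assms(4)]])
qed (use assms is_homD in auto)

lemma yhom_hsm:
  assumes "wf_gmod M" "wf_gmod N" "yhom M N f"
  shows "yhom M N (hsm c f)"
  unfolding yhom_def
  using assms yhomD(2)[OF assms(3)]
  by (auto simp: fam_hsm[unfolded hsm_def] yhomD hsm_def mat_smult_left mat_smult_right wf_gmod_dims
      fam_dims[OF yhomD(1)[OF assms(3)]])

lemma is_hom_hsm:
  assumes "wf_gmod M" "wf_gmod N" "is_hom M N f"
  shows "is_hom M N (hsm c f)"
proof (rule is_homI[OF yhom_hsm])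
  show "hsm c f (n + 1) * xact M n = xact N n * hsm c f n" for n
    using assms is_homD(2)[OF assms(3)]
    by (auto simp: hsm_def mat_smult_left mat_smult_right wf_gmod_dims
      fam_dims[OF is_homD(1)[OF assms(3)]])
qed (use assms is_homD in auto)

lemma is_hom_hid: "wf_gmod M \<Longrightarrow> is_hom M M (hid M)"
  unfolding is_hom_def hid_def using wf_gmodD[of M]
  by (auto simp: left_mult_one_mat[OF wf_gmodD(1)] right_mult_one_mat[OF wf_gmodD(1)]
    left_mult_one_mat[OF wf_gmodD(2)] right_mult_one_mat[OF wf_gmodD(2)])

lemma is_hom_hzero: "wf_gmod M \<Longrightarrow> wf_gmod N \<Longrightarrow> is_hom M N (hzero M N)"
  unfolding is_hom_def hzero_def
  by (auto simp: left_mult_zero_mat[OF wf_gmodD(1)] right_mult_zero_mat[OF wf_gmodD(1)]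
    left_mult_zero_mat[OF wf_gmodD(2)] right_mult_zero_mat[OF wf_gmodD(2)])

text \<open>Direct sums are recognised by inclusions and projections rather than by an isomorphism
  with \<open>dsum\<close>: summands arise by splitting idempotents, and additivity arguments use
  just these identities.\<close>

definition biprod_wit where
  "biprod_wit M A B i1 i2 p1 p2 \<longleftrightarrow> is_hom A M i1 \<and> is_hom B M i2 \<and> is_hom M A p1 \<and> is_hom M B p2
    \<and> hcomp p1 i1 = hid A \<and> hcomp p2 i2 = hid B \<and> hcomp p1 i2 = hzero B A \<and> hcomp p2 i1 = hzero A B
    \<and> hadd (hcomp i1 p1) (hcomp i2 p2) = hid M"

definition biprod where
  "biprod M A B \<longleftrightarrow> (\<exists>i1 i2 p1 p2. biprod_wit M A B i1 i2 p1 p2)"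

text \<open>A column of two blocks, written with an empty strip so that the product formula for two
  by two block matrices applies; \<open>rblk\<close> is the analogous row.\<close>

definition cblk :: "'a :: zero mat \<Rightarrow> 'a mat \<Rightarrow> 'a mat" where
  "cblk A C = four_block_mat A (0\<^sub>m (dim_row A) 0) C (0\<^sub>m (dim_row C) 0)"
definition rblk :: "'a :: zero mat \<Rightarrow> 'a mat \<Rightarrow> 'a mat" where
  "rblk A B = four_block_mat A B (0\<^sub>m 0 (dim_col A)) (0\<^sub>m 0 (dim_col B))"

section \<open>Products of block rows and columns, and the direct sum as a biproduct\<close>

lemma cblk_dims [simp]: "dim_row (cblk A C) = dim_row A + dim_row C" "dim_col (cblk A C) = dim_col A"
  by (auto simp: cblk_def)
lemma rblk_dims [simp]: "dim_row (rblk A C) = dim_row A" "dim_col (rblk A C) = dim_col A + dim_col C"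
  by (auto simp: rblk_def)

lemma mult_four_block_mat_dims:
  fixes A1 :: "'a :: semiring_0 mat"
  assumes "dim_row B1 = dim_row A1" "dim_col P1 = dim_col A1" "dim_row D1 = dim_row P1" "dim_col D1 = dim_col B1"
    "dim_row B2 = dim_row A2" "dim_col P2 = dim_col A2" "dim_row D2 = dim_row P2" "dim_col D2 = dim_col B2"
    "dim_col A1 = dim_row A2" "dim_col B1 = dim_row P2"
  shows "four_block_mat A1 B1 P1 D1 * four_block_mat A2 B2 P2 D2 =
    four_block_mat (A1 * A2 + B1 * P2) (A1 * B2 + B1 * D2) (P1 * A2 + D1 * P2) (P1 * B2 + D1 * D2)"
  by (rule mult_four_block_mat[of _ "dim_row A1" "dim_col A1" _ "dim_col B1" _ "dim_row P1" _ _ "dim_col A2" _ "dim_col B2"])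
    (use assms in auto)

lemma four_block_thin:
  "four_block_mat A (0\<^sub>m (dim_row A) 0) (0\<^sub>m 0 (dim_col A)) (0\<^sub>m 0 0) = A"
  by (intro eq_matI) auto

lemma cblk_mult:
  fixes A :: "'a :: semiring_0 mat"
  assumes "dim_col A = dim_row X" "dim_col B = dim_row X"
  shows "cblk A B * X = cblk (A * X) (B * X)"
  unfolding cblk_def
  by (subst (1) four_block_thin[of X, symmetric], subst mult_four_block_mat_dims)
    (use assms in \<open>auto intro!: cong_four_block_mat eq_matI\<close>)

lemma mult_rblk:
  fixes A :: "'a :: semiring_0 mat"
  assumes "dim_row A = dim_col X" "dim_row B = dim_col X"
  shows "X * rblk A B = rblk (X * A) (X * B)"
  unfolding rblk_def
  by (subst (1) four_block_thin[of X, symmetric], subst mult_four_block_mat_dims)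
    (use assms in \<open>auto intro!: cong_four_block_mat eq_matI\<close>)

lemma four_block_mult_cblk:
  fixes A :: "'a :: semiring_0 mat"
  assumes "dim_row B = dim_row A" "dim_col P = dim_col A" "dim_row D = dim_row P" "dim_col D = dim_col B"
    "dim_col A = dim_row X" "dim_col B = dim_row Y" "dim_col X = dim_col Y"
  shows "four_block_mat A B P D * cblk X Y = cblk (A * X + B * Y) (P * X + D * Y)"
  unfolding cblk_def
  by (subst mult_four_block_mat_dims) (use assms in \<open>auto intro!: cong_four_block_mat eq_matI\<close>)

lemma rblk_mult_four_block:
  fixes A :: "'a :: semiring_0 mat"
  assumes "dim_row B = dim_row A" "dim_col P = dim_col A" "dim_row D = dim_row P" "dim_col D = dim_col B"
    "dim_row A = dim_col X" "dim_row P = dim_col Y" "dim_row X = dim_row Y"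
  shows "rblk X Y * four_block_mat A B P D = rblk (X * A + Y * P) (X * B + Y * D)"
  unfolding rblk_def
  by (subst mult_four_block_mat_dims) (use assms in \<open>auto intro!: cong_four_block_mat eq_matI\<close>)

lemma rblk_mult_cblk:
  fixes A :: "'a :: semiring_0 mat"
  assumes "dim_row B = dim_row A" "dim_col A = dim_row X" "dim_col B = dim_row Y" "dim_col X = dim_col Y"
  shows "rblk A B * cblk X Y = A * X + B * Y"
proof -
  have "rblk A B * cblk X Y = four_block_mat (A * X + B * Y) (0\<^sub>m (dim_row A) 0) (0\<^sub>m 0 (dim_col X)) (0\<^sub>m 0 0)"
    unfolding rblk_def cblk_def
    by (subst mult_four_block_mat_dims) (use assms in \<open>auto intro!: cong_four_block_mat eq_matI\<close>)
  also have "\<dots> = A * X + B * Y" by (intro eq_matI) (use assms in auto)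
  finally show ?thesis .
qed

lemma cblk_mult_rblk:
  fixes A :: "'a :: semiring_0 mat"
  assumes "dim_col A = dim_row X" "dim_col B = dim_row X" "dim_row X = dim_row Y"
  shows "cblk A B * rblk X Y = four_block_mat (A * X) (A * Y) (B * X) (B * Y)"
  unfolding rblk_def cblk_def
  by (subst mult_four_block_mat_dims) (use assms in \<open>auto intro!: cong_four_block_mat eq_matI\<close>)

definition dsum_in1 :: "gmod \<Rightarrow> gmod \<Rightarrow> int \<Rightarrow> complex mat" where
  "dsum_in1 A B = (\<lambda>n. cblk (1\<^sub>m (gdim A n)) (0\<^sub>m (gdim B n) (gdim A n)))"
definition dsum_in2 :: "gmod \<Rightarrow> gmod \<Rightarrow> int \<Rightarrow> complex mat" where
  "dsum_in2 A B = (\<lambda>n. cblk (0\<^sub>m (gdim A n) (gdim B n)) (1\<^sub>m (gdim B n)))"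
definition dsum_pr1 :: "gmod \<Rightarrow> gmod \<Rightarrow> int \<Rightarrow> complex mat" where
  "dsum_pr1 A B = (\<lambda>n. rblk (1\<^sub>m (gdim A n)) (0\<^sub>m (gdim A n) (gdim B n)))"
definition dsum_pr2 :: "gmod \<Rightarrow> gmod \<Rightarrow> int \<Rightarrow> complex mat" where
  "dsum_pr2 A B = (\<lambda>n. rblk (0\<^sub>m (gdim B n) (gdim A n)) (1\<^sub>m (gdim B n)))"

lemma gdim_dsum [simp]: "gdim (dsum A B) n = gdim A n + gdim B n" by (simp add: dsum_def)

lemma mat_unit_dims:
  fixes A :: "'a :: semiring_1 mat"
  shows "dim_row A = n \<Longrightarrow> 1\<^sub>m n * A = A" "dim_col A = n \<Longrightarrow> A * 1\<^sub>m n = A"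
    "dim_row A = m \<Longrightarrow> 0\<^sub>m n m * A = 0\<^sub>m n (dim_col A)" "dim_col A = n \<Longrightarrow> A * 0\<^sub>m n m = 0\<^sub>m (dim_row A) m"
    "dim_row A = n \<Longrightarrow> dim_col A = m \<Longrightarrow> 0\<^sub>m n m + A = A" "dim_row A = n \<Longrightarrow> dim_col A = m \<Longrightarrow> A + 0\<^sub>m n m = A"
  by (auto intro!: eq_matI)

lemma wf_dsum:
  assumes "wf_gmod A" "wf_gmod B"
  shows "wf_gmod (dsum A B)"
  unfolding wf_gmod_def
proof (intro allI conjI)
  note d = wf_gmod_dims[OF assms(1)] wf_gmod_dims[OF assms(2)]
  fix n
  show "xact (dsum A B) n \<in> carrier_mat (gdim (dsum A B) (n+1)) (gdim (dsum A B) n)"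
    "yact (dsum A B) n \<in> carrier_mat (gdim (dsum A B) (n-1)) (gdim (dsum A B) n)"
    using d[of n] by (auto simp: dsum_def)
  show "xact (dsum A B) (n+1) * xact (dsum A B) n = 0\<^sub>m (gdim (dsum A B) (n+2)) (gdim (dsum A B) n)"
    using wf_gmodD(3)[OF assms(1)] wf_gmodD(3)[OF assms(2)]
    by (simp add: dsum_def mult_four_block_mat_dims d mat_unit_dims add.assoc)
  show "xact (dsum A B) (n-1) * yact (dsum A B) n = yact (dsum A B) (n+1) * xact (dsum A B) n"
    using wf_gmodD(4)[OF assms(1)] wf_gmodD(4)[OF assms(2)]
    by (simp add: dsum_def mult_four_block_mat_dims d mat_unit_dims)
qed

lemma biprod_dsum:
  assumes A: "wf_gmod A" and B: "wf_gmod B"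
  shows "biprod_wit (dsum A B) A B (dsum_in1 A B) (dsum_in2 A B) (dsum_pr1 A B) (dsum_pr2 A B)"
proof -
  note d = wf_gmod_dims[OF A] wf_gmod_dims[OF B] mat_unit_dims
  note D = dsum_in1_def dsum_in2_def dsum_pr1_def dsum_pr2_def dsum_def
  note m = cblk_mult mult_rblk four_block_mult_cblk rblk_mult_four_block rblk_mult_cblk cblk_mult_rblk
  have "is_hom A (dsum A B) (dsum_in1 A B)" "is_hom B (dsum A B) (dsum_in2 A B)"
    "is_hom (dsum A B) A (dsum_pr1 A B)" "is_hom (dsum A B) B (dsum_pr2 A B)"
    unfolding is_hom_def by (auto simp: D m d intro!: carrier_matI)
  moreover have "hcomp (dsum_pr1 A B) (dsum_in1 A B) = hid A" "hcomp (dsum_pr2 A B) (dsum_in2 A B) = hid B"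
    "hcomp (dsum_pr1 A B) (dsum_in2 A B) = hzero B A" "hcomp (dsum_pr2 A B) (dsum_in1 A B) = hzero A B"
    unfolding hcomp_def hid_def hzero_def by (auto simp: D m d intro!: ext)
  moreover have "hadd (hcomp (dsum_in1 A B) (dsum_pr1 A B)) (hcomp (dsum_in2 A B) (dsum_pr2 A B)) = hid (dsum A B)"
    unfolding hcomp_def hid_def hadd_def dsum_in1_def dsum_in2_def dsum_pr1_def dsum_pr2_def
    by (rule ext, subst (1 2) cblk_mult_rblk) (auto simp: mat_unit_dims intro!: eq_matI)
  ultimately show ?thesis by (simp add: biprod_wit_def)
qed

lemma iso_sym: "iso M N \<Longrightarrow> iso N M" unfolding iso_def by blast

lemma iso_gdim: "iso M N \<Longrightarrow> gdim M n = gdim N n"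
proof -
  assume "iso M N"
  then obtain f g where f: "is_hom M N f" "is_hom N M g" and e: "hcomp g f = hid M" "hcomp f g = hid N"
    unfolding iso_def by blast
  have "f n * g n = 1\<^sub>m (gdim N n)" "g n * f n = 1\<^sub>m (gdim M n)"
    using fun_cong[OF e(1), of n] fun_cong[OF e(2), of n] by (auto simp: hcomp_def hid_def)
  then show ?thesis using inverse_mats_imp_same_dim famD[OF is_homD(1)] f by metis
qed

lemma biprod_imp_iso:
  assumes w: "wf_gmod M" "wf_gmod A" "wf_gmod B" and b: "biprod M A B"
  shows "iso M (dsum A B)"
proof -
  obtain i1 i2 p1 p2 where b: "biprod_wit M A B i1 i2 p1 p2" using b biprod_def by blast
  let ?S = "dsum A B"
  obtain j1 j2 q1 q2 where c: "biprod_wit ?S A B j1 j2 q1 q2" using biprod_dsum w by blast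
  note b = b[unfolded biprod_wit_def] and c = c[unfolded biprod_wit_def]
  note f = is_homD(1)[of A M i1] is_homD(1)[of B M i2] is_homD(1)[of M A p1] is_homD(1)[of M B p2]
    is_homD(1)[of A ?S j1] is_homD(1)[of B ?S j2] is_homD(1)[of ?S A q1] is_homD(1)[of ?S B q2]
  have F: "fam A M i1" "fam B M i2" "fam M A p1" "fam M B p2" "fam A ?S j1" "fam B ?S j2" "fam ?S A q1" "fam ?S B q2"
    using b c f by auto
  \<comment> \<open>One computation serves for both composites: the inner projections and injections
    cancel, since together they form the identity matrix of the two summands.\<close>
  have gen: "hcomp (hadd (hcomp j1 p1) (hcomp j2 p2)) (hadd (hcomp i1 q1) (hcomp i2 q2)) = hadd (hcomp j1 q1) (hcomp j2 q2)"
    if F: "fam A M i1" "fam B M i2" "fam M A p1" "fam M B p2" "fam A N j1" "fam B N j2" "fam N A q1" "fam N B q2"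
      and e: "hcomp p1 i1 = hid A" "hcomp p2 i2 = hid B" "hcomp p1 i2 = hzero B A" "hcomp p2 i1 = hzero A B"
    for M N i1 i2 p1 p2 j1 j2 q1 q2
  proof (rule ext)
    fix n
    note d = fam_dims[OF F(1)] fam_dims[OF F(2)] fam_dims[OF F(3)] fam_dims[OF F(4)]
      fam_dims[OF F(5)] fam_dims[OF F(6)] fam_dims[OF F(7)] fam_dims[OF F(8)]
    have e': "p1 n * i1 n = 1\<^sub>m (gdim A n)" "p2 n * i2 n = 1\<^sub>m (gdim B n)"
      "p1 n * i2 n = 0\<^sub>m (gdim A n) (gdim B n)" "p2 n * i1 n = 0\<^sub>m (gdim B n) (gdim A n)"
      using fun_cong[OF e(1), of n] fun_cong[OF e(2), of n] fun_cong[OF e(3), of n] fun_cong[OF e(4), of n]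
      by (auto simp: hcomp_def hid_def hzero_def)
    have c: "X * (Y * (Z * W)) = X * ((Y * Z) * W)"
      if "dim_col Y = dim_row Z" "dim_col Z = dim_row W" for X Y Z W :: "complex mat"
      using that by (simp add: mat_assoc)
    show "hcomp (hadd (hcomp j1 p1) (hcomp j2 p2)) (hadd (hcomp i1 q1) (hcomp i2 q2)) n = hadd (hcomp j1 q1) (hcomp j2 q2) n"
      unfolding hcomp_def hadd_def
      by (simp add: d mat_distrib_left mat_distrib_right mat_assoc)
         (simp add: d c e' mat_unit_dims)
  qed
  have "is_hom M ?S (hadd (hcomp j1 p1) (hcomp j2 p2))" "is_hom ?S M (hadd (hcomp i1 q1) (hcomp i2 q2))"
    using b c w wf_dsum[OF w(2,3)] is_hom_hcomp[of M A ?S p1 j1] is_hom_hcomp[of M B ?S p2 j2]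
      is_hom_hcomp[of ?S A M q1 i1] is_hom_hcomp[of ?S B M q2 i2] by (auto intro!: is_hom_hadd)
  moreover have "hcomp (hadd (hcomp i1 q1) (hcomp i2 q2)) (hadd (hcomp j1 p1) (hcomp j2 p2)) = hid M"
    using gen[of ?S j1 j2 q1 q2 M i1 i2 p1 p2] F b c by simp
  moreover have "hcomp (hadd (hcomp j1 p1) (hcomp j2 p2)) (hadd (hcomp i1 q1) (hcomp i2 q2)) = hid ?S"
    using gen[of M i1 i2 p1 p2 ?S j1 j2 q1 q2] F b c by simp
  ultimately show ?thesis unfolding iso_def by blast
qed

lemma biprod_swap:
  assumes "wf_gmod M" "wf_gmod A" "wf_gmod B" "biprod M A B"
  shows "biprod M B A"
proof -
  obtain i1 i2 p1 p2 where b: "biprod_wit M A B i1 i2 p1 p2" using assms biprod_def by blast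
  note b = b[unfolded biprod_wit_def]
  have "hadd (hcomp i2 p2) (hcomp i1 p1) = hadd (hcomp i1 p1) (hcomp i2 p2)"
    by (rule hadd_comm[of M M]) (use b is_homD(1) fam_hcomp in blast)+
  then have "biprod_wit M B A i2 i1 p2 p1" unfolding biprod_wit_def using b by auto
  then show ?thesis unfolding biprod_def by blast
qed

lemma biprod_gdim:
  assumes "wf_gmod M" "wf_gmod A" "wf_gmod B" "biprod M A B"
  shows "gdim M n = gdim A n + gdim B n"
  using iso_gdim[OF biprod_imp_iso[OF assms], of n] by simp

text \<open>The complement is the image of the idempotent \<open>1 - i p\<close>.\<close>
lemma biprod_of_section:
  assumes M: "wf_gmod M" and A: "wf_gmod A" and i: "is_hom A M i" and p: "is_hom M A p" and pi: "hcomp p i = hid A"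
  shows "\<exists>B. wf_gmod B \<and> biprod M A B"
proof -
  note d = fam_dims[OF is_homD(1)[OF i]] fam_dims[OF is_homD(1)[OF p]] wf_gmod_dims[OF M] wf_gmod_dims[OF A]
  define E where "E = (\<lambda>n. 1\<^sub>m (gdim M n) - i n * p n)"
  have E: "E n \<in> carrier_mat (gdim M n) (gdim M n)" for n unfolding E_def using d by auto
  have pi': "p n * i n = 1\<^sub>m (gdim A n)" for n using fun_cong[OF pi, of n] by (auto simp: hcomp_def hid_def)
  have diff_left: "X * (Y - Z) = X * Y - X * Z" if "dim_col X = dim_row Y" "dim_row Y = dim_row Z" "dim_col Y = dim_col Z"
    for X Y Z :: "complex mat" by (rule mult_minus_distrib_mat) (use that in auto)
  have diff_right: "(Y - Z) * X = Y * X - Z * X" if "dim_col Y = dim_row X" "dim_row Y = dim_row Z" "dim_col Y = dim_col Z"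
    for X Y Z :: "complex mat" by (rule minus_mult_distrib_mat) (use that in auto)
  have pE: "p n * E n = 0\<^sub>m (gdim A n) (gdim M n)" for n
  proof -
    have "p n * E n = p n - p n * (i n * p n)" unfolding E_def by (subst diff_left) (auto simp: d mat_unit_dims)
    also have "p n * (i n * p n) = p n" using pi' by (simp add: mat_assoc[symmetric] d mat_unit_dims)
    finally show ?thesis using d by auto
  qed
  have Ei: "E n * i n = 0\<^sub>m (gdim M n) (gdim A n)" for n
  proof -
    have "E n * i n = i n - (i n * p n) * i n" unfolding E_def by (subst diff_right) (auto simp: d mat_unit_dims)
    also have "(i n * p n) * i n = i n" using pi' by (simp add: mat_assoc d mat_unit_dims)
    finally show ?thesis using d by auto
  qed
  have EE: "E n * E n = E n" for n
  proof -
    have "E n * E n = E n * (1\<^sub>m (gdim M n) - i n * p n)" by (simp add: E_def)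
    also have "\<dots> = E n - (E n * i n) * p n" by (subst diff_left) (auto simp: d carrier_matD[OF E] mat_unit_dims mat_assoc)
    also have "\<dots> = E n" unfolding Ei by (rule eq_matI) (auto simp: d carrier_matD[OF E] mat_unit_dims)
    finally show ?thesis .
  qed
  obtain r a b where ab: "\<And>n. a n \<in> carrier_mat (gdim M n) (r n) \<and> b n \<in> carrier_mat (r n) (gdim M n)
      \<and> a n * b n = E n \<and> b n * a n = 1\<^sub>m (r n)"
    using idempotent_factorization[OF E EE] by metis
  have ad: "dim_row (a n) = gdim M n" "dim_col (a n) = r n" "dim_row (b n) = r n" "dim_col (b n) = gdim M n" for n
    using ab[of n] by auto
  have abE: "a n * b n = E n" and ba: "b n * a n = 1\<^sub>m (r n)" for n using ab by auto
  have Ea: "E n * a n = a n" for n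
    unfolding abE[symmetric] using ba by (simp add: mat_assoc ad mat_unit_dims)
  have bE: "b n * E n = b n" for n
    unfolding abE[symmetric] using ba by (simp add: mat_assoc[symmetric] ad mat_unit_dims)
  have xE: "E (n+1) * xact M n = xact M n * E n" for n
  proof -
    have "(i (n+1) * p (n+1)) * xact M n = xact M n * (i n * p n)"
      using fun_cong[OF refl] is_homD(2)[OF is_hom_hcomp[OF M A M p i]] by (simp add: hcomp_def)
    then show ?thesis unfolding E_def by (simp add: diff_left diff_right d mat_unit_dims)
  qed
  have yE: "E (n-1) * yact M n = yact M n * E n" for n
  proof -
    have "(i (n-1) * p (n-1)) * yact M n = yact M n * (i n * p n)"
      using fun_cong[OF refl] is_homD(3)[OF is_hom_hcomp[OF M A M p i]] by (simp add: hcomp_def)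
    then show ?thesis unfolding E_def by (simp add: diff_left diff_right d mat_unit_dims)
  qed
  note dd = d ad carrier_matD[OF E]
  \<comment> \<open>\<open>r n\<close> is the rank of \<open>E n\<close>. Transporting the actions
    along \<open>a\<close> and \<open>b\<close> restricts them to the image of \<open>E\<close>, and
    \<open>a\<close>, \<open>b\<close> become homomorphisms because \<open>E\<close> commutes with
    \<open>x\<close> and \<open>y\<close>.\<close>
  define B where "B = \<lparr>gdim = r, xact = (\<lambda>n. b (n+1) * (xact M n * a n)), yact = (\<lambda>n. b (n-1) * (yact M n * a n))\<rparr>"
  have Bs: "gdim B n = r n" "xact B n = b (n+1) * (xact M n * a n)" "yact B n = b (n-1) * (yact M n * a n)" for n
    by (auto simp: B_def)
  have ax: "a (n+1) * xact B n = xact M n * a n" for n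
  proof -
    have "a (n+1) * xact B n = E (n+1) * xact M n * a n" unfolding Bs abE[symmetric] by (simp add: mat_assoc dd)
    also have "\<dots> = xact M n * (E n * a n)" unfolding xE by (simp add: mat_assoc dd)
    finally show ?thesis by (simp add: Ea)
  qed
  have ay: "a (n-1) * yact B n = yact M n * a n" for n
  proof -
    have "a (n-1) * yact B n = E (n-1) * yact M n * a n" unfolding Bs abE[symmetric] by (simp add: mat_assoc dd)
    also have "\<dots> = yact M n * (E n * a n)" unfolding yE by (simp add: mat_assoc dd)
    finally show ?thesis by (simp add: Ea)
  qed
  have bx: "b (n+1) * xact M n = xact B n * b n" for n
  proof -
    have "xact B n * b n = b (n+1) * (xact M n * E n)" unfolding Bs abE[symmetric] by (simp add: mat_assoc dd)
    also have "\<dots> = b (n+1) * E (n+1) * xact M n" unfolding xE[symmetric] by (simp add: mat_assoc dd)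
    finally show ?thesis by (simp add: bE)
  qed
  have by_: "b (n-1) * yact M n = yact B n * b n" for n
  proof -
    have "yact B n * b n = b (n-1) * (yact M n * E n)" unfolding Bs abE[symmetric] by (simp add: mat_assoc dd)
    also have "\<dots> = b (n-1) * E (n-1) * yact M n" unfolding yE[symmetric] by (simp add: mat_assoc dd)
    finally show ?thesis by (simp add: bE)
  qed
  have Bd: "dim_row (xact B n) = r (n+1)" "dim_col (xact B n) = r n" "dim_row (yact B n) = r (n-1)" "dim_col (yact B n) = r n" for n
    by (auto simp: Bs dd)
  \<comment> \<open>\<open>a n\<close> has a left inverse, so the module axioms for \<open>B\<close>
    may be checked inside \<open>M\<close>.\<close>
  have cancel: "P = Q" if "a n * P = a n * Q" "dim_row P = r n" "dim_row Q = r n" for P Q n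
  proof -
    have "P = (b n * a n) * P" "(b n * a n) * Q = Q" unfolding ba using that by (auto simp: mat_unit_dims)
    then show ?thesis using that by (simp add: mat_assoc dd)
  qed
  have wB: "wf_gmod B" unfolding wf_gmod_def
  proof (intro allI conjI)
    fix n
    show "xact B n \<in> carrier_mat (gdim B (n+1)) (gdim B n)" "yact B n \<in> carrier_mat (gdim B (n-1)) (gdim B n)"
      using Bd Bs by auto
    have n2: "n + 1 + 1 = n + 2" by simp
    have "a (n+2) * (xact B (n+1) * xact B n) = xact M (n+1) * (a (n+1) * xact B n)"
      using ax[of "n+1", unfolded n2] Bd[of "n+1", unfolded n2] Bd[of n] dd
      by (simp only: mat_assoc[symmetric])
    also have "\<dots> = 0\<^sub>m (gdim M (n+2)) (gdim M n) * a n"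
      unfolding ax using wf_gmodD(3)[OF M, of n] by (simp add: mat_assoc[symmetric] dd)
    finally have "a (n+2) * (xact B (n+1) * xact B n) = a (n+2) * 0\<^sub>m (r (n+2)) (r n)" by (simp add: mat_unit_dims dd)
    then show "xact B (n+1) * xact B n = 0\<^sub>m (gdim B (n+2)) (gdim B n)"
      unfolding Bs(1) by (rule cancel) (simp_all only: Bd n2 index_mult_mat index_zero_mat)
    have "a n * (xact B (n-1) * yact B n) = xact M (n-1) * (a (n-1) * yact B n)"
      using ax[of "n-1"] Bd dd by (simp add: mat_assoc[symmetric])
    also have "\<dots> = yact M (n+1) * (a (n+1) * xact B n)"
      unfolding ax ay using wf_gmodD(4)[OF M, of n] by (simp add: mat_assoc[symmetric] dd)
    also have "\<dots> = a n * (yact B (n+1) * xact B n)"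
      using ay[of "n+1"] Bd dd by (simp add: mat_assoc[symmetric])
    finally show "xact B (n-1) * yact B n = yact B (n+1) * xact B n"
      by (rule cancel) (simp_all add: Bd)
  qed
  have "is_hom B M a" unfolding is_hom_def using ab Bs ax ay by auto
  moreover have "is_hom M B b" unfolding is_hom_def using ab Bs bx by_ by auto
  moreover have "hcomp b a = hid B" unfolding hcomp_def hid_def using ba Bs by auto
  moreover have "hcomp p a = hzero B A"
  proof
    fix n
    have "p n * a n = (p n * E n) * a n" using Ea by (simp add: mat_assoc dd)
    then show "hcomp p a n = hzero B A n" unfolding pE hcomp_def hzero_def Bs by (simp add: mat_unit_dims dd)
  qed
  moreover have "hcomp b i = hzero A B"
  proof
    fix n
    have "b n * i n = b n * (E n * i n)" using bE by (simp add: mat_assoc[symmetric] dd)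
    then show "hcomp b i n = hzero A B n" unfolding Ei hcomp_def hzero_def Bs by (simp add: mat_unit_dims dd)
  qed
  moreover have "hadd (hcomp i p) (hcomp a b) = hid M"
    unfolding hadd_def hcomp_def abE hid_def E_def by (rule ext, rule eq_matI) (auto simp: d)
  ultimately have "biprod_wit M A B i a p b" unfolding biprod_wit_def using i p pi by auto
  with wB show ?thesis unfolding biprod_def by blast
qed

section \<open>Finite generation and the colimit along y\<close>

fun ymat :: "gmod \<Rightarrow> int \<Rightarrow> nat \<Rightarrow> complex mat" where
  "ymat M m 0 = 1\<^sub>m (gdim M m)"
| "ymat M m (Suc b) = yact M (m - int b) * ymat M m b"

text \<open>The power of \<open>y\<close> from degree \<open>m\<close> down to degree
  \<open>n\<close>. For \<open>n > m\<close> the exponent is truncated to zero, which is why the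
  lemmas below assume \<open>n \<le> m\<close>.\<close>

definition yto :: "gmod \<Rightarrow> int \<Rightarrow> int \<Rightarrow> complex mat" where
  "yto M m n = ymat M m (nat (m - n))"

lemma ymat_carrier: "wf_gmod M \<Longrightarrow> ymat M m b \<in> carrier_mat (gdim M (m - int b)) (gdim M m)"
proof (induction b)
  case (Suc b)
  have "yact M (m - int b) \<in> carrier_mat (gdim M (m - int (Suc b))) (gdim M (m - int b))"
    using wf_gmodD(2)[OF Suc(2), of "m - int b"] by (simp add: algebra_simps)
  then show ?case using Suc by (auto intro: mult_carrier_mat)
qed simp

lemma yto_carrier: "wf_gmod M \<Longrightarrow> n \<le> m \<Longrightarrow> yto M m n \<in> carrier_mat (gdim M n) (gdim M m)"
  unfolding yto_def using ymat_carrier[of M m "nat (m - n)"] by simp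

lemma yto_self [simp]: "yto M m m = 1\<^sub>m (gdim M m)" by (simp add: yto_def)

lemma yto_dec: "n \<le> m \<Longrightarrow> yto M m (n - 1) = yact M n * yto M m n"
proof -
  assume "n \<le> m"
  then have "nat (m - (n - 1)) = Suc (nat (m - n))" "m - int (nat (m - n)) = n" by auto
  then show ?thesis unfolding yto_def by simp
qed

lemma int_down_induct [consumes 1, case_names base step]:
  fixes n m :: int
  assumes "n \<le> m" "P m" "\<And>n. n \<le> m \<Longrightarrow> P n \<Longrightarrow> P (n - 1)"
  shows "P n"
  using int_le_induct[of n m P] assms by blast

lemma yto_inc:
  assumes "wf_gmod M"
  shows "n \<le> m \<Longrightarrow> yto M m n * yact M (m + 1) = yto M (m + 1) n"
proof (induction rule: int_down_induct)
  case base
  have "yto M (m+1) (m + 1 - 1) = yact M (m+1) * yto M (m+1) (m+1)" by (rule yto_dec) simp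
  then show ?case using wf_gmod_dims[OF assms] by (simp add: mat_unit_dims)
next
  case (step n)
  have "yto M m (n - 1) * yact M (m + 1) = yact M n * (yto M m n * yact M (m + 1))"
    using step carrier_matD[OF yto_carrier[OF assms step(1)]]
    by (simp add: yto_dec mat_assoc wf_gmod_dims[OF assms])
  also have "\<dots> = yto M (m + 1) (n - 1)" using step by (simp add: yto_dec)
  finally show ?case .
qed

lemma yhom_yto:
  assumes "wf_gmod M" "wf_gmod N" "yhom M N f"
  shows "n \<le> m \<Longrightarrow> f n * yto M m n = yto N m n * f m"
proof (induction rule: int_down_induct)
  case base
  then show ?case using fam_dims[OF yhomD(1)[OF assms(3)]] by (simp add: mat_unit_dims)
next
  case (step n)
  note d = fam_dims[OF yhomD(1)[OF assms(3)]] wf_gmod_dims[OF assms(1)] wf_gmod_dims[OF assms(2)]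
    carrier_matD[OF yto_carrier[OF assms(1) step(1)]] carrier_matD[OF yto_carrier[OF assms(2) step(1)]]
  have "f (n - 1) * yto M m (n - 1) = (f (n - 1) * yact M n) * yto M m n"
    using step(1) by (simp add: yto_dec mat_assoc d)
  also have "\<dots> = yact N n * (f n * yto M m n)" unfolding yhomD(2)[OF assms(3)] by (simp add: mat_assoc d)
  also have "\<dots> = yto N m (n - 1) * f m" unfolding step(2) using step(1) by (simp add: yto_dec mat_assoc d)
  finally show ?case .
qed

lemma xact_yto:
  assumes "wf_gmod M"
  shows "n \<le> m \<Longrightarrow> xact M n * yto M m n = yto M (m + 1) (n + 1) * xact M m"
proof (induction rule: int_down_induct)
  case base
  then show ?case using wf_gmod_dims[OF assms(1)] by (simp add: mat_unit_dims)
next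
  case (step n)
  have le: "n + 1 \<le> m + 1" using step by simp
  note d = wf_gmod_dims[OF assms(1)] 
    carrier_matD[OF yto_carrier[OF assms(1) step(1)]] carrier_matD[OF yto_carrier[OF assms(1) le]]
  have "xact M (n - 1) * yto M m (n - 1) = (xact M (n - 1) * yact M n) * yto M m n"
    using step(1) by (simp add: yto_dec mat_assoc d)
  also have "\<dots> = yact M (n + 1) * (xact M n * yto M m n)" unfolding wf_gmodD(4)[OF assms] by (simp add: mat_assoc d)
  also have "\<dots> = (yact M (n + 1) * yto M (m + 1) (n + 1)) * xact M m" unfolding step(2) by (simp add: mat_assoc d)
  also have "yact M (n + 1) * yto M (m + 1) (n + 1) = yto M (m + 1) (n - 1 + 1)" using yto_dec[OF le, of M] by simp
  finally show ?case .
qed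

lemma yiter_eq:
  assumes "wf_gmod M" "v \<in> carrier_vec (gdim M m)"
  shows "yiter M b m v = ymat M m b *\<^sub>v v"
proof (induction b)
  case (Suc b)
  have "dim_row (ymat M m b) = gdim M (m - int b)" "dim_col (ymat M m b) = gdim M m"
    using ymat_carrier[OF assms(1), of m b] by auto
  then show ?case using Suc assms by (simp add: mat_vec_assoc wf_gmod_dims)
qed (use assms in simp)

lemma mult_mat_vec_zero: "A \<in> carrier_mat n m \<Longrightarrow> A *\<^sub>v 0\<^sub>v m = (0\<^sub>v n :: 'a :: semiring_0 vec)"
  by (intro eq_vecI) auto

lemma mult_mat_vec_lin:
  fixes A :: "'a :: field mat"
  assumes "A \<in> carrier_mat n m" "v \<in> carrier_vec m" "w \<in> carrier_vec m"
  shows "A *\<^sub>v (c \<cdot>\<^sub>v v + w) = c \<cdot>\<^sub>v (A *\<^sub>v v) + A *\<^sub>v w"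
proof -
  have "A *\<^sub>v (c \<cdot>\<^sub>v v + w) = A *\<^sub>v (c \<cdot>\<^sub>v v) + A *\<^sub>v w"
    by (rule mult_add_distrib_mat_vec) (use assms in auto)
  then show ?thesis using mult_mat_vec[OF assms(1,2)] by simp
qed

definition y_inj :: "gmod \<Rightarrow> bool" where
  "y_inj M \<longleftrightarrow> (\<forall>n. \<forall>v \<in> carrier_vec (gdim M n). yact M n *\<^sub>v v = 0\<^sub>v (gdim M (n-1)) \<longrightarrow> v = 0\<^sub>v (gdim M n))"

definition y_surj_low :: "gmod \<Rightarrow> bool" where
  "y_surj_low M \<longleftrightarrow> (\<exists>L. \<forall>n\<le>L. \<forall>w \<in> carrier_vec (gdim M (n-1)). \<exists>v \<in> carrier_vec (gdim M n). yact M n *\<^sub>v v = w)"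

definition bdd_top :: "gmod \<Rightarrow> bool" where
  "bdd_top M \<longleftrightarrow> (\<exists>U. \<forall>n>U. gdim M n = 0)"

text \<open>If \<open>y v = 0\<close> then \<open>x v\<close> is killed by both \<open>x\<close> and \<open>y\<close>.\<close>
lemma mcm_iff_y_inj:
  assumes M: "wf_gmod M"
  shows "mcm M \<longleftrightarrow> y_inj M"
proof
  assume m: "mcm M"
  show "y_inj M" unfolding y_inj_def
  proof (intro allI ballI impI)
    fix n v assume v: "v \<in> carrier_vec (gdim M n)" and y: "yact M n *\<^sub>v v = 0\<^sub>v (gdim M (n-1))"
    note d = wf_gmod_dims[OF M] carrier_vecD[OF v]
    let ?u = "xact M n *\<^sub>v v"
    have u: "?u \<in> carrier_vec (gdim M (n+1))" by (rule carrier_vecI) (simp add: d)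
    have "xact M (n+1) *\<^sub>v ?u = (xact M (n+1) * xact M n) *\<^sub>v v" by (simp add: mat_vec_assoc d)
    also have "\<dots> = 0\<^sub>v (gdim M (n+2))" unfolding wf_gmodD(3)[OF M] using v by (intro eq_vecI) auto
    finally have 1: "xact M (n+1) *\<^sub>v ?u = 0\<^sub>v (gdim M (n+1+1))" by (simp add: add.commute)
    have "yact M (n+1) *\<^sub>v ?u = (xact M (n-1) * yact M n) *\<^sub>v v" unfolding wf_gmodD(4)[OF M] by (simp add: mat_vec_assoc d)
    also have "\<dots> = xact M (n-1) *\<^sub>v (yact M n *\<^sub>v v)" by (simp add: mat_vec_assoc d)
    also have "\<dots> = 0\<^sub>v (gdim M (n+1-1))" unfolding y using mult_mat_vec_zero[OF wf_gmodD(1)[OF M, of "n-1"]] by simp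
    finally have "?u = 0\<^sub>v (gdim M (n+1))" using m u 1 unfolding mcm_def by blast
    then show "v = 0\<^sub>v (gdim M n)" using m v y unfolding mcm_def by blast
  qed
qed (auto simp: mcm_def y_inj_def)

definition lin_comb :: "gmod \<Rightarrow> int \<Rightarrow> (complex \<times> (int \<times> complex vec) \<times> bool \<times> nat) list \<Rightarrow> complex vec" where
  "lin_comb M m ts = foldr (\<lambda>(c,(n,v),e,b) acc. c \<cdot>\<^sub>v mono_act M e b n v + acc) ts (0\<^sub>v (gdim M m))"

lemma lin_comb_simps [simp]:
  "lin_comb M m [] = 0\<^sub>v (gdim M m)"
  "lin_comb M m ((c,(n,v),e,b) # ts) = c \<cdot>\<^sub>v mono_act M e b n v + lin_comb M m ts"
  by (simp_all add: lin_comb_def)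

lemma fin_gen_lin_comb: "fin_gen M \<longleftrightarrow> (\<exists>G. finite G \<and> (\<forall>(n,v)\<in>G. v \<in> carrier_vec (gdim M n)) \<and>
     (\<forall>m. \<forall>w \<in> carrier_vec (gdim M m).
        \<exists>ts. (\<forall>(c,(n,v),e,b) \<in> set ts. (n,v) \<in> G \<and> mono_deg e b n = m) \<and> w = lin_comb M m ts))"
  by (simp add: fin_gen_def lin_comb_def)

text \<open>A monomial raises the degree by at most one, through \<open>x\<close>, so nothing lives
  more than one degree above the generators.\<close>

lemma fin_gen_imp_bdd_top:
  assumes "fin_gen M"
  shows "bdd_top M"
proof -
  obtain G where G: "finite G" "\<forall>(n,v)\<in>G. v \<in> carrier_vec (gdim M n)"
    and gen: "\<And>m w. w \<in> carrier_vec (gdim M m) \<Longrightarrow>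
        \<exists>ts.
          (\<forall>(c,(n,v),e,b) \<in> set ts. (n,v) \<in> G \<and> mono_deg e b n = m) \<and>
          w = lin_comb M m ts"
    using assms unfolding fin_gen_lin_comb by blast
  have "\<exists>U. \<forall>n \<in> fst ` G. n \<le> U"
    using finite_imageI[OF G(1), of fst] by (meson Max_ge)
  then obtain U where U: "\<And>n v. (n,v) \<in> G \<Longrightarrow> n \<le> U" by force
  have "gdim M m = 0" if m: "m > U + 1" for m
  proof (rule ccontr)
    assume "gdim M m \<noteq> 0"
    then have "unit_vec (gdim M m) 0 \<noteq> (0\<^sub>v (gdim M m) :: complex vec)" by (intro unit_vec_nonzero) auto
    moreover obtain ts where
      ts: "\<forall>(c,(n,v),e,b) \<in> set ts. (n,v) \<in> G \<and> mono_deg e b n = m"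
      "unit_vec (gdim M m) 0 = lin_comb M m ts"
      using gen[OF unit_vec_carrier[of "gdim M m" 0]] by blast
    moreover have "ts = []"
    proof (rule ccontr)
      assume "ts \<noteq> []"
      then have "hd ts \<in> set ts" by simp
      moreover obtain c n v e b where "hd ts = (c,(n,v),e,b)" using surj_pair by metis
      ultimately have "(c,(n,v),e,b) \<in> set ts" by simp
      then have "(n,v) \<in> G" "mono_deg e b n = m" using ts(1) by auto
      then show False using U[of n v] m unfolding mono_deg_def by (auto split: if_splits)
    qed
    ultimately show False by simp
  qed
  then show ?thesis unfolding bdd_top_def by blast
qed

text \<open>Below all generator degrees every monomial that occurs is divisible by \<open>y\<close>.\<close>
lemma fin_gen_imp_y_surj_low:
  assumes M: "wf_gmod M" and "fin_gen M"
  shows "y_surj_low M"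
proof -
  obtain G where G: "finite G" "\<forall>(n,v)\<in>G. v \<in> carrier_vec (gdim M n)"
    and gen: "\<And>m w. w \<in> carrier_vec (gdim M m) \<Longrightarrow>
        \<exists>ts.
          (\<forall>(c,(n,v),e,b) \<in> set ts. (n,v) \<in> G \<and> mono_deg e b n = m) \<and>
          w = lin_comb M m ts"
    using assms unfolding fin_gen_lin_comb by blast
  note d = wf_gmod_dims[OF M]
  have "\<exists>L. \<forall>n \<in> fst ` G. L \<le> n"
    using finite_imageI[OF G(1), of fst] by (meson Min_le)
  then obtain L where L: "\<And>n v. (n,v) \<in> G \<Longrightarrow> L \<le> n" by force
  have "\<exists>v \<in> carrier_vec (gdim M n). yact M n *\<^sub>v v = w" if n: "n \<le> L" and w: "w \<in> carrier_vec (gdim M (n-1))" for n w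
  proof -
    define S where "S = {yact M n *\<^sub>v v | v. v \<in> carrier_vec (gdim M n)}"
    have S0: "0\<^sub>v (gdim M (n-1)) \<in> S" unfolding S_def using mult_mat_vec_zero[OF wf_gmodD(2)[OF M, of n]] 
      by (auto intro!: exI[of _ "0\<^sub>v (gdim M n)"])
    have Sadd: "c \<cdot>\<^sub>v u + u' \<in> S" if uS: "u \<in> S" "u' \<in> S" for c u u'
    proof -
      obtain v v' where v: "u = yact M n *\<^sub>v v" "v \<in> carrier_vec (gdim M n)" "u' = yact M n *\<^sub>v v'" "v' \<in> carrier_vec (gdim M n)"
        using uS unfolding S_def by blast
      have "c \<cdot>\<^sub>v u + u' = yact M n *\<^sub>v (c \<cdot>\<^sub>v v + v')"
        unfolding v(1,3)
        by (rule mult_mat_vec_lin[OF wf_gmodD(2)[OF M] v(2,4), symmetric])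
      moreover have "c \<cdot>\<^sub>v v + v' \<in> carrier_vec (gdim M n)" using v by simp
      ultimately show ?thesis unfolding S_def mem_Collect_eq by (intro exI conjI)
    qed
    have mono: "mono_act M e b n' v \<in> S" if "(n',v) \<in> G" "mono_deg e b n' = n - 1" for n' v e b
    proof -
      have v: "v \<in> carrier_vec (gdim M n')" using that G by auto
      have n': "L \<le> n'" using L that by blast
      have "b \<noteq> 0" using that n n' unfolding mono_deg_def by (auto split: if_splits)
      then obtain b' where b': "b = Suc b'" by (cases b) auto
      let ?u = "ymat M n' b' *\<^sub>v v"
      have yc: "ymat M n' b' \<in> carrier_mat (gdim M (n' - int b')) (gdim M n')" by (rule ymat_carrier[OF M])
      have u: "?u \<in> carrier_vec (gdim M (n' - int b'))" using yc v by auto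
      have eq: "yiter M b n' v = yact M (n' - int b') *\<^sub>v ?u" unfolding b' using yiter_eq[OF M v, of b'] by simp
      show ?thesis
      proof (cases e)
        case False
        then have "n' - int b' = n" using that(2) unfolding mono_deg_def b' by simp
        then show ?thesis using False eq u unfolding mono_act_def S_def by auto
      next
        case True
        then have deg: "n' - int b' = n - 1" using that(2) unfolding mono_deg_def b' by simp
        then have deg': "n' - int b = n - 1 - 1" using b' by simp
        have yr: "dim_row (ymat M n' b') = gdim M (n - 1)" using yc deg by auto
        have "mono_act M e b n' v = xact M (n - 1 - 1) *\<^sub>v (yact M (n - 1) *\<^sub>v ?u)"
          using True eq deg deg' unfolding mono_act_def by simp
        also have "\<dots> = (xact M (n - 1 - 1) * yact M (n - 1)) *\<^sub>v ?u"
          by (subst mat_vec_assoc) (auto simp: d yr)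
        also have "\<dots> = yact M n *\<^sub>v (xact M (n - 1) *\<^sub>v ?u)"
          unfolding wf_gmodD(4)[OF M] by (subst mat_vec_assoc) (auto simp: d yr)
        finally have "mono_act M e b n' v = yact M n *\<^sub>v (xact M (n - 1) *\<^sub>v ?u)" .
        moreover have "xact M (n - 1) *\<^sub>v ?u \<in> carrier_vec (gdim M n)"
          using wf_gmodD(1)[OF M, of "n-1"] u unfolding deg by auto
        ultimately show ?thesis unfolding S_def by blast
      qed
    qed
    obtain ts where
      ts: "\<forall>(c,(n',v),e,b) \<in> set ts. (n',v) \<in> G \<and> mono_deg e b n' = n - 1"
      "w = lin_comb M (n-1) ts"
      using gen[OF w] by blast
    from ts(1) have "lin_comb M (n-1) ts \<in> S"
      by (induction ts) (use S0 Sadd mono in \<open>auto split: prod.splits\<close>)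
    then show ?thesis using ts(2) unfolding S_def by auto
  qed
  then show ?thesis unfolding y_surj_low_def by blast
qed

text \<open>The unit vectors in the degrees from \<open>L\<close> to \<open>U\<close> generate:
  below \<open>L\<close> every element is a power of \<open>y\<close> times an element of degree
  \<open>L\<close>, and above \<open>U\<close> there is nothing.\<close>

lemma fin_genI:
  assumes M: "wf_gmod M" and b: "bdd_top M" and s: "y_surj_low M"
  shows "fin_gen M"
proof -
  note d = wf_gmod_dims[OF M]
  obtain U where U: "\<And>n. n > U \<Longrightarrow> gdim M n = 0" using b unfolding bdd_top_def by blast
  obtain L where L: "\<And>n w. n \<le> L \<Longrightarrow> w \<in> carrier_vec (gdim M (n-1)) \<Longrightarrow> \<exists>v \<in> carrier_vec (gdim M n). yact M n *\<^sub>v v = w"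
    using s unfolding y_surj_low_def by blast
  define G where "G = (\<lambda>(n, i). (n, unit_vec (gdim M n) i :: complex vec)) ` (SIGMA n : {L..U}. {..<gdim M n})"
  have Gin: "(n, unit_vec (gdim M n) i) \<in> G" if "L \<le> n" "n \<le> U" "i < gdim M n" for n i
    unfolding G_def using that by force
  define S where "S m = {lin_comb M m ts |
      ts.
      \<forall>(c,(n,v),e,b) \<in> set ts. (n,v) \<in> G \<and> mono_deg e b n = m}" for m
  have S0: "0\<^sub>v (gdim M m) \<in> S m" for m unfolding S_def by (auto intro!: exI[of _ "[]"])
  have Sadd: "c \<cdot>\<^sub>v mono_act M e b n v + u \<in> S m" if uS: "u \<in> S m" "(n,v) \<in> G" "mono_deg e b n = m" for c e b n v u m
  proof -
    obtain ts where
      ts: "\<forall>(c,(n',v),e,b) \<in> set ts. (n',v) \<in> G \<and> mono_deg e b n' = m"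
      "u = lin_comb M m ts"
      using uS(1) unfolding S_def by blast
    show ?thesis unfolding S_def using ts uS by (auto intro!: exI[of _ "(c,(n,v),e,b) # ts"])
  qed
  have high: "ymat M n b *\<^sub>v u \<in> S (n - int b)" if n: "L \<le> n" "n \<le> U" and u: "u \<in> carrier_vec (gdim M n)" for n b u
  proof -
    note yc = ymat_carrier[OF M, of n b]
    \<comment> \<open>The vector is built up one coordinate at a time, each adding one monomial in a
      unit vector.\<close>
    have "ymat M n b *\<^sub>v vec (gdim M n) (\<lambda>i. if i < k then u $ i else 0) \<in> S (n - int b)" if "k \<le> gdim M n" for k
      using that
    proof (induction k)
      case 0
      have "vec (gdim M n) (\<lambda>i. if i < 0 then u $ i else 0) = 0\<^sub>v (gdim M n)" by (intro eq_vecI) auto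
      then show ?case using S0 mult_mat_vec_zero[OF yc] by simp
    next
      case (Suc k)
      let ?v = "vec (gdim M n) (\<lambda>i. if i < k then u $ i else 0)"
      have "vec (gdim M n) (\<lambda>i. if i < Suc k then u $ i else 0) = u $ k \<cdot>\<^sub>v unit_vec (gdim M n) k + ?v"
        using Suc by (intro eq_vecI) (auto simp: less_Suc_eq)
      then have "ymat M n b *\<^sub>v vec (gdim M n) (\<lambda>i. if i < Suc k then u $ i else 0) =
         u $ k \<cdot>\<^sub>v (ymat M n b *\<^sub>v unit_vec (gdim M n) k) + ymat M n b *\<^sub>v ?v"
        by (simp add: mult_add_distrib_mat_vec[OF yc] mult_mat_vec[OF yc])
      also have "ymat M n b *\<^sub>v unit_vec (gdim M n) k = mono_act M False b n (unit_vec (gdim M n) k)"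
        unfolding mono_act_def by (simp add: yiter_eq[OF M])
      also have "u $ k \<cdot>\<^sub>v mono_act M False b n (unit_vec (gdim M n) k) + ymat M n b *\<^sub>v ?v \<in> S (n - int b)"
        by (rule Sadd) (use Suc n Gin in \<open>auto simp: mono_deg_def\<close>)
      finally show ?case .
    qed
    from this[of "gdim M n"] have "ymat M n b *\<^sub>v vec (gdim M n) (\<lambda>i. if i < gdim M n then u $ i else 0) \<in> S (n - int b)" by simp
    also have "vec (gdim M n) (\<lambda>i. if i < gdim M n then u $ i else 0) = u" using u by (intro eq_vecI) auto
    finally show ?thesis .
  qed
  have low: "\<exists>u \<in> carrier_vec (gdim M L). w = ymat M L k *\<^sub>v u" if "w \<in> carrier_vec (gdim M (L - int k))" for w k
    using that
  proof (induction k arbitrary: w)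
    case 0 then show ?case by (auto intro!: bexI[of _ w])
  next
    case (Suc k)
    then obtain v where v: "v \<in> carrier_vec (gdim M (L - int k))" "yact M (L - int k) *\<^sub>v v = w"
      using L[of "L - int k" w] by (auto simp: algebra_simps)
    then obtain u where u: "u \<in> carrier_vec (gdim M L)" "v = ymat M L k *\<^sub>v u" using Suc.IH by blast
    then have "w = ymat M L (Suc k) *\<^sub>v u" using v carrier_matD[OF ymat_carrier[OF M, of L k]] 
      by (simp add: mat_vec_assoc d)
    then show ?case using u by blast
  qed
  have all: "w \<in> S m" if w: "w \<in> carrier_vec (gdim M m)" for w m
  \<comment> \<open>For \<open>L > U\<close> there are no generators at all; then degree
    \<open>L\<close> is zero, and surjectivity of \<open>y\<close> makes all lower degrees zero
    too.\<close>
  proof (cases "m > U \<or> L > U")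
    case True
    have "w = 0\<^sub>v (gdim M m)"
    proof (cases "m > U")
      case True then show ?thesis using U[of m] w by (intro eq_vecI) auto
    next
      case False
      then have m: "m \<le> L" using True by simp
      have mL: "L - int (nat (L - m)) = m" using m by simp
      obtain u where u: "u \<in> carrier_vec (gdim M L)" "w = ymat M L (nat (L - m)) *\<^sub>v u"
        using low[of w "nat (L - m)"] w m by auto
      have "gdim M L = 0" using U[of L] True False by simp
      then have "u = 0\<^sub>v (gdim M L)" using u by (intro eq_vecI) auto
      then show ?thesis using u mult_mat_vec_zero[OF ymat_carrier[OF M, of L "nat (L - m)"]] mL by simp
    qed
    then show ?thesis using S0 by simp
  next
    case False
    show ?thesis
    proof (cases "L \<le> m")
      case True
      then show ?thesis using high[of m w 0] False w by simp
    next
      case m: False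
      obtain u where u: "u \<in> carrier_vec (gdim M L)" "w = ymat M L (nat (L - m)) *\<^sub>v u"
        using low[of w "nat (L - m)"] w m by auto
      then show ?thesis using high[of L u "nat (L - m)"] False m by auto
    qed
  qed
  have "finite G" unfolding G_def by auto
  moreover have "\<forall>(n,v)\<in>G. v \<in> carrier_vec (gdim M n)" unfolding G_def by auto
  moreover have "\<exists>ts.
          (\<forall>(c,(n,v),e,b) \<in> set ts. (n,v) \<in> G \<and> mono_deg e b n = m) \<and>
          w = lin_comb M m ts"
    if "w \<in> carrier_vec (gdim M m)" for m w
    using all[OF that] unfolding S_def by blast
  ultimately show ?thesis unfolding fin_gen_lin_comb by blast
qed

text \<open>The working form of membership: no generators are mentioned, and each condition passes
  easily to summands and extensions.\<close>

lemma C2_iff: "M \<in> C2 \<longleftrightarrow> wf_gmod M \<and> bdd_top M \<and> y_inj M \<and> y_surj_low M"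
  unfolding C2_def using mcm_iff_y_inj fin_gen_imp_bdd_top fin_gen_imp_y_surj_low fin_genI by blast

lemma C2_wf: "M \<in> C2 \<Longrightarrow> wf_gmod M" by (simp add: C2_iff)

text \<open>The rank over C[y], seen as the constant dimension in low degrees. It is the measure for
  the induction that splits off arc modules.\<close>

definition low_rank :: "gmod \<Rightarrow> nat \<Rightarrow> bool" where
  "low_rank M r \<longleftrightarrow> (\<exists>L. \<forall>n\<le>L. gdim M n = r)"

lemma y_bij_low:
  assumes M: "M \<in> C2"
  shows "\<exists>L r Y. \<forall>n\<le>L. gdim M n = r \<and> Y n \<in> carrier_mat (gdim M n) (gdim M (n-1))
      \<and> yact M n * Y n = 1\<^sub>m (gdim M (n-1)) \<and> Y n * yact M n = 1\<^sub>m (gdim M n)"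
proof -
  have w: "wf_gmod M" using M C2_wf by blast
  obtain L where L: "\<And>n w. n \<le> L \<Longrightarrow> w \<in> carrier_vec (gdim M (n-1)) \<Longrightarrow> \<exists>v \<in> carrier_vec (gdim M n). yact M n *\<^sub>v v = w"
    using M unfolding C2_iff y_surj_low_def by blast
  have inj: "\<And>n v. v \<in> carrier_vec (gdim M n) \<Longrightarrow> yact M n *\<^sub>v v = 0\<^sub>v (gdim M (n-1)) \<Longrightarrow> v = 0\<^sub>v (gdim M n)"
    using M unfolding C2_iff y_inj_def by blast
  have *: "gdim M (n-1) = gdim M n" "\<exists>B \<in> carrier_mat (gdim M n) (gdim M (n-1)). yact M n * B = 1\<^sub>m (gdim M (n-1)) \<and> B * yact M n = 1\<^sub>m (gdim M n)"
    if "n \<le> L" for n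
    using mat_inverse_of_bij[OF wf_gmodD(2)[OF w] inj L[OF that]] by auto
  have "gdim M n = gdim M L" if "n \<le> L" for n
    using that by (induction rule: int_down_induct) (use * in auto)
  then show ?thesis using *(2) by metis
qed

lemma ex_low_rank: "M \<in> C2 \<Longrightarrow> \<exists>r. low_rank M r"
  using y_bij_low unfolding low_rank_def by blast

text \<open>The colimit of \<open>M\<close> along \<open>y\<close> is a space of dimension \<open>r\<close> with a nilpotent operator \<open>X\<close>,
  and \<open>K n\<close> embeds the degree \<open>n\<close> part into it.\<close>
lemma C2_colimit:
  assumes M: "M \<in> C2"
  shows "\<exists>r K X. (\<forall>n. K n \<in> carrier_mat r (gdim M n)) \<and> X \<in> carrier_mat r r
    \<and> (\<forall>n. K (n-1) * yact M n = K n) \<and> (\<forall>n. K (n+1) * xact M n = X * K n)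
    \<and> (\<forall>n. \<forall>v \<in> carrier_vec (gdim M n). K n *\<^sub>v v = 0\<^sub>v r \<longrightarrow> v = 0\<^sub>v (gdim M n))"
proof -
  have w: "wf_gmod M" using M C2_wf by blast
  note d = wf_gmod_dims[OF w]
  obtain L r Y where Y: "\<And>n. n \<le> L \<Longrightarrow> gdim M n = r \<and> Y n \<in> carrier_mat (gdim M n) (gdim M (n-1))
      \<and> yact M n * Y n = 1\<^sub>m (gdim M (n-1)) \<and> Y n * yact M n = 1\<^sub>m (gdim M n)"
    using y_bij_low[OF M] by blast
  \<comment> \<open>The colimit is modelled by degree \<open>L\<close>. From there the embeddings
    are powers of \<open>y\<close> in higher degrees and products of the inverses \<open>Y\<close>
    in lower ones.\<close>
  define K0 where "K0 = rec_nat (1\<^sub>m r) (\<lambda>k A. A * Y (L - int k))"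
  have K00: "K0 0 = 1\<^sub>m r" and K0S: "K0 (Suc k) = K0 k * Y (L - int k)" for k unfolding K0_def by auto
  have K0c: "K0 k \<in> carrier_mat r r" for k
  proof (induction k)
    case (Suc k)
    have "gdim M (L - int k) = r" "gdim M (L - int k - 1) = r" using Y[of "L - int k"] Y[of "L - int k - 1"] by simp_all
    moreover have "Y (L - int k) \<in> carrier_mat (gdim M (L - int k)) (gdim M (L - int k - 1))"
    proof -
      have "L - int k \<le> L" by simp
      from Y[OF this] show ?thesis by blast
    qed
    ultimately have "Y (L - int k) \<in> carrier_mat r r" by (simp only:)
    then show ?case unfolding K0S using Suc by auto
  qed (simp add: K00)
  define K where "K n = (if n \<ge> L then yto M n L else K0 (nat (L - n)))" for n
  have gL: "gdim M L = r" using Y by simp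
  have Kc: "K n \<in> carrier_mat r (gdim M n)" for n
    using yto_carrier[OF w, of L n] K0c Y[of n] gL unfolding K_def by auto
  have KL: "K L = 1\<^sub>m r" unfolding K_def using gL by simp
  have Klow: "K (n-1) = K n * Y n" if "n \<le> L" for n
  proof -
    have "nat (L - (n - 1)) = Suc (nat (L - n))" "L - int (nat (L - n)) = n" using that by auto
    then have "K (n - 1) = K0 (nat (L - n)) * Y n" unfolding K_def using that K0S[of "nat (L - n)"] by auto
    moreover have "K0 (nat (L - n)) = K n" using that KL K00 unfolding K_def by auto
    ultimately show ?thesis by simp
  qed
  note kd = carrier_matD[OF Kc]
  have Ky: "K (n-1) * yact M n = K n" for n
  proof (cases "n \<le> L")
    case True
    note Yn = Y[OF True]
    have "K (n-1) * yact M n = K n * (Y n * yact M n)"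
      unfolding Klow[OF True] using Yn by (subst mat_assoc) (auto simp: kd d)
    also have "\<dots> = K n" using Yn by (simp add: mat_unit_dims kd)
    finally show ?thesis .
  next
    case False
    then show ?thesis using yto_inc[OF w, of L "n - 1"] unfolding K_def by auto
  qed
  \<comment> \<open>In degree \<open>L\<close> the embedding is the identity, so the relation
    between \<open>X\<close> and \<open>x\<close> in that degree leaves no other choice.\<close>
  define X where "X = K (L+1) * xact M L"
  have X: "X \<in> carrier_mat r r" unfolding X_def using Kc[of "L+1"] wf_gmodD(1)[OF w, of L] gL by auto
  note xd = carrier_matD[OF X]
  have up: "K (n+1) * xact M n = X * K n" if "L \<le> n" for n
    using that
  proof (induction rule: int_ge_induct)
    case base
    then show ?case unfolding KL X_def using gL by (simp add: mat_unit_dims d)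
  next
    case (step n)
    have "K (n+1+1) * xact M (n+1) = K (n+1) * (yact M (n+1+1) * xact M (n+1))"
    proof -
      have "K (n+1) * yact M (n+1+1) = K (n+1+1)" using Ky[of "n+1+1"] by (simp only: add_diff_cancel)
      then have "K (n+1+1) * xact M (n+1) = (K (n+1) * yact M (n+1+1)) * xact M (n+1)" by (simp only:)
      also have "\<dots> = K (n+1) * (yact M (n+1+1) * xact M (n+1))" by (rule mat_assoc) (simp_all only: kd d add_diff_cancel)
      finally show ?thesis .
    qed
    also have "\<dots> = K (n+1) * (xact M n * yact M (n+1))" using wf_gmodD(4)[OF w, of "n+1"] by simp
    also have "\<dots> = X * (K n * yact M (n+1))" using step by (simp add: mat_assoc[symmetric] kd d xd)
    finally show ?case using Ky[of "n+1"] by simp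
  qed
  \<comment> \<open>Above \<open>L\<close> the relation propagates because \<open>x\<close> and
    \<open>y\<close> commute; below \<open>L\<close> it is carried down by inverting
    \<open>y\<close>.\<close>
  have Kx: "K (n+1) * xact M n = X * K n" for n
  proof (cases "L \<le> n")
    case False
    then have "n \<le> L" by simp
    then show ?thesis
    proof (induction rule: int_down_induct)
      case (step n)
      note Yn = Y[OF step(1)]
      have Yd: "dim_row (Y n) = gdim M n" "dim_col (Y n) = gdim M (n-1)" using Yn by auto
      have "K n * xact M (n-1) = K n * xact M (n-1) * (yact M n * Y n)" using Yn by (simp add: mat_unit_dims d kd)
      also have "\<dots> = K n * (xact M (n-1) * yact M n) * Y n" by (simp add: mat_assoc d kd Yd)
      also have "\<dots> = (K n * yact M (n+1)) * xact M n * Y n" unfolding wf_gmodD(4)[OF w] by (simp add: mat_assoc d kd Yd)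
      also have "\<dots> = X * K n * Y n" using Ky[of "n+1"] step by simp
      also have "\<dots> = X * K (n-1)" unfolding Klow[OF step(1)] by (simp add: mat_assoc d kd Yd xd)
      finally show ?case by simp
    qed (use up in simp)
  qed (use up in simp)
  have inj: "v = 0\<^sub>v (gdim M n)" if v: "v \<in> carrier_vec (gdim M n)" and z: "K n *\<^sub>v v = 0\<^sub>v r" for n v
  proof (cases "L \<le> n")
    case True
    then show ?thesis using v z
    proof (induction n arbitrary: v rule: int_ge_induct)
      case base then show ?case unfolding KL using gL by simp
    next
      case (step n)
      have "K n *\<^sub>v (yact M (n+1) *\<^sub>v v) = (K (n + 1 - 1) * yact M (n+1)) *\<^sub>v v"
        using step by (subst mat_vec_assoc) (auto simp: d kd)
      also have "\<dots> = 0\<^sub>v r" unfolding Ky using step by simp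
      finally have "yact M (n+1) *\<^sub>v v = 0\<^sub>v (gdim M (n + 1 - 1))"
        using step.IH[of "yact M (n+1) *\<^sub>v v"] step wf_gmodD(2)[OF w, of "n+1"] by auto
      then show ?case using M step unfolding C2_iff y_inj_def by blast
    qed
  next
    case False
    then have "n \<le> L" by simp
    then show ?thesis using v z
    proof (induction n arbitrary: v rule: int_down_induct)
      case base then show ?case unfolding KL using gL by simp
    next
      case (step n)
      note Yn = Y[OF step(1)]
      have Yd: "dim_row (Y n) = gdim M n" "dim_col (Y n) = gdim M (n-1)" using Yn by auto
      have v: "dim_vec v = gdim M (n-1)" using step by auto
      have "K n *\<^sub>v (Y n *\<^sub>v v) = 0\<^sub>v r" using step unfolding Klow[OF step(1)] by (simp add: mat_vec_assoc kd Yd v)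
      then have "Y n *\<^sub>v v = 0\<^sub>v (gdim M n)" using step.IH[of "Y n *\<^sub>v v"] Yn step(3) by auto
      then have "yact M n *\<^sub>v (Y n *\<^sub>v v) = 0\<^sub>v (gdim M (n-1))" using mult_mat_vec_zero[OF wf_gmodD(2)[OF w]] by simp
      moreover have "yact M n *\<^sub>v (Y n *\<^sub>v v) = v" using Yn step(3) by (subst mat_vec_assoc[symmetric]) (auto simp: d v)
      ultimately show ?case by simp
    qed
  qed
  show ?thesis using Kc X Ky Kx inj by blast
qed

section \<open>Arc modules\<close>

fun ele :: "int \<Rightarrow> ext_int \<Rightarrow> bool" where
  "ele n NegInf = False"
| "ele n (Fin a) = (n \<le> a)"

lemma ele_mono: "ele n c \<Longrightarrow> m \<le> n \<Longrightarrow> ele m c" by (cases c) auto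

lemma ele_lt_arc: "is_arc \<alpha> \<Longrightarrow> ele n (fst \<alpha>) \<Longrightarrow> n < snd \<alpha>"
  by (cases "fst \<alpha>") (auto simp: is_arc_def)

definition arc_dim :: "arc \<Rightarrow> int \<Rightarrow> nat" where
  "arc_dim \<alpha> n = (if n \<le> snd \<alpha> then 1 else 0) + (if ele n (fst \<alpha>) then 1 else 0)"

abbreviation amod :: "arc \<Rightarrow> gmod" where "amod \<equiv> module_of_arc"

text \<open>The ends of a finite arc are the degrees of the generators \<open>y^k\<close> and
  \<open>x\<close> of the shifted ideal, and the end of an infinite arc is the degree of the
  generator of C[y]. This gives finite and infinite arcs one description, in which the second basis
  vector never occurs for \<open>NegInf\<close>.\<close>

lemma amod_sel:
  assumes "is_arc \<alpha>"
  shows "gdim (amod \<alpha>) n = arc_dim \<alpha> n"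
    "xact (amod \<alpha>) n = mat (arc_dim \<alpha> (n+1)) (arc_dim \<alpha> n) (\<lambda>(i,j). if i = 0 \<and> j = 1 then 1 else 0)"
    "yact (amod \<alpha>) n = mat (arc_dim \<alpha> (n-1)) (arc_dim \<alpha> n) (\<lambda>(i,j). if i = j then 1 else 0)"
proof -
  obtain c b where \<alpha>: "\<alpha> = (c, b)" by fastforce
  have "gdim (amod \<alpha>) n = arc_dim \<alpha> n \<and>
    xact (amod \<alpha>) n = mat (arc_dim \<alpha> (n+1)) (arc_dim \<alpha> n) (\<lambda>(i,j). if i = 0 \<and> j = 1 then 1 else 0) \<and>
    yact (amod \<alpha>) n = mat (arc_dim \<alpha> (n-1)) (arc_dim \<alpha> n) (\<lambda>(i,j). if i = j then 1 else 0)"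
  proof (cases c)
    case NegInf
    then show ?thesis unfolding \<alpha> by (auto simp: shift_def cy_mod_def arc_dim_def intro!: eq_matI)
  next
    case (Fin a)
    then have ab: "a < b" using assms \<alpha> by (simp add: is_arc_def)
    have dims: "ideal_dim (nat (b - 1 - a)) (1 - b + m) = arc_dim \<alpha> m" for m
      using ab unfolding \<alpha> Fin ideal_dim_def arc_dim_def by auto
    have e: "1 - b + n + 1 = 1 - b + (n + 1)" "1 - b + n - 1 = 1 - b + (n - 1)" by auto
    show ?thesis using dims[of n] dims[of "n+1"] dims[of "n-1"] unfolding \<alpha> Fin
      by (simp add: shift_def ideal_mod_def e del: add_diff_eq diff_add_eq)
  qed
  then show "gdim (amod \<alpha>) n = arc_dim \<alpha> n"
    "xact (amod \<alpha>) n = mat (arc_dim \<alpha> (n+1)) (arc_dim \<alpha> n) (\<lambda>(i,j). if i = 0 \<and> j = 1 then 1 else 0)"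
    "yact (amod \<alpha>) n = mat (arc_dim \<alpha> (n-1)) (arc_dim \<alpha> n) (\<lambda>(i,j). if i = j then 1 else 0)" by auto
qed

text \<open>\<open>av \<alpha> n p q\<close> is \<open>p e + q f\<close> in degree \<open>n\<close>, where \<open>e\<close> and \<open>f\<close> are the multiples of the
  generators in degrees \<open>snd \<alpha>\<close> and \<open>fst \<alpha>\<close>; coordinates whose basis vector does not exist in
  degree \<open>n\<close> are dropped, and \<open>okv\<close> says that nothing is dropped.\<close>
definition av :: "arc \<Rightarrow> int \<Rightarrow> complex \<Rightarrow> complex \<Rightarrow> complex vec" where
  "av \<alpha> n p q = vec (arc_dim \<alpha> n) (\<lambda>i. if i = 0 then p else q)"

definition okv :: "arc \<Rightarrow> int \<Rightarrow> complex \<Rightarrow> complex \<Rightarrow> bool" where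
  "okv \<alpha> n p q \<longleftrightarrow> (p = 0 \<or> n \<le> snd \<alpha>) \<and> (q = 0 \<or> ele n (fst \<alpha>))"

lemma av_carrier [simp]: "is_arc \<alpha> \<Longrightarrow> av \<alpha> n p q \<in> carrier_vec (gdim (amod \<alpha>) n)"
  by (simp add: av_def amod_sel)

lemma dim_av [simp]: "dim_vec (av \<alpha> n p q) = arc_dim \<alpha> n" by (simp add: av_def)

lemma av_zero [simp]: "av \<alpha> n 0 0 = 0\<^sub>v (arc_dim \<alpha> n)" by (auto simp: av_def)
lemma av_add: "av \<alpha> n p q + av \<alpha> n p' q' = av \<alpha> n (p + p') (q + q')" by (auto simp: av_def)
lemma av_smult: "k \<cdot>\<^sub>v av \<alpha> n p q = av \<alpha> n (k * p) (k * q)" by (auto simp: av_def)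

lemma arc_dim_le2: "arc_dim \<alpha> n \<le> 2" by (simp add: arc_dim_def)

lemma arc_dim_cases:
  assumes "is_arc \<alpha>"
  obtains "\<not> n \<le> snd \<alpha>" "\<not> ele n (fst \<alpha>)" "arc_dim \<alpha> n = 0"
  | "n \<le> snd \<alpha>" "\<not> ele n (fst \<alpha>)" "arc_dim \<alpha> n = 1"
  | "n < snd \<alpha>" "ele n (fst \<alpha>)" "arc_dim \<alpha> n = 2"
  using ele_lt_arc[OF assms, of n] unfolding arc_dim_def by (cases "ele n (fst \<alpha>)"; cases "n \<le> snd \<alpha>") auto

lemma av_inj:
  assumes "is_arc \<alpha>" "okv \<alpha> n p q" "okv \<alpha> n p' q'"
  shows "av \<alpha> n p q = av \<alpha> n p' q' \<longleftrightarrow> p = p' \<and> q = q'"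
proof (cases rule: arc_dim_cases[OF assms(1), of n])
  case 3
  have "p = p' \<and> q = q'" if e: "av \<alpha> n p q = av \<alpha> n p' q'"
    using arg_cong[OF e, of "\<lambda>v. v $ 0"] arg_cong[OF e, of "\<lambda>v. v $ 1"] 3 by (simp add: av_def)
  then show ?thesis by auto
next
  case 2
  have "p = p'" if e: "av \<alpha> n p q = av \<alpha> n p' q'"
    using arg_cong[OF e, of "\<lambda>v. v $ 0"] 2 by (simp add: av_def)
  then show ?thesis using 2 assms by (auto simp: okv_def)
qed (use assms in \<open>auto simp: okv_def\<close>)

lemma smult_zero_vec [simp]: "c \<cdot>\<^sub>v 0\<^sub>v n = (0\<^sub>v n :: 'a :: semiring_0 vec)"
  by (intro eq_vecI) auto

lemma av_eq_0_iff:
  assumes "is_arc \<alpha>" "okv \<alpha> n p q"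
  shows "av \<alpha> n p q = 0\<^sub>v (arc_dim \<alpha> n) \<longleftrightarrow> p = 0 \<and> q = 0"
  using av_inj[OF assms, of 0 0] by (simp add: okv_def)

lemma av_ex:
  assumes "is_arc \<alpha>" "v \<in> carrier_vec (gdim (amod \<alpha>) n)"
  shows "\<exists>p q. okv \<alpha> n p q \<and> v = av \<alpha> n p q"
proof (cases rule: arc_dim_cases[OF assms(1), of n])
  case 1
  then show ?thesis using assms by (auto simp: amod_sel okv_def av_def intro!: exI[of _ 0])
next
  case 2
  then have "v = av \<alpha> n (v $ 0) 0" using assms by (intro eq_vecI) (auto simp: amod_sel av_def)
  then show ?thesis using 2 by (intro exI[of _ "v $ 0"] exI[of _ 0]) (auto simp: okv_def)
next
  case 3
  then have "v = av \<alpha> n (v $ 0) (v $ 1)" using assms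
    by (intro eq_vecI) (auto simp: amod_sel av_def less_2_cases_iff)
  then show ?thesis using 3 by (intro exI[of _ "v $ 0"] exI[of _ "v $ 1"]) (auto simp: okv_def)
qed

lemma mat_av_mult:
  assumes "i < dim_row A" "dim_col A = arc_dim \<alpha> n"
  shows "(A *\<^sub>v av \<alpha> n p q) $ i = (if 0 < arc_dim \<alpha> n then A $$ (i,0) * p else 0) + (if 1 < arc_dim \<alpha> n then A $$ (i,1) * q else 0)"
proof -
  have "(A *\<^sub>v av \<alpha> n p q) $ i = (\<Sum>j<arc_dim \<alpha> n. A $$ (i,j) * (if j = 0 then p else q))"
    using assms by (auto simp: av_def scalar_prod_def atLeast0LessThan intro!: sum.cong)
  moreover have "arc_dim \<alpha> n = 0 \<or> arc_dim \<alpha> n = Suc 0 \<or> arc_dim \<alpha> n = Suc (Suc 0)"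
    using arc_dim_le2[of \<alpha> n] by linarith
  ultimately show ?thesis by (elim disjE) auto
qed

lemma amod_x:
  assumes "is_arc \<alpha>" "okv \<alpha> n p q"
  shows "xact (amod \<alpha>) n *\<^sub>v av \<alpha> n p q = av \<alpha> (n+1) q 0"
proof (rule eq_vecI)
  fix i assume "i < dim_vec (av \<alpha> (n+1) q 0)"
  then have i: "i < arc_dim \<alpha> (n+1)" by simp
  have "arc_dim \<alpha> n \<le> 1 \<Longrightarrow> q = 0"
    by (cases rule: arc_dim_cases[OF assms(1), of n]) (use assms in \<open>auto simp: okv_def\<close>)
  then show "(xact (amod \<alpha>) n *\<^sub>v av \<alpha> n p q) $ i = av \<alpha> (n+1) q 0 $ i"
    using i assms(1) by (subst mat_av_mult) (auto simp: amod_sel av_def)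
qed (use assms in \<open>auto simp: amod_sel\<close>)

lemma amod_y:
  assumes "is_arc \<alpha>" "okv \<alpha> n p q"
  shows "yact (amod \<alpha>) n *\<^sub>v av \<alpha> n p q = av \<alpha> (n-1) p q"
proof (rule eq_vecI)
  fix i assume "i < dim_vec (av \<alpha> (n-1) p q)"
  then have i: "i < arc_dim \<alpha> (n-1)" by simp
  then have i2: "i < 2" using arc_dim_le2[of \<alpha> "n-1"] by linarith
  have "arc_dim \<alpha> n \<le> 1 \<Longrightarrow> q = 0" "arc_dim \<alpha> n = 0 \<Longrightarrow> p = 0"
    by (cases rule: arc_dim_cases[OF assms(1), of n], use assms in \<open>auto simp: okv_def\<close>)+
  then show "(yact (amod \<alpha>) n *\<^sub>v av \<alpha> n p q) $ i = av \<alpha> (n-1) p q $ i"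
    using i i2 assms(1) by (subst mat_av_mult) (auto simp: amod_sel av_def less_2_cases_iff)
qed (use assms in \<open>auto simp: amod_sel\<close>)

lemma okv_dec: "okv \<alpha> n p q \<Longrightarrow> m \<le> n \<Longrightarrow> okv \<alpha> m p q"
  by (auto simp: okv_def intro: ele_mono)

lemma okv_x: "is_arc \<alpha> \<Longrightarrow> okv \<alpha> n p q \<Longrightarrow> okv \<alpha> (n+1) q 0"
  using ele_lt_arc[of \<alpha> n] by (auto simp: okv_def)

lemma okv_zero [simp]: "okv \<alpha> n 0 0" by (simp add: okv_def)

lemma wf_amod:
  assumes "is_arc \<alpha>"
  shows "wf_gmod (amod \<alpha>)"
proof -
  have c: "xact (amod \<alpha>) n \<in> carrier_mat (gdim (amod \<alpha>) (n+1)) (gdim (amod \<alpha>) n)"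
    "yact (amod \<alpha>) n \<in> carrier_mat (gdim (amod \<alpha>) (n-1)) (gdim (amod \<alpha>) n)" for n
    using assms by (auto simp: amod_sel)
  have "xact (amod \<alpha>) (n+1) * xact (amod \<alpha>) n = 0\<^sub>m (gdim (amod \<alpha>) (n+2)) (gdim (amod \<alpha>) n)" for n
  proof (rule mat_eq_on_vecsI[where nr = "gdim (amod \<alpha>) (n+2)" and nc = "gdim (amod \<alpha>) n"])
    fix v :: "complex vec" assume v: "v \<in> carrier_vec (gdim (amod \<alpha>) n)"
    then obtain p q where pq: "okv \<alpha> n p q" "v = av \<alpha> n p q" using av_ex assms by blast
    have "xact (amod \<alpha>) (n+1) * xact (amod \<alpha>) n *\<^sub>v v = xact (amod \<alpha>) (n+1) *\<^sub>v (xact (amod \<alpha>) n *\<^sub>v v)"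
      using v assms by (intro mat_vec_assoc) (auto simp: amod_sel)
    also have "\<dots> = av \<alpha> (n+1+1) 0 0" unfolding pq(2) using pq assms okv_x by (simp add: amod_x)
    also have "\<dots> = 0\<^sub>m (gdim (amod \<alpha>) (n+2)) (gdim (amod \<alpha>) n) *\<^sub>v v"
      using v assms by (intro eq_vecI) (auto simp: amod_sel add.commute)
    finally show "xact (amod \<alpha>) (n+1) * xact (amod \<alpha>) n *\<^sub>v v = 0\<^sub>m (gdim (amod \<alpha>) (n+2)) (gdim (amod \<alpha>) n) *\<^sub>v v" .
  qed (use assms in \<open>auto simp: amod_sel add.commute\<close>)
  moreover have "xact (amod \<alpha>) (n-1) * yact (amod \<alpha>) n = yact (amod \<alpha>) (n+1) * xact (amod \<alpha>) n" for n
  proof (rule mat_eq_on_vecsI[where nr = "gdim (amod \<alpha>) n" and nc = "gdim (amod \<alpha>) n"])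
    fix v :: "complex vec" assume v: "v \<in> carrier_vec (gdim (amod \<alpha>) n)"
    then obtain p q where pq: "okv \<alpha> n p q" "v = av \<alpha> n p q" using av_ex assms by blast
    have "xact (amod \<alpha>) (n-1) * yact (amod \<alpha>) n *\<^sub>v v = xact (amod \<alpha>) (n-1) *\<^sub>v (yact (amod \<alpha>) n *\<^sub>v v)"
      using v assms by (intro mat_vec_assoc) (auto simp: amod_sel)
    also have "\<dots> = av \<alpha> n q 0" unfolding pq(2) using pq assms okv_dec[OF pq(1), of "n-1"] by (simp add: amod_x amod_y)
    also have "\<dots> = yact (amod \<alpha>) (n+1) *\<^sub>v (xact (amod \<alpha>) n *\<^sub>v v)"
      unfolding pq(2) using pq assms okv_x[OF assms pq(1)] by (simp add: amod_x amod_y)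
    also have "\<dots> = yact (amod \<alpha>) (n+1) * xact (amod \<alpha>) n *\<^sub>v v"
      using v assms by (intro mat_vec_assoc[symmetric]) (auto simp: amod_sel)
    finally show "xact (amod \<alpha>) (n-1) * yact (amod \<alpha>) n *\<^sub>v v = yact (amod \<alpha>) (n+1) * xact (amod \<alpha>) n *\<^sub>v v" .
  qed (use assms in \<open>auto simp: amod_sel\<close>)
  ultimately show ?thesis using c unfolding wf_gmod_def by blast
qed

lemma amod_C2:
  assumes "is_arc \<alpha>"
  shows "amod \<alpha> \<in> C2"
proof -
  have "bdd_top (amod \<alpha>)" unfolding bdd_top_def
    using assms ele_lt_arc[OF assms] by (intro exI[of _ "snd \<alpha>"]) (fastforce simp: amod_sel arc_dim_def)
  moreover have "y_inj (amod \<alpha>)" unfolding y_inj_def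
  proof (intro allI ballI impI)
    fix n and v :: "complex vec" assume v: "v \<in> carrier_vec (gdim (amod \<alpha>) n)" and z: "yact (amod \<alpha>) n *\<^sub>v v = 0\<^sub>v (gdim (amod \<alpha>) (n-1))"
    obtain p q where pq: "okv \<alpha> n p q" "v = av \<alpha> n p q" using av_ex assms v by blast
    have "av \<alpha> (n-1) p q = 0\<^sub>v (arc_dim \<alpha> (n-1))" using z unfolding pq(2) amod_y[OF assms pq(1)] by (simp add: amod_sel assms)
    then show "v = 0\<^sub>v (gdim (amod \<alpha>) n)" using pq okv_dec[OF pq(1), of "n-1"] assms
      by (simp add: av_eq_0_iff amod_sel)
  qed
  moreover have "y_surj_low (amod \<alpha>)" unfolding y_surj_low_def
  proof -
    obtain L where L: "L \<le> snd \<alpha>" "fst \<alpha> = NegInf \<or> ele L (fst \<alpha>)"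
      using assms by (cases "fst \<alpha>") (auto simp: is_arc_def)
    have "\<exists>v \<in> carrier_vec (gdim (amod \<alpha>) n). yact (amod \<alpha>) n *\<^sub>v v = w"
      if n: "n \<le> L" and w: "w \<in> carrier_vec (gdim (amod \<alpha>) (n-1))" for n w
    proof -
      obtain p q where pq: "okv \<alpha> (n-1) p q" "w = av \<alpha> (n-1) p q" using av_ex assms w by blast
      have "okv \<alpha> n p q" using pq(1) L n unfolding okv_def by (auto intro: ele_mono)
      then show ?thesis using pq assms amod_y[of \<alpha> n p q] by (intro bexI[of _ "av \<alpha> n p q"]) auto
    qed
    then show "\<exists>L. \<forall>n\<le>L. \<forall>w \<in> carrier_vec (gdim (amod \<alpha>) (n-1)). \<exists>v \<in> carrier_vec (gdim (amod \<alpha>) n). yact (amod \<alpha>) n *\<^sub>v v = w" by blast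
  qed
  ultimately show ?thesis using wf_amod[OF assms] by (simp add: C2_iff)
qed

lemma amod_yto:
  assumes "is_arc \<alpha>" "okv \<alpha> m p q"
  shows "n \<le> m \<Longrightarrow> yto (amod \<alpha>) m n *\<^sub>v av \<alpha> m p q = av \<alpha> n p q"
proof (induction rule: int_down_induct)
  case base
  then show ?case using assms by simp
next
  case (step n)
  have "yto (amod \<alpha>) m (n-1) *\<^sub>v av \<alpha> m p q = yact (amod \<alpha>) n *\<^sub>v (yto (amod \<alpha>) m n *\<^sub>v av \<alpha> m p q)"
    unfolding yto_dec[OF step(1)] using carrier_matD[OF yto_carrier[OF wf_amod[OF assms(1)] step(1)]] assms(1)
    by (intro mat_vec_assoc) (auto simp: amod_sel)
  then show ?case using step assms okv_dec[OF assms(2) step(1)] by (simp add: amod_y)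
qed

text \<open>The multiple of \<open>w\<close> by a power of \<open>y\<close> that lies in degree \<open>n\<close>, for \<open>w\<close> of degree \<open>c\<close>;
  zero if there is none, in particular for \<open>c = NegInf\<close>, where \<open>w\<close> is a dummy.
  Then \<open>gen_hom \<alpha> N w v\<close> is the map sending the generators \<open>e\<close> to \<open>w\<close> and \<open>f\<close> to \<open>v\<close>.\<close>
definition low :: "gmod \<Rightarrow> ext_int \<Rightarrow> int \<Rightarrow> complex vec \<Rightarrow> complex vec" where
  "low N c n w = (case c of NegInf \<Rightarrow> 0\<^sub>v (gdim N n) | Fin b \<Rightarrow> if n \<le> b then yto N b n *\<^sub>v w else 0\<^sub>v (gdim N n))"

definition gen_hom :: "arc \<Rightarrow> gmod \<Rightarrow> complex vec \<Rightarrow> complex vec \<Rightarrow> int \<Rightarrow> complex mat" where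
  "gen_hom \<alpha> N w v = (\<lambda>n. mat (gdim N n) (arc_dim \<alpha> n)
     (\<lambda>(i,j). if j = 0 then low N (Fin (snd \<alpha>)) n w $ i else low N (fst \<alpha>) n v $ i))"

definition gen_carrier :: "gmod \<Rightarrow> ext_int \<Rightarrow> complex vec \<Rightarrow> bool" where
  "gen_carrier N c v \<longleftrightarrow> (\<forall>a. c = Fin a \<longrightarrow> v \<in> carrier_vec (gdim N a))"

lemma low_carrier: "wf_gmod N \<Longrightarrow> low N c n w \<in> carrier_vec (gdim N n)"
  using carrier_matD[OF yto_carrier[of N n]] unfolding low_def
  by (auto split: ext_int.split intro!: carrier_vecI)

lemma low_y:
  assumes N: "wf_gmod N" and "ele n c" "gen_carrier N c w"
  shows "yact N n *\<^sub>v low N c n w = low N c (n-1) w"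
proof -
  obtain b where b: "c = Fin b" "n \<le> b" using assms(2) by (cases c) auto
  have w: "w \<in> carrier_vec (gdim N b)" using assms b by (auto simp: gen_carrier_def)
  have "yto N b (n-1) *\<^sub>v w = yact N n *\<^sub>v (yto N b n *\<^sub>v w)"
    unfolding yto_dec[OF b(2)] using carrier_matD[OF yto_carrier[OF N b(2)]] wf_gmod_dims[OF N] w
    by (intro mat_vec_assoc) auto
  then show ?thesis using b by (simp add: low_def)
qed

lemma low_x:
  assumes N: "wf_gmod N" and "n \<le> b" "w \<in> carrier_vec (gdim N b)"
  shows "xact N n *\<^sub>v low N (Fin b) n w = low N (Fin (b+1)) (n+1) (xact N b *\<^sub>v w)"
proof -
  have nb: "n + 1 \<le> b + 1" using assms by simp
  note d = carrier_matD[OF yto_carrier[OF N assms(2)]] wf_gmod_dims[OF N] carrier_vecD[OF assms(3)]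
     carrier_matD[OF yto_carrier[OF N nb]]
  have "xact N n *\<^sub>v (yto N b n *\<^sub>v w) = (xact N n * yto N b n) *\<^sub>v w"
    by (rule mat_vec_assoc[symmetric]) (simp_all add: d)
  also have "\<dots> = yto N (b+1) (n+1) *\<^sub>v (xact N b *\<^sub>v w)"
    unfolding xact_yto[OF N assms(2)] by (rule mat_vec_assoc) (simp_all add: d)
  finally show ?thesis using assms by (simp add: low_def)
qed

lemma low_zero: "wf_gmod N \<Longrightarrow> low N (Fin b) n (0\<^sub>v (gdim N b)) = 0\<^sub>v (gdim N n)"
  using mult_mat_vec_zero[OF yto_carrier[of N n b]] by (simp add: low_def)

lemma yto_trans:
  assumes N: "wf_gmod N" and "m \<le> k"
  shows "n \<le> m \<Longrightarrow> yto N m n * yto N k m = yto N k n"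
proof (induction rule: int_down_induct)
  case base
  then show ?case using carrier_matD[OF yto_carrier[OF N assms(2)]] by (simp add: mat_unit_dims)
next
  case (step n)
  have "yto N m (n-1) * yto N k m = yact N n * (yto N m n * yto N k m)"
    unfolding yto_dec[OF step(1)] using carrier_matD[OF yto_carrier[OF N step(1)]] carrier_matD[OF yto_carrier[OF N assms(2)]]
    by (intro mat_assoc) (auto simp: wf_gmod_dims[OF N])
  also have "\<dots> = yto N k (n-1)" unfolding step(2) using step(1) assms yto_dec[of n k N] by simp
  finally show ?case .
qed

lemma low_trans:
  assumes N: "wf_gmod N" and "m \<le> b" "n \<le> m" "w \<in> carrier_vec (gdim N b)"
  shows "low N (Fin m) n (low N (Fin b) m w) = low N (Fin b) n w"
  using assms carrier_matD[OF yto_carrier[OF N assms(2)]] carrier_matD[OF yto_carrier[OF N assms(3)]]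
  by (simp add: low_def mat_vec_assoc[symmetric] yto_trans)

lemma gen_hom_carrier: "is_arc \<alpha> \<Longrightarrow> fam (amod \<alpha>) N (gen_hom \<alpha> N w v)"
  by (simp add: fam_def gen_hom_def amod_sel)

lemma gen_hom_av:
  assumes "is_arc \<alpha>" "wf_gmod N" "okv \<alpha> n p q"
  shows "gen_hom \<alpha> N w v n *\<^sub>v av \<alpha> n p q = p \<cdot>\<^sub>v low N (Fin (snd \<alpha>)) n w + q \<cdot>\<^sub>v low N (fst \<alpha>) n v"
proof (rule eq_vecI)
  note c = carrier_vecD[OF low_carrier[OF assms(2)]]
  fix i assume "i < dim_vec (p \<cdot>\<^sub>v low N (Fin (snd \<alpha>)) n w + q \<cdot>\<^sub>v low N (fst \<alpha>) n v)"
  then have i: "i < gdim N n" by (simp add: c)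
  have *: "arc_dim \<alpha> n \<le> 1 \<Longrightarrow> q = 0" "arc_dim \<alpha> n = 0 \<Longrightarrow> p = 0"
    by (cases rule: arc_dim_cases[OF assms(1), of n], use assms in \<open>auto simp: okv_def\<close>)+
  show "(gen_hom \<alpha> N w v n *\<^sub>v av \<alpha> n p q) $ i = (p \<cdot>\<^sub>v low N (Fin (snd \<alpha>)) n w + q \<cdot>\<^sub>v low N (fst \<alpha>) n v) $ i"
    using i * by (subst mat_av_mult) (auto simp: gen_hom_def c mult.commute)
qed (simp add: gen_hom_def carrier_vecD[OF low_carrier[OF assms(2)]])

lemma fam_eq_on_av:
  assumes \<alpha>: "is_arc \<alpha>" and f: "fam (amod \<alpha>) N f" "fam (amod \<alpha>) N g"
    and eq: "\<And>n p q. okv \<alpha> n p q \<Longrightarrow> f n *\<^sub>v av \<alpha> n p q = g n *\<^sub>v av \<alpha> n p q"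
  shows "f = g"
proof
  fix n
  show "f n = g n"
  proof (rule mat_eq_on_vecsI[OF famD[OF f(1)] famD[OF f(2)]])
    fix v :: "complex vec" assume "v \<in> carrier_vec (gdim (amod \<alpha>) n)"
    then show "f n *\<^sub>v v = g n *\<^sub>v v" using av_ex[OF \<alpha>] eq by blast
  qed
qed

lemma yhom_amodI:
  assumes \<alpha>: "is_arc \<alpha>" and N: "wf_gmod N" and f: "fam (amod \<alpha>) N f"
    and eq: "\<And>n p q. okv \<alpha> n p q \<Longrightarrow> f (n-1) *\<^sub>v av \<alpha> (n-1) p q = yact N n *\<^sub>v (f n *\<^sub>v av \<alpha> n p q)"
  shows "yhom (amod \<alpha>) N f"
  unfolding yhom_def
proof (intro conjI allI f)
  fix n
  note d = fam_dims[OF f] wf_gmod_dims[OF N] wf_gmod_dims[OF wf_amod[OF \<alpha>]]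
  show "f (n-1) * yact (amod \<alpha>) n = yact N n * f n"
  proof (rule mat_eq_on_vecsI[where nr = "gdim N (n-1)" and nc = "gdim (amod \<alpha>) n"])
    fix v :: "complex vec" assume v: "v \<in> carrier_vec (gdim (amod \<alpha>) n)"
    then obtain p q where pq: "okv \<alpha> n p q" "v = av \<alpha> n p q" using av_ex \<alpha> by blast
    have "f (n-1) * yact (amod \<alpha>) n *\<^sub>v v = f (n-1) *\<^sub>v (yact (amod \<alpha>) n *\<^sub>v v)"
      using v by (intro mat_vec_assoc) (auto simp: d)
    also have "\<dots> = yact N n *\<^sub>v (f n *\<^sub>v v)" using eq[OF pq(1)] amod_y[OF \<alpha> pq(1)] pq(2) by simp
    also have "\<dots> = (yact N n * f n) *\<^sub>v v" using v by (intro mat_vec_assoc[symmetric]) (auto simp: d)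
    finally show "f (n-1) * yact (amod \<alpha>) n *\<^sub>v v = (yact N n * f n) *\<^sub>v v" .
  qed (auto intro!: carrier_matI simp: d)
qed

lemma is_hom_amodI:
  assumes \<alpha>: "is_arc \<alpha>" and N: "wf_gmod N" and f: "yhom (amod \<alpha>) N f"
    and eq: "\<And>n p q. okv \<alpha> n p q \<Longrightarrow> f (n+1) *\<^sub>v av \<alpha> (n+1) q 0 = xact N n *\<^sub>v (f n *\<^sub>v av \<alpha> n p q)"
  shows "is_hom (amod \<alpha>) N f"
proof (rule is_homI[OF f])
  fix n
  note d = fam_dims[OF yhomD(1)[OF f]] wf_gmod_dims[OF N] wf_gmod_dims[OF wf_amod[OF \<alpha>]]
  show "f (n+1) * xact (amod \<alpha>) n = xact N n * f n"
  proof (rule mat_eq_on_vecsI[where nr = "gdim N (n+1)" and nc = "gdim (amod \<alpha>) n"])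
    fix v :: "complex vec" assume v: "v \<in> carrier_vec (gdim (amod \<alpha>) n)"
    then obtain p q where pq: "okv \<alpha> n p q" "v = av \<alpha> n p q" using av_ex \<alpha> by blast
    have "f (n+1) * xact (amod \<alpha>) n *\<^sub>v v = f (n+1) *\<^sub>v (xact (amod \<alpha>) n *\<^sub>v v)"
      using v by (intro mat_vec_assoc) (auto simp: d)
    also have "\<dots> = xact N n *\<^sub>v (f n *\<^sub>v v)" using eq[OF pq(1)] amod_x[OF \<alpha> pq(1)] pq(2) by simp
    also have "\<dots> = (xact N n * f n) *\<^sub>v v" using v by (intro mat_vec_assoc[symmetric]) (auto simp: d)
    finally show "f (n+1) * xact (amod \<alpha>) n *\<^sub>v v = (xact N n * f n) *\<^sub>v v" .
  qed (auto intro!: carrier_matI simp: d)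
qed

text \<open>An arc module is free over C[y] on its generators, so their images may be prescribed
  arbitrarily.\<close>

lemma yhom_gen_hom:
  assumes \<alpha>: "is_arc \<alpha>" and N: "wf_gmod N" and w: "w \<in> carrier_vec (gdim N (snd \<alpha>))"
    and v: "gen_carrier N (fst \<alpha>) v"
  shows "yhom (amod \<alpha>) N (gen_hom \<alpha> N w v)"
proof (rule yhom_amodI[OF \<alpha> N gen_hom_carrier[OF \<alpha>]])
  fix n p q assume ok: "okv \<alpha> n p q"
  let ?W = "low N (Fin (snd \<alpha>))" and ?V = "low N (fst \<alpha>)"
  note c = low_carrier[OF N]
  have 1: "p \<cdot>\<^sub>v ?W (n-1) w = p \<cdot>\<^sub>v (yact N n *\<^sub>v ?W n w)"
  proof (cases "p = 0")
    case True then show ?thesis using c[of "Fin (snd \<alpha>)" "n-1" w] wf_gmod_dims[OF N] by (intro eq_vecI) auto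
  next
    case False
    then have "n \<le> snd \<alpha>" using ok by (simp add: okv_def)
    then show ?thesis using low_y[OF N, of n "Fin (snd \<alpha>)" w] w by (simp add: gen_carrier_def)
  qed
  have 2: "q \<cdot>\<^sub>v ?V (n-1) v = q \<cdot>\<^sub>v (yact N n *\<^sub>v ?V n v)"
  proof (cases "q = 0")
    case True then show ?thesis using c[of "fst \<alpha>" "n-1" v] wf_gmod_dims[OF N] by (intro eq_vecI) auto
  next
    case False
    then have "ele n (fst \<alpha>)" using ok by (simp add: okv_def)
    then show ?thesis using low_y[OF N, of n "fst \<alpha>" v] v by simp
  qed
  have "yact N n *\<^sub>v (p \<cdot>\<^sub>v ?W n w + q \<cdot>\<^sub>v ?V n v) = p \<cdot>\<^sub>v (yact N n *\<^sub>v ?W n w) + yact N n *\<^sub>v (q \<cdot>\<^sub>v ?V n v)"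
    using c by (intro mult_mat_vec_lin[OF wf_gmodD(2)[OF N]]) auto
  also have "yact N n *\<^sub>v (q \<cdot>\<^sub>v ?V n v) = q \<cdot>\<^sub>v (yact N n *\<^sub>v ?V n v)" 
    by (rule mult_mat_vec[OF wf_gmodD(2)[OF N] c])
  finally show "gen_hom \<alpha> N w v (n - 1) *\<^sub>v av \<alpha> (n - 1) p q = yact N n *\<^sub>v (gen_hom \<alpha> N w v n *\<^sub>v av \<alpha> n p q)"
    using gen_hom_av[OF \<alpha> N ok] gen_hom_av[OF \<alpha> N okv_dec[OF ok, of "n-1"]] 1 2 by simp
qed

text \<open>Commutation with \<open>x\<close> has to be tested on generators only. The relations are
  that \<open>x\<close> kills \<open>e\<close> and sends \<open>f\<close> to the multiple of
  \<open>e\<close> one degree above \<open>f\<close>; \<open>xw\<close> and \<open>xv\<close> are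
  their images.\<close>

lemma is_hom_gen_hom:
  assumes \<alpha>: "is_arc \<alpha>" and N: "wf_gmod N" and w: "w \<in> carrier_vec (gdim N (snd \<alpha>))"
    and v: "gen_carrier N (fst \<alpha>) v"
    and xw: "xact N (snd \<alpha>) *\<^sub>v w = 0\<^sub>v (gdim N (snd \<alpha> + 1))"
    and xv: "\<And>a. fst \<alpha> = Fin a \<Longrightarrow> xact N a *\<^sub>v v = low N (Fin (snd \<alpha>)) (a+1) w"
  shows "is_hom (amod \<alpha>) N (gen_hom \<alpha> N w v)"
proof (rule is_hom_amodI[OF \<alpha> N yhom_gen_hom[OF \<alpha> N w v]])
  fix n p q assume ok: "okv \<alpha> n p q"
  let ?W = "low N (Fin (snd \<alpha>))" and ?V = "low N (fst \<alpha>)"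
  note c = low_carrier[OF N]
  note z = mult_mat_vec_zero[OF wf_gmodD(1)[OF N]]
  have 1: "p \<cdot>\<^sub>v (xact N n *\<^sub>v ?W n w) = 0\<^sub>v (gdim N (n+1))"
  proof (cases "n \<le> snd \<alpha>")
    case True
    then show ?thesis using low_x[OF N True w] xw low_zero[OF N, of "snd \<alpha> + 1" "n + 1"] by simp
  next
    case False
    then show ?thesis using z[of n] by (simp add: low_def)
  qed
  have 2: "q \<cdot>\<^sub>v (xact N n *\<^sub>v ?V n v) = q \<cdot>\<^sub>v ?W (n+1) w"
  proof (cases "q = 0")
    case True then show ?thesis using c[of "Fin (snd \<alpha>)" "n+1" w] wf_gmod_dims[OF N] by (intro eq_vecI) auto
  next
    case False
    then have e: "ele n (fst \<alpha>)" using ok by (simp add: okv_def)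
    then obtain a where a: "fst \<alpha> = Fin a" "n \<le> a" by (cases "fst \<alpha>") auto
    have "a < snd \<alpha>" using \<alpha> a by (simp add: is_arc_def)
    then have "low N (Fin (a+1)) (n+1) (?W (a+1) w) = ?W (n+1) w"
      using a w by (intro low_trans[OF N]) auto
    then have "xact N n *\<^sub>v ?V n v = ?W (n+1) w"
      unfolding a using low_x[OF N a(2), of v] v xv[OF a(1)] a by (simp add: gen_carrier_def)
    then show ?thesis by simp
  qed
  have "xact N n *\<^sub>v (p \<cdot>\<^sub>v ?W n w + q \<cdot>\<^sub>v ?V n v) = p \<cdot>\<^sub>v (xact N n *\<^sub>v ?W n w) + xact N n *\<^sub>v (q \<cdot>\<^sub>v ?V n v)"
    using c by (intro mult_mat_vec_lin[OF wf_gmodD(1)[OF N]]) auto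
  also have "xact N n *\<^sub>v (q \<cdot>\<^sub>v ?V n v) = q \<cdot>\<^sub>v (xact N n *\<^sub>v ?V n v)" 
    by (rule mult_mat_vec[OF wf_gmodD(1)[OF N] c])
  finally have "xact N n *\<^sub>v (gen_hom \<alpha> N w v n *\<^sub>v av \<alpha> n p q) = q \<cdot>\<^sub>v ?W (n+1) w"
    using gen_hom_av[OF \<alpha> N ok] 1 2 c[of "Fin (snd \<alpha>)" "n+1" w] by simp
  moreover have "gen_hom \<alpha> N w v (n+1) *\<^sub>v av \<alpha> (n+1) q 0 = q \<cdot>\<^sub>v ?W (n+1) w + 0 \<cdot>\<^sub>v ?V (n+1) v"
    by (rule gen_hom_av[OF \<alpha> N okv_x[OF \<alpha> ok]])
  moreover have "q \<cdot>\<^sub>v ?W (n+1) w + 0 \<cdot>\<^sub>v ?V (n+1) v = q \<cdot>\<^sub>v ?W (n+1) w"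
    using c[of "Fin (snd \<alpha>)" "n+1" w] c[of "fst \<alpha>" "n+1" v] by (intro eq_vecI) auto
  ultimately show "gen_hom \<alpha> N w v (n+1) *\<^sub>v av \<alpha> (n+1) q 0 = xact N n *\<^sub>v (gen_hom \<alpha> N w v n *\<^sub>v av \<alpha> n p q)"
    by simp
qed

definition gen_f :: "arc \<Rightarrow> (int \<Rightarrow> complex mat) \<Rightarrow> complex vec" where
  "gen_f \<alpha> f = (case fst \<alpha> of NegInf \<Rightarrow> 0\<^sub>v 0 | Fin a \<Rightarrow> f a *\<^sub>v av \<alpha> a 0 1)"

lemma okv_gen: "okv \<alpha> (snd \<alpha>) 1 0" "fst \<alpha> = Fin a \<Longrightarrow> okv \<alpha> a 0 1"
  by (auto simp: okv_def)

text \<open>Uniqueness in the freeness over C[y]; for an infinite arc the dummy value of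
  \<open>gen_f\<close> is never looked at.\<close>

lemma yhom_amod_eq:
  assumes \<alpha>: "is_arc \<alpha>" and N: "wf_gmod N" and f: "yhom (amod \<alpha>) N f"
  shows "f = gen_hom \<alpha> N (f (snd \<alpha>) *\<^sub>v av \<alpha> (snd \<alpha>) 1 0) (gen_f \<alpha> f)"
proof (rule fam_eq_on_av[OF \<alpha> yhomD(1)[OF f] gen_hom_carrier[OF \<alpha>]])
  fix n p q assume ok: "okv \<alpha> n p q"
  note fc = famD[OF yhomD(1)[OF f]]
  note A = wf_amod[OF \<alpha>]
  note c = low_carrier[OF N]
  have *: "f n *\<^sub>v av \<alpha> n p' q' = yto N m n *\<^sub>v (f m *\<^sub>v av \<alpha> m p' q')" if "n \<le> m" "okv \<alpha> m p' q'" for m p' q'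
  proof -
    note d = carrier_matD[OF fc] carrier_matD[OF yto_carrier[OF N that(1)]] carrier_matD[OF yto_carrier[OF A that(1)]]
    have "f n *\<^sub>v av \<alpha> n p' q' = (f n * yto (amod \<alpha>) m n) *\<^sub>v av \<alpha> m p' q'"
      using that amod_yto[OF \<alpha> that(2,1)] by (subst mat_vec_assoc) (simp_all add: d amod_sel \<alpha>)
    also have "\<dots> = yto N m n *\<^sub>v (f m *\<^sub>v av \<alpha> m p' q')"
      unfolding yhom_yto[OF A N f that(1)] by (rule mat_vec_assoc) (simp_all add: d amod_sel \<alpha>)
    finally show ?thesis .
  qed
  have "av \<alpha> n p q = p \<cdot>\<^sub>v av \<alpha> n 1 0 + av \<alpha> n 0 q" by (simp add: av_smult av_add)
  then have "f n *\<^sub>v av \<alpha> n p q = p \<cdot>\<^sub>v (f n *\<^sub>v av \<alpha> n 1 0) + f n *\<^sub>v av \<alpha> n 0 q"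
    using mult_mat_vec_lin[OF fc] \<alpha> by simp
  also have "av \<alpha> n 0 q = q \<cdot>\<^sub>v av \<alpha> n 0 1" by (simp add: av_smult)
  also have "f n *\<^sub>v (q \<cdot>\<^sub>v av \<alpha> n 0 1) = q \<cdot>\<^sub>v (f n *\<^sub>v av \<alpha> n 0 1)" using mult_mat_vec[OF fc] \<alpha> by simp
  also have "p \<cdot>\<^sub>v (f n *\<^sub>v av \<alpha> n 1 0) = p \<cdot>\<^sub>v low N (Fin (snd \<alpha>)) n (f (snd \<alpha>) *\<^sub>v av \<alpha> (snd \<alpha>) 1 0)"
  proof (cases "p = 0")
    case True then show ?thesis using fc[of n] c[of "Fin (snd \<alpha>)" n "f (snd \<alpha>) *\<^sub>v av \<alpha> (snd \<alpha>) 1 0"] by (intro eq_vecI) auto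
  next
    case False
    then have "n \<le> snd \<alpha>" using ok by (simp add: okv_def)
    then show ?thesis using *[OF _ okv_gen(1)] by (simp add: low_def)
  qed
  also have "q \<cdot>\<^sub>v (f n *\<^sub>v av \<alpha> n 0 1) = q \<cdot>\<^sub>v low N (fst \<alpha>) n (gen_f \<alpha> f)"
  proof (cases "q = 0")
    case True then show ?thesis using fc[of n] c[of "fst \<alpha>" n "gen_f \<alpha> f"] by (intro eq_vecI) auto
  next
    case False
    then have "ele n (fst \<alpha>)" using ok by (simp add: okv_def)
    then obtain a where a: "fst \<alpha> = Fin a" "n \<le> a" by (cases "fst \<alpha>") auto
    then show ?thesis using *[OF a(2) okv_gen(2)[OF a(1)]] by (simp add: low_def gen_f_def)
  qed
  finally show "f n *\<^sub>v av \<alpha> n p q = gen_hom \<alpha> N (f (snd \<alpha>) *\<^sub>v av \<alpha> (snd \<alpha>) 1 0) (gen_f \<alpha> f) n *\<^sub>v av \<alpha> n p q"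
    using gen_hom_av[OF \<alpha> N ok] by simp
qed

lemma yhom_amod_ext:
  assumes "is_arc \<alpha>" "wf_gmod N" "yhom (amod \<alpha>) N f" "yhom (amod \<alpha>) N g"
    and "f (snd \<alpha>) *\<^sub>v av \<alpha> (snd \<alpha>) 1 0 = g (snd \<alpha>) *\<^sub>v av \<alpha> (snd \<alpha>) 1 0"
    and "\<And>a. fst \<alpha> = Fin a \<Longrightarrow> f a *\<^sub>v av \<alpha> a 0 1 = g a *\<^sub>v av \<alpha> a 0 1"
  shows "f = g"
proof -
  have "gen_f \<alpha> f = gen_f \<alpha> g" using assms(6) by (auto simp: gen_f_def split: ext_int.split)
  then show ?thesis using yhom_amod_eq[OF assms(1-3)] yhom_amod_eq[OF assms(1,2,4)] assms(5) by metis
qed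

lemma gen_hom_gen:
  assumes "is_arc \<alpha>" "wf_gmod N"
  shows "w \<in> carrier_vec (gdim N (snd \<alpha>)) \<Longrightarrow> gen_hom \<alpha> N w v (snd \<alpha>) *\<^sub>v av \<alpha> (snd \<alpha>) 1 0 = w"
    "fst \<alpha> = Fin a \<Longrightarrow> v \<in> carrier_vec (gdim N a) \<Longrightarrow> gen_hom \<alpha> N w v a *\<^sub>v av \<alpha> a 0 1 = v"
proof -
  assume w: "w \<in> carrier_vec (gdim N (snd \<alpha>))"
  show "gen_hom \<alpha> N w v (snd \<alpha>) *\<^sub>v av \<alpha> (snd \<alpha>) 1 0 = w"
    using gen_hom_av[OF assms okv_gen(1)] w low_carrier[OF assms(2), of "fst \<alpha>" "snd \<alpha>" v]
    by (simp add: low_def) (intro eq_vecI, auto)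
next
  assume a: "fst \<alpha> = Fin a" and v: "v \<in> carrier_vec (gdim N a)"
  show "gen_hom \<alpha> N w v a *\<^sub>v av \<alpha> a 0 1 = v"
    using gen_hom_av[OF assms okv_gen(2)[OF a]] a v low_carrier[OF assms(2), of "Fin (snd \<alpha>)" a w]
    by (simp add: low_def[of _ "Fin a"]) (intro eq_vecI, auto)
qed

section \<open>Decomposition into arc modules\<close>

lemma zero_mat_mult_vec: "v \<in> carrier_vec m \<Longrightarrow> 0\<^sub>m n m *\<^sub>v v = (0\<^sub>v n :: 'a :: semiring_0 vec)"
  by (intro eq_vecI) auto

lemma yhom_y_vec:
  assumes "wf_gmod M" "wf_gmod N" "yhom M N f" "v \<in> carrier_vec (gdim M n)"
  shows "f (n-1) *\<^sub>v (yact M n *\<^sub>v v) = yact N n *\<^sub>v (f n *\<^sub>v v)"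
proof -
  note d = fam_dims[OF yhomD(1)[OF assms(3)]] wf_gmod_dims[OF assms(1)] wf_gmod_dims[OF assms(2)] carrier_vecD[OF assms(4)]
  have "f (n-1) *\<^sub>v (yact M n *\<^sub>v v) = (f (n-1) * yact M n) *\<^sub>v v"
    by (rule mat_vec_assoc[symmetric]) (simp_all add: d)
  also have "\<dots> = yact N n *\<^sub>v (f n *\<^sub>v v)"
    unfolding yhomD(2)[OF assms(3)] by (rule mat_vec_assoc) (simp_all add: d)
  finally show ?thesis .
qed

lemma is_hom_x_vec:
  assumes "wf_gmod M" "wf_gmod N" "is_hom M N f" "v \<in> carrier_vec (gdim M n)"
  shows "f (n+1) *\<^sub>v (xact M n *\<^sub>v v) = xact N n *\<^sub>v (f n *\<^sub>v v)"
proof -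
  note d = fam_dims[OF is_homD(1)[OF assms(3)]] wf_gmod_dims[OF assms(1)] wf_gmod_dims[OF assms(2)] carrier_vecD[OF assms(4)]
  have "f (n+1) *\<^sub>v (xact M n *\<^sub>v v) = (f (n+1) * xact M n) *\<^sub>v v"
    by (rule mat_vec_assoc[symmetric]) (simp_all add: d)
  also have "\<dots> = xact N n *\<^sub>v (f n *\<^sub>v v)"
    unfolding is_homD(2)[OF assms(3)] by (rule mat_vec_assoc) (simp_all add: d)
  finally show ?thesis .
qed

lemma hcomp_vec:
  assumes "fam M N f" "fam N P g" "v \<in> carrier_vec (gdim M n)"
  shows "hcomp g f n *\<^sub>v v = g n *\<^sub>v (f n *\<^sub>v v)"
  unfolding hcomp_def
  by (rule mat_vec_assoc) (simp_all add: fam_dims[OF assms(1)] fam_dims[OF assms(2)] carrier_vecD[OF assms(3)])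

text \<open>Injectivity of \<open>y\<close> is inherited through the inclusion, surjectivity in low
  degrees through the projection, and boundedness from the dimensions.\<close>

lemma C2_summand:
  assumes M: "M \<in> C2" and A: "wf_gmod A" and B: "wf_gmod B" and b: "biprod M A B"
  shows "A \<in> C2"
proof -
  have w: "wf_gmod M" using M C2_wf by blast
  obtain i1 i2 p1 p2 where bw: "biprod_wit M A B i1 i2 p1 p2" using b biprod_def by blast
  then have i: "is_hom A M i1" and p: "is_hom M A p1" and pi: "hcomp p1 i1 = hid A" by (auto simp: biprod_wit_def)
  note F = is_homD(1)[OF i] is_homD(1)[OF p]
  have pi: "p1 n *\<^sub>v (i1 n *\<^sub>v v) = v" if "v \<in> carrier_vec (gdim A n)" for n v
    using hcomp_vec[OF F that] pi that by (simp add: hid_def)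
  have "bdd_top A" using M biprod_gdim[OF w A B b] unfolding C2_iff bdd_top_def by auto
  moreover have "y_inj A" unfolding y_inj_def
  proof (intro allI ballI impI)
    fix n and v :: "complex vec" assume v: "v \<in> carrier_vec (gdim A n)" and z: "yact A n *\<^sub>v v = 0\<^sub>v (gdim A (n-1))"
    have "yact M n *\<^sub>v (i1 n *\<^sub>v v) = 0\<^sub>v (gdim M (n-1))"
      using yhom_y_vec[OF A w is_homD(4)[OF i] v] z mult_mat_vec_zero[OF famD[OF F(1)]] by simp
    moreover have "i1 n *\<^sub>v v \<in> carrier_vec (gdim M n)" using famD[OF F(1)] v by (rule mult_mat_vec_carrier)
    ultimately have "i1 n *\<^sub>v v = 0\<^sub>v (gdim M n)" using M unfolding C2_iff y_inj_def by blast
    then show "v = 0\<^sub>v (gdim A n)" using pi[OF v] mult_mat_vec_zero[OF famD[OF F(2)]] by simp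
  qed
  moreover have "y_surj_low A"
  proof -
    obtain L where L: "\<And>n u. n \<le> L \<Longrightarrow> u \<in> carrier_vec (gdim M (n-1)) \<Longrightarrow> \<exists>v \<in> carrier_vec (gdim M n). yact M n *\<^sub>v v = u"
      using M unfolding C2_iff y_surj_low_def by blast
    have "\<exists>v \<in> carrier_vec (gdim A n). yact A n *\<^sub>v v = u" if n: "n \<le> L" and u: "u \<in> carrier_vec (gdim A (n-1))" for n u
    proof -
      have "i1 (n-1) *\<^sub>v u \<in> carrier_vec (gdim M (n-1))" using famD[OF F(1)] u by (rule mult_mat_vec_carrier)
      then obtain v where v: "v \<in> carrier_vec (gdim M n)" "yact M n *\<^sub>v v = i1 (n-1) *\<^sub>v u" using L n by blast
      have "yact A n *\<^sub>v (p1 n *\<^sub>v v) = u" using yhom_y_vec[OF w A is_homD(4)[OF p] v(1)] v(2) pi[OF u] by simp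
      moreover have "p1 n *\<^sub>v v \<in> carrier_vec (gdim A n)" using famD[OF F(2)] v(1) by (rule mult_mat_vec_carrier)
      ultimately show ?thesis by blast
    qed
    then show ?thesis unfolding y_surj_low_def by blast
  qed
  ultimately show ?thesis using A by (simp add: C2_iff)
qed

lemma int_ex_max:
  fixes U :: int
  assumes "P a" "\<And>a. P a \<Longrightarrow> a \<le> U"
  obtains m where "P m" "\<And>a. P a \<Longrightarrow> a \<le> m"
proof -
  obtain m where m: "P m" "\<And>a. P a \<Longrightarrow> nat (U - m) \<le> nat (U - a)"
    using ex_has_least_nat[of P a "\<lambda>a. nat (U - a)"] assms(1) by blast
  have "a \<le> m" if "P a" for a using m(2)[OF that] assms(2)[OF that] assms(2)[OF m(1)] by linarith
  with m(1) that show thesis by blast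
qed

section \<open>Retractions onto arc modules from functionals on the colimit\<close>

locale colimit =
  fixes M :: gmod and r :: nat and K :: "int \<Rightarrow> complex mat" and X :: "complex mat"
  assumes M: "M \<in> C2" and K: "\<And>n. K n \<in> carrier_mat r (gdim M n)" and X: "X \<in> carrier_mat r r"
    and Ky: "\<And>n. K (n-1) * yact M n = K n" and Kx: "\<And>n. K (n+1) * xact M n = X * K n"
    and K_inj: "\<And>n v. v \<in> carrier_vec (gdim M n) \<Longrightarrow> K n *\<^sub>v v = 0\<^sub>v r \<Longrightarrow> v = 0\<^sub>v (gdim M n)"
begin

lemma wf: "wf_gmod M" using M C2_wf by blast

lemmas kd = carrier_matD[OF K] carrier_matD[OF X] wf_gmod_dims[OF wf]

lemma Ky_vec: "v \<in> carrier_vec (gdim M n) \<Longrightarrow> K (n-1) *\<^sub>v (yact M n *\<^sub>v v) = K n *\<^sub>v v"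
  using mat_vec_assoc[of "K (n-1)" "yact M n" v] Ky[of n] by (simp add: kd)

lemma Kx_vec: "v \<in> carrier_vec (gdim M n) \<Longrightarrow> K (n+1) *\<^sub>v (xact M n *\<^sub>v v) = X *\<^sub>v (K n *\<^sub>v v)"
  using mat_vec_assoc[of "K (n+1)" "xact M n" v] mat_vec_assoc[of X "K n" v] Kx[of n] by (simp add: kd)

lemma Kv_carrier: "v \<in> carrier_vec (gdim M n) \<Longrightarrow> K n *\<^sub>v v \<in> carrier_vec r"
  by (rule mult_mat_vec_carrier[OF K])

lemma XKv_carrier: "v \<in> carrier_vec (gdim M n) \<Longrightarrow> X *\<^sub>v (K n *\<^sub>v v) \<in> carrier_vec r"
  by (rule mult_mat_vec_carrier[OF X Kv_carrier])

lemma xv_carrier: "v \<in> carrier_vec (gdim M n) \<Longrightarrow> xact M n *\<^sub>v v \<in> carrier_vec (gdim M (n+1))"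
  by (rule mult_mat_vec_carrier[OF wf_gmodD(1)[OF wf]])

lemma yv_carrier: "v \<in> carrier_vec (gdim M n) \<Longrightarrow> yact M n *\<^sub>v v \<in> carrier_vec (gdim M (n-1))"
  by (rule mult_mat_vec_carrier[OF wf_gmodD(2)[OF wf]])

lemma XX_vec: "v \<in> carrier_vec (gdim M n) \<Longrightarrow> X *\<^sub>v (X *\<^sub>v (K n *\<^sub>v v)) = 0\<^sub>v r"
proof -
  assume v: "v \<in> carrier_vec (gdim M n)"
  have "xact M (n+1) *\<^sub>v (xact M n *\<^sub>v v) = (xact M (n+1) * xact M n) *\<^sub>v v"
    by (rule mat_vec_assoc[symmetric]) (use v in \<open>auto simp: kd\<close>)
  also have "\<dots> = 0\<^sub>v (gdim M (n+2))" unfolding wf_gmodD(3)[OF wf] using v by (intro eq_vecI) auto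
  finally have "K (n+1+1) *\<^sub>v (xact M (n+1) *\<^sub>v (xact M n *\<^sub>v v)) = 0\<^sub>v r"
    using mult_mat_vec_zero[OF K, of "n+2"] by (simp add: add.commute)
  then show ?thesis unfolding Kx_vec[OF xv_carrier[OF v]] Kx_vec[OF v] .
qed

lemma K_cancel:
  assumes "v \<in> carrier_vec (gdim M n)" "u \<in> carrier_vec (gdim M n)" "K n *\<^sub>v v = K n *\<^sub>v u"
  shows "v = u"
proof -
  have "K n *\<^sub>v (v - u) = K n *\<^sub>v v - K n *\<^sub>v u" by (rule mult_minus_distrib_mat_vec[OF K assms(1,2)])
  also have "\<dots> = 0\<^sub>v r" unfolding assms(3) using Kv_carrier[OF assms(2)] by simp
  finally have z: "v - u = 0\<^sub>v (gdim M n)" using K_inj assms(1,2) minus_carrier_vec by blast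
  show ?thesis
  proof (rule eq_vecI)
    fix i assume i: "i < dim_vec u"
    then show "v $ i = u $ i" using arg_cong[OF z, of "\<lambda>x. x $ i"] assms(1,2) by simp
  qed (use assms in auto)
qed

text \<open>In the colimit multiplication by \<open>y\<close> becomes the identity.\<close>

lemma K_low: 
  assumes w: "w \<in> carrier_vec (gdim M b)"
  shows "n \<le> b \<Longrightarrow> K n *\<^sub>v low M (Fin b) n w = K b *\<^sub>v w"
proof (induction rule: int_down_induct)
  case base
  then show ?case using w by (simp add: low_def)
next
  case (step n)
  have "low M (Fin b) (n-1) w = yact M n *\<^sub>v low M (Fin b) n w"
    using low_y[OF wf, of n "Fin b" w] step(1) w by (simp add: gen_carrier_def)
  then show ?case using Ky_vec[OF low_carrier[OF wf]] step by simp
qed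

text \<open>The candidate retraction sends \<open>v\<close> to \<open>l v\<close> times
  \<open>e\<close> plus \<open>l (X v)\<close> times \<open>f\<close>. The second coefficient is
  forced by compatibility with \<open>x\<close>, which turns \<open>f\<close> into
  \<open>e\<close>.\<close>

definition fproj :: "arc \<Rightarrow> complex vec \<Rightarrow> int \<Rightarrow> complex mat" where
  "fproj \<alpha> l = (\<lambda>n. mat (arc_dim \<alpha> n) (gdim M n)
     (\<lambda>(i,j). if i = 0 then (transpose_mat (K n) *\<^sub>v l) $ j else (transpose_mat (X * K n) *\<^sub>v l) $ j))"

lemma fproj_vec:
  assumes "l \<in> carrier_vec r" "v \<in> carrier_vec (gdim M n)"
  shows "fproj \<alpha> l n *\<^sub>v v = av \<alpha> n (l \<bullet> (K n *\<^sub>v v)) (l \<bullet> (X *\<^sub>v (K n *\<^sub>v v)))"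
proof (rule eq_vecI)
  fix i assume "i < dim_vec (av \<alpha> n (l \<bullet> (K n *\<^sub>v v)) (l \<bullet> (X *\<^sub>v (K n *\<^sub>v v))))"
  then have i: "i < arc_dim \<alpha> n" by simp
  have XK: "X * K n \<in> carrier_mat r (gdim M n)" by (rule mult_carrier_mat[OF X K])
  have "(fproj \<alpha> l n *\<^sub>v v) $ i = (if i = 0 then (transpose_mat (K n) *\<^sub>v l) \<bullet> v else (transpose_mat (X * K n) *\<^sub>v l) \<bullet> v)"
    using i assms(2) unfolding fproj_def by (auto simp: scalar_prod_def)
  also have "(transpose_mat (K n) *\<^sub>v l) \<bullet> v = l \<bullet> (K n *\<^sub>v v)"
    by (rule transpose_vec_mult_scalar[OF K assms(2,1)])
  also have "(transpose_mat (X * K n) *\<^sub>v l) \<bullet> v = l \<bullet> ((X * K n) *\<^sub>v v)"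
    by (rule transpose_vec_mult_scalar[OF XK assms(2,1)])
  also have "(X * K n) *\<^sub>v v = X *\<^sub>v (K n *\<^sub>v v)"
    by (rule mat_vec_assoc) (use assms in \<open>auto simp: kd\<close>)
  finally show "(fproj \<alpha> l n *\<^sub>v v) $ i = av \<alpha> n (l \<bullet> (K n *\<^sub>v v)) (l \<bullet> (X *\<^sub>v (K n *\<^sub>v v))) $ i"
    using i by (simp add: av_def)
qed (simp add: fproj_def)

text \<open>\<open>k1\<close> and \<open>k2\<close> say that each coefficient is zero in the degrees
  where its basis vector does not exist. Nothing is truncated then, and the actions can be compared
  coefficientwise.\<close>

lemma fproj_hom:
  assumes \<alpha>: "is_arc \<alpha>" and l: "l \<in> carrier_vec r"
    and k1: "\<And>n v. n > snd \<alpha> \<Longrightarrow> v \<in> carrier_vec (gdim M n) \<Longrightarrow> l \<bullet> (K n *\<^sub>v v) = 0"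
    and k2: "\<And>n v. \<not> ele n (fst \<alpha>) \<Longrightarrow> v \<in> carrier_vec (gdim M n) \<Longrightarrow> l \<bullet> (X *\<^sub>v (K n *\<^sub>v v)) = 0"
  shows "is_hom M (amod \<alpha>) (fproj \<alpha> l)"
proof -
  have F: "fam M (amod \<alpha>) (fproj \<alpha> l)" using \<alpha> by (simp add: fam_def fproj_def amod_sel)
  note A = wf_amod[OF \<alpha>]
  note d = fam_dims[OF F] kd wf_gmod_dims[OF A]
  have ok: "okv \<alpha> n (l \<bullet> (K n *\<^sub>v v)) (l \<bullet> (X *\<^sub>v (K n *\<^sub>v v)))" if "v \<in> carrier_vec (gdim M n)" for n v
    unfolding okv_def using k1[OF _ that] k2[OF _ that] by force
  have "fproj \<alpha> l (n-1) * yact M n = yact (amod \<alpha>) n * fproj \<alpha> l n" for n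
  proof (rule mat_eq_on_vecsI[where nr = "gdim (amod \<alpha>) (n-1)" and nc = "gdim M n"])
    fix v :: "complex vec" assume v: "v \<in> carrier_vec (gdim M n)"
    have "(fproj \<alpha> l (n-1) * yact M n) *\<^sub>v v = fproj \<alpha> l (n-1) *\<^sub>v (yact M n *\<^sub>v v)"
      by (rule mat_vec_assoc) (use v in \<open>auto simp: d\<close>)
    also have "\<dots> = yact (amod \<alpha>) n *\<^sub>v (fproj \<alpha> l n *\<^sub>v v)"
      unfolding fproj_vec[OF l yv_carrier[OF v]] fproj_vec[OF l v] Ky_vec[OF v] using amod_y[OF \<alpha> ok[OF v]] by simp
    also have "\<dots> = (yact (amod \<alpha>) n * fproj \<alpha> l n) *\<^sub>v v"
      by (rule mat_vec_assoc[symmetric]) (use v in \<open>auto simp: d\<close>)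
    finally show "(fproj \<alpha> l (n-1) * yact M n) *\<^sub>v v = (yact (amod \<alpha>) n * fproj \<alpha> l n) *\<^sub>v v" .
  qed (auto intro!: carrier_matI simp: d)
  then have "yhom M (amod \<alpha>) (fproj \<alpha> l)" using F by (simp add: yhom_def)
  moreover have "fproj \<alpha> l (n+1) * xact M n = xact (amod \<alpha>) n * fproj \<alpha> l n" for n
  proof (rule mat_eq_on_vecsI[where nr = "gdim (amod \<alpha>) (n+1)" and nc = "gdim M n"])
    fix v :: "complex vec" assume v: "v \<in> carrier_vec (gdim M n)"
    have "(fproj \<alpha> l (n+1) * xact M n) *\<^sub>v v = fproj \<alpha> l (n+1) *\<^sub>v (xact M n *\<^sub>v v)"
      by (rule mat_vec_assoc) (use v in \<open>auto simp: d\<close>)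
    also have "\<dots> = xact (amod \<alpha>) n *\<^sub>v (fproj \<alpha> l n *\<^sub>v v)"
      unfolding fproj_vec[OF l xv_carrier[OF v]] fproj_vec[OF l v] Kx_vec[OF v]
      using amod_x[OF \<alpha> ok[OF v]] XX_vec[OF v] l by simp
    also have "\<dots> = (xact (amod \<alpha>) n * fproj \<alpha> l n) *\<^sub>v v"
      by (rule mat_vec_assoc[symmetric]) (use v in \<open>auto simp: d\<close>)
    finally show "(fproj \<alpha> l (n+1) * xact M n) *\<^sub>v v = (xact (amod \<alpha>) n * fproj \<alpha> l n) *\<^sub>v v" .
  qed (auto intro!: carrier_matI simp: d)
  ultimately show ?thesis by (rule is_homI)
qed

text \<open>The composite \<open>fproj\<close> after \<open>gen_hom\<close> is the identity on
  generators: \<open>l\<close> takes the value 1 on \<open>w\<close> and 0 on \<open>v\<close>,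
  while \<open>X\<close> kills \<open>w\<close> and sends \<open>v\<close> to \<open>w\<close> in
  the colimit.\<close>

lemma split_off_arc:
  assumes \<alpha>: "is_arc \<alpha>" and l: "l \<in> carrier_vec r"
    and k1: "\<And>n v. n > snd \<alpha> \<Longrightarrow> v \<in> carrier_vec (gdim M n) \<Longrightarrow> l \<bullet> (K n *\<^sub>v v) = 0"
    and k2: "\<And>n v. \<not> ele n (fst \<alpha>) \<Longrightarrow> v \<in> carrier_vec (gdim M n) \<Longrightarrow> l \<bullet> (X *\<^sub>v (K n *\<^sub>v v)) = 0"
    and w: "w \<in> carrier_vec (gdim M (snd \<alpha>))" and v: "gen_carrier M (fst \<alpha>) v"
    and xw: "xact M (snd \<alpha>) *\<^sub>v w = 0\<^sub>v (gdim M (snd \<alpha> + 1))"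
    and xv: "\<And>a. fst \<alpha> = Fin a \<Longrightarrow> xact M a *\<^sub>v v = low M (Fin (snd \<alpha>)) (a+1) w"
    and lw: "l \<bullet> (K (snd \<alpha>) *\<^sub>v w) = 1"
    and lv: "\<And>a. fst \<alpha> = Fin a \<Longrightarrow> l \<bullet> (K a *\<^sub>v v) = 0"
  shows "\<exists>N. wf_gmod N \<and> biprod M (amod \<alpha>) N"
proof (rule biprod_of_section[OF wf wf_amod[OF \<alpha>]])
  let ?i = "gen_hom \<alpha> M w v" and ?p = "fproj \<alpha> l"
  show i: "is_hom (amod \<alpha>) M ?i" by (rule is_hom_gen_hom[OF \<alpha> wf w v xw xv])
  show p: "is_hom M (amod \<alpha>) ?p" by (rule fproj_hom[OF \<alpha> l k1 k2])
  note A = wf_amod[OF \<alpha>]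
  note F = is_homD(1)[OF i] is_homD(1)[OF p]
  show "hcomp ?p ?i = hid (amod \<alpha>)"
  proof (rule yhom_amod_ext[OF \<alpha> A is_homD(4)[OF is_hom_hcomp[OF A wf A i p]] is_homD(4)[OF is_hom_hid[OF A]]])
    have "X *\<^sub>v (K (snd \<alpha>) *\<^sub>v w) = 0\<^sub>v r"
      using Kx_vec[OF w] xw mult_mat_vec_zero[OF K] by simp
    then show "hcomp ?p ?i (snd \<alpha>) *\<^sub>v av \<alpha> (snd \<alpha>) 1 0 = hid (amod \<alpha>) (snd \<alpha>) *\<^sub>v av \<alpha> (snd \<alpha>) 1 0"
      using hcomp_vec[OF F av_carrier[OF \<alpha>]] gen_hom_gen(1)[OF \<alpha> wf w] fproj_vec[OF l w] lw l av_carrier[OF \<alpha>]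
      by (simp add: hid_def)
  next
    fix a assume a: "fst \<alpha> = Fin a"
    then have va: "v \<in> carrier_vec (gdim M a)" using v by (simp add: gen_carrier_def)
    have "a + 1 \<le> snd \<alpha>" using \<alpha> a by (simp add: is_arc_def)
    then have "X *\<^sub>v (K a *\<^sub>v v) = K (snd \<alpha>) *\<^sub>v w" using Kx_vec[OF va] xv[OF a] K_low[OF w] by simp
    then show "hcomp ?p ?i a *\<^sub>v av \<alpha> a 0 1 = hid (amod \<alpha>) a *\<^sub>v av \<alpha> a 0 1"
      using hcomp_vec[OF F av_carrier[OF \<alpha>]] gen_hom_gen(2)[OF \<alpha> wf a va] fproj_vec[OF l va] lv[OF a] lw av_carrier[OF \<alpha>]
      by (simp add: hid_def)
  qed
qed

text \<open>The images of the \<open>K n\<close> shrink as \<open>n\<close> grows, because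
  \<open>K n\<close> factors through \<open>K (n-1)\<close>.\<close>

lemma kill_above:
  assumes l: "\<And>v. v \<in> carrier_vec (gdim M (b+1)) \<Longrightarrow> l \<bullet> (K (b+1) *\<^sub>v v) = 0"
    and "n > b" "v \<in> carrier_vec (gdim M n)"
  shows "l \<bullet> (K n *\<^sub>v v) = 0"
proof -
  have "b + 1 \<le> n" using assms(2) by simp
  then show ?thesis using assms(3)
  proof (induction n arbitrary: v rule: int_ge_induct)
    case (step n)
    then show ?case using Ky_vec[OF step(3)] step.IH[of "yact M (n+1) *\<^sub>v v"] yv_carrier[OF step(3)] by simp
  qed (use l in simp)
qed

text \<open>Take a maximal with \<open>x\<close> nonzero in degree \<open>a\<close>, a vector \<open>v\<close> there with \<open>x v \<noteq> 0\<close>, and divide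
  \<open>x v\<close> by the highest possible power of \<open>y\<close>. The resulting copy of an arc module splits off, because
  a functional detecting \<open>x v\<close> but no multiple of a higher power of \<open>y\<close> defines a retraction.
  If \<open>x = 0\<close>, an element of maximal degree generates a summand.\<close>
lemma ex_arc_summand:
  assumes nz: "gdim M n0 \<noteq> 0"
  shows "\<exists>\<alpha> N. is_arc \<alpha> \<and> wf_gmod N \<and> biprod M (amod \<alpha>) N"
proof -
  obtain U where U: "\<And>n. n > U \<Longrightarrow> gdim M n = 0" using M unfolding C2_iff bdd_top_def by blast
  show ?thesis
  proof (cases "\<exists>a. xact M a \<noteq> 0\<^sub>m (gdim M (a+1)) (gdim M a)")
    case False
    then have x0: "xact M n *\<^sub>v v = 0\<^sub>v (gdim M (n+1))" if "v \<in> carrier_vec (gdim M n)" for n v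
      using that by (simp add: zero_mat_mult_vec)
    obtain b where b: "gdim M b \<noteq> 0" "\<And>a. gdim M a \<noteq> 0 \<Longrightarrow> a \<le> b"
      using int_ex_max[of "\<lambda>a. gdim M a \<noteq> 0" n0 U] nz U by (metis not_less)
    let ?w = "unit_vec (gdim M b) 0 :: complex vec"
    have wc: "?w \<in> carrier_vec (gdim M b)" by simp
    have "?w \<noteq> 0\<^sub>v (gdim M b)" using b(1) by (intro unit_vec_nonzero) auto
    then have "K b *\<^sub>v ?w \<noteq> 0\<^sub>v r" using K_inj[OF wc] by blast
    moreover have b1: "gdim M (b+1) = 0" using b(2)[of "b+1"] by fastforce
    moreover have "K (b+1) *\<^sub>v u = 0\<^sub>v r" if "u \<in> carrier_vec (gdim M (b+1))" for u
      using that b1 K[of "b+1"] by (intro eq_vecI) (auto simp: scalar_prod_def)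
    ultimately obtain l where l: "l \<in> carrier_vec r" "l \<bullet> (K b *\<^sub>v ?w) = 1"
       "\<And>u. u \<in> carrier_vec (gdim M (b+1)) \<Longrightarrow> l \<bullet> (K (b+1) *\<^sub>v u) = 0"
      using separating_functional[OF K Kv_carrier[OF wc], of "b+1"] by metis
    have "\<exists>N. wf_gmod N \<and> biprod M (amod (NegInf, b)) N"
    proof (rule split_off_arc[where w = ?w and v = "0\<^sub>v 0" and l = l])
      fix n and v :: "complex vec" assume v: "v \<in> carrier_vec (gdim M n)"
      show "l \<bullet> (X *\<^sub>v (K n *\<^sub>v v)) = 0"
        unfolding Kx_vec[OF v, symmetric] x0[OF v] using mult_mat_vec_zero[OF K] l(1) by simp
    next
      fix n and v :: "complex vec" assume "snd (NegInf, b) < n" "v \<in> carrier_vec (gdim M n)"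
      then show "l \<bullet> (K n *\<^sub>v v) = 0" using kill_above[OF l(3)] by simp
    qed (use l wc x0[OF wc] in \<open>auto simp: is_arc_def gen_carrier_def\<close>)
    then show ?thesis by (metis ext_less.simps(2) fst_conv is_arc_def)
  next
    case True
    let ?P = "\<lambda>a. xact M a \<noteq> 0\<^sub>m (gdim M (a+1)) (gdim M a)"
    have "a \<le> U" if "?P a" for a
    proof (rule ccontr)
      assume "\<not> a \<le> U"
      then have "gdim M a = 0" using U by simp
      then have "?P a = False" using wf_gmodD(1)[OF wf, of a] by (auto intro!: eq_matI)
      then show False using that by simp
    qed
    then obtain a where a: "?P a" "\<And>a'. ?P a' \<Longrightarrow> a' \<le> a" using int_ex_max[of ?P _ U] True by blast
    obtain v0 where v0: "v0 \<in> carrier_vec (gdim M a)" "xact M a *\<^sub>v v0 \<noteq> 0\<^sub>v (gdim M (a+1))"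
    proof (rule ccontr)
      assume H: "\<not> thesis"
      have "xact M a = 0\<^sub>m (gdim M (a+1)) (gdim M a)"
      proof (rule mat_eq_on_vecsI[OF wf_gmodD(1)[OF wf]])
        fix v :: "complex vec" assume v: "v \<in> carrier_vec (gdim M a)"
        then have "xact M a *\<^sub>v v = 0\<^sub>v (gdim M (a+1))" using H that by blast
        then show "xact M a *\<^sub>v v = 0\<^sub>m (gdim M (a+1)) (gdim M a) *\<^sub>v v" using v by (simp add: zero_mat_mult_vec)
      qed simp
      then show False using a by simp
    qed
    have x0: "xact M n *\<^sub>v v = 0\<^sub>v (gdim M (n+1))" if "n > a" "v \<in> carrier_vec (gdim M n)" for n v
    proof -
      have "xact M n = 0\<^sub>m (gdim M (n+1)) (gdim M n)" using a(2)[of n] that by force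
      then show ?thesis using that by (simp add: zero_mat_mult_vec)
    qed
    define u where "u = X *\<^sub>v (K a *\<^sub>v v0)"
    have u_eq: "K (a+1) *\<^sub>v (xact M a *\<^sub>v v0) = u" unfolding u_def by (rule Kx_vec[OF v0(1)])
    have u0: "u \<noteq> 0\<^sub>v r" using K_inj[OF xv_carrier[OF v0(1)]] u_eq v0(2) by auto
    have Xu: "X *\<^sub>v u = 0\<^sub>v r" unfolding u_def by (rule XX_vec[OF v0(1)])
    have uc: "u \<in> carrier_vec r" unfolding u_def by (rule XKv_carrier[OF v0(1)])
    \<comment> \<open>For \<open>b > a\<close> this says that \<open>x v0\<close> is divisible by a
      power of \<open>y\<close> with quotient in degree \<open>b\<close>; equality in the colimit
      suffices since \<open>K\<close> is injective.\<close>
    let ?Q = "\<lambda>b. \<exists>w \<in> carrier_vec (gdim M b). K b *\<^sub>v w = u"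
    have "b \<le> U" if Q: "?Q b" for b
    proof (rule ccontr)
      assume "\<not> b \<le> U"
      then have g: "gdim M b = 0" using U by simp
      obtain w where "w \<in> carrier_vec (gdim M b)" "K b *\<^sub>v w = u" using Q by blast
      then have "u = 0\<^sub>v r" using g K[of b] by (auto simp: scalar_prod_def intro!: eq_vecI)
      then show False using u0 by simp
    qed
    moreover have Q1: "?Q (a+1)" using u_eq xv_carrier[OF v0(1)] by blast
    ultimately obtain b where b: "?Q b" "\<And>b'. ?Q b' \<Longrightarrow> b' \<le> b" using int_ex_max[of ?Q "a+1" U] by blast
    have ab: "a + 1 \<le> b" using b(2)[OF Q1] .
    obtain w where w: "w \<in> carrier_vec (gdim M b)" "K b *\<^sub>v w = u" using b(1) by blast
    have "u \<noteq> K (b+1) *\<^sub>v v" if "v \<in> carrier_vec (gdim M (b+1))" for v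
      using b(2)[of "b+1"] that by force
    then obtain l where l: "l \<in> carrier_vec r" "l \<bullet> u = 1"
       "\<And>u. u \<in> carrier_vec (gdim M (b+1)) \<Longrightarrow> l \<bullet> (K (b+1) *\<^sub>v u) = 0"
      using separating_functional[OF K uc, of "b+1"] by metis
    \<comment> \<open>The copy of \<open>w\<close> in degree \<open>a\<close> is killed by
      \<open>X\<close>, so adding a multiple of it does not change \<open>x v0\<close>. As
      \<open>l\<close> is 1 on \<open>u\<close>, this multiple makes \<open>l\<close> vanish on the
      corrected vector.\<close>
    define t where "t = - (l \<bullet> (K a *\<^sub>v v0))"
    let ?lw = "low M (Fin b) a w"
    define v where "v = t \<cdot>\<^sub>v ?lw + v0"
    have lc: "?lw \<in> carrier_vec (gdim M a)" by (rule low_carrier[OF wf])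
    have v: "v \<in> carrier_vec (gdim M a)" unfolding v_def using lc v0(1) by simp
    have Klw: "K a *\<^sub>v ?lw = u" using K_low[OF w(1), of a] ab w(2) by simp
    have Kv: "K a *\<^sub>v v = t \<cdot>\<^sub>v u + K a *\<^sub>v v0"
      unfolding v_def using mult_mat_vec_lin[OF K lc v0(1)] Klw by simp
    have XKv: "X *\<^sub>v (K a *\<^sub>v v) = u"
      unfolding Kv using mult_mat_vec_lin[OF X uc Kv_carrier[OF v0(1)]] Xu uc by (simp add: u_def)
    have lKv: "l \<bullet> (K a *\<^sub>v v) = 0"
      unfolding Kv using l uc Kv_carrier[OF v0(1)] by (simp add: scalar_prod_add_distrib[of _ r] t_def)
    have xv: "xact M a *\<^sub>v v = low M (Fin b) (a+1) w"
      using K_cancel[OF xv_carrier[OF v] low_carrier[OF wf]] Kx_vec[OF v] XKv K_low[OF w(1) ab] w(2) by simp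
    have xw: "xact M b *\<^sub>v w = 0\<^sub>v (gdim M (b+1))"
      using K_inj[OF xv_carrier[OF w(1)]] Kx_vec[OF w(1)] Xu w(2) by simp
    have "\<exists>N. wf_gmod N \<and> biprod M (amod (Fin a, b)) N"
    proof (rule split_off_arc[where w = w and v = v and l = l])
      fix n and v' :: "complex vec" assume "\<not> ele n (fst (Fin a, b))" and v': "v' \<in> carrier_vec (gdim M n)"
      then have "n > a" by simp
      then show "l \<bullet> (X *\<^sub>v (K n *\<^sub>v v')) = 0"
        unfolding Kx_vec[OF v', symmetric] using x0[OF _ v'] mult_mat_vec_zero[OF K] l(1) by simp
    next
      fix n and v' :: "complex vec" assume "snd (Fin a, b) < n" "v' \<in> carrier_vec (gdim M n)"
      then show "l \<bullet> (K n *\<^sub>v v') = 0" using kill_above[OF l(3)] by simp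
    qed (use l w v xv xw lKv ab in \<open>auto simp: is_arc_def gen_carrier_def\<close>)
    moreover have "is_arc (Fin a, b)" using ab by (simp add: is_arc_def)
    ultimately show ?thesis by blast
  qed
qed

end

text \<open>Existence of the decomposition, phrased as an induction on the rank over C[y]. Every
  additive property of \<open>C2\<close> then only needs to be checked on arc modules.\<close>

lemma C2_induct [consumes 1, case_names zero biprod]:
  assumes "M \<in> C2"
    and zero: "\<And>M. M \<in> C2 \<Longrightarrow> (\<And>n. gdim M n = 0) \<Longrightarrow> P M"
    and step: "\<And>M \<alpha> N. M \<in> C2 \<Longrightarrow> is_arc \<alpha> \<Longrightarrow> N \<in> C2 \<Longrightarrow> biprod M (amod \<alpha>) N \<Longrightarrow> P N \<Longrightarrow> P M"
  shows "P M"
proof -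
  obtain r where "low_rank M r" using ex_low_rank assms(1) by blast
  then show ?thesis using assms(1)
  proof (induction r arbitrary: M rule: less_induct)
    case (less r)
    show ?case
    proof (cases "\<forall>n. gdim M n = 0")
      case True then show ?thesis using zero less by blast
    next
      case False
      then obtain n0 where n0: "gdim M n0 \<noteq> 0" by blast
      obtain r' K X where c: "colimit M r' K X" using C2_colimit[OF less(3)] less(3) unfolding colimit_def by blast
      obtain \<alpha> N where \<alpha>: "is_arc \<alpha>" and N: "wf_gmod N" and b: "biprod M (amod \<alpha>) N"
        using colimit.ex_arc_summand[OF c n0] by blast
      note M = C2_wf[OF less(3)] and A = wf_amod[OF \<alpha>]
      have NC: "N \<in> C2" using C2_summand[OF less(3) N A biprod_swap[OF M A N b]] .
      obtain s where s: "low_rank N s" using ex_low_rank NC by blast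
      obtain L L' where L: "\<And>n. n \<le> L \<Longrightarrow> gdim M n = r" "\<And>n. n \<le> L' \<Longrightarrow> gdim N n = s"
        using s less(2) unfolding low_rank_def by blast
      \<comment> \<open>Low enough for both ranks to be visible and for the arc module to be
        nonzero, so the rank strictly drops.\<close>
      let ?n = "min (snd \<alpha>) (min L L')"
      have "r = arc_dim \<alpha> ?n + s" using biprod_gdim[OF M A N b, of ?n] L[of ?n] amod_sel(1)[OF \<alpha>] by simp
      moreover have "arc_dim \<alpha> ?n > 0" by (simp add: arc_dim_def)
      ultimately have "s < r" by simp
      then have "P N" using less(1) s NC by blast
      then show ?thesis using step less(3) \<alpha> NC b by blast
    qed
  qed
qed

section \<open>Homomorphisms between arc modules and cocycles\<close>

text \<open>\<open>hA\<close> is \<open>e \<mapsto> e', f \<mapsto> f'\<close> and \<open>hB\<close> is \<open>e \<mapsto> 0, f \<mapsto> e'\<close>, up to powers of \<open>y\<close>; these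
  are homomorphisms under \<open>validA\<close> and \<open>validB\<close> respectively. Multiples of the generator \<open>f\<close>
  exist only for arcs with finite left end.\<close>
definition hA :: "arc \<Rightarrow> arc \<Rightarrow> int \<Rightarrow> complex mat" where
  "hA \<alpha> \<gamma> = (\<lambda>n. mat (arc_dim \<gamma> n) (arc_dim \<alpha> n) (\<lambda>(i,j). if i = j then 1 else 0))"
definition hB :: "arc \<Rightarrow> arc \<Rightarrow> int \<Rightarrow> complex mat" where
  "hB \<alpha> \<gamma> = (\<lambda>n. mat (arc_dim \<gamma> n) (arc_dim \<alpha> n) (\<lambda>(i,j). if i = 0 \<and> j = 1 then 1 else 0))"

definition validA :: "arc \<Rightarrow> arc \<Rightarrow> bool" where
  "validA \<alpha> \<gamma> \<longleftrightarrow> (\<forall>a. fst \<alpha> = Fin a \<longrightarrow> ele a (fst \<gamma>)) \<and> snd \<alpha> \<le> snd \<gamma>"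
definition validB :: "arc \<Rightarrow> arc \<Rightarrow> bool" where
  "validB \<alpha> \<gamma> \<longleftrightarrow> (\<exists>a. fst \<alpha> = Fin a \<and> a \<le> snd \<gamma>)"

lemma fam_hAB: "is_arc \<alpha> \<Longrightarrow> is_arc \<gamma> \<Longrightarrow> fam (amod \<alpha>) (amod \<gamma>) (hA \<alpha> \<gamma>)"
   "is_arc \<alpha> \<Longrightarrow> is_arc \<gamma> \<Longrightarrow> fam (amod \<alpha>) (amod \<gamma>) (hB \<alpha> \<gamma>)"
  by (auto simp: fam_def hA_def hB_def amod_sel)

lemma okv_dim: "is_arc \<alpha> \<Longrightarrow> okv \<alpha> n p q \<Longrightarrow> arc_dim \<alpha> n \<le> 1 \<Longrightarrow> q = 0"
    "is_arc \<alpha> \<Longrightarrow> okv \<alpha> n p q \<Longrightarrow> arc_dim \<alpha> n = 0 \<Longrightarrow> p = 0"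
  by (erule arc_dim_cases[of \<alpha> n], auto simp: okv_def)+

lemma hA_av: 
  assumes "is_arc \<alpha>" "okv \<alpha> n p q"
  shows "hA \<alpha> \<gamma> n *\<^sub>v av \<alpha> n p q = av \<gamma> n p q"
proof (rule eq_vecI)
  fix i assume "i < dim_vec (av \<gamma> n p q)"
  then have i: "i < arc_dim \<gamma> n" by simp
  then have i2: "i < 2" using arc_dim_le2[of \<gamma> n] by linarith
  show "(hA \<alpha> \<gamma> n *\<^sub>v av \<alpha> n p q) $ i = av \<gamma> n p q $ i"
    using i i2 okv_dim[OF assms] by (subst mat_av_mult) (auto simp: hA_def av_def less_2_cases_iff)
qed (auto simp: hA_def)

lemma hB_av: 
  assumes "is_arc \<alpha>" "okv \<alpha> n p q"
  shows "hB \<alpha> \<gamma> n *\<^sub>v av \<alpha> n p q = av \<gamma> n q 0"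
proof (rule eq_vecI)
  fix i assume "i < dim_vec (av \<gamma> n q 0)"
  then have i: "i < arc_dim \<gamma> n" by simp
  then have i2: "i < 2" using arc_dim_le2[of \<gamma> n] by linarith
  show "(hB \<alpha> \<gamma> n *\<^sub>v av \<alpha> n p q) $ i = av \<gamma> n q 0 $ i"
    using i i2 okv_dim[OF assms] by (subst mat_av_mult) (auto simp: hB_def av_def less_2_cases_iff)
qed (auto simp: hB_def)

lemma okv_validA: "validA \<alpha> \<gamma> \<Longrightarrow> okv \<alpha> n p q \<Longrightarrow> okv \<gamma> n p q"
  unfolding okv_def validA_def by (cases "fst \<alpha>") (auto intro: ele_mono)

lemma okv_validB: "validB \<alpha> \<gamma> \<Longrightarrow> okv \<alpha> n p q \<Longrightarrow> okv \<gamma> n q 0"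
  unfolding okv_def validB_def by auto

lemma is_hom_hA:
  assumes "is_arc \<alpha>" "is_arc \<gamma>" "validA \<alpha> \<gamma>"
  shows "is_hom (amod \<alpha>) (amod \<gamma>) (hA \<alpha> \<gamma>)"
proof (rule is_hom_amodI[OF assms(1) wf_amod[OF assms(2)] yhom_amodI[OF assms(1) wf_amod[OF assms(2)] fam_hAB(1)[OF assms(1,2)]]])
  fix n p q assume ok: "okv \<alpha> n p q"
  note ok' = okv_validA[OF assms(3) ok]
  show "hA \<alpha> \<gamma> (n-1) *\<^sub>v av \<alpha> (n-1) p q = yact (amod \<gamma>) n *\<^sub>v (hA \<alpha> \<gamma> n *\<^sub>v av \<alpha> n p q)"
    using hA_av[OF assms(1) ok] hA_av[OF assms(1) okv_dec[OF ok, of "n-1"]] amod_y[OF assms(2) ok'] by simp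
  show "hA \<alpha> \<gamma> (n+1) *\<^sub>v av \<alpha> (n+1) q 0 = xact (amod \<gamma>) n *\<^sub>v (hA \<alpha> \<gamma> n *\<^sub>v av \<alpha> n p q)"
    using hA_av[OF assms(1) ok] hA_av[OF assms(1) okv_x[OF assms(1) ok]] amod_x[OF assms(2) ok'] by simp
qed

lemma is_hom_hB:
  assumes "is_arc \<alpha>" "is_arc \<gamma>" "validB \<alpha> \<gamma>"
  shows "is_hom (amod \<alpha>) (amod \<gamma>) (hB \<alpha> \<gamma>)"
proof (rule is_hom_amodI[OF assms(1) wf_amod[OF assms(2)] yhom_amodI[OF assms(1) wf_amod[OF assms(2)] fam_hAB(2)[OF assms(1,2)]]])
  fix n p q assume ok: "okv \<alpha> n p q"
  note ok' = okv_validB[OF assms(3) ok]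
  show "hB \<alpha> \<gamma> (n-1) *\<^sub>v av \<alpha> (n-1) p q = yact (amod \<gamma>) n *\<^sub>v (hB \<alpha> \<gamma> n *\<^sub>v av \<alpha> n p q)"
    using hB_av[OF assms(1) ok] hB_av[OF assms(1) okv_dec[OF ok, of "n-1"]] amod_y[OF assms(2) ok'] by simp
  show "hB \<alpha> \<gamma> (n+1) *\<^sub>v av \<alpha> (n+1) q 0 = xact (amod \<gamma>) n *\<^sub>v (hB \<alpha> \<gamma> n *\<^sub>v av \<alpha> n p q)"
    using hB_av[OF assms(1) ok] hB_av[OF assms(1) okv_x[OF assms(1) ok]] amod_x[OF assms(2) ok'] by simp
qed

text \<open>Only the first map has to be valid, so that the intermediate element is not truncated.
  The remaining composite, of two maps \<open>hB\<close>, sends \<open>f\<close> to a multiple of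
  \<open>e\<close> and then to zero.\<close>

lemma hcomp_hAB:
  assumes "is_arc \<alpha>" "is_arc \<beta>" "is_arc \<gamma>"
  shows "validA \<alpha> \<beta> \<Longrightarrow> hcomp (hA \<beta> \<gamma>) (hA \<alpha> \<beta>) = hA \<alpha> \<gamma>"
    "validB \<alpha> \<beta> \<Longrightarrow> hcomp (hA \<beta> \<gamma>) (hB \<alpha> \<beta>) = hB \<alpha> \<gamma>"
    "validA \<alpha> \<beta> \<Longrightarrow> hcomp (hB \<beta> \<gamma>) (hA \<alpha> \<beta>) = hB \<alpha> \<gamma>"
  using okv_validA[of \<alpha> \<beta>] okv_validB[of \<alpha> \<beta>] assms
  by (auto intro!: fam_eq_on_av[OF assms(1)] fam_hcomp[of _ "amod \<beta>"] fam_hAB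
      simp: hcomp_vec[OF fam_hAB(1)[OF assms(1,2)] fam_hAB(1)[OF assms(2,3)]]
        hcomp_vec[OF fam_hAB(1)[OF assms(1,2)] fam_hAB(2)[OF assms(2,3)]]
        hcomp_vec[OF fam_hAB(2)[OF assms(1,2)] fam_hAB(1)[OF assms(2,3)]] hA_av hB_av)

text \<open>Compatibility with \<open>x\<close> forces the coefficient of \<open>f \<mapsto> f'\<close> to be that of \<open>e \<mapsto> e'\<close>.\<close>
lemma hom_arcs:
  assumes \<alpha>: "is_arc \<alpha>" and \<gamma>: "is_arc \<gamma>" and g: "is_hom (amod \<alpha>) (amod \<gamma>) g"
  shows "\<exists>p q. g = hadd (hsm p (hA \<alpha> \<gamma>)) (hsm q (hB \<alpha> \<gamma>)) \<and> (p \<noteq> 0 \<longrightarrow> validA \<alpha> \<gamma>) \<and> (q \<noteq> 0 \<longrightarrow> validB \<alpha> \<gamma>)"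
proof -
  obtain b where b: "snd \<alpha> = b" by simp
  note A = wf_amod[OF \<alpha>] and G = wf_amod[OF \<gamma>]
  note gf = is_homD(1)[OF g]
  have gc: "g n *\<^sub>v av \<alpha> n s t \<in> carrier_vec (gdim (amod \<gamma>) n)" for n s t
    by (rule mult_mat_vec_carrier[OF famD[OF gf] av_carrier[OF \<alpha>]])
  obtain p p' where p: "okv \<gamma> b p p'" "g b *\<^sub>v av \<alpha> b 1 0 = av \<gamma> b p p'" using av_ex[OF \<gamma> gc] by blast
  have okb: "okv \<alpha> b 1 0" using okv_gen(1) b by blast
  \<comment> \<open>Since \<open>x\<close> kills \<open>e\<close>, the image of \<open>e\<close> has
    no component along the second generator of the target.\<close>
  have "av \<gamma> (b+1) p' 0 = g (b+1) *\<^sub>v av \<alpha> (b+1) 0 0"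
    using is_hom_x_vec[OF A G g av_carrier[OF \<alpha>], of b 1 0] amod_x[OF \<alpha> okb] amod_x[OF \<gamma> p(1)] p(2) by simp
  also have "\<dots> = 0\<^sub>v (arc_dim \<gamma> (b+1))" using mult_mat_vec_zero[OF famD[OF gf], of "b+1"] by (simp add: amod_sel \<alpha> \<gamma>)
  finally have p'0: "p' = 0" using av_eq_0_iff[OF \<gamma> okv_x[OF \<gamma> p(1)]] by simp
  have gen: "g = gen_hom \<alpha> (amod \<gamma>) (av \<gamma> b p 0) (gen_f \<alpha> g)"
    using yhom_amod_eq[OF \<alpha> G is_homD(4)[OF g]] p p'0 b by simp
  have okp: "okv \<gamma> b p 0" using p p'0 by simp
  have lin: "p \<cdot>\<^sub>v av \<gamma> n s t + q \<cdot>\<^sub>v av \<gamma> n t 0 = hadd (hsm p (hA \<alpha> \<gamma>)) (hsm q (hB \<alpha> \<gamma>)) n *\<^sub>v av \<alpha> n s t"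
    if ok: "okv \<alpha> n s t" for p q n s t
  proof -
    have m: "hA \<alpha> \<gamma> n \<in> carrier_mat (arc_dim \<gamma> n) (arc_dim \<alpha> n)" "hB \<alpha> \<gamma> n \<in> carrier_mat (arc_dim \<gamma> n) (arc_dim \<alpha> n)"
      by (auto simp: hA_def hB_def)
    have v: "av \<alpha> n s t \<in> carrier_vec (arc_dim \<alpha> n)" by (simp add: carrier_vecI)
    have "(k \<cdot>\<^sub>m F) *\<^sub>v av \<alpha> n s t = k \<cdot>\<^sub>v (F *\<^sub>v av \<alpha> n s t)" if "F \<in> carrier_mat (arc_dim \<gamma> n) (arc_dim \<alpha> n)" for k F
      using that v by (intro eq_vecI) auto
    then show ?thesis unfolding hadd_def hsm_def
      using hA_av[OF \<alpha> ok, of \<gamma>] hB_av[OF \<alpha> ok, of \<gamma>] m v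
      by (subst add_mult_distrib_mat_vec[of _ "arc_dim \<gamma> n" "arc_dim \<alpha> n"]) auto
  qed
  show ?thesis
  proof (cases "fst \<alpha>")
    case NegInf
    have "g = hadd (hsm p (hA \<alpha> \<gamma>)) (hsm 0 (hB \<alpha> \<gamma>))"
    proof (rule fam_eq_on_av[OF \<alpha> gf fam_hadd[OF fam_hsm[OF fam_hAB(1)[OF \<alpha> \<gamma>]] fam_hsm[OF fam_hAB(2)[OF \<alpha> \<gamma>]]]])
      fix n s t assume ok: "okv \<alpha> n s t"
      have t: "t = 0" using ok NegInf by (simp add: okv_def)
      have sn: "s = 0 \<or> n \<le> b" using ok b by (simp add: okv_def)
      have "g n *\<^sub>v av \<alpha> n s t = s \<cdot>\<^sub>v low (amod \<gamma>) (Fin b) n (av \<gamma> b p 0) + t \<cdot>\<^sub>v low (amod \<gamma>) (fst \<alpha>) n (gen_f \<alpha> g)"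
        using gen_hom_av[OF \<alpha> G ok, of "av \<gamma> b p 0" "gen_f \<alpha> g"] b gen by simp
      also have "\<dots> = av \<gamma> n (s * p) 0"
        using sn amod_yto[OF \<gamma> okp, of n] t NegInf G \<gamma> low_carrier[OF G, of "Fin b" n "av \<gamma> b p 0"]
        by (auto simp: low_def av_smult av_add amod_sel intro!: eq_vecI)
      also have "\<dots> = p \<cdot>\<^sub>v av \<gamma> n s t + 0 \<cdot>\<^sub>v av \<gamma> n t 0"
        by (rule eq_vecI) (auto simp: t av_def mult.commute)
      also have "\<dots> = hadd (hsm p (hA \<alpha> \<gamma>)) (hsm 0 (hB \<alpha> \<gamma>)) n *\<^sub>v av \<alpha> n s t" by (rule lin[OF ok])
      finally show "g n *\<^sub>v av \<alpha> n s t = hadd (hsm p (hA \<alpha> \<gamma>)) (hsm 0 (hB \<alpha> \<gamma>)) n *\<^sub>v av \<alpha> n s t" .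
    qed
    moreover have "p \<noteq> 0 \<longrightarrow> validA \<alpha> \<gamma>" using okp NegInf b by (auto simp: okv_def validA_def)
    ultimately show ?thesis by blast
  next
    case (Fin a)
    have ab: "a + 1 \<le> b" using \<alpha> Fin b by (simp add: is_arc_def)
    have oka: "okv \<alpha> a 0 1" using okv_gen(2)[OF Fin] .
    obtain q p2 where q: "okv \<gamma> a q p2" "g a *\<^sub>v av \<alpha> a 0 1 = av \<gamma> a q p2" using av_ex[OF \<gamma> gc] by blast
    have "av \<gamma> (a+1) p2 0 = g (a+1) *\<^sub>v av \<alpha> (a+1) 1 0"
      using is_hom_x_vec[OF A G g av_carrier[OF \<alpha>], of a 0 1] amod_x[OF \<alpha> oka] amod_x[OF \<gamma> q(1)] q(2) by simp
    also have "\<dots> = av \<gamma> (a+1) p 0"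
    proof -
      have ok1: "okv \<alpha> (a+1) 1 0" using okv_dec[OF okb ab] .
      have "gen_hom \<alpha> (amod \<gamma>) (av \<gamma> b p 0) (gen_f \<alpha> g) (a+1) *\<^sub>v av \<alpha> (a+1) 1 0 = av \<gamma> (a+1) p 0"
        using gen_hom_av[OF \<alpha> G ok1, of "av \<gamma> b p 0" "gen_f \<alpha> g"] ab b amod_yto[OF \<gamma> okp, of "a+1"] Fin \<gamma>
        by (auto simp: low_def amod_sel intro!: eq_vecI)
      then show ?thesis using gen by simp
    qed
    finally have "p2 = p" using av_inj[OF \<gamma> okv_x[OF \<gamma> q(1)] okv_dec[OF okp ab]] by simp
    then have q: "okv \<gamma> a q p" "g a *\<^sub>v av \<alpha> a 0 1 = av \<gamma> a q p" using q by auto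
    then have gf': "gen_f \<alpha> g = av \<gamma> a q p" by (simp add: gen_f_def Fin)
    have "g = hadd (hsm p (hA \<alpha> \<gamma>)) (hsm q (hB \<alpha> \<gamma>))"
    proof (rule fam_eq_on_av[OF \<alpha> gf fam_hadd[OF fam_hsm[OF fam_hAB(1)[OF \<alpha> \<gamma>]] fam_hsm[OF fam_hAB(2)[OF \<alpha> \<gamma>]]]])
      fix n s t assume ok: "okv \<alpha> n s t"
      have tn: "t = 0 \<or> n \<le> a" using ok Fin by (simp add: okv_def)
      have sn: "s = 0 \<or> n \<le> b" using ok b by (simp add: okv_def)
      have "g n *\<^sub>v av \<alpha> n s t = s \<cdot>\<^sub>v low (amod \<gamma>) (Fin b) n (av \<gamma> b p 0) + t \<cdot>\<^sub>v low (amod \<gamma>) (Fin a) n (av \<gamma> a q p)"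
        using gen_hom_av[OF \<alpha> G ok, of "av \<gamma> b p 0" "gen_f \<alpha> g"] b gen gf' Fin by simp
      also have "s \<cdot>\<^sub>v low (amod \<gamma>) (Fin b) n (av \<gamma> b p 0) = av \<gamma> n (s * p) 0"
        using sn amod_yto[OF \<gamma> okp, of n] \<gamma> low_carrier[OF G, of "Fin b" n "av \<gamma> b p 0"]
        by (auto simp: low_def av_smult amod_sel intro!: eq_vecI)
      also have "t \<cdot>\<^sub>v low (amod \<gamma>) (Fin a) n (av \<gamma> a q p) = av \<gamma> n (t * q) (t * p)"
        using tn amod_yto[OF \<gamma> q(1), of n] \<gamma> low_carrier[OF G, of "Fin a" n "av \<gamma> a q p"]
        by (auto simp: low_def av_smult amod_sel intro!: eq_vecI)
      also have "av \<gamma> n (s * p) 0 + av \<gamma> n (t * q) (t * p) = p \<cdot>\<^sub>v av \<gamma> n s t + q \<cdot>\<^sub>v av \<gamma> n t 0"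
        by (simp add: av_add av_smult mult.commute)
      also have "\<dots> = hadd (hsm p (hA \<alpha> \<gamma>)) (hsm q (hB \<alpha> \<gamma>)) n *\<^sub>v av \<alpha> n s t"
        by (rule lin[OF ok])
      finally show "g n *\<^sub>v av \<alpha> n s t = hadd (hsm p (hA \<alpha> \<gamma>)) (hsm q (hB \<alpha> \<gamma>)) n *\<^sub>v av \<alpha> n s t" .
    qed
    moreover have "p \<noteq> 0 \<longrightarrow> validA \<alpha> \<gamma>" "q \<noteq> 0 \<longrightarrow> validB \<alpha> \<gamma>"
      using okp q(1) Fin b by (auto simp: okv_def validA_def validB_def)
    ultimately show ?thesis by blast
  qed
qed

text \<open>The shift of \<open>B\<close> with the sign of \<open>x\<close> changed: homomorphisms \<open>A \<rightarrow> tw B\<close> are the cocycles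
  describing the extensions of \<open>A\<close> by \<open>B\<close> that split over \<open>\<complex>[y]\<close>, and \<open>dd A B s\<close> is the coboundary of \<open>s\<close>.\<close>
definition tw :: "gmod \<Rightarrow> gmod" where
  "tw B = \<lparr> gdim = (\<lambda>n. gdim B (n+1)), xact = (\<lambda>n. (-1) \<cdot>\<^sub>m xact B (n+1)), yact = (\<lambda>n. yact B (n+1)) \<rparr>"

definition dd :: "gmod \<Rightarrow> gmod \<Rightarrow> (int \<Rightarrow> complex mat) \<Rightarrow> int \<Rightarrow> complex mat" where
  "dd A B s = (\<lambda>n. xact B n * s n + (-1) \<cdot>\<^sub>m (s (n+1) * xact A n))"

definition tw_map :: "(int \<Rightarrow> complex mat) \<Rightarrow> int \<Rightarrow> complex mat" where
  "tw_map g = (\<lambda>n. g (n+1))"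

text \<open>The condition \<open>Ext\<^sup>1 = 0\<close> in the cocycle model, where no middle term
  is quantified over.\<close>

definition vanish :: "gmod \<Rightarrow> gmod \<Rightarrow> bool" where
  "vanish A B \<longleftrightarrow> (\<forall>\<delta>. is_hom A (tw B) \<delta> \<longrightarrow> (\<exists>s. yhom A B s \<and> \<delta> = dd A B s))"

lemma tw_sel [simp]: "gdim (tw B) n = gdim B (n+1)" "xact (tw B) n = (-1) \<cdot>\<^sub>m xact B (n+1)" "yact (tw B) n = yact B (n+1)"
  by (simp_all add: tw_def)

lemma smult_minus_one_twice [simp]: "(-1) \<cdot>\<^sub>m ((-1) \<cdot>\<^sub>m A) = (A :: 'a :: ring_1 mat)"
  by (intro eq_matI) auto

lemma wf_tw:
  assumes B: "wf_gmod B"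
  shows "wf_gmod (tw B)"
  unfolding wf_gmod_def
proof (intro allI conjI)
  note d = wf_gmod_dims[OF B]
  fix n :: int
  have e: "n + 1 - 1 = n - 1 + 1" "n + 2 + 1 = n + 1 + 2" by simp_all
  show "xact (tw B) n \<in> carrier_mat (gdim (tw B) (n + 1)) (gdim (tw B) n)"
    using wf_gmodD(1)[OF B, of "n+1"] by simp
  show "yact (tw B) n \<in> carrier_mat (gdim (tw B) (n - 1)) (gdim (tw B) n)"
    using wf_gmodD(2)[OF B, of "n+1"] by simp
  show "xact (tw B) (n + 1) * xact (tw B) n = 0\<^sub>m (gdim (tw B) (n + 2)) (gdim (tw B) n)"
    unfolding tw_sel e using wf_gmodD(3)[OF B, of "n+1"] by (simp add: mat_smult_left mat_smult_right d)
  show "xact (tw B) (n - 1) * yact (tw B) n = yact (tw B) (n + 1) * xact (tw B) n"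
    using wf_gmodD(4)[OF B, of "n+1"] by (simp add: mat_smult_left mat_smult_right d)
qed

lemma tw_map_hom:
  assumes "wf_gmod B" "wf_gmod B'" "is_hom B B' g"
  shows "is_hom (tw B) (tw B') (tw_map g)"
  unfolding is_hom_def
proof (intro allI conjI)
  note d = wf_gmod_dims[OF assms(1)] wf_gmod_dims[OF assms(2)] fam_dims[OF is_homD(1)[OF assms(3)]]
  fix n
  show "tw_map g n \<in> carrier_mat (gdim (tw B') n) (gdim (tw B) n)" using d by (auto simp: tw_map_def)
  show "tw_map g (n + 1) * xact (tw B) n = xact (tw B') n * tw_map g n"
    using is_homD(2)[OF assms(3), of "n+1"] by (simp add: tw_map_def mat_smult_left mat_smult_right d)
  show "tw_map g (n - 1) * yact (tw B) n = yact (tw B') n * tw_map g n"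
    using is_homD(3)[OF assms(3), of "n+1"] by (simp add: tw_map_def)
qed

text \<open>As \<open>x\<close> squares to zero on both sides, composing the coboundary with
  \<open>x\<close> before or after leaves only the term \<open>x s x\<close>, with opposite signs;
  the sign in \<open>tw\<close> compensates for this.\<close>

lemma dd_hom:
  assumes A: "wf_gmod A" and B: "wf_gmod B" and s: "yhom A B s"
  shows "is_hom A (tw B) (dd A B s)"
  unfolding is_hom_def
proof (intro allI conjI)
  note d = wf_gmod_dims[OF A] wf_gmod_dims[OF B] fam_dims[OF yhomD(1)[OF s]]
  note dist = mat_distrib_left mat_distrib_right mat_smult_left mat_smult_right
  fix n
  show "dd A B s n \<in> carrier_mat (gdim (tw B) n) (gdim A n)" using d by (auto simp: dd_def)
  have n2: "n + 1 + 1 = n + 2" by simp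
  have 1: "(s (n+2) * xact A (n+1)) * xact A n = 0\<^sub>m (gdim B (n+2)) (gdim A n)"
  proof -
    have "(s (n+1+1) * xact A (n+1)) * xact A n = s (n+1+1) * (xact A (n+1) * xact A n)"
      by (rule mat_assoc) (simp_all only: d)
    then show ?thesis unfolding wf_gmodD(3)[OF A] n2 by (simp add: mat_unit_dims d)
  qed
  have 2: "xact B (n+1) * (xact B n * s n) = 0\<^sub>m (gdim B (n+2)) (gdim A n)"
  proof -
    have "xact B (n+1) * (xact B n * s n) = (xact B (n+1) * xact B n) * s n"
      by (rule mat_assoc[symmetric]) (simp_all only: d)
    then show ?thesis unfolding wf_gmodD(3)[OF B] by (simp add: mat_unit_dims d)
  qed
  let ?T = "xact B (n+1) * (s (n+1) * xact A n)"
  have Td: "dim_row ?T = gdim B (n+2)" "dim_col ?T = gdim A n" by (simp_all only: d n2 index_mult_mat)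
  have "dd A B s (n+1) * xact A n = (xact B (n+1) * s (n+1) + (-1) \<cdot>\<^sub>m (s (n+2) * xact A (n+1))) * xact A n"
    unfolding dd_def n2 ..
  also have "\<dots> = xact B (n+1) * s (n+1) * xact A n + ((-1) \<cdot>\<^sub>m (s (n+2) * xact A (n+1))) * xact A n"
    by (rule mat_distrib_right) (simp_all only: d index_mult_mat index_smult_mat n2)
  also have "xact B (n+1) * s (n+1) * xact A n = ?T" by (rule mat_assoc) (simp_all only: d)
  also have "((-1) \<cdot>\<^sub>m (s (n+2) * xact A (n+1))) * xact A n = 0\<^sub>m (gdim B (n+2)) (gdim A n)"
    by (subst mat_smult_left) (simp_all add: d 1)
  also have "?T + 0\<^sub>m (gdim B (n+2)) (gdim A n) = ?T" by (rule mat_unit_dims) (rule Td)+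
  finally have l: "dd A B s (n+1) * xact A n = ?T" .
  have "xact (tw B) n * dd A B s n = (-1) \<cdot>\<^sub>m (xact B (n+1) * (xact B n * s n + (-1) \<cdot>\<^sub>m (s (n+1) * xact A n)))"
    unfolding tw_sel dd_def by (rule mat_smult_left) (simp add: d)
  also have "xact B (n+1) * (xact B n * s n + (-1) \<cdot>\<^sub>m (s (n+1) * xact A n)) =
      xact B (n+1) * (xact B n * s n) + xact B (n+1) * ((-1) \<cdot>\<^sub>m (s (n+1) * xact A n))"
    by (rule mat_distrib_left) (simp_all add: d)
  also have "\<dots> = (-1) \<cdot>\<^sub>m ?T"
    unfolding 2 by (subst mat_smult_right) (use Td in \<open>simp_all add: d mat_unit_dims\<close>)
  finally show "dd A B s (n+1) * xact A n = xact (tw B) n * dd A B s n" unfolding l by simp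
  have t1: "xact B (n-1) * s (n-1) * yact A n = yact B (n+1) * (xact B n * s n)"
  proof -
    have "xact B (n-1) * s (n-1) * yact A n = xact B (n-1) * (yact B n * s n)"
      using yhomD(2)[OF s] by (simp add: mat_assoc d)
    also have "\<dots> = (yact B (n+1) * xact B n) * s n"
      unfolding wf_gmodD(4)[OF B, symmetric] by (simp add: mat_assoc d)
    finally show ?thesis by (simp add: mat_assoc d)
  qed
  have t2: "s n * xact A (n-1) * yact A n = yact B (n+1) * (s (n+1) * xact A n)"
  proof -
    have "s n * xact A (n-1) * yact A n = s n * (yact A (n+1) * xact A n)"
      unfolding wf_gmodD(4)[OF A, symmetric] by (simp add: mat_assoc d)
    also have "\<dots> = (s (n+1-1) * yact A (n+1)) * xact A n" by (simp add: mat_assoc d)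
    also have "\<dots> = (yact B (n+1) * s (n+1)) * xact A n" unfolding yhomD(2)[OF s] ..
    finally show ?thesis by (simp add: mat_assoc d)
  qed
  show "dd A B s (n-1) * yact A n = yact (tw B) n * dd A B s n"
    unfolding dd_def tw_sel using t1 t2 by (simp add: dist d)
qed

section \<open>Naturality of coboundaries and additivity of \<open>vanish\<close>\<close>

lemma dd_precomp:
  assumes A: "wf_gmod A" "wf_gmod A'" and B: "wf_gmod B" and s: "fam A B s" and h: "is_hom A' A h"
  shows "hcomp (dd A B s) h = dd A' B (hcomp s h)"
proof
  fix n
  note d = wf_gmod_dims[OF A(1)] wf_gmod_dims[OF A(2)] wf_gmod_dims[OF B] fam_dims[OF s] fam_dims[OF is_homD(1)[OF h]]
  have "(s (n+1) * xact A n) * h n = s (n+1) * (h (n+1) * xact A' n)"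
    unfolding is_homD(2)[OF h] by (simp add: mat_assoc d)
  then show "hcomp (dd A B s) h n = dd A' B (hcomp s h) n"
    unfolding hcomp_def dd_def by (simp add: mat_distrib_right mat_smult_left d mat_assoc)
qed

lemma dd_postcomp:
  assumes A: "wf_gmod A" and B: "wf_gmod B" "wf_gmod B'" and s: "fam A B s" and g: "is_hom B B' g"
  shows "hcomp (tw_map g) (dd A B s) = dd A B' (hcomp g s)"
proof
  fix n
  note d = wf_gmod_dims[OF A(1)] wf_gmod_dims[OF B(1)] wf_gmod_dims[OF B(2)] fam_dims[OF s] fam_dims[OF is_homD(1)[OF g]]
  have "g (n+1) * (xact B n * s n) = xact B' n * (g n * s n)"
    using is_homD(2)[OF g, of n] by (simp add: mat_assoc[symmetric] d)
  then show "hcomp (tw_map g) (dd A B s) n = dd A B' (hcomp g s) n"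
    unfolding hcomp_def dd_def tw_map_def by (simp add: mat_distrib_left mat_smult_right d mat_assoc)
qed

lemma dd_add:
  assumes A: "wf_gmod A" and B: "wf_gmod B" and s: "fam A B s" "fam A B t"
  shows "hadd (dd A B s) (dd A B t) = dd A B (hadd s t)"
proof
  fix n
  note d = wf_gmod_dims[OF A] wf_gmod_dims[OF B] fam_dims[OF s(1)] fam_dims[OF s(2)]
  show "hadd (dd A B s) (dd A B t) n = dd A B (hadd s t) n"
    unfolding hadd_def dd_def
    by (simp add: mat_distrib_left mat_distrib_right d, rule eq_matI) (auto simp: d)
qed

lemma dd_smult:
  assumes A: "wf_gmod A" and B: "wf_gmod B" and s: "fam A B s"
  shows "hsm c (dd A B s) = dd A B (hsm c s)"
proof
  fix n
  note d = wf_gmod_dims[OF A] wf_gmod_dims[OF B] fam_dims[OF s(1)]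
  show "hsm c (dd A B s) n = dd A B (hsm c s) n"
    unfolding hsm_def dd_def
    by (simp add: mat_smult_left mat_smult_right d, rule eq_matI) (auto simp: d algebra_simps)
qed

lemma biprod_witD:
  assumes "biprod_wit M A B i1 i2 p1 p2"
  shows "is_hom A M i1" "is_hom B M i2" "is_hom M A p1" "is_hom M B p2" "hcomp p1 i1 = hid A" "hcomp p2 i2 = hid B"
    "hadd (hcomp i1 p1) (hcomp i2 p2) = hid M"
  using assms by (auto simp: biprod_wit_def)

text \<open>The cocycle is restricted to both summands, bounded there, and the two cochains are
  extended along the projections and added.\<close>

lemma vanish_biprod_left:
  assumes w: "wf_gmod M" "wf_gmod A" "wf_gmod A'" "wf_gmod B" and b: "biprod M A A'"
    and v: "vanish A B" "vanish A' B"
  shows "vanish M B"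
  unfolding vanish_def
proof (intro allI impI)
  fix \<delta> assume \<delta>: "is_hom M (tw B) \<delta>"
  obtain i1 i2 p1 p2 where "biprod_wit M A A' i1 i2 p1 p2" using b biprod_def by blast
  note bw = biprod_witD[OF this]
  note F = is_homD(1)[OF bw(1)] is_homD(1)[OF bw(2)] is_homD(1)[OF bw(3)] is_homD(1)[OF bw(4)] is_homD(1)[OF \<delta>]
  note T = wf_tw[OF w(4)]
  obtain s where s: "yhom A B s" "hcomp \<delta> i1 = dd A B s"
    using v(1) is_hom_hcomp[OF w(2,1) T bw(1) \<delta>] unfolding vanish_def by blast
  obtain t where t: "yhom A' B t" "hcomp \<delta> i2 = dd A' B t"
    using v(2) is_hom_hcomp[OF w(3,1) T bw(2) \<delta>] unfolding vanish_def by blast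
  have "\<delta> = hcomp \<delta> (hadd (hcomp i1 p1) (hcomp i2 p2))" unfolding bw(7) using hcomp_hid_right[OF F(5)] by simp
  also have "\<dots> = hadd (hcomp \<delta> (hcomp i1 p1)) (hcomp \<delta> (hcomp i2 p2))"
    by (rule hcomp_hadd_right[OF fam_hcomp[OF F(3,1)] fam_hcomp[OF F(4,2)] F(5)])
  also have "hcomp \<delta> (hcomp i1 p1) = dd M B (hcomp s p1)"
    unfolding hcomp_assoc[OF F(3,1,5)] s(2) by (rule dd_precomp[OF w(2,1,4) yhomD(1)[OF s(1)] bw(3)])
  also have "hcomp \<delta> (hcomp i2 p2) = dd M B (hcomp t p2)"
    unfolding hcomp_assoc[OF F(4,2,5)] t(2) by (rule dd_precomp[OF w(3,1,4) yhomD(1)[OF t(1)] bw(4)])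
  also have "hadd (dd M B (hcomp s p1)) (dd M B (hcomp t p2)) = dd M B (hadd (hcomp s p1) (hcomp t p2))"
    by (rule dd_add[OF w(1,4) fam_hcomp[OF F(3) yhomD(1)[OF s(1)]] fam_hcomp[OF F(4) yhomD(1)[OF t(1)]]])
  finally have "\<delta> = dd M B (hadd (hcomp s p1) (hcomp t p2))" .
  moreover have "yhom M B (hadd (hcomp s p1) (hcomp t p2))"
    by (rule yhom_hadd[OF w(1,4) yhom_hcomp[OF w(1,2,4) is_homD(4)[OF bw(3)] s(1)] yhom_hcomp[OF w(1,3,4) is_homD(4)[OF bw(4)] t(1)]])
  ultimately show "\<exists>s. yhom M B s \<and> \<delta> = dd M B s" by blast
qed

lemma tw_map_hadd: "tw_map (hadd f g) = hadd (tw_map f) (tw_map g)" by (simp add: tw_map_def hadd_def)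
lemma tw_map_hcomp: "tw_map (hcomp f g) = hcomp (tw_map f) (tw_map g)" by (simp add: tw_map_def hcomp_def)
lemma tw_map_hid: "tw_map (hid M) = hid (tw M)" by (simp add: tw_map_def hid_def)

lemma vanish_biprod_right:
  assumes w: "wf_gmod M" "wf_gmod B" "wf_gmod B'" "wf_gmod A" and b: "biprod M B B'"
    and v: "vanish A B" "vanish A B'"
  shows "vanish A M"
  unfolding vanish_def
proof (intro allI impI)
  fix \<delta> assume \<delta>: "is_hom A (tw M) \<delta>"
  obtain i1 i2 p1 p2 where "biprod_wit M B B' i1 i2 p1 p2" using b biprod_def by blast
  note bw = biprod_witD[OF this]
  note T = wf_tw[OF w(1)] wf_tw[OF w(2)] wf_tw[OF w(3)]
  note tb = tw_map_hom[OF w(2,1) bw(1)] tw_map_hom[OF w(3,1) bw(2)] tw_map_hom[OF w(1,2) bw(3)] tw_map_hom[OF w(1,3) bw(4)]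
  note F = is_homD(1)[OF tb(1)] is_homD(1)[OF tb(2)] is_homD(1)[OF tb(3)] is_homD(1)[OF tb(4)] is_homD(1)[OF \<delta>]
  obtain s where s: "yhom A B s" "hcomp (tw_map p1) \<delta> = dd A B s"
    using v(1) is_hom_hcomp[OF w(4) T(1,2) \<delta> tb(3)] unfolding vanish_def by blast
  obtain t where t: "yhom A B' t" "hcomp (tw_map p2) \<delta> = dd A B' t"
    using v(2) is_hom_hcomp[OF w(4) T(1,3) \<delta> tb(4)] unfolding vanish_def by blast
  have "\<delta> = hcomp (tw_map (hadd (hcomp i1 p1) (hcomp i2 p2))) \<delta>"
    unfolding bw(7) tw_map_hid using hcomp_hid_left[OF F(5)] by simp
  also have "\<dots> = hadd (hcomp (hcomp (tw_map i1) (tw_map p1)) \<delta>) (hcomp (hcomp (tw_map i2) (tw_map p2)) \<delta>)"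
    unfolding tw_map_hadd tw_map_hcomp by (rule hcomp_hadd_left[OF F(5) fam_hcomp[OF F(3,1)] fam_hcomp[OF F(4,2)]])
  also have "hcomp (hcomp (tw_map i1) (tw_map p1)) \<delta> = dd A M (hcomp i1 s)"
    unfolding hcomp_assoc[OF F(5,3,1), symmetric] s(2) by (rule dd_postcomp[OF w(4,2,1) yhomD(1)[OF s(1)] bw(1)])
  also have "hcomp (hcomp (tw_map i2) (tw_map p2)) \<delta> = dd A M (hcomp i2 t)"
    unfolding hcomp_assoc[OF F(5,4,2), symmetric] t(2) by (rule dd_postcomp[OF w(4,3,1) yhomD(1)[OF t(1)] bw(2)])
  also have "hadd (dd A M (hcomp i1 s)) (dd A M (hcomp i2 t)) = dd A M (hadd (hcomp i1 s) (hcomp i2 t))"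
    by (rule dd_add[OF w(4,1) fam_hcomp[OF yhomD(1)[OF s(1)] is_homD(1)[OF bw(1)]] fam_hcomp[OF yhomD(1)[OF t(1)] is_homD(1)[OF bw(2)]]])
  finally have "\<delta> = dd A M (hadd (hcomp i1 s) (hcomp i2 t))" .
  moreover have "yhom A M (hadd (hcomp i1 s) (hcomp i2 t))"
    by (rule yhom_hadd[OF w(4,1) yhom_hcomp[OF w(4,2,1) s(1) is_homD(4)[OF bw(1)]] yhom_hcomp[OF w(4,3,1) t(1) is_homD(4)[OF bw(2)]]])
  ultimately show "\<exists>s. yhom A M s \<and> \<delta> = dd A M s" by blast
qed

text \<open>A cocycle on the summand is pulled back along the projection to \<open>M\<close>; a
  cochain bounding it there restricts back along the inclusion.\<close>

lemma vanish_summand_left: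
  assumes w: "wf_gmod M" "wf_gmod A" "wf_gmod A'" "wf_gmod B" and b: "biprod M A A'" and v: "vanish M B"
  shows "vanish A B"
  unfolding vanish_def
proof (intro allI impI)
  fix \<delta> assume \<delta>: "is_hom A (tw B) \<delta>"
  obtain i1 i2 p1 p2 where "biprod_wit M A A' i1 i2 p1 p2" using b biprod_def by blast
  note bw = biprod_witD[OF this]
  note F = is_homD(1)[OF bw(1)] is_homD(1)[OF bw(3)] is_homD(1)[OF \<delta>]
  obtain s where s: "yhom M B s" "hcomp \<delta> p1 = dd M B s"
    using v is_hom_hcomp[OF w(1,2) wf_tw[OF w(4)] bw(3) \<delta>] unfolding vanish_def by blast
  have "\<delta> = hcomp \<delta> (hcomp p1 i1)" unfolding bw(5) using hcomp_hid_right[OF F(3)] by simp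
  also have "\<dots> = dd A B (hcomp s i1)"
    unfolding hcomp_assoc[OF F(1,2,3)] s(2) by (rule dd_precomp[OF w(1,2,4) yhomD(1)[OF s(1)] bw(1)])
  finally show "\<exists>s. yhom A B s \<and> \<delta> = dd A B s"
    using yhom_hcomp[OF w(2,1,4) is_homD(4)[OF bw(1)] s(1)] by blast
qed

lemma vanish_summand_right:
  assumes w: "wf_gmod M" "wf_gmod B" "wf_gmod B'" "wf_gmod A" and b: "biprod M B B'" and v: "vanish A M"
  shows "vanish A B"
  unfolding vanish_def
proof (intro allI impI)
  fix \<delta> assume \<delta>: "is_hom A (tw B) \<delta>"
  obtain i1 i2 p1 p2 where "biprod_wit M B B' i1 i2 p1 p2" using b biprod_def by blast
  note bw = biprod_witD[OF this]
  note tb = tw_map_hom[OF w(2,1) bw(1)] tw_map_hom[OF w(1,2) bw(3)]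
  note F = is_homD(1)[OF tb(1)] is_homD(1)[OF tb(2)] is_homD(1)[OF \<delta>]
  obtain s where s: "yhom A M s" "hcomp (tw_map i1) \<delta> = dd A M s"
    using v is_hom_hcomp[OF w(4) wf_tw[OF w(2)] wf_tw[OF w(1)] \<delta> tb(1)] unfolding vanish_def by blast
  have "\<delta> = hcomp (hcomp (tw_map p1) (tw_map i1)) \<delta>"
    unfolding tw_map_hcomp[symmetric] bw(5) tw_map_hid using hcomp_hid_left[OF F(3)] by simp
  also have "\<dots> = dd A B (hcomp p1 s)"
    unfolding hcomp_assoc[OF F(3,1,2), symmetric] s(2) by (rule dd_postcomp[OF w(4,1,2) yhomD(1)[OF s(1)] bw(3)])
  finally show "\<exists>s. yhom A B s \<and> \<delta> = dd A B s"
    using yhom_hcomp[OF w(4,1,2) s(1) is_homD(4)[OF bw(3)]] by blast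
qed

lemma fam_zero_dim:
  assumes "\<And>n. gdim M n = 0 \<or> gdim N n = 0" "fam M N f" "fam M N g"
  shows "f = g"
proof
  fix n show "f n = g n" using assms(1)[of n] famD[OF assms(2), of n] famD[OF assms(3), of n] by (intro eq_matI) auto
qed

lemma vanish_zero:
  assumes "wf_gmod A" "wf_gmod B" "(\<forall>n. gdim A n = 0) \<or> (\<forall>n. gdim B n = 0)"
  shows "vanish A B"
  unfolding vanish_def
proof (intro allI impI)
  fix \<delta> assume \<delta>: "is_hom A (tw B) \<delta>"
  have y: "yhom A B (hzero A B)" using is_homD(4)[OF is_hom_hzero[OF assms(1,2)]] .
  have "\<delta> = dd A B (hzero A B)"
    by (rule fam_zero_dim[OF _ is_homD(1)[OF \<delta>] is_homD(1)[OF dd_hom[OF assms(1,2) y]]]) (use assms(3) in auto)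
  then show "\<exists>s. yhom A B s \<and> \<delta> = dd A B s" using y by blast
qed

section \<open>Extensions and cocycles\<close>

lemma yproj_biprod:
  assumes w: "wf_gmod M" "wf_gmod A" "wf_gmod B" "wf_gmod E" "wf_gmod N" and b: "biprod M A B"
    and p: "yhom E N p" and g: "yhom M N g"
    and h: "\<And>g. yhom A N g \<Longrightarrow> \<exists>h. yhom A E h \<and> hcomp p h = g" "\<And>g. yhom B N g \<Longrightarrow> \<exists>h. yhom B E h \<and> hcomp p h = g"
  shows "\<exists>h. yhom M E h \<and> hcomp p h = g"
proof -
  obtain i1 i2 p1 p2 where "biprod_wit M A B i1 i2 p1 p2" using b biprod_def by blast
  note bw = biprod_witD[OF this]
  note Y = is_homD(4)[OF bw(1)] is_homD(4)[OF bw(2)] is_homD(4)[OF bw(3)] is_homD(4)[OF bw(4)]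
  note F = is_homD(1)[OF bw(1)] is_homD(1)[OF bw(2)] is_homD(1)[OF bw(3)] is_homD(1)[OF bw(4)] yhomD(1)[OF p] yhomD(1)[OF g]
  obtain h1 where h1: "yhom A E h1" "hcomp p h1 = hcomp g i1" using h(1)[OF yhom_hcomp[OF w(2,1,5) Y(1) g]] by blast
  obtain h2 where h2: "yhom B E h2" "hcomp p h2 = hcomp g i2" using h(2)[OF yhom_hcomp[OF w(3,1,5) Y(2) g]] by blast
  note H = yhomD(1)[OF h1(1)] yhomD(1)[OF h2(1)]
  have "hcomp p (hadd (hcomp h1 p1) (hcomp h2 p2)) = hadd (hcomp p (hcomp h1 p1)) (hcomp p (hcomp h2 p2))"
    by (rule hcomp_hadd_right[OF fam_hcomp[OF F(3) H(1)] fam_hcomp[OF F(4) H(2)] F(5)])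
  also have "\<dots> = hadd (hcomp (hcomp g i1) p1) (hcomp (hcomp g i2) p2)"
    unfolding hcomp_assoc[OF F(3) H(1) F(5)] hcomp_assoc[OF F(4) H(2) F(5)] h1(2) h2(2) ..
  also have "\<dots> = hcomp g (hadd (hcomp i1 p1) (hcomp i2 p2))"
    unfolding hcomp_assoc[OF F(3,1,6), symmetric] hcomp_assoc[OF F(4,2,6), symmetric]
    by (rule hcomp_hadd_right[OF fam_hcomp[OF F(3,1)] fam_hcomp[OF F(4,2)] F(6), symmetric])
  also have "\<dots> = g" unfolding bw(7) by (rule hcomp_hid_right[OF F(6)])
  finally show ?thesis
    using yhom_hadd[OF w(1,4) yhom_hcomp[OF w(1,2,4) Y(3) h1(1)] yhom_hcomp[OF w(1,3,4) Y(4) h2(1)]] by blast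
qed

text \<open>Freeness over C[y] makes the lifting a choice of preimages of the generators.\<close>

lemma yproj_amod:
  assumes \<alpha>: "is_arc \<alpha>" and w: "wf_gmod E" "wf_gmod N" and p: "yhom E N p" and g: "yhom (amod \<alpha>) N g"
    and surj: "\<And>n w. w \<in> carrier_vec (gdim N n) \<Longrightarrow> \<exists>u \<in> carrier_vec (gdim E n). p n *\<^sub>v u = w"
  shows "\<exists>h. yhom (amod \<alpha>) E h \<and> hcomp p h = g"
proof -
  note A = wf_amod[OF \<alpha>]
  have gc: "g n *\<^sub>v av \<alpha> n s t \<in> carrier_vec (gdim N n)" for n s t
    by (rule mult_mat_vec_carrier[OF famD[OF yhomD(1)[OF g]] av_carrier[OF \<alpha>]])
  obtain e where e: "e \<in> carrier_vec (gdim E (snd \<alpha>))" "p (snd \<alpha>) *\<^sub>v e = g (snd \<alpha>) *\<^sub>v av \<alpha> (snd \<alpha>) 1 0"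
    using surj[OF gc] by blast
  have "\<exists>f. gen_carrier E (fst \<alpha>) f \<and> (\<forall>a. fst \<alpha> = Fin a \<longrightarrow> p a *\<^sub>v f = g a *\<^sub>v av \<alpha> a 0 1)"
  proof (cases "fst \<alpha>")
    case (Fin a)
    then show ?thesis using surj[OF gc, of a 0 1] by (auto simp: gen_carrier_def)
  qed (simp add: gen_carrier_def)
  then obtain f where f: "gen_carrier E (fst \<alpha>) f" "\<And>a. fst \<alpha> = Fin a \<Longrightarrow> p a *\<^sub>v f = g a *\<^sub>v av \<alpha> a 0 1" by blast
  let ?h = "gen_hom \<alpha> E e f"
  have h: "yhom (amod \<alpha>) E ?h" by (rule yhom_gen_hom[OF \<alpha> w(1) e(1) f(1)])
  have "hcomp p ?h = g"
  proof (rule yhom_amod_ext[OF \<alpha> w(2) yhom_hcomp[OF A w h p] g])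
    show "hcomp p ?h (snd \<alpha>) *\<^sub>v av \<alpha> (snd \<alpha>) 1 0 = g (snd \<alpha>) *\<^sub>v av \<alpha> (snd \<alpha>) 1 0"
      unfolding hcomp_vec[OF yhomD(1)[OF h] yhomD(1)[OF p] av_carrier[OF \<alpha>]] gen_hom_gen(1)[OF \<alpha> w(1) e(1)] by (rule e(2))
    fix a assume a: "fst \<alpha> = Fin a"
    then have "f \<in> carrier_vec (gdim E a)" using f(1) by (simp add: gen_carrier_def)
    then show "hcomp p ?h a *\<^sub>v av \<alpha> a 0 1 = g a *\<^sub>v av \<alpha> a 0 1"
      unfolding hcomp_vec[OF yhomD(1)[OF h] yhomD(1)[OF p] av_carrier[OF \<alpha>]]
      using gen_hom_gen(2)[OF \<alpha> w(1) a] f(2)[OF a] by simp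
  qed
  with h show ?thesis by blast
qed

text \<open>Objects of \<open>C2\<close> are projective over C[y]. This is inherited from the arc
  modules along the decomposition, and it is what splits every extension over C[y].\<close>

lemma C2_yproj:
  assumes "A \<in> C2" and w: "wf_gmod E" "wf_gmod N" and p: "yhom E N p"
    and surj: "\<And>n w. w \<in> carrier_vec (gdim N n) \<Longrightarrow> \<exists>u \<in> carrier_vec (gdim E n). p n *\<^sub>v u = w"
    and g: "yhom A N g"
  shows "\<exists>h. yhom A E h \<and> hcomp p h = g"
  using assms(1) g
proof (induction A arbitrary: g rule: C2_induct)
  case (zero M)
  have h: "yhom M E (hzero M E)" by (rule is_homD(4)[OF is_hom_hzero[OF C2_wf[OF zero(1)] w(1)]])
  have "hcomp p (hzero M E) = g"
    by (rule fam_zero_dim[OF _ fam_hcomp[OF yhomD(1)[OF h] yhomD(1)[OF p]] yhomD(1)[OF zero(3)]]) (use zero in auto)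
  with h show ?case by blast
next
  case (biprod M \<alpha> N')
  show ?case
    by (rule yproj_biprod[OF C2_wf[OF biprod(1)] wf_amod[OF biprod(2)] C2_wf[OF biprod(3)] w biprod(4) p biprod(6)
        yproj_amod[OF biprod(2) w p _ surj] biprod(5)])
qed

lemma mat_factor_through:
  fixes I H :: "'a :: semiring_1 mat"
  assumes I: "I \<in> carrier_mat m k" and H: "H \<in> carrier_mat m l"
    and im: "\<And>v. v \<in> carrier_vec l \<Longrightarrow> \<exists>u \<in> carrier_vec k. H *\<^sub>v v = I *\<^sub>v u"
  shows "\<exists>D \<in> carrier_mat k l. H = I * D"
proof -
  obtain f where f: "\<And>j. f j \<in> carrier_vec k \<and> H *\<^sub>v unit_vec l j = I *\<^sub>v f j"
    using im[OF unit_vec_carrier] by metis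
  define D where "D = mat_of_cols k (map f [0..<l])"
  have D: "D \<in> carrier_mat k l" unfolding D_def by auto
  have "H = I * D"
  proof (rule eq_matI)
    fix i j assume "i < dim_row (I * D)" "j < dim_col (I * D)"
    then have ij: "i < m" "j < l" using I D by auto
    have "(I * D) $$ (i,j) = row I i \<bullet> col D j" using ij I D by auto
    also have "col D j = f j" unfolding D_def using ij f by (subst col_mat_of_cols) auto
    also have "row I i \<bullet> f j = (I *\<^sub>v f j) $ i" using ij I by auto
    also have "\<dots> = (H *\<^sub>v unit_vec l j) $ i" using f by simp
    also have "\<dots> = H $$ (i,j)" using ij H by simp
    finally show "H $$ (i,j) = (I * D) $$ (i,j)" by simp
  qed (use I D H in auto)
  with D show ?thesis by blast
qed

lemma inj_mat_cancel:
  fixes I P Q :: "complex mat"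
  assumes I: "I \<in> carrier_mat m k" and inj: "\<And>v. v \<in> carrier_vec k \<Longrightarrow> I *\<^sub>v v = 0\<^sub>v m \<Longrightarrow> v = 0\<^sub>v k"
    and PQ: "P \<in> carrier_mat k l" "Q \<in> carrier_mat k l" "I * P = I * Q"
  shows "P = Q"
proof -
  have "I * (P - Q) = 0\<^sub>m m l"
    unfolding mult_minus_distrib_mat[OF I PQ(1,2)] PQ(3) using I PQ by (intro eq_matI) auto
  have "P - Q = 0\<^sub>m k l"
  proof (rule mat_eq_on_vecsI)
    fix v :: "complex vec" assume v: "v \<in> carrier_vec l"
    have PQc: "P - Q \<in> carrier_mat k l" using PQ by auto
    have "I *\<^sub>v ((P - Q) *\<^sub>v v) = (I * (P - Q)) *\<^sub>v v"
      using I PQc v by (intro mat_vec_assoc[symmetric]) auto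
    also have "\<dots> = 0\<^sub>v m" unfolding \<open>I * (P - Q) = 0\<^sub>m m l\<close> by (rule zero_mat_mult_vec[OF v])
    finally have "(P - Q) *\<^sub>v v = 0\<^sub>v k" using inj mult_mat_vec_carrier[OF PQc v] by blast
    then show "(P - Q) *\<^sub>v v = 0\<^sub>m k l *\<^sub>v v" using zero_mat_mult_vec[OF v] by simp
  qed (use PQ in auto)
  show ?thesis
  proof (rule eq_matI)
    fix i j assume "i < dim_row Q" "j < dim_col Q"
    then show "P $$ (i,j) = Q $$ (i,j)"
      using arg_cong[OF \<open>P - Q = 0\<^sub>m k l\<close>, of "\<lambda>A. A $$ (i,j)"] PQ by simp
  qed (use PQ in auto)
qed

text \<open>Choose a \<open>\<complex>[y]\<close>-linear section \<open>\<sigma>\<close>; its failure to commute with \<open>x\<close> is a cocycle \<open>\<delta>\<close>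
  with values in the kernel, and a cochain with coboundary \<open>\<delta>\<close> corrects \<open>\<sigma>\<close>.\<close>
lemma vanish_imp_ext1_zero:
  assumes A: "A \<in> C2" and B: "wf_gmod B" and v: "vanish A B"
  shows "ext1_zero A B"
  unfolding ext1_zero_def
proof (intro allI impI)
  fix E i p assume "E \<in> C2 \<and> ses B E A i p"
  then have E: "E \<in> C2" and s: "ses B E A i p" by auto
  note w = C2_wf[OF A] C2_wf[OF E]
  have i: "is_hom B E i" and p: "is_hom E A p"
    and inj: "\<And>n v. v \<in> carrier_vec (gdim B n) \<Longrightarrow> i n *\<^sub>v v = 0\<^sub>v (gdim E n) \<Longrightarrow> v = 0\<^sub>v (gdim B n)"
    and surj: "\<And>n w. w \<in> carrier_vec (gdim A n) \<Longrightarrow> \<exists>u \<in> carrier_vec (gdim E n). p n *\<^sub>v u = w"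
    and ex: "\<And>n u. u \<in> carrier_vec (gdim E n) \<Longrightarrow> p n *\<^sub>v u = 0\<^sub>v (gdim A n) \<longleftrightarrow> (\<exists>v \<in> carrier_vec (gdim B n). u = i n *\<^sub>v v)"
    using s unfolding ses_def by blast+
  note F = is_homD(1)[OF i] is_homD(1)[OF p]
  obtain \<sigma> where \<sigma>: "yhom A E \<sigma>" "hcomp p \<sigma> = hid A"
    using C2_yproj[OF A w(2,1) is_homD(4)[OF p] surj is_homD(4)[OF is_hom_hid[OF w(1)]]] by blast
  let ?\<eta> = "dd A E \<sigma>"
  have \<eta>: "is_hom A (tw E) ?\<eta>" by (rule dd_hom[OF w \<sigma>(1)])
  have "hcomp (tw_map p) ?\<eta> = dd A A (hid A)"
    unfolding \<sigma>(2)[symmetric] by (rule dd_postcomp[OF w(1,2,1) yhomD(1)[OF \<sigma>(1)] p])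
  also have "dd A A (hid A) = hzero A (tw A)"
  proof
    fix n
    show "dd A A (hid A) n = hzero A (tw A) n"
      by (rule eq_matI) (auto simp: dd_def hid_def hzero_def mat_unit_dims wf_gmod_dims[OF w(1)])
  qed
  finally have p\<eta>: "hcomp (tw_map p) ?\<eta> = hzero A (tw A)" .
  have tp: "is_hom (tw E) (tw A) (tw_map p)" by (rule tw_map_hom[OF w(2,1) p])
  \<comment> \<open>The identity of \<open>A\<close> commutes with \<open>x\<close>, so
    \<open>p\<close> kills the coboundary of \<open>\<sigma>\<close>. By exactness that coboundary
    factors through \<open>i\<close>, and injectivity of \<open>i\<close> then makes the factor
    \<open>D\<close> a cocycle.\<close>
  have "\<exists>D. \<forall>n. D n \<in> carrier_mat (gdim B (n+1)) (gdim A n) \<and> ?\<eta> n = i (n+1) * D n"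
  proof (rule choice, rule allI)
    fix n
    have ec: "?\<eta> n \<in> carrier_mat (gdim E (n+1)) (gdim A n)" using famD[OF is_homD(1)[OF \<eta>], of n] by simp
    have "\<exists>D \<in> carrier_mat (gdim B (n+1)) (gdim A n). ?\<eta> n = i (n+1) * D"
    proof (rule mat_factor_through[OF famD[OF F(1)] ec])
      fix v :: "complex vec" assume v: "v \<in> carrier_vec (gdim A n)"
      have "p (n+1) *\<^sub>v (?\<eta> n *\<^sub>v v) = hcomp (tw_map p) ?\<eta> n *\<^sub>v v"
        using hcomp_vec[OF is_homD(1)[OF \<eta>] is_homD(1)[OF tp] v] by (simp add: tw_map_def)
      also have "\<dots> = 0\<^sub>v (gdim A (n+1))" unfolding p\<eta> using zero_mat_mult_vec[OF v] by (simp add: hzero_def)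
      finally show "\<exists>u \<in> carrier_vec (gdim B (n+1)). ?\<eta> n *\<^sub>v v = i (n+1) *\<^sub>v u"
        using ex[OF mult_mat_vec_carrier[OF ec v]] by blast
    qed
    then show "\<exists>D. D \<in> carrier_mat (gdim B (n+1)) (gdim A n) \<and> ?\<eta> n = i (n+1) * D" by blast
  qed
  then obtain D where D: "\<And>n. D n \<in> carrier_mat (gdim B (n+1)) (gdim A n)" "\<And>n. ?\<eta> n = i (n+1) * D n" by blast
  have eD: "?\<eta> = hcomp (tw_map i) D" unfolding hcomp_def tw_map_def using D(2) by auto
  have ti: "is_hom (tw B) (tw E) (tw_map i)" by (rule tw_map_hom[OF B w(2) i])
  note T = wf_tw[OF B] wf_tw[OF w(2)]
  have FD: "fam A (tw B) D" using D(1) by (simp add: fam_def)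
  note d = wf_gmod_dims[OF w(1)] wf_gmod_dims[OF w(2)] wf_gmod_dims[OF T(1)] wf_gmod_dims[OF T(2)]
     fam_dims[OF FD] fam_dims[OF is_homD(1)[OF ti]]
  have tinj: "P = Q" if "tw_map i n * P = tw_map i n * Q" "P \<in> carrier_mat (gdim (tw B) n) l" "Q \<in> carrier_mat (gdim (tw B) n) l" for P Q n l
    by (rule inj_mat_cancel[OF famD[OF is_homD(1)[OF ti]] _ that(2,3,1)]) (use inj in \<open>simp add: tw_map_def\<close>)
  have "is_hom A (tw B) D"
    unfolding is_hom_def
  proof (intro allI conjI)
    fix n
    show "D n \<in> carrier_mat (gdim (tw B) n) (gdim A n)" by (rule famD[OF FD])
    have "tw_map i (n+1) * (D (n+1) * xact A n) = ?\<eta> (n+1) * xact A n"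
      unfolding eD hcomp_def by (rule mat_assoc[symmetric]) (simp_all only: d)
    also have "\<dots> = xact (tw E) n * (tw_map i n * D n)"
      unfolding is_homD(2)[OF \<eta>] unfolding eD hcomp_def ..
    also have "\<dots> = (xact (tw E) n * tw_map i n) * D n" by (rule mat_assoc[symmetric]) (simp_all only: d)
    also have "\<dots> = tw_map i (n+1) * (xact (tw B) n * D n)"
      unfolding is_homD(2)[OF ti, symmetric] by (rule mat_assoc) (simp_all only: d)
    finally show "D (n+1) * xact A n = xact (tw B) n * D n"
      by (rule tinj[where l = "gdim A n"]) (auto intro!: carrier_matI simp only: d index_mult_mat)
    have "tw_map i (n-1) * (D (n-1) * yact A n) = ?\<eta> (n-1) * yact A n"
      unfolding eD hcomp_def by (rule mat_assoc[symmetric]) (simp_all only: d)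
    also have "\<dots> = yact (tw E) n * (tw_map i n * D n)"
      unfolding is_homD(3)[OF \<eta>] unfolding eD hcomp_def ..
    also have "\<dots> = (yact (tw E) n * tw_map i n) * D n" by (rule mat_assoc[symmetric]) (simp_all only: d)
    also have "\<dots> = tw_map i (n-1) * (yact (tw B) n * D n)"
      unfolding is_homD(3)[OF ti, symmetric] by (rule mat_assoc) (simp_all only: d)
    finally show "D (n-1) * yact A n = yact (tw B) n * D n"
      by (rule tinj[where l = "gdim A n"]) (auto intro!: carrier_matI simp only: d index_mult_mat)
  qed
  then obtain t where t: "yhom A B t" "D = dd A B t" using v unfolding vanish_def by blast
  note Ft = yhomD(1)[OF t(1)] yhomD(1)[OF \<sigma>(1)]
  have it: "yhom A E (hcomp i t)" by (rule yhom_hcomp[OF w(1) B w(2) t(1) is_homD(4)[OF i]])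
  \<comment> \<open>The coboundary of \<open>hcomp i t\<close> is that of \<open>\<sigma>\<close>,
    so the difference commutes with \<open>x\<close>; it is still a section because \<open>p\<close>
    kills the image of \<open>i\<close>.\<close>
  let ?s = "hadd \<sigma> (hsm (-1) (hcomp i t))"
  have ys: "yhom A E ?s" by (rule yhom_hadd[OF w \<sigma>(1) yhom_hsm[OF w it]])
  have ie: "dd A E (hcomp i t) = ?\<eta>"
    unfolding eD t(2) by (rule dd_postcomp[OF w(1) B w(2) Ft(1) i, symmetric])
  have "dd A E ?s = hadd ?\<eta> (hsm (-1) (dd A E (hcomp i t)))"
    unfolding dd_smult[OF w yhomD(1)[OF it]] by (rule dd_add[OF w Ft(2) fam_hsm[OF yhomD(1)[OF it]], symmetric])
  then have dz: "dd A E ?s n = 0\<^sub>m (gdim E (n+1)) (gdim A n)" for n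
    unfolding ie using famD[OF is_homD(1)[OF \<eta>], of n] by (auto simp: hadd_def hsm_def intro!: eq_matI)
  have "is_hom A E ?s"
  proof (rule is_homI[OF ys])
    fix n
    note ds = fam_dims[OF yhomD(1)[OF ys]] wf_gmod_dims[OF w(1)] wf_gmod_dims[OF w(2)]
    show "?s (n+1) * xact A n = xact E n * ?s n"
    proof (rule eq_matI)
      fix a b assume "a < dim_row (xact E n * ?s n)" "b < dim_col (xact E n * ?s n)"
      then have ab: "a < gdim E (n+1)" "b < gdim A n" by (simp_all only: ds index_mult_mat)
      let ?P = "?s (n+1) * xact A n" and ?Q = "xact E n * ?s n"
      have dim: "dim_row ?P = gdim E (n+1)" "dim_col ?P = gdim A n" "dim_row ?Q = gdim E (n+1)" "dim_col ?Q = gdim A n"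
        by (simp_all only: ds index_mult_mat)
      have "0 = (?Q + (-1) \<cdot>\<^sub>m ?P) $$ (a,b)" using dz[of n] ab unfolding dd_def by simp
      also have "\<dots> = ?Q $$ (a,b) - ?P $$ (a,b)" using ab dim by (simp del: index_mult_mat(1))
      finally show "?P $$ (a,b) = ?Q $$ (a,b)" by simp
    qed (simp_all only: ds index_mult_mat)
  qed
  moreover have "hcomp p ?s = hid A"
  proof -
    have pi: "hcomp p i = hzero B A"
    proof
      fix n
      show "hcomp p i n = hzero B A n"
      proof (rule mat_eq_on_vecsI[OF famD[OF fam_hcomp[OF F(1,2)]] famD[OF fam_hzero]])
        fix v :: "complex vec" assume v: "v \<in> carrier_vec (gdim B n)"
        have "p n *\<^sub>v (i n *\<^sub>v v) = 0\<^sub>v (gdim A n)"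
          using ex[OF mult_mat_vec_carrier[OF famD[OF F(1)] v]] v by blast
        then show "hcomp p i n *\<^sub>v v = hzero B A n *\<^sub>v v"
          using hcomp_vec[OF F v] zero_mat_mult_vec[OF v] by (simp add: hzero_def)
      qed
    qed
    have "hcomp p ?s = hadd (hid A) (hcomp p (hsm (-1) (hcomp i t)))"
      unfolding \<sigma>(2)[symmetric] by (rule hcomp_hadd_right[OF Ft(2) fam_hsm[OF yhomD(1)[OF it]] F(2)])
    also have "hcomp p (hsm (-1) (hcomp i t)) = hsm (-1) (hcomp (hcomp p i) t)"
      unfolding hcomp_hsm_right[OF yhomD(1)[OF it] F(2)] hcomp_assoc[OF Ft(1) F] ..
    also have "\<dots> = hzero A A" unfolding pi hcomp_hzero_left[OF Ft(1)] by (simp add: hsm_def hzero_def)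
    also have "hadd (hid A) (hzero A A) = hid A" by (rule hadd_hzero_right[OF fam_hid])
    finally show ?thesis .
  qed
  ultimately show "\<exists>s. is_hom A E s \<and> hcomp p s = hid A" by blast
qed

text \<open>\<open>B\<close> comes first because it is the submodule. The action of \<open>x\<close>
  is triangular with corner \<open>\<delta>\<close>, and it squares to zero because
  \<open>\<delta>\<close> anticommutes with \<open>x\<close>, which is what the sign in
  \<open>tw\<close> encodes. The action of \<open>y\<close> is diagonal.\<close>

definition cone :: "gmod \<Rightarrow> gmod \<Rightarrow> (int \<Rightarrow> complex mat) \<Rightarrow> gmod" where
  "cone A B \<delta> = \<lparr> gdim = (\<lambda>n. gdim B n + gdim A n),
     xact = (\<lambda>n. four_block_mat (xact B n) (\<delta> n) (0\<^sub>m (gdim A (n+1)) (gdim B n)) (xact A n)),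
     yact = (\<lambda>n. four_block_mat (yact B n) (0\<^sub>m (gdim B (n-1)) (gdim A n)) (0\<^sub>m (gdim A (n-1)) (gdim B n)) (yact A n)) \<rparr>"

text \<open>The extension defined by a cocycle; its maps to and from \<open>A\<close> and \<open>B\<close> are those of the direct
  sum, where the section of the quotient and the retraction onto the submodule are only \<open>\<complex>[y]\<close>-linear.\<close>
lemma ext1_zero_imp_vanish:
  assumes A: "A \<in> C2" and B: "B \<in> C2" and z: "ext1_zero A B"
  shows "vanish A B"
  unfolding vanish_def
proof (intro allI impI)
  fix \<delta> assume \<delta>: "is_hom A (tw B) \<delta>"
  note w = C2_wf[OF A] C2_wf[OF B]
  define E where "E = cone A B \<delta>"
  have Es: "gdim E n = gdim B n + gdim A n"
     "xact E n = four_block_mat (xact B n) (\<delta> n) (0\<^sub>m (gdim A (n+1)) (gdim B n)) (xact A n)"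
     "yact E n = four_block_mat (yact B n) (0\<^sub>m (gdim B (n-1)) (gdim A n)) (0\<^sub>m (gdim A (n-1)) (gdim B n)) (yact A n)" for n
    by (simp_all add: E_def cone_def)
  have \<delta>d: "dim_row (\<delta> n) = gdim B (n+1)" "dim_col (\<delta> n) = gdim A n" for n
    using fam_dims[OF is_homD(1)[OF \<delta>]] by simp_all
  note d = wf_gmod_dims[OF w(1)] wf_gmod_dims[OF w(2)] \<delta>d mat_unit_dims
  have wE: "wf_gmod E"
    unfolding wf_gmod_def
  proof (intro allI conjI)
    fix n :: int
    have n2: "n + 1 + 1 = n + 2" by simp
    show "xact E n \<in> carrier_mat (gdim E (n + 1)) (gdim E n)" "yact E n \<in> carrier_mat (gdim E (n - 1)) (gdim E n)"
      unfolding Es using wf_gmodD(1,2)[OF w(1), of n] wf_gmodD(1,2)[OF w(2), of n] by auto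
    have x: "\<delta> (n+1) * xact A n = (-1) \<cdot>\<^sub>m (xact B (n+1) * \<delta> n)"
      using is_homD(2)[OF \<delta>, of n] by (simp add: mat_smult_left d)
    have c: "xact B (n+1) * \<delta> n \<in> carrier_mat (gdim B (n+2)) (gdim A n)" by (rule carrier_matI) (simp_all only: d n2 index_mult_mat)
    have xd: "xact B (n+1) * \<delta> n + \<delta> (n+1) * xact A n = 0\<^sub>m (gdim B (n+2)) (gdim A n)"
    proof -
      have "P + (-1) \<cdot>\<^sub>m P = 0\<^sub>m r k" if "P \<in> carrier_mat r k" for P :: "complex mat" and r k
        using that by (intro eq_matI) auto
      then show ?thesis unfolding x using c by blast
    qed
    show "xact E (n + 1) * xact E n = 0\<^sub>m (gdim E (n + 2)) (gdim E n)"
      unfolding Es n2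
      by (subst mult_four_block_mat_dims)
        (simp_all only: d n2 xd wf_gmodD(3)[OF w(1)] wf_gmodD(3)[OF w(2)] index_zero_mat four_block_zero_mat)
    have y: "\<delta> (n-1) * yact A n = yact B (n+1) * \<delta> n" using is_homD(3)[OF \<delta>, of n] by simp
    show "xact E (n - 1) * yact E n = yact E (n + 1) * xact E n"
      unfolding Es using wf_gmodD(4)[OF w(1), of n] wf_gmodD(4)[OF w(2), of n] y
      by (simp add: mult_four_block_mat_dims d)
  qed
  let ?i = "dsum_in1 B A" and ?j = "dsum_in2 B A" and ?q = "dsum_pr1 B A" and ?p = "dsum_pr2 B A"
  note D = dsum_in1_def dsum_in2_def dsum_pr1_def dsum_pr2_def
  note m = cblk_mult mult_rblk four_block_mult_cblk rblk_mult_four_block rblk_mult_cblk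
  have i: "is_hom B E ?i" and p: "is_hom E A ?p"
    unfolding is_hom_def by (auto simp: D m d Es intro!: carrier_matI)
  have q: "yhom E B ?q" and j: "yhom A E ?j"
    unfolding yhom_def fam_def by (auto simp: D m d Es intro!: carrier_matI)
  have bw: "biprod_wit (dsum B A) B A ?i ?j ?q ?p" by (rule biprod_dsum[OF w(2,1)])
  have hid_E: "hid (dsum B A) = hid E" by (simp add: hid_def Es)
  have e: "hcomp ?q ?i = hid B" "hcomp ?p ?j = hid A" "hcomp ?p ?i = hzero B A" "hadd (hcomp ?i ?q) (hcomp ?j ?p) = hid E"
    using bw hid_E unfolding biprod_wit_def by auto
  note F = is_homD(1)[OF i] is_homD(1)[OF p] yhomD(1)[OF q] yhomD(1)[OF j]
  have dec: "?i n *\<^sub>v (?q n *\<^sub>v u) + ?j n *\<^sub>v (?p n *\<^sub>v u) = u" if u: "u \<in> carrier_vec (gdim E n)" for n u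
  proof -
    have "hadd (hcomp ?i ?q) (hcomp ?j ?p) n *\<^sub>v u = hcomp ?i ?q n *\<^sub>v u + hcomp ?j ?p n *\<^sub>v u"
      unfolding hadd_def by (rule add_mult_distrib_mat_vec[OF famD[OF fam_hcomp[OF F(3,1)]] famD[OF fam_hcomp[OF F(2,4)]] u])
    also have "\<dots> = ?i n *\<^sub>v (?q n *\<^sub>v u) + ?j n *\<^sub>v (?p n *\<^sub>v u)"
      using hcomp_vec[OF F(3,1) u] hcomp_vec[OF F(2,4) u] by simp
    finally show ?thesis unfolding e(4) using u by (simp add: hid_def)
  qed
  have qv: "?q n *\<^sub>v u \<in> carrier_vec (gdim B n)" and pv: "?p n *\<^sub>v u \<in> carrier_vec (gdim A n)" if "u \<in> carrier_vec (gdim E n)" for n u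
    using mult_mat_vec_carrier[OF famD[OF F(3)] that] mult_mat_vec_carrier[OF famD[OF F(2)] that] by auto
  have iv: "v \<in> carrier_vec (gdim B n) \<Longrightarrow> ?i n *\<^sub>v v \<in> carrier_vec (gdim E n)" for n v by (rule mult_mat_vec_carrier[OF famD[OF F(1)]])
  have jv: "v \<in> carrier_vec (gdim A n) \<Longrightarrow> ?j n *\<^sub>v v \<in> carrier_vec (gdim E n)" for n v by (rule mult_mat_vec_carrier[OF famD[OF F(4)]])
  have z0: "?i n *\<^sub>v 0\<^sub>v (gdim B n) = 0\<^sub>v (gdim E n)" "?j n *\<^sub>v 0\<^sub>v (gdim A n) = 0\<^sub>v (gdim E n)"
     "?q n *\<^sub>v 0\<^sub>v (gdim E n) = 0\<^sub>v (gdim B n)" "?p n *\<^sub>v 0\<^sub>v (gdim E n) = 0\<^sub>v (gdim A n)" for n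
    using mult_mat_vec_zero[OF famD[OF F(1)]] mult_mat_vec_zero[OF famD[OF F(2)]]
       mult_mat_vec_zero[OF famD[OF F(3)]] mult_mat_vec_zero[OF famD[OF F(4)]] by auto
  \<comment> \<open>Since \<open>y\<close> acts diagonally, the conditions for \<open>C2\<close>
    hold componentwise.\<close>
  have EC: "E \<in> C2"
    unfolding C2_iff
  proof (intro conjI wE)
    obtain U U' where "\<And>n. n > U \<Longrightarrow> gdim A n = 0" "\<And>n. n > U' \<Longrightarrow> gdim B n = 0"
      using A B unfolding C2_iff bdd_top_def by blast
    then show "bdd_top E" unfolding bdd_top_def Es by (intro exI[of _ "max U U'"]) auto
    show "y_inj E" unfolding y_inj_def
    proof (intro allI ballI impI)
      fix n and u :: "complex vec" assume u: "u \<in> carrier_vec (gdim E n)" and yu: "yact E n *\<^sub>v u = 0\<^sub>v (gdim E (n-1))"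
      have "yact B n *\<^sub>v (?q n *\<^sub>v u) = 0\<^sub>v (gdim B (n-1))" using yhom_y_vec[OF wE w(2) q u] yu z0 by simp
      then have 1: "?q n *\<^sub>v u = 0\<^sub>v (gdim B n)" using B qv[OF u] unfolding C2_iff y_inj_def by blast
      have "yact A n *\<^sub>v (?p n *\<^sub>v u) = 0\<^sub>v (gdim A (n-1))" using yhom_y_vec[OF wE w(1) is_homD(4)[OF p] u] yu z0 by simp
      then have 2: "?p n *\<^sub>v u = 0\<^sub>v (gdim A n)" using A pv[OF u] unfolding C2_iff y_inj_def by blast
      show "u = 0\<^sub>v (gdim E n)" using dec[OF u] unfolding 1 2 z0 by simp
    qed
    obtain L where L: "\<And>n u. n \<le> L \<Longrightarrow> u \<in> carrier_vec (gdim A (n-1)) \<Longrightarrow> \<exists>v \<in> carrier_vec (gdim A n). yact A n *\<^sub>v v = u"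
      using A unfolding C2_iff y_surj_low_def by blast
    obtain L' where L': "\<And>n u. n \<le> L' \<Longrightarrow> u \<in> carrier_vec (gdim B (n-1)) \<Longrightarrow> \<exists>v \<in> carrier_vec (gdim B n). yact B n *\<^sub>v v = u"
      using B unfolding C2_iff y_surj_low_def by blast
    have "\<exists>v \<in> carrier_vec (gdim E n). yact E n *\<^sub>v v = u" if n: "n \<le> min L L'" and u: "u \<in> carrier_vec (gdim E (n-1))" for n u
    proof -
      obtain a where a: "a \<in> carrier_vec (gdim A n)" "yact A n *\<^sub>v a = ?p (n-1) *\<^sub>v u" using L[OF _ pv[OF u]] n by auto
      obtain b where b: "b \<in> carrier_vec (gdim B n)" "yact B n *\<^sub>v b = ?q (n-1) *\<^sub>v u" using L'[OF _ qv[OF u]] n by auto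
      have "yact E n *\<^sub>v (?i n *\<^sub>v b + ?j n *\<^sub>v a) = yact E n *\<^sub>v (?i n *\<^sub>v b) + yact E n *\<^sub>v (?j n *\<^sub>v a)"
        by (rule mult_add_distrib_mat_vec[OF wf_gmodD(2)[OF wE] iv[OF b(1)] jv[OF a(1)]])
      also have "\<dots> = u"
        unfolding yhom_y_vec[OF w(2) wE is_homD(4)[OF i] b(1), symmetric] yhom_y_vec[OF w(1) wE j a(1), symmetric] a(2) b(2)
        by (rule dec[OF u])
      finally show ?thesis using iv[OF b(1)] jv[OF a(1)] by (intro bexI[of _ "?i n *\<^sub>v b + ?j n *\<^sub>v a"]) auto
    qed
    then show "y_surj_low E" unfolding y_surj_low_def by blast
  qed
  have qi: "?q n *\<^sub>v (?i n *\<^sub>v v) = v" if v: "v \<in> carrier_vec (gdim B n)" for n v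
    using hcomp_vec[OF F(1,3) v] e(1) v by (simp add: hid_def)
  have pj: "?p n *\<^sub>v (?j n *\<^sub>v v) = v" if v: "v \<in> carrier_vec (gdim A n)" for n v
    using hcomp_vec[OF F(4,2) v] e(2) v by (simp add: hid_def)
  have pi: "?p n *\<^sub>v (?i n *\<^sub>v v) = 0\<^sub>v (gdim A n)" if v: "v \<in> carrier_vec (gdim B n)" for n v
    using hcomp_vec[OF F(1,2) v] e(3) zero_mat_mult_vec[OF v] by (simp add: hzero_def)
  have "ses B E A ?i ?p" unfolding ses_def
  proof (intro conjI allI i p ballI impI iffI)
    fix n and v :: "complex vec" assume v: "v \<in> carrier_vec (gdim B n)" and "?i n *\<^sub>v v = 0\<^sub>v (gdim E n)"
    then show "v = 0\<^sub>v (gdim B n)" using qi[OF v] z0 by simp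
  next
    fix n and v :: "complex vec" assume v: "v \<in> carrier_vec (gdim A n)"
    then show "\<exists>u \<in> carrier_vec (gdim E n). ?p n *\<^sub>v u = v" using pj[OF v] jv[OF v] by blast
  next
    fix n and u :: "complex vec" assume u: "u \<in> carrier_vec (gdim E n)" and "?p n *\<^sub>v u = 0\<^sub>v (gdim A n)"
    then have "?i n *\<^sub>v (?q n *\<^sub>v u) + 0\<^sub>v (gdim E n) = u" using dec[OF u] z0 by simp
    then have "u = ?i n *\<^sub>v (?q n *\<^sub>v u)" using iv[OF qv[OF u]] by simp
    then show "\<exists>v \<in> carrier_vec (gdim B n). u = ?i n *\<^sub>v v" using qv[OF u] by blast
  next
    fix n and u :: "complex vec" assume "\<exists>v \<in> carrier_vec (gdim B n). u = ?i n *\<^sub>v v"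
    then show "?p n *\<^sub>v u = 0\<^sub>v (gdim A n)" using pi by blast
  qed
  then obtain s where s: "is_hom A E s" "hcomp ?p s = hid A" using z EC unfolding ext1_zero_def by blast
  \<comment> \<open>The component of the splitting in \<open>A\<close> is the identity; its
    component in \<open>B\<close> is, up to sign, a cochain with coboundary
    \<open>\<delta>\<close>.\<close>
  let ?t = "hcomp ?q s"
  have t: "yhom A B ?t" by (rule yhom_hcomp[OF w(1) wE w(2) is_homD(4)[OF s(1)] q])
  note sd = fam_dims[OF is_homD(1)[OF s(1)]] fam_dims[OF F(3)] fam_dims[OF F(2)] wf_gmod_dims[OF wE]
  have "\<delta> = dd A B (hsm (-1) ?t)"
  proof
    fix n
    \<comment> \<open>The retraction onto \<open>B\<close> is only C[y]-linear, and
      \<open>\<delta>\<close> is exactly its failure to commute with \<open>x\<close>.\<close>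
    have qx: "?q (n+1) * xact E n = xact B n * ?q n + \<delta> n * ?p n"
    proof -
      have "xact B n * ?q n + \<delta> n * ?p n = rblk (xact B n) (\<delta> n)"
        unfolding D by (simp add: m d) (rule eq_matI, auto simp: rblk_def d)
      moreover have "?q (n+1) * xact E n = rblk (xact B n) (\<delta> n)" unfolding D Es by (simp add: m d)
      ultimately show ?thesis by simp
    qed
    have ps: "?p n * s n = 1\<^sub>m (gdim A n)" using fun_cong[OF s(2), of n] by (simp add: hcomp_def hid_def)
    have "?t (n+1) * xact A n = ?q (n+1) * (s (n+1) * xact A n)"
      unfolding hcomp_def by (rule mat_assoc) (simp_all only: sd d)
    also have "\<dots> = (?q (n+1) * xact E n) * s n"
      unfolding is_homD(2)[OF s(1)] by (rule mat_assoc[symmetric]) (simp_all only: sd d)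
    also have "\<dots> = (xact B n * ?q n) * s n + (\<delta> n * ?p n) * s n"
      unfolding qx by (rule mat_distrib_right) (simp_all only: sd d index_mult_mat)
    also have "(xact B n * ?q n) * s n = xact B n * ?t n"
      unfolding hcomp_def by (rule mat_assoc) (simp_all only: sd d)
    also have "(\<delta> n * ?p n) * s n = \<delta> n * (?p n * s n)" by (rule mat_assoc) (simp_all only: sd d)
    also have "\<dots> = \<delta> n" unfolding ps by (simp add: d)
    finally have tx: "?t (n+1) * xact A n = xact B n * ?t n + \<delta> n" .
    note td = fam_dims[OF yhomD(1)[OF t]]
    have "dd A B (hsm (-1) ?t) n = (-1) \<cdot>\<^sub>m (xact B n * ?t n) + (?t (n+1) * xact A n)"
      unfolding dd_def hsm_def by (simp add: mat_smult_left mat_smult_right td d)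
    also have "\<dots> = \<delta> n"
    proof -
      have c: "xact B n * ?t n \<in> carrier_mat (gdim B (n+1)) (gdim A n)" "\<delta> n \<in> carrier_mat (gdim B (n+1)) (gdim A n)"
        by (rule carrier_matI; simp only: td d index_mult_mat)+
      have "(-1) \<cdot>\<^sub>m P + (P + Q) = Q" if "P \<in> carrier_mat r k" "Q \<in> carrier_mat r k" for P Q :: "complex mat" and r k
        using that by (intro eq_matI) auto
      then show ?thesis unfolding tx using c by blast
    qed
    finally show "\<delta> n = dd A B (hsm (-1) ?t) n" by simp
  qed
  moreover have "yhom A B (hsm (-1) ?t)" by (rule yhom_hsm[OF w t])
  ultimately show "\<exists>s. yhom A B s \<and> \<delta> = dd A B s" by blast
qed

lemma ext1_zero_iff_vanish: "A \<in> C2 \<Longrightarrow> B \<in> C2 \<Longrightarrow> ext1_zero A B \<longleftrightarrow> vanish A B"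
  using ext1_zero_imp_vanish vanish_imp_ext1_zero C2_wf by blast

section \<open>Extensions between arc modules\<close>

text \<open>The obstruction to \<open>Ext\<^sup>1 = 0\<close>. Two infinite arcs never cross, but between distinct ones there
  is a nontrivial extension in one of the two directions.\<close>
definition bad :: "arc \<Rightarrow> arc \<Rightarrow> bool" where
  "bad \<alpha> \<gamma> \<longleftrightarrow> arcs_cross \<alpha> \<gamma> \<or> (fst \<alpha> = NegInf \<and> fst \<gamma> = NegInf \<and> snd \<alpha> < snd \<gamma>)"

text \<open>The two alternatives match the two kinds of nontrivial cocycle. In the first,
  \<open>e\<close> goes to \<open>e'\<close> and \<open>f\<close>, if present, to
  \<open>-f'\<close>, but \<open>f'\<close> has no multiple in the degree of \<open>e\<close> from
  which \<open>x\<close> could produce this. In the second, \<open>e\<close> goes to 0 and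
  \<open>f\<close> to \<open>e'\<close>, and neither \<open>x\<close> applied to \<open>f'\<close>
  nor a multiple of \<open>e'\<close> in the degree of \<open>e\<close> is available.\<close>

lemma bad_cases:
  assumes "is_arc \<alpha>" "is_arc \<gamma>"
  shows "bad \<alpha> \<gamma> \<longleftrightarrow>
    (snd \<alpha> < snd \<gamma> \<and> \<not> ele (snd \<alpha>) (fst \<gamma>) \<and> (\<forall>a. fst \<alpha> = Fin a \<longrightarrow> ele (a+1) (fst \<gamma>))) \<or>
    (\<exists>a. fst \<alpha> = Fin a \<and> \<not> ele a (fst \<gamma>) \<and> a < snd \<gamma> \<and> snd \<gamma> < snd \<alpha>)"
proof -
  obtain a b c d where "\<alpha> = (a,b)" "\<gamma> = (c,d)" by fastforce
  then show ?thesis using assms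
    by (cases a; cases c) (auto simp: bad_def arcs_cross_def is_arc_def)
qed

lemma yto_tw: "n \<le> m \<Longrightarrow> yto (tw B) m n = yto B (m+1) (n+1)"
proof (induction rule: int_down_induct)
  case (step n)
  have "n + 1 \<le> m + 1" using step by simp
  then have "yto B (m+1) (n+1-1) = yact B (n+1) * yto B (m+1) (n+1)" by (rule yto_dec)
  then show ?case using step by (simp add: yto_dec)
qed simp

lemma yhom_e:
  assumes \<alpha>: "is_arc \<alpha>" and N: "wf_gmod N" and f: "yhom (amod \<alpha>) N f" and n: "n \<le> snd \<alpha>"
  shows "f n *\<^sub>v av \<alpha> n 1 0 = yto N (snd \<alpha>) n *\<^sub>v (f (snd \<alpha>) *\<^sub>v av \<alpha> (snd \<alpha>) 1 0)"
proof -
  let ?w = "f (snd \<alpha>) *\<^sub>v av \<alpha> (snd \<alpha>) 1 0"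
  have ok: "okv \<alpha> n 1 0" using n by (simp add: okv_def)
  have "f n *\<^sub>v av \<alpha> n 1 0 = 1 \<cdot>\<^sub>v low N (Fin (snd \<alpha>)) n ?w + 0 \<cdot>\<^sub>v low N (fst \<alpha>) n (gen_f \<alpha> f)"
    using gen_hom_av[OF \<alpha> N ok, of ?w "gen_f \<alpha> f"] yhom_amod_eq[OF \<alpha> N f] by simp
  also have "\<dots> = low N (Fin (snd \<alpha>)) n ?w"
    using low_carrier[OF N, of "Fin (snd \<alpha>)" n ?w] low_carrier[OF N, of "fst \<alpha>" n "gen_f \<alpha> f"]
    by (intro eq_vecI) auto
  finally show ?thesis using n by (simp add: low_def)
qed

lemma smult_mat_vec: "A \<in> carrier_mat n m \<Longrightarrow> v \<in> carrier_vec m \<Longrightarrow> (k \<cdot>\<^sub>m A) *\<^sub>v v = k \<cdot>\<^sub>v (A *\<^sub>v (v :: 'a :: comm_ring_1 vec))"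
  by (intro eq_vecI) auto

lemma tw_x_vec:
  assumes "wf_gmod B" "v \<in> carrier_vec (gdim B (n+1))"
  shows "xact (tw B) n *\<^sub>v v = (-1) \<cdot>\<^sub>v (xact B (n+1) *\<^sub>v v)"
  unfolding tw_sel by (rule smult_mat_vec[OF wf_gmodD(1)[OF assms(1)] assms(2)])

lemma dd_vec:
  assumes A: "wf_gmod A" and B: "wf_gmod B" and s: "fam A B s" and v: "v \<in> carrier_vec (gdim A n)"
  shows "dd A B s n *\<^sub>v v = xact B n *\<^sub>v (s n *\<^sub>v v) + (-1) \<cdot>\<^sub>v (s (n+1) *\<^sub>v (xact A n *\<^sub>v v))"
proof -
  have c: "xact B n * s n \<in> carrier_mat (gdim B (n+1)) (gdim A n)" "s (n+1) * xact A n \<in> carrier_mat (gdim B (n+1)) (gdim A n)"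
    by (rule mult_carrier_mat[OF wf_gmodD(1)[OF B] famD[OF s]]) (rule mult_carrier_mat[OF famD[OF s] wf_gmodD(1)[OF A]])
  have "dd A B s n *\<^sub>v v = (xact B n * s n) *\<^sub>v v + ((-1) \<cdot>\<^sub>m (s (n+1) * xact A n)) *\<^sub>v v"
    unfolding dd_def by (rule add_mult_distrib_mat_vec[OF c(1) _ v]) (use c in simp)
  also have "((-1) \<cdot>\<^sub>m (s (n+1) * xact A n)) *\<^sub>v v = (-1) \<cdot>\<^sub>v ((s (n+1) * xact A n) *\<^sub>v v)" by (rule smult_mat_vec[OF c(2) v])
  also have "(s (n+1) * xact A n) *\<^sub>v v = s (n+1) *\<^sub>v (xact A n *\<^sub>v v)"
    by (rule assoc_mult_mat_vec[OF famD[OF s] wf_gmodD(1)[OF A] v])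
  also have "(xact B n * s n) *\<^sub>v v = xact B n *\<^sub>v (s n *\<^sub>v v)"
    by (rule assoc_mult_mat_vec[OF wf_gmodD(1)[OF B] famD[OF s] v])
  finally show ?thesis .
qed

lemma dd_arc_e:
  assumes \<alpha>: "is_arc \<alpha>" and B: "wf_gmod B" and s: "yhom (amod \<alpha>) B s"
  shows "dd (amod \<alpha>) B s (snd \<alpha>) *\<^sub>v av \<alpha> (snd \<alpha>) 1 0 = xact B (snd \<alpha>) *\<^sub>v (s (snd \<alpha>) *\<^sub>v av \<alpha> (snd \<alpha>) 1 0)"
proof -
  note sf = yhomD(1)[OF s] and A = wf_amod[OF \<alpha>]
  have "xact (amod \<alpha>) (snd \<alpha>) *\<^sub>v av \<alpha> (snd \<alpha>) 1 0 = 0\<^sub>v (gdim (amod \<alpha>) (snd \<alpha> + 1))"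
    using amod_x[OF \<alpha> okv_gen(1)] \<alpha> by (simp add: amod_sel)
  moreover have "xact B (snd \<alpha>) *\<^sub>v (s (snd \<alpha>) *\<^sub>v av \<alpha> (snd \<alpha>) 1 0) \<in> carrier_vec (gdim B (snd \<alpha> + 1))"
    using mult_mat_vec_carrier[OF wf_gmodD(1)[OF B] mult_mat_vec_carrier[OF famD[OF sf] av_carrier[OF \<alpha>]]] .
  ultimately show ?thesis using dd_vec[OF A B sf av_carrier[OF \<alpha>], of "snd \<alpha>" 1 0] mult_mat_vec_zero[OF famD[OF sf]] by simp
qed

lemma dd_arc_f:
  assumes \<alpha>: "is_arc \<alpha>" and B: "wf_gmod B" and s: "yhom (amod \<alpha>) B s" and a: "fst \<alpha> = Fin a"
  shows "dd (amod \<alpha>) B s a *\<^sub>v av \<alpha> a 0 1 = xact B a *\<^sub>v (s a *\<^sub>v av \<alpha> a 0 1)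
     + (-1) \<cdot>\<^sub>v (yto B (snd \<alpha>) (a+1) *\<^sub>v (s (snd \<alpha>) *\<^sub>v av \<alpha> (snd \<alpha>) 1 0))"
proof -
  note sf = yhomD(1)[OF s] and A = wf_amod[OF \<alpha>]
  have "a + 1 \<le> snd \<alpha>" using \<alpha> a by (simp add: is_arc_def)
  then show ?thesis using dd_vec[OF A B sf av_carrier[OF \<alpha>], of a 0 1] amod_x[OF \<alpha> okv_gen(2)[OF a]]
    yhom_e[OF \<alpha> B s, of "a+1"] by simp
qed

text \<open>A cocycle is determined by its values on \<open>e\<close> and \<open>f\<close>.
  Compatibility with \<open>x\<close> leaves one free coefficient for \<open>e\<close> and one more
  for \<open>f\<close>, and outside the two alternatives of \<open>bad_cases\<close> each of them is
  removed by a cochain given on generators.\<close>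

lemma not_bad_imp_vanish:
  assumes \<alpha>: "is_arc \<alpha>" and \<gamma>: "is_arc \<gamma>" and nb: "\<not> bad \<alpha> \<gamma>"
  shows "vanish (amod \<alpha>) (amod \<gamma>)"
  unfolding vanish_def
proof (intro allI impI)
  fix \<delta> assume \<delta>: "is_hom (amod \<alpha>) (tw (amod \<gamma>)) \<delta>"
  obtain b where b: "snd \<alpha> = b" by simp
  note A = wf_amod[OF \<alpha>] and G = wf_amod[OF \<gamma>]
  note T = wf_tw[OF G]
  note \<delta>y = is_homD(4)[OF \<delta>]
  note nb = nb[unfolded bad_cases[OF \<alpha> \<gamma>] b]
  have \<delta>c: "\<delta> n *\<^sub>v av \<alpha> n p q \<in> carrier_vec (gdim (amod \<gamma>) (n+1))" for n p q
    using mult_mat_vec_carrier[OF famD[OF is_homD(1)[OF \<delta>]] av_carrier[OF \<alpha>], of n p q] by simp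
  obtain s r where sr: "okv \<gamma> (b+1) s r" "\<delta> b *\<^sub>v av \<alpha> b 1 0 = av \<gamma> (b+1) s r" using av_ex[OF \<gamma> \<delta>c] by blast
  have okb: "okv \<alpha> b 1 0" using okv_gen(1) b by blast
  have "(-1) \<cdot>\<^sub>v av \<gamma> (b+1+1) r 0 = \<delta> (b+1) *\<^sub>v av \<alpha> (b+1) 0 0"
    using is_hom_x_vec[OF A T \<delta> av_carrier[OF \<alpha>], of b 1 0] amod_x[OF \<alpha> okb] amod_x[OF \<gamma> sr(1)] sr(2)
      tw_x_vec[OF G av_carrier[OF \<gamma>]] by simp
  also have "\<dots> = 0\<^sub>v (arc_dim \<gamma> (b+1+1))"
    using mult_mat_vec_zero[OF famD[OF is_homD(1)[OF \<delta>]], of "b+1"] by (simp add: amod_sel \<alpha> \<gamma>)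
  finally have "av \<gamma> (b+1+1) (-r) 0 = 0\<^sub>v (arc_dim \<gamma> (b+1+1))" by (simp add: av_smult)
  moreover have "okv \<gamma> (b+1+1) (-r) 0" using okv_x[OF \<gamma> sr(1)] by (simp add: okv_def)
  ultimately have r: "r = 0" using av_eq_0_iff[OF \<gamma>] by fastforce
  note sr = sr[unfolded r]
  show "\<exists>s. yhom (amod \<alpha>) (amod \<gamma>) s \<and> \<delta> = dd (amod \<alpha>) (amod \<gamma>) s"
  proof (cases "fst \<alpha>")
    case NegInf
    \<comment> \<open>A nonzero coefficient needs \<open>b < snd \<gamma>\<close>; as the pair is
      not bad, \<open>f'\<close> then has a multiple in degree \<open>b\<close>, and
      \<open>x\<close> maps it to the required multiple of \<open>e'\<close>.\<close>
    have ok: "okv \<gamma> b 0 s" using nb sr(1) NegInf unfolding okv_def by auto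
    let ?h = "gen_hom \<alpha> (amod \<gamma>) (av \<gamma> b 0 s) (0\<^sub>v 0)"
    have h: "yhom (amod \<alpha>) (amod \<gamma>) ?h"
      by (rule yhom_gen_hom[OF \<alpha> G]) (use \<gamma> NegInf b in \<open>auto simp: gen_carrier_def\<close>)
    have "\<delta> = dd (amod \<alpha>) (amod \<gamma>) ?h"
    proof (rule yhom_amod_ext[OF \<alpha> T \<delta>y is_homD(4)[OF dd_hom[OF A G h]]])
      show "\<delta> (snd \<alpha>) *\<^sub>v av \<alpha> (snd \<alpha>) 1 0 = dd (amod \<alpha>) (amod \<gamma>) ?h (snd \<alpha>) *\<^sub>v av \<alpha> (snd \<alpha>) 1 0"
        unfolding dd_arc_e[OF \<alpha> G h] using gen_hom_gen(1)[OF \<alpha> G, of "av \<gamma> b 0 s"] amod_x[OF \<gamma> ok] sr(2) \<gamma> b by simp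
    qed (use NegInf in simp)
    then show ?thesis using h by blast
  next
    case (Fin a)
    have ab: "a + 1 \<le> b" using \<alpha> Fin b by (simp add: is_arc_def)
    have oka: "okv \<alpha> a 0 1" using okv_gen(2)[OF Fin] .
    obtain q p where qp: "okv \<gamma> (a+1) q p" "\<delta> a *\<^sub>v av \<alpha> a 0 1 = av \<gamma> (a+1) q p" using av_ex[OF \<gamma> \<delta>c] by blast
    have "av \<gamma> (a+1+1) s 0 = \<delta> (a+1) *\<^sub>v av \<alpha> (a+1) 1 0"
      using yhom_e[OF \<alpha> T \<delta>y, of "a+1"] ab b sr(2) yto_tw[OF ab, of "amod \<gamma>"] amod_yto[OF \<gamma> sr(1), of "a+1+1"] by simp
    also have "\<dots> = (-1) \<cdot>\<^sub>v av \<gamma> (a+1+1) p 0"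
      using is_hom_x_vec[OF A T \<delta> av_carrier[OF \<alpha>], of a 0 1] amod_x[OF \<alpha> oka] amod_x[OF \<gamma> qp(1)] qp(2)
        tw_x_vec[OF G av_carrier[OF \<gamma>]] by simp
    finally have "av \<gamma> (a+1+1) s 0 = av \<gamma> (a+1+1) (-p) 0" by (simp add: av_smult)
    moreover have "okv \<gamma> (a+1+1) s 0" using okv_dec[OF sr(1)] ab by simp
    moreover have "okv \<gamma> (a+1+1) (-p) 0" using okv_x[OF \<gamma> qp(1)] by (simp add: okv_def)
    ultimately have s: "s = - p" using av_inj[OF \<gamma>] by blast
    \<comment> \<open>The coefficient \<open>q\<close> can come from the \<open>f'\<close> component
      of the image of \<open>f\<close>, if that exists in degree \<open>a\<close>. Otherwise it
      comes, with opposite sign, from the \<open>e'\<close> component of the image of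
      \<open>e\<close>, which exists because the pair is not bad.\<close>
    define \<epsilon> where "\<epsilon> = (if ele a (fst \<gamma>) then 0 else - q)"
    define \<beta> where "\<beta> = (if ele a (fst \<gamma>) then q else 0)"
    have ok1: "okv \<gamma> b \<epsilon> s"
      using nb sr(1) qp(1) Fin ab unfolding okv_def s \<epsilon>_def by auto
    have ok2: "okv \<gamma> a 0 \<beta>" unfolding okv_def \<beta>_def by auto
    let ?h = "gen_hom \<alpha> (amod \<gamma>) (av \<gamma> b \<epsilon> s) (av \<gamma> a 0 \<beta>)"
    have h: "yhom (amod \<alpha>) (amod \<gamma>) ?h"
      by (rule yhom_gen_hom[OF \<alpha> G]) (use \<gamma> Fin b in \<open>auto simp: gen_carrier_def\<close>)
    have he: "?h (snd \<alpha>) *\<^sub>v av \<alpha> (snd \<alpha>) 1 0 = av \<gamma> b \<epsilon> s" using gen_hom_gen(1)[OF \<alpha> G, of "av \<gamma> b \<epsilon> s"] \<gamma> b by simp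
    have hf: "?h a *\<^sub>v av \<alpha> a 0 1 = av \<gamma> a 0 \<beta>" using gen_hom_gen(2)[OF \<alpha> G Fin] \<gamma> by simp
    have "\<delta> = dd (amod \<alpha>) (amod \<gamma>) ?h"
    proof (rule yhom_amod_ext[OF \<alpha> T \<delta>y is_homD(4)[OF dd_hom[OF A G h]]])
      show "\<delta> (snd \<alpha>) *\<^sub>v av \<alpha> (snd \<alpha>) 1 0 = dd (amod \<alpha>) (amod \<gamma>) ?h (snd \<alpha>) *\<^sub>v av \<alpha> (snd \<alpha>) 1 0"
        unfolding dd_arc_e[OF \<alpha> G h] he using amod_x[OF \<gamma> ok1] sr(2) b by simp
      fix a' assume "fst \<alpha> = Fin a'"
      then have a': "a' = a" using Fin by simp
      show "\<delta> a' *\<^sub>v av \<alpha> a' 0 1 = dd (amod \<alpha>) (amod \<gamma>) ?h a' *\<^sub>v av \<alpha> a' 0 1"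
        unfolding a' dd_arc_f[OF \<alpha> G h Fin] he hf using amod_x[OF \<gamma> ok2] amod_yto[OF \<gamma> ok1, of "a+1"] ab b qp(2)
        by (simp add: av_smult av_add s \<epsilon>_def \<beta>_def)
    qed
    then show ?thesis using h by blast
  qed
qed

text \<open>In each case the cocycle is explicit, and its value on one generator lies outside the
  reach of any coboundary for degree reasons.\<close>

lemma bad_imp_not_vanish:
  assumes \<alpha>: "is_arc \<alpha>" and \<gamma>: "is_arc \<gamma>" and bd: "bad \<alpha> \<gamma>"
  shows "\<not> vanish (amod \<alpha>) (amod \<gamma>)"
proof
  assume v: "vanish (amod \<alpha>) (amod \<gamma>)"
  obtain b where b: "snd \<alpha> = b" by simp
  note A = wf_amod[OF \<alpha>] and G = wf_amod[OF \<gamma>]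
  note T = wf_tw[OF G]
  have sc: "s n *\<^sub>v av \<alpha> n p q \<in> carrier_vec (gdim (amod \<gamma>) n)" if "yhom (amod \<alpha>) (amod \<gamma>) s" for s n p q
    using mult_mat_vec_carrier[OF famD[OF yhomD(1)[OF that]] av_carrier[OF \<alpha>]] .
  consider (1) "b < snd \<gamma>" "\<not> ele b (fst \<gamma>)" "\<And>a. fst \<alpha> = Fin a \<Longrightarrow> ele (a+1) (fst \<gamma>)"
    | (2) a where "fst \<alpha> = Fin a" "\<not> ele a (fst \<gamma>)" "a < snd \<gamma>" "snd \<gamma> < b"
    using bd unfolding bad_cases[OF \<alpha> \<gamma>] b by blast
  then show False
  proof cases
    case 1
    have okw: "okv \<gamma> (b+1) 1 0" using 1 by (simp add: okv_def)
    \<comment> \<open>The coefficient -1 compensates for the sign of \<open>x\<close> in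
      \<open>tw\<close>.\<close>
    define f where "f = (case fst \<alpha> of NegInf \<Rightarrow> 0\<^sub>v 0 | Fin a \<Rightarrow> av \<gamma> (a+1) 0 (-1))"
    let ?\<delta> = "gen_hom \<alpha> (tw (amod \<gamma>)) (av \<gamma> (b+1) 1 0) f"
    have wc: "av \<gamma> (b+1) 1 0 \<in> carrier_vec (gdim (tw (amod \<gamma>)) (snd \<alpha>))" using \<gamma> b by simp
    have "is_hom (amod \<alpha>) (tw (amod \<gamma>)) ?\<delta>"
    proof (rule is_hom_gen_hom[OF \<alpha> T wc])
      show "gen_carrier (tw (amod \<gamma>)) (fst \<alpha>) f" using \<gamma> by (auto simp: gen_carrier_def f_def)
      show "xact (tw (amod \<gamma>)) (snd \<alpha>) *\<^sub>v av \<gamma> (b+1) 1 0 = 0\<^sub>v (gdim (tw (amod \<gamma>)) (snd \<alpha> + 1))"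
        unfolding b tw_x_vec[OF G av_carrier[OF \<gamma>]] amod_x[OF \<gamma> okw] using \<gamma> by (simp add: amod_sel)
      fix a assume a: "fst \<alpha> = Fin a"
      have ab: "a + 1 \<le> b" using \<alpha> a b by (simp add: is_arc_def)
      have okf: "okv \<gamma> (a+1) 0 (-1)" using 1(3)[OF a] by (simp add: okv_def)
      show "xact (tw (amod \<gamma>)) a *\<^sub>v f = low (tw (amod \<gamma>)) (Fin (snd \<alpha>)) (a+1) (av \<gamma> (b+1) 1 0)"
        using tw_x_vec[OF G av_carrier[OF \<gamma>], of a 0 "-1"] amod_x[OF \<gamma> okf] amod_yto[OF \<gamma> okw, of "a+1+1"]
          ab b yto_tw[OF ab, of "amod \<gamma>"] by (simp add: f_def a low_def av_smult)
    qed
    then obtain s where s: "yhom (amod \<alpha>) (amod \<gamma>) s" "?\<delta> = dd (amod \<alpha>) (amod \<gamma>) s" using v unfolding vanish_def by blast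
    obtain p q where pq: "okv \<gamma> b p q" "s b *\<^sub>v av \<alpha> b 1 0 = av \<gamma> b p q" using av_ex[OF \<gamma> sc[OF s(1)]] by blast
    have q: "q = 0" using pq(1) 1 by (simp add: okv_def)
    have "av \<gamma> (b+1) 1 0 = ?\<delta> (snd \<alpha>) *\<^sub>v av \<alpha> (snd \<alpha>) 1 0" using gen_hom_gen(1)[OF \<alpha> T wc] by simp
    also have "\<dots> = av \<gamma> (b+1) 0 0"
      unfolding s(2) dd_arc_e[OF \<alpha> G s(1)] unfolding b pq(2) using amod_x[OF \<gamma> pq(1)] q by simp
    finally show False using av_eq_0_iff[OF \<gamma> okw] by simp
  next
    case 2
    have ab: "a + 1 \<le> b" using \<alpha> 2(1) b by (simp add: is_arc_def)
    have okf: "okv \<gamma> (a+1) 1 0" using 2 by (simp add: okv_def)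
    \<comment> \<open>In the second case \<open>e\<close> goes to zero, and \<open>f\<close> to the
      multiple of \<open>e'\<close> one degree above it.\<close>
    let ?w = "0\<^sub>v (gdim (tw (amod \<gamma>)) (snd \<alpha>))"
    let ?\<delta> = "gen_hom \<alpha> (tw (amod \<gamma>)) ?w (av \<gamma> (a+1) 1 0)"
    have fc: "av \<gamma> (a+1) 1 0 \<in> carrier_vec (gdim (tw (amod \<gamma>)) a)" using \<gamma> by simp
    have "is_hom (amod \<alpha>) (tw (amod \<gamma>)) ?\<delta>"
    proof (rule is_hom_gen_hom[OF \<alpha> T])
      show "gen_carrier (tw (amod \<gamma>)) (fst \<alpha>) (av \<gamma> (a+1) 1 0)" using fc 2(1) by (auto simp: gen_carrier_def)
      show "xact (tw (amod \<gamma>)) (snd \<alpha>) *\<^sub>v ?w = 0\<^sub>v (gdim (tw (amod \<gamma>)) (snd \<alpha> + 1))"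
        by (rule mult_mat_vec_zero[OF wf_gmodD(1)[OF T]])
      fix a' assume "fst \<alpha> = Fin a'"
      then have a': "a' = a" using 2(1) by simp
      have "xact (tw (amod \<gamma>)) a *\<^sub>v av \<gamma> (a+1) 1 0 = 0\<^sub>v (gdim (tw (amod \<gamma>)) (a+1))"
        unfolding tw_x_vec[OF G av_carrier[OF \<gamma>]] amod_x[OF \<gamma> okf] using \<gamma> by (simp add: amod_sel)
      then show "xact (tw (amod \<gamma>)) a' *\<^sub>v av \<gamma> (a+1) 1 0 = low (tw (amod \<gamma>)) (Fin (snd \<alpha>)) (a'+1) ?w"
        unfolding a' low_zero[OF T] .
    qed simp
    then obtain s where s: "yhom (amod \<alpha>) (amod \<gamma>) s" "?\<delta> = dd (amod \<alpha>) (amod \<gamma>) s" using v unfolding vanish_def by blast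
    obtain p q where pq: "okv \<gamma> b p q" "s b *\<^sub>v av \<alpha> b 1 0 = av \<gamma> b p q" using av_ex[OF \<gamma> sc[OF s(1)]] by blast
    obtain p' q' where pq': "okv \<gamma> a p' q'" "s a *\<^sub>v av \<alpha> a 0 1 = av \<gamma> a p' q'" using av_ex[OF \<gamma> sc[OF s(1)]] by blast
    have "\<not> ele b (fst \<gamma>)" using 2(2) ele_mono[of b "fst \<gamma>" a] ab by auto
    then have z: "p = 0" "q = 0" "q' = 0" using pq(1) pq'(1) 2 by (simp_all add: okv_def)
    have "av \<gamma> (a+1) 1 0 = ?\<delta> a *\<^sub>v av \<alpha> a 0 1" using gen_hom_gen(2)[OF \<alpha> T 2(1) fc] by simp
    also have "\<dots> = av \<gamma> (a+1) 0 0 + (-1) \<cdot>\<^sub>v (yto (amod \<gamma>) b (a+1) *\<^sub>v av \<gamma> b 0 0)"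
      unfolding s(2) dd_arc_f[OF \<alpha> G s(1) 2(1)] unfolding b pq(2) pq'(2) using amod_x[OF \<gamma> pq'(1)] z by simp
    also have "\<dots> = 0\<^sub>v (arc_dim \<gamma> (a+1))"
      using amod_yto[OF \<gamma> okv_zero ab] by (simp add: carrier_vecI)
    finally show False using av_eq_0_iff[OF \<gamma> okf] by simp
  qed
qed

section \<open>Subcategories and approximations\<close>

lemma arc_in_arcs_of: "is_arc \<alpha> \<Longrightarrow> amod \<alpha> \<in> T \<longleftrightarrow> \<alpha> \<in> arcs_of T"
  by (simp add: arcs_of_def)

lemma wf_zero_gmod: "wf_gmod zero_gmod"
  by (simp add: wf_gmod_def zero_gmod_def)

lemma gdim_zero_gmod [simp]: "gdim zero_gmod n = 0"
  by (simp add: zero_gmod_def)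

lemma subcat_zero:
  assumes T: "subcat T" and M: "M \<in> C2" and z: "\<And>n. gdim M n = 0"
  shows "M \<in> T"
proof -
  note w = C2_wf[OF M] wf_zero_gmod
  note h = is_hom_hzero[OF w] is_hom_hzero[OF w(2,1)]
  have "hcomp (hzero zero_gmod M) (hzero M zero_gmod) = hid M"
    by (rule fam_zero_dim[OF _ fam_hcomp[OF fam_hzero fam_hzero] fam_hid]) (simp add: z)
  moreover have "hcomp (hzero M zero_gmod) (hzero zero_gmod M) = hid zero_gmod"
    by (rule fam_zero_dim[OF _ fam_hcomp[OF fam_hzero fam_hzero] fam_hid]) simp
  ultimately have "iso zero_gmod M" using h unfolding iso_def by blast
  then show ?thesis using T M unfolding subcat_def by blast
qed

lemma subcat_biprod:
  assumes T: "subcat T" and M: "M \<in> C2" and A: "A \<in> C2" and B: "B \<in> C2" and b: "biprod M A B"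
  shows "M \<in> T \<longleftrightarrow> A \<in> T \<and> B \<in> T"
proof -
  note w = C2_wf[OF M] C2_wf[OF A] C2_wf[OF B]
  have i: "iso M (dsum A B)" by (rule biprod_imp_iso[OF w b])
  have i': "iso M (dsum B A)" by (rule biprod_imp_iso[OF w(1,3,2) biprod_swap[OF w b]])
  show ?thesis using T M A B i i' iso_sym[OF i] unfolding subcat_def by blast
qed

lemma biprod_vanish_iff:
  assumes "M \<in> C2" "A \<in> C2" "B \<in> C2" "biprod M A B" "X \<in> C2"
  shows "vanish M X \<longleftrightarrow> vanish A X \<and> vanish B X" "vanish X M \<longleftrightarrow> vanish X A \<and> vanish X B"
proof -
  note w = C2_wf[OF assms(1)] C2_wf[OF assms(2)] C2_wf[OF assms(3)]
  note x = C2_wf[OF assms(5)]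
  note sw = biprod_swap[OF w assms(4)]
  show "vanish M X \<longleftrightarrow> vanish A X \<and> vanish B X"
    using vanish_biprod_left[OF w x assms(4)] vanish_summand_left[OF w x assms(4)]
      vanish_summand_left[OF w(1,3,2) x sw] by blast
  show "vanish X M \<longleftrightarrow> vanish X A \<and> vanish X B"
    using vanish_biprod_right[OF w x assms(4)] vanish_summand_right[OF w x assms(4)]
      vanish_summand_right[OF w(1,3,2) x sw] by blast
qed

lemma subcat_C2: "subcat T \<Longrightarrow> X \<in> T \<Longrightarrow> X \<in> C2"
  unfolding subcat_def by blast

lemma vanish_arcs: "is_arc \<alpha> \<Longrightarrow> is_arc \<gamma> \<Longrightarrow> vanish (amod \<alpha>) (amod \<gamma>) \<longleftrightarrow> \<not> bad \<alpha> \<gamma>"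
  using not_bad_imp_vanish bad_imp_not_vanish by blast

lemma vanish_subcat_arc:
  assumes T: "subcat T" and \<gamma>: "is_arc \<gamma>"
  shows "(\<forall>X\<in>T. vanish X (amod \<gamma>)) \<longleftrightarrow> (\<forall>\<beta>\<in>arcs_of T. \<not> bad \<beta> \<gamma>)"
    "(\<forall>X\<in>T. vanish (amod \<gamma>) X) \<longleftrightarrow> (\<forall>\<beta>\<in>arcs_of T. \<not> bad \<gamma> \<beta>)"
proof -
  note g = wf_amod[OF \<gamma>] amod_C2[OF \<gamma>]
  have 1: "vanish X (amod \<gamma>)" if X: "X \<in> C2" "X \<in> T" and nb: "\<forall>\<beta>\<in>arcs_of T. \<not> bad \<beta> \<gamma>" for X
    using X
  proof (induction X rule: C2_induct)
    case (zero M)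
    then show ?case using vanish_zero[OF C2_wf g(1)] by blast
  next
    case (biprod M \<alpha> N)
    have "amod \<alpha> \<in> T" "N \<in> T" using subcat_biprod[OF T biprod(1) amod_C2[OF biprod(2)] biprod(3,4)] biprod by auto
    then show ?case
      using biprod_vanish_iff(1)[OF biprod(1) amod_C2[OF biprod(2)] biprod(3,4) g(2)] nb
        vanish_arcs[OF biprod(2) \<gamma>] arc_in_arcs_of[OF biprod(2)] biprod by blast
  qed
  have 2: "vanish (amod \<gamma>) X" if X: "X \<in> C2" "X \<in> T" and nb: "\<forall>\<beta>\<in>arcs_of T. \<not> bad \<gamma> \<beta>" for X
    using X
  proof (induction X rule: C2_induct)
    case (zero M)
    then show ?case using vanish_zero[OF g(1) C2_wf] by blast
  next
    case (biprod M \<alpha> N)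
    have "amod \<alpha> \<in> T" "N \<in> T" using subcat_biprod[OF T biprod(1) amod_C2[OF biprod(2)] biprod(3,4)] biprod by auto
    then show ?case
      using biprod_vanish_iff(2)[OF biprod(1) amod_C2[OF biprod(2)] biprod(3,4) g(2)] nb
        vanish_arcs[OF \<gamma> biprod(2)] arc_in_arcs_of[OF biprod(2)] biprod by blast
  qed
  show "(\<forall>X\<in>T. vanish X (amod \<gamma>)) \<longleftrightarrow> (\<forall>\<beta>\<in>arcs_of T. \<not> bad \<beta> \<gamma>)"
    using 1 subcat_C2[OF T] vanish_arcs \<gamma> unfolding arcs_of_def by blast
  show "(\<forall>X\<in>T. vanish (amod \<gamma>) X) \<longleftrightarrow> (\<forall>\<beta>\<in>arcs_of T. \<not> bad \<gamma> \<beta>)"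
    using 2 subcat_C2[OF T] vanish_arcs \<gamma> unfolding arcs_of_def by blast
qed

text \<open>Both membership in \<open>T\<close> and vanishing of extensions are additive over
  biproducts, so the equality of subcategories can be tested on arc modules.\<close>

lemma right_perp_iff:
  assumes T: "subcat T"
  shows "{M \<in> C2. \<forall>X\<in>T. ext1_zero X M} = T \<longleftrightarrow>
    (\<forall>\<gamma>. is_arc \<gamma> \<longrightarrow> (\<gamma> \<in> arcs_of T \<longleftrightarrow> (\<forall>\<beta>\<in>arcs_of T. \<not> bad \<beta> \<gamma>)))"
proof -
  have "{M \<in> C2. \<forall>X\<in>T. ext1_zero X M} = T \<longleftrightarrow> (\<forall>M\<in>C2. (\<forall>X\<in>T. vanish X M) \<longleftrightarrow> M \<in> T)"
    using ext1_zero_iff_vanish subcat_C2[OF T] by blast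
  also have "\<dots> \<longleftrightarrow> (\<forall>\<gamma>. is_arc \<gamma> \<longrightarrow> (\<gamma> \<in> arcs_of T \<longleftrightarrow> (\<forall>\<beta>\<in>arcs_of T. \<not> bad \<beta> \<gamma>)))"
  proof
    assume "\<forall>M\<in>C2. (\<forall>X\<in>T. vanish X M) \<longleftrightarrow> M \<in> T"
    then show "\<forall>\<gamma>. is_arc \<gamma> \<longrightarrow> (\<gamma> \<in> arcs_of T \<longleftrightarrow> (\<forall>\<beta>\<in>arcs_of T. \<not> bad \<beta> \<gamma>))"
      using amod_C2 vanish_subcat_arc(1)[OF T] arc_in_arcs_of by blast
  next
    assume R: "\<forall>\<gamma>. is_arc \<gamma> \<longrightarrow> (\<gamma> \<in> arcs_of T \<longleftrightarrow> (\<forall>\<beta>\<in>arcs_of T. \<not> bad \<beta> \<gamma>))"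
    show "\<forall>M\<in>C2. (\<forall>X\<in>T. vanish X M) \<longleftrightarrow> M \<in> T"
    proof
      fix M assume "M \<in> C2"
      then show "(\<forall>X\<in>T. vanish X M) \<longleftrightarrow> M \<in> T"
      proof (induction M rule: C2_induct)
        case (zero M)
        have "vanish X M" if "X \<in> T" for X using vanish_zero[OF C2_wf[OF subcat_C2[OF T that]] C2_wf[OF zero(1)]] zero(2) by simp
        then show ?case using subcat_zero[OF T zero] by blast
      next
        case (biprod M \<alpha> N)
        note a = amod_C2[OF biprod(2)]
        have "(\<forall>X\<in>T. vanish X M) \<longleftrightarrow> (\<forall>X\<in>T. vanish X (amod \<alpha>)) \<and> (\<forall>X\<in>T. vanish X N)"
          using biprod_vanish_iff(2)[OF biprod(1) a biprod(3,4) subcat_C2[OF T]] by blast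
        moreover have "(\<forall>X\<in>T. vanish X (amod \<alpha>)) \<longleftrightarrow> amod \<alpha> \<in> T"
          unfolding vanish_subcat_arc(1)[OF T biprod(2)] arc_in_arcs_of[OF biprod(2)] using R biprod(2) by blast
        ultimately show ?case using biprod(5) subcat_biprod[OF T biprod(1) a biprod(3,4)] by blast
      qed
    qed
  qed
  finally show ?thesis .
qed

lemma left_perp_iff:
  assumes T: "subcat T"
  shows "{M \<in> C2. \<forall>X\<in>T. ext1_zero M X} = T \<longleftrightarrow>
    (\<forall>\<gamma>. is_arc \<gamma> \<longrightarrow> (\<gamma> \<in> arcs_of T \<longleftrightarrow> (\<forall>\<beta>\<in>arcs_of T. \<not> bad \<gamma> \<beta>)))"
proof -
  have "{M \<in> C2. \<forall>X\<in>T. ext1_zero M X} = T \<longleftrightarrow> (\<forall>M\<in>C2. (\<forall>X\<in>T. vanish M X) \<longleftrightarrow> M \<in> T)"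
    using ext1_zero_iff_vanish subcat_C2[OF T] by blast
  also have "\<dots> \<longleftrightarrow> (\<forall>\<gamma>. is_arc \<gamma> \<longrightarrow> (\<gamma> \<in> arcs_of T \<longleftrightarrow> (\<forall>\<beta>\<in>arcs_of T. \<not> bad \<gamma> \<beta>)))"
  proof
    assume "\<forall>M\<in>C2. (\<forall>X\<in>T. vanish M X) \<longleftrightarrow> M \<in> T"
    then show "\<forall>\<gamma>. is_arc \<gamma> \<longrightarrow> (\<gamma> \<in> arcs_of T \<longleftrightarrow> (\<forall>\<beta>\<in>arcs_of T. \<not> bad \<gamma> \<beta>))"
      using amod_C2 vanish_subcat_arc(2)[OF T] arc_in_arcs_of by blast
  next
    assume R: "\<forall>\<gamma>. is_arc \<gamma> \<longrightarrow> (\<gamma> \<in> arcs_of T \<longleftrightarrow> (\<forall>\<beta>\<in>arcs_of T. \<not> bad \<gamma> \<beta>))"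
    show "\<forall>M\<in>C2. (\<forall>X\<in>T. vanish M X) \<longleftrightarrow> M \<in> T"
    proof
      fix M assume "M \<in> C2"
      then show "(\<forall>X\<in>T. vanish M X) \<longleftrightarrow> M \<in> T"
      proof (induction M rule: C2_induct)
        case (zero M)
        have "vanish M X" if "X \<in> T" for X using vanish_zero[OF C2_wf[OF zero(1)] C2_wf[OF subcat_C2[OF T that]]] zero(2) by simp
        then show ?case using subcat_zero[OF T zero] by blast
      next
        case (biprod M \<alpha> N)
        note a = amod_C2[OF biprod(2)]
        have "(\<forall>X\<in>T. vanish M X) \<longleftrightarrow> (\<forall>X\<in>T. vanish (amod \<alpha>) X) \<and> (\<forall>X\<in>T. vanish N X)"
          using biprod_vanish_iff(1)[OF biprod(1) a biprod(3,4) subcat_C2[OF T]] by blast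
        moreover have "(\<forall>X\<in>T. vanish (amod \<alpha>) X) \<longleftrightarrow> amod \<alpha> \<in> T"
          unfolding vanish_subcat_arc(2)[OF T biprod(2)] arc_in_arcs_of[OF biprod(2)] using R biprod(2) by blast
        ultimately show ?case using biprod(5) subcat_biprod[OF T biprod(1) a biprod(3,4)] by blast
      qed
    qed
  qed
  finally show ?thesis .
qed

section \<open>Approximations\<close>

definition right_factors :: "gmod \<Rightarrow> (int \<Rightarrow> complex mat) \<Rightarrow> gmod \<Rightarrow> (int \<Rightarrow> complex mat) \<Rightarrow> bool" where
  "right_factors X f Y g \<longleftrightarrow> (\<exists>h. is_hom Y X h \<and> hcomp f h = g)"

definition left_factors :: "gmod \<Rightarrow> (int \<Rightarrow> complex mat) \<Rightarrow> gmod \<Rightarrow> (int \<Rightarrow> complex mat) \<Rightarrow> bool" where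
  "left_factors X f Y g \<longleftrightarrow> (\<exists>h. is_hom X Y h \<and> hcomp h f = g)"

definition right_approx :: "gmod set \<Rightarrow> gmod \<Rightarrow> bool" where
  "right_approx T M \<longleftrightarrow> (\<exists>X f. X \<in> T \<and> is_hom X M f \<and> (\<forall>Y g. Y \<in> T \<and> is_hom Y M g \<longrightarrow> right_factors X f Y g))"

definition left_approx :: "gmod set \<Rightarrow> gmod \<Rightarrow> bool" where
  "left_approx T M \<longleftrightarrow> (\<exists>X f. X \<in> T \<and> is_hom M X f \<and> (\<forall>Y g. Y \<in> T \<and> is_hom M Y g \<longrightarrow> left_factors X f Y g))"

text \<open>The maps factoring through \<open>f\<close> are closed under sums, multiples and
  precomposition; for arc modules this leaves only \<open>hA\<close> and \<open>hB\<close> to be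
  tested.\<close>

lemma right_factors_hadd:
  assumes w: "wf_gmod X" "wf_gmod M" "wf_gmod Y" and f: "is_hom X M f"
    and g: "right_factors X f Y g" "right_factors X f Y g'"
  shows "right_factors X f Y (hadd g g')"
proof -
  obtain h h' where h: "is_hom Y X h" "hcomp f h = g" "is_hom Y X h'" "hcomp f h' = g'" using g unfolding right_factors_def by blast
  have "hcomp f (hadd h h') = hadd g g'"
    unfolding h(2,4)[symmetric] by (rule hcomp_hadd_right[OF is_homD(1)[OF h(1)] is_homD(1)[OF h(3)] is_homD(1)[OF f]])
  then show ?thesis using is_hom_hadd[OF w(3,1) h(1,3)] unfolding right_factors_def by blast
qed

lemma left_factors_hadd:
  assumes w: "wf_gmod X" "wf_gmod M" "wf_gmod Y" and f: "is_hom M X f"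
    and g: "left_factors X f Y g" "left_factors X f Y g'"
  shows "left_factors X f Y (hadd g g')"
proof -
  obtain h h' where h: "is_hom X Y h" "hcomp h f = g" "is_hom X Y h'" "hcomp h' f = g'" using g unfolding left_factors_def by blast
  have "hcomp (hadd h h') f = hadd g g'"
    unfolding h(2,4)[symmetric] by (rule hcomp_hadd_left[OF is_homD(1)[OF f] is_homD(1)[OF h(1)] is_homD(1)[OF h(3)]])
  then show ?thesis using is_hom_hadd[OF w(1,3) h(1,3)] unfolding left_factors_def by blast
qed

lemma hsm_zero:
  assumes "fam M N f"
  shows "hsm 0 f = hzero M N"
  unfolding hsm_def hzero_def by (rule ext, rule eq_matI) (auto simp: fam_dims[OF assms])

text \<open>The factorisation is demanded for nonzero \<open>c\<close> only, to fit
  \<open>hom_arcs\<close>: if a coefficient is zero, the corresponding \<open>hA\<close> or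
  \<open>hB\<close> need not be a homomorphism.\<close>

lemma right_factors_hsm:
  assumes w: "wf_gmod X" "wf_gmod M" "wf_gmod Y" and f: "is_hom X M f" and F: "fam Y M g"
    and g: "c \<noteq> 0 \<Longrightarrow> right_factors X f Y g"
  shows "right_factors X f Y (hsm c g)"
proof (cases "c = 0")
  case True
  have "hcomp f (hzero Y X) = hsm c g" unfolding True hsm_zero[OF F] by (rule hcomp_hzero_right[OF is_homD(1)[OF f]])
  then show ?thesis using is_hom_hzero[OF w(3,1)] unfolding right_factors_def by blast
next
  case False
  then obtain h where h: "is_hom Y X h" "hcomp f h = g" using g unfolding right_factors_def by blast
  have "hcomp f (hsm c h) = hsm c g" unfolding h(2)[symmetric] by (rule hcomp_hsm_right[OF is_homD(1)[OF h(1)] is_homD(1)[OF f]])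
  then show ?thesis using is_hom_hsm[OF w(3,1) h(1)] unfolding right_factors_def by blast
qed

lemma left_factors_hsm:
  assumes w: "wf_gmod X" "wf_gmod M" "wf_gmod Y" and f: "is_hom M X f" and F: "fam M Y g"
    and g: "c \<noteq> 0 \<Longrightarrow> left_factors X f Y g"
  shows "left_factors X f Y (hsm c g)"
proof (cases "c = 0")
  case True
  have "hcomp (hzero X Y) f = hsm c g" unfolding True hsm_zero[OF F] by (rule hcomp_hzero_left[OF is_homD(1)[OF f]])
  then show ?thesis using is_hom_hzero[OF w(1,3)] unfolding left_factors_def by blast
next
  case False
  then obtain h where h: "is_hom X Y h" "hcomp h f = g" using g unfolding left_factors_def by blast
  have "hcomp (hsm c h) f = hsm c g" unfolding h(2)[symmetric] by (rule hcomp_hsm_left[OF is_homD(1)[OF f] is_homD(1)[OF h(1)]])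
  then show ?thesis using is_hom_hsm[OF w(1,3) h(1)] unfolding left_factors_def by blast
qed

lemma right_factors_comp:
  assumes w: "wf_gmod X" "wf_gmod X'" "wf_gmod Y" and f: "is_hom X M f"
    and 1: "right_factors X f X' f'" and 2: "right_factors X' f' Y g"
  shows "right_factors X f Y g"
proof -
  obtain h h' where h: "is_hom X' X h" "hcomp f h = f'" "is_hom Y X' h'" "hcomp f' h' = g" using 1 2 unfolding right_factors_def by blast
  have "hcomp f (hcomp h h') = g"
    unfolding hcomp_assoc[OF is_homD(1)[OF h(3)] is_homD(1)[OF h(1)] is_homD(1)[OF f]] h(2,4) ..
  then show ?thesis using is_hom_hcomp[OF w(3,2,1) h(3,1)] unfolding right_factors_def by blast
qed

lemma left_factors_comp:
  assumes w: "wf_gmod X" "wf_gmod X'" "wf_gmod Y" and f: "is_hom M X f"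
    and 1: "left_factors X f X' f'" and 2: "left_factors X' f' Y g"
  shows "left_factors X f Y g"
proof -
  obtain h h' where h: "is_hom X X' h" "hcomp h f = f'" "is_hom X' Y h'" "hcomp h' f' = g" using 1 2 unfolding left_factors_def by blast
  have "hcomp (hcomp h' h) f = g"
    unfolding hcomp_assoc[OF is_homD(1)[OF f] is_homD(1)[OF h(1)] is_homD(1)[OF h(3)], symmetric] h(2,4) ..
  then show ?thesis using is_hom_hcomp[OF w(1,2,3) h(1,3)] unfolding left_factors_def by blast
qed

lemma hom_to_biprod:
  assumes "biprod_wit M A B i1 i2 p1 p2" "fam Y M g"
  shows "g = hadd (hcomp i1 (hcomp p1 g)) (hcomp i2 (hcomp p2 g))"
proof -
  note bw = biprod_witD[OF assms(1)]
  note F = is_homD(1)[OF bw(1)] is_homD(1)[OF bw(2)] is_homD(1)[OF bw(3)] is_homD(1)[OF bw(4)]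
  have "g = hcomp (hadd (hcomp i1 p1) (hcomp i2 p2)) g" unfolding bw(7) using hcomp_hid_left[OF assms(2)] by simp
  also have "\<dots> = hadd (hcomp i1 (hcomp p1 g)) (hcomp i2 (hcomp p2 g))"
    unfolding hcomp_hadd_left[OF assms(2) fam_hcomp[OF F(3,1)] fam_hcomp[OF F(4,2)]]
      hcomp_assoc[OF assms(2) F(3,1)] hcomp_assoc[OF assms(2) F(4,2)] ..
  finally show ?thesis .
qed

lemma hom_from_biprod:
  assumes "biprod_wit M A B i1 i2 p1 p2" "fam M Y g"
  shows "g = hadd (hcomp (hcomp g i1) p1) (hcomp (hcomp g i2) p2)"
proof -
  note bw = biprod_witD[OF assms(1)]
  note F = is_homD(1)[OF bw(1)] is_homD(1)[OF bw(2)] is_homD(1)[OF bw(3)] is_homD(1)[OF bw(4)]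
  have "g = hcomp g (hadd (hcomp i1 p1) (hcomp i2 p2))" unfolding bw(7) using hcomp_hid_right[OF assms(2)] by simp
  also have "\<dots> = hadd (hcomp (hcomp g i1) p1) (hcomp (hcomp g i2) p2)"
    unfolding hcomp_hadd_right[OF fam_hcomp[OF F(3,1)] fam_hcomp[OF F(4,2)] assms(2)]
      hcomp_assoc[OF F(3,1) assms(2)] hcomp_assoc[OF F(4,2) assms(2)] ..
  finally show ?thesis .
qed

lemma subcat_dsum: "subcat T \<Longrightarrow> X \<in> T \<Longrightarrow> X' \<in> T \<Longrightarrow> dsum X X' \<in> T"
  unfolding subcat_def by blast

text \<open>The map out of the direct sum with components \<open>f\<close> and \<open>f'\<close>
  restricts to both along the inclusions.\<close>

lemma right_pair:
  assumes T: "subcat T" and M: "wf_gmod M" and X: "X \<in> T" "X' \<in> T" and f: "is_hom X M f" "is_hom X' M f'"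
  shows "\<exists>Z k. Z \<in> T \<and> is_hom Z M k \<and> right_factors Z k X f \<and> right_factors Z k X' f'"
proof -
  note w = C2_wf[OF subcat_C2[OF T X(1)]] C2_wf[OF subcat_C2[OF T X(2)]]
  note D = wf_dsum[OF w]
  obtain i1 i2 p1 p2 where b: "biprod_wit (dsum X X') X X' i1 i2 p1 p2" using biprod_dsum[OF w] by blast
  note bw = biprod_witD[OF b]
  have o: "hcomp p1 i2 = hzero X' X" "hcomp p2 i1 = hzero X X'" using b by (auto simp: biprod_wit_def)
  note F = is_homD(1)[OF bw(1)] is_homD(1)[OF bw(2)] is_homD(1)[OF bw(3)] is_homD(1)[OF bw(4)] is_homD(1)[OF f(1)] is_homD(1)[OF f(2)]
  let ?k = "hadd (hcomp f p1) (hcomp f' p2)"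
  have k: "is_hom (dsum X X') M ?k"
    by (rule is_hom_hadd[OF D M is_hom_hcomp[OF D w(1) M bw(3) f(1)] is_hom_hcomp[OF D w(2) M bw(4) f(2)]])
  have "hcomp ?k i1 = f"
    unfolding hcomp_hadd_left[OF F(1) fam_hcomp[OF F(3,5)] fam_hcomp[OF F(4,6)]]
      hcomp_assoc[OF F(1,3,5), symmetric] hcomp_assoc[OF F(1,4,6), symmetric] bw(5) o(2)
      hcomp_hid_right[OF F(5)] hcomp_hzero_right[OF F(6)] by (rule hadd_hzero_right[OF F(5)])
  moreover have "hcomp ?k i2 = f'"
    unfolding hcomp_hadd_left[OF F(2) fam_hcomp[OF F(3,5)] fam_hcomp[OF F(4,6)]]
      hcomp_assoc[OF F(2,3,5), symmetric] hcomp_assoc[OF F(2,4,6), symmetric] bw(6) o(1)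
      hcomp_hid_right[OF F(6)] hcomp_hzero_right[OF F(5)] by (rule hadd_hzero_left[OF F(6)])
  ultimately show ?thesis using k bw(1,2) subcat_dsum[OF T X] unfolding right_factors_def by blast
qed

lemma left_pair:
  assumes T: "subcat T" and M: "wf_gmod M" and X: "X \<in> T" "X' \<in> T" and f: "is_hom M X f" "is_hom M X' f'"
  shows "\<exists>Z k. Z \<in> T \<and> is_hom M Z k \<and> left_factors Z k X f \<and> left_factors Z k X' f'"
proof -
  note w = C2_wf[OF subcat_C2[OF T X(1)]] C2_wf[OF subcat_C2[OF T X(2)]]
  note D = wf_dsum[OF w]
  obtain i1 i2 p1 p2 where b: "biprod_wit (dsum X X') X X' i1 i2 p1 p2" using biprod_dsum[OF w] by blast
  note bw = biprod_witD[OF b]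
  have o: "hcomp p1 i2 = hzero X' X" "hcomp p2 i1 = hzero X X'" using b by (auto simp: biprod_wit_def)
  note F = is_homD(1)[OF bw(1)] is_homD(1)[OF bw(2)] is_homD(1)[OF bw(3)] is_homD(1)[OF bw(4)] is_homD(1)[OF f(1)] is_homD(1)[OF f(2)]
  let ?k = "hadd (hcomp i1 f) (hcomp i2 f')"
  have k: "is_hom M (dsum X X') ?k"
    by (rule is_hom_hadd[OF M D is_hom_hcomp[OF M w(1) D f(1) bw(1)] is_hom_hcomp[OF M w(2) D f(2) bw(2)]])
  have "hcomp p1 ?k = f"
    unfolding hcomp_hadd_right[OF fam_hcomp[OF F(5,1)] fam_hcomp[OF F(6,2)] F(3)]
      hcomp_assoc[OF F(5,1,3)] hcomp_assoc[OF F(6,2,3)] bw(5) o(1)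
      hcomp_hid_left[OF F(5)] hcomp_hzero_left[OF F(6)] by (rule hadd_hzero_right[OF F(5)])
  moreover have "hcomp p2 ?k = f'"
    unfolding hcomp_hadd_right[OF fam_hcomp[OF F(5,1)] fam_hcomp[OF F(6,2)] F(4)]
      hcomp_assoc[OF F(5,1,4)] hcomp_assoc[OF F(6,2,4)] bw(6) o(2)
      hcomp_hid_left[OF F(6)] hcomp_hzero_left[OF F(5)] by (rule hadd_hzero_left[OF F(6)])
  ultimately show ?thesis using k bw(3,4) subcat_dsum[OF T X] unfolding left_factors_def by blast
qed

text \<open>Approximations of the summands are combined; a map into \<open>M\<close> is the sum of
  its two components, each of which lifts.\<close>

lemma right_approx_biprod:
  assumes T: "subcat T" and M: "M \<in> C2" and A: "A \<in> C2" and B: "B \<in> C2" and b: "biprod M A B"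
    and a: "right_approx T A" "right_approx T B"
  shows "right_approx T M"
proof -
  note w = C2_wf[OF M] C2_wf[OF A] C2_wf[OF B]
  obtain i1 i2 p1 p2 where bb: "biprod_wit M A B i1 i2 p1 p2" using b biprod_def by blast
  note bw = biprod_witD[OF bb]
  obtain X f where X: "X \<in> T" "is_hom X A f" "\<And>Y g. Y \<in> T \<Longrightarrow> is_hom Y A g \<Longrightarrow> right_factors X f Y g"
    using a(1) unfolding right_approx_def by blast
  obtain X' f' where X': "X' \<in> T" "is_hom X' B f'" "\<And>Y g. Y \<in> T \<Longrightarrow> is_hom Y B g \<Longrightarrow> right_factors X' f' Y g"
    using a(2) unfolding right_approx_def by blast
  note wX = C2_wf[OF subcat_C2[OF T X(1)]] C2_wf[OF subcat_C2[OF T X'(1)]]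
  obtain Z k where Z: "Z \<in> T" "is_hom Z M k" "right_factors Z k X (hcomp i1 f)" "right_factors Z k X' (hcomp i2 f')"
    using right_pair[OF T w(1) X(1) X'(1) is_hom_hcomp[OF wX(1) w(2,1) X(2) bw(1)] is_hom_hcomp[OF wX(2) w(3,1) X'(2) bw(2)]] by blast
  note wZ = C2_wf[OF subcat_C2[OF T Z(1)]]
  have "right_factors Z k Y g" if Y: "Y \<in> T" and g: "is_hom Y M g" for Y g
  proof -
    note wY = C2_wf[OF subcat_C2[OF T Y]]
    have lift: "right_factors V (hcomp i v) Y (hcomp i g')" if "right_factors V v Y g'" "is_hom V C v" "is_hom C M i" for V C v i g'
    proof -
      obtain h where h: "is_hom Y V h" "hcomp v h = g'" using \<open>right_factors V v Y g'\<close> unfolding right_factors_def by blast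
      have "hcomp (hcomp i v) h = hcomp i g'"
        using hcomp_assoc[OF is_homD(1)[OF h(1)] is_homD(1)[OF that(2)] is_homD(1)[OF that(3)]] h(2) by simp
      then show ?thesis using h(1) unfolding right_factors_def by blast
    qed
    have "right_factors X (hcomp i1 f) Y (hcomp i1 (hcomp p1 g))"
      by (rule lift[OF X(3)[OF Y is_hom_hcomp[OF wY w(1,2) g bw(3)]] X(2) bw(1)])
    then have 1: "right_factors Z k Y (hcomp i1 (hcomp p1 g))" by (rule right_factors_comp[OF wZ wX(1) wY Z(2,3)])
    have "right_factors X' (hcomp i2 f') Y (hcomp i2 (hcomp p2 g))"
      by (rule lift[OF X'(3)[OF Y is_hom_hcomp[OF wY w(1,3) g bw(4)]] X'(2) bw(2)])
    then have 2: "right_factors Z k Y (hcomp i2 (hcomp p2 g))" by (rule right_factors_comp[OF wZ wX(2) wY Z(2,4)])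
    show ?thesis
      using right_factors_hadd[OF wZ w(1) wY Z(2) 1 2] hom_to_biprod[OF bb is_homD(1)[OF g]] by simp
  qed
  then show ?thesis using Z unfolding right_approx_def by blast
qed

lemma left_approx_biprod:
  assumes T: "subcat T" and M: "M \<in> C2" and A: "A \<in> C2" and B: "B \<in> C2" and b: "biprod M A B"
    and a: "left_approx T A" "left_approx T B"
  shows "left_approx T M"
proof -
  note w = C2_wf[OF M] C2_wf[OF A] C2_wf[OF B]
  obtain i1 i2 p1 p2 where bb: "biprod_wit M A B i1 i2 p1 p2" using b biprod_def by blast
  note bw = biprod_witD[OF bb]
  obtain X f where X: "X \<in> T" "is_hom A X f" "\<And>Y g. Y \<in> T \<Longrightarrow> is_hom A Y g \<Longrightarrow> left_factors X f Y g"
    using a(1) unfolding left_approx_def by blast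
  obtain X' f' where X': "X' \<in> T" "is_hom B X' f'" "\<And>Y g. Y \<in> T \<Longrightarrow> is_hom B Y g \<Longrightarrow> left_factors X' f' Y g"
    using a(2) unfolding left_approx_def by blast
  note wX = C2_wf[OF subcat_C2[OF T X(1)]] C2_wf[OF subcat_C2[OF T X'(1)]]
  obtain Z k where Z: "Z \<in> T" "is_hom M Z k" "left_factors Z k X (hcomp f p1)" "left_factors Z k X' (hcomp f' p2)"
    using left_pair[OF T w(1) X(1) X'(1) is_hom_hcomp[OF w(1,2) wX(1) bw(3) X(2)] is_hom_hcomp[OF w(1,3) wX(2) bw(4) X'(2)]] by blast
  note wZ = C2_wf[OF subcat_C2[OF T Z(1)]]
  have "left_factors Z k Y g" if Y: "Y \<in> T" and g: "is_hom M Y g" for Y g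
  proof -
    note wY = C2_wf[OF subcat_C2[OF T Y]]
    have lift: "left_factors V (hcomp v p) Y (hcomp g' p)" if "left_factors V v Y g'" "is_hom C V v" "is_hom M C p" for V C v p g'
    proof -
      obtain h where h: "is_hom V Y h" "hcomp h v = g'" using \<open>left_factors V v Y g'\<close> unfolding left_factors_def by blast
      have "hcomp h (hcomp v p) = hcomp g' p"
        using hcomp_assoc[OF is_homD(1)[OF that(3)] is_homD(1)[OF that(2)] is_homD(1)[OF h(1)]] h(2) by simp
      then show ?thesis using h(1) unfolding left_factors_def by blast
    qed
    have "left_factors X (hcomp f p1) Y (hcomp (hcomp g i1) p1)"
      by (rule lift[OF X(3)[OF Y is_hom_hcomp[OF w(2,1) wY bw(1) g]] X(2) bw(3)])
    then have 1: "left_factors Z k Y (hcomp (hcomp g i1) p1)" by (rule left_factors_comp[OF wZ wX(1) wY Z(2,3)])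
    have "left_factors X' (hcomp f' p2) Y (hcomp (hcomp g i2) p2)"
      by (rule lift[OF X'(3)[OF Y is_hom_hcomp[OF w(3,1) wY bw(2) g]] X'(2) bw(4)])
    then have 2: "left_factors Z k Y (hcomp (hcomp g i2) p2)" by (rule left_factors_comp[OF wZ wX(2) wY Z(2,4)])
    show ?thesis
      using left_factors_hadd[OF wZ w(1) wY Z(2) 1 2] hom_from_biprod[OF bb is_homD(1)[OF g]] by simp
  qed
  then show ?thesis using Z unfolding left_approx_def by blast
qed

lemma zero_gmod_subcat: "subcat T \<Longrightarrow> zero_gmod \<in> T"
  unfolding subcat_def by blast

lemma contrav_finiteI:
  assumes T: "subcat T" and a: "\<And>\<gamma>. is_arc \<gamma> \<Longrightarrow> right_approx T (amod \<gamma>)"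
  shows "contrav_finite T"
proof -
  have "right_approx T M" if "M \<in> C2" for M
    using that
  proof (induction M rule: C2_induct)
    case (zero M)
    note w = wf_zero_gmod C2_wf[OF zero(1)]
    note h = is_hom_hzero[OF w]
    have "right_factors zero_gmod (hzero zero_gmod M) Y g" if Y: "Y \<in> T" "is_hom Y M g" for Y g
    proof -
      have "hcomp (hzero zero_gmod M) (hzero Y zero_gmod) = g"
        by (rule fam_zero_dim[OF _ fam_hcomp[OF fam_hzero fam_hzero] is_homD(1)[OF Y(2)]]) (simp add: zero)
      then show ?thesis using is_hom_hzero[OF C2_wf[OF subcat_C2[OF T Y(1)]] w(1)] unfolding right_factors_def by blast
    qed
    then show ?case using zero_gmod_subcat[OF T] h unfolding right_approx_def by blast
  next
    case (biprod M \<alpha> N)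
    then show ?case using right_approx_biprod[OF T biprod(1) amod_C2[OF biprod(2)] biprod(3,4) a[OF biprod(2)]] by blast
  qed
  then show ?thesis unfolding contrav_finite_def right_approx_def right_factors_def by blast
qed

lemma cov_finiteI:
  assumes T: "subcat T" and a: "\<And>\<gamma>. is_arc \<gamma> \<Longrightarrow> left_approx T (amod \<gamma>)"
  shows "cov_finite T"
proof -
  have "left_approx T M" if "M \<in> C2" for M
    using that
  proof (induction M rule: C2_induct)
    case (zero M)
    note w = wf_zero_gmod C2_wf[OF zero(1)]
    note h = is_hom_hzero[OF w(2,1)]
    have "left_factors zero_gmod (hzero M zero_gmod) Y g" if Y: "Y \<in> T" "is_hom M Y g" for Y g
    proof -
      have "hcomp (hzero zero_gmod Y) (hzero M zero_gmod) = g"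
        by (rule fam_zero_dim[OF _ fam_hcomp[OF fam_hzero fam_hzero] is_homD(1)[OF Y(2)]]) (simp add: zero)
      then show ?thesis using is_hom_hzero[OF w(1) C2_wf[OF subcat_C2[OF T Y(1)]]] unfolding left_factors_def by blast
    qed
    then show ?case using zero_gmod_subcat[OF T] h unfolding left_approx_def by blast
  next
    case (biprod M \<alpha> N)
    then show ?case using left_approx_biprod[OF T biprod(1) amod_C2[OF biprod(2)] biprod(3,4) a[OF biprod(2)]] by blast
  qed
  then show ?thesis unfolding cov_finite_def left_approx_def left_factors_def by blast
qed

text \<open>Iterating the pairing shows that an approximation is found once a finite family is known
  through which all other maps factor.\<close>

lemma right_collect:
  assumes T: "subcat T" and M: "wf_gmod M" and fin: "finite \<Phi>"
    and \<Phi>: "\<And>X f. (X, f) \<in> \<Phi> \<Longrightarrow> X \<in> T \<and> is_hom X M f"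
  shows "\<exists>Z k. Z \<in> T \<and> is_hom Z M k \<and> (\<forall>(X, f) \<in> \<Phi>. right_factors Z k X f)"
  using fin \<Phi>
proof (induction \<Phi> rule: finite_induct)
  case empty
  then show ?case using zero_gmod_subcat[OF T] is_hom_hzero[OF wf_zero_gmod M] by blast
next
  case (insert x \<Phi>)
  obtain X f where x: "x = (X, f)" by fastforce
  obtain Z k where Z: "Z \<in> T" "is_hom Z M k" "\<forall>(X, f) \<in> \<Phi>. right_factors Z k X f" using insert by blast
  have X: "X \<in> T" "is_hom X M f" using insert(4)[of X f] x by auto
  obtain Z' k' where Z': "Z' \<in> T" "is_hom Z' M k'" "right_factors Z' k' Z k" "right_factors Z' k' X f"
    using right_pair[OF T M Z(1) X(1) Z(2) X(2)] by blast
  note w = C2_wf[OF subcat_C2[OF T]]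
  have "right_factors Z' k' Y g" if "(Y, g) \<in> insert x \<Phi>" for Y g
  proof (cases "(Y, g) = x")
    case True then show ?thesis using Z'(4) x by simp
  next
    case False
    then have Yg: "(Y, g) \<in> \<Phi>" using that by simp
    then have "Y \<in> T" using insert(4) by blast
    then show ?thesis using right_factors_comp[OF w[OF Z'(1)] w[OF Z(1)] w Z'(2,3)] Z(3) Yg by blast
  qed
  then show ?case using Z' by blast
qed

lemma left_collect:
  assumes T: "subcat T" and M: "wf_gmod M" and fin: "finite \<Phi>"
    and \<Phi>: "\<And>X f. (X, f) \<in> \<Phi> \<Longrightarrow> X \<in> T \<and> is_hom M X f"
  shows "\<exists>Z k. Z \<in> T \<and> is_hom M Z k \<and> (\<forall>(X, f) \<in> \<Phi>. left_factors Z k X f)"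
  using fin \<Phi>
proof (induction \<Phi> rule: finite_induct)
  case empty
  then show ?case using zero_gmod_subcat[OF T] is_hom_hzero[OF M wf_zero_gmod] by blast
next
  case (insert x \<Phi>)
  obtain X f where x: "x = (X, f)" by fastforce
  obtain Z k where Z: "Z \<in> T" "is_hom M Z k" "\<forall>(X, f) \<in> \<Phi>. left_factors Z k X f" using insert by blast
  have X: "X \<in> T" "is_hom M X f" using insert(4)[of X f] x by auto
  obtain Z' k' where Z': "Z' \<in> T" "is_hom M Z' k'" "left_factors Z' k' Z k" "left_factors Z' k' X f"
    using left_pair[OF T M Z(1) X(1) Z(2) X(2)] by blast
  note w = C2_wf[OF subcat_C2[OF T]]
  have "left_factors Z' k' Y g" if "(Y, g) \<in> insert x \<Phi>" for Y g
  proof (cases "(Y, g) = x")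
    case True then show ?thesis using Z'(4) x by simp
  next
    case False
    then have Yg: "(Y, g) \<in> \<Phi>" using that by simp
    then have "Y \<in> T" using insert(4) by blast
    then show ?thesis using left_factors_comp[OF w[OF Z'(1)] w[OF Z(1)] w Z'(2,3)] Z(3) Yg by blast
  qed
  then show ?case using Z' by blast
qed

text \<open>\<open>FA\<close> and \<open>FB\<close> are the summands of the approximation, mapping to \<open>\<gamma>\<close> by \<open>hA\<close> and \<open>hB\<close>.\<close>
lemma right_approx_arc:
  assumes T: "subcat T" and \<gamma>: "is_arc \<gamma>"
    and FA: "finite FA" "FA \<subseteq> arcs_of T" "\<And>\<beta>. \<beta> \<in> FA \<Longrightarrow> validA \<beta> \<gamma>"
    and FB: "finite FB" "FB \<subseteq> arcs_of T" "\<And>\<beta>. \<beta> \<in> FB \<Longrightarrow> validB \<beta> \<gamma>"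
    and cA: "\<And>\<delta>. \<delta> \<in> arcs_of T \<Longrightarrow> validA \<delta> \<gamma> \<Longrightarrow> \<exists>\<beta>\<in>FA. validA \<delta> \<beta>"
    and cB: "\<And>\<delta>. \<delta> \<in> arcs_of T \<Longrightarrow> validB \<delta> \<gamma> \<Longrightarrow> (\<exists>\<beta>\<in>FA. validB \<delta> \<beta>) \<or> (\<exists>\<beta>\<in>FB. validA \<delta> \<beta>)"
  shows "right_approx T (amod \<gamma>)"
proof -
  note G = wf_amod[OF \<gamma>]
  have arcs: "is_arc \<beta>" "amod \<beta> \<in> T" if "\<beta> \<in> arcs_of T" for \<beta> using that by (auto simp: arcs_of_def)
  define \<Phi> where "\<Phi> = (\<lambda>\<beta>. (amod \<beta>, hA \<beta> \<gamma>)) ` FA \<union> (\<lambda>\<beta>. (amod \<beta>, hB \<beta> \<gamma>)) ` FB"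
  have "finite \<Phi>" using FA(1) FB(1) by (simp add: \<Phi>_def)
  moreover have "X \<in> T \<and> is_hom X (amod \<gamma>) f" if "(X, f) \<in> \<Phi>" for X f
    using that FA(2,3) FB(2,3) arcs is_hom_hA[OF _ \<gamma>] is_hom_hB[OF _ \<gamma>] unfolding \<Phi>_def by auto
  ultimately obtain Z k where Z: "Z \<in> T" "is_hom Z (amod \<gamma>) k" "\<forall>(X, f) \<in> \<Phi>. right_factors Z k X f"
    using right_collect[OF T G] by metis
  note wZ = C2_wf[OF subcat_C2[OF T Z(1)]]
  have thr: "right_factors Z k (amod \<delta>) g"
    if "(amod \<beta>, f) \<in> \<Phi>" "is_arc \<beta>" "is_arc \<delta>" "is_hom (amod \<delta>) (amod \<beta>) h" "hcomp f h = g" for \<beta> \<delta> f g h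
  proof (rule right_factors_comp[OF wZ wf_amod[OF that(2)] wf_amod[OF that(3)] Z(2)])
    show "right_factors Z k (amod \<beta>) f" using Z(3) that(1) by blast
    show "right_factors (amod \<beta>) f (amod \<delta>) g" using that(4,5) unfolding right_factors_def by blast
  qed
  have fA: "right_factors Z k (amod \<delta>) (hA \<delta> \<gamma>)" if d: "\<delta> \<in> arcs_of T" "validA \<delta> \<gamma>" for \<delta>
  proof -
    obtain \<beta> where \<beta>: "\<beta> \<in> FA" "validA \<delta> \<beta>" using cA[OF d] by blast
    note b = arcs(1)[OF d(1)] arcs(1)[of \<beta>]
    have \<beta>a: "is_arc \<beta>" using \<beta> FA(2) arcs by blast
    show ?thesis
      by (rule thr[OF _ \<beta>a b(1) is_hom_hA[OF b(1) \<beta>a \<beta>(2)] hcomp_hAB(1)[OF b(1) \<beta>a \<gamma> \<beta>(2)]]) (use \<beta>(1) in \<open>simp add: \<Phi>_def\<close>)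
  qed
  have fB: "right_factors Z k (amod \<delta>) (hB \<delta> \<gamma>)" if d: "\<delta> \<in> arcs_of T" "validB \<delta> \<gamma>" for \<delta>
  proof -
    note b = arcs(1)[OF d(1)]
    \<comment> \<open>A map \<open>hB\<close> into \<open>\<gamma>\<close> can be factored in two
      ways: as \<open>hB\<close> followed by a member \<open>hA\<close> of the family, or as
      \<open>hA\<close> followed by a member \<open>hB\<close>.\<close>
    from cB[OF d] show ?thesis
    proof
      assume "\<exists>\<beta>\<in>FA. validB \<delta> \<beta>"
      then obtain \<beta> where \<beta>: "\<beta> \<in> FA" "validB \<delta> \<beta>" by blast
      have \<beta>a: "is_arc \<beta>" using \<beta> FA(2) arcs by blast
      show ?thesis
        by (rule thr[OF _ \<beta>a b is_hom_hB[OF b \<beta>a \<beta>(2)] hcomp_hAB(2)[OF b \<beta>a \<gamma> \<beta>(2)]]) (use \<beta>(1) in \<open>simp add: \<Phi>_def\<close>)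
    next
      assume "\<exists>\<beta>\<in>FB. validA \<delta> \<beta>"
      then obtain \<beta> where \<beta>: "\<beta> \<in> FB" "validA \<delta> \<beta>" by blast
      have \<beta>a: "is_arc \<beta>" using \<beta> FB(2) arcs by blast
      show ?thesis
        by (rule thr[OF _ \<beta>a b is_hom_hA[OF b \<beta>a \<beta>(2)] hcomp_hAB(3)[OF b \<beta>a \<gamma> \<beta>(2)]]) (use \<beta>(1) in \<open>simp add: \<Phi>_def\<close>)
    qed
  qed
  have "right_factors Z k Y g" if "Y \<in> C2" "Y \<in> T" "is_hom Y (amod \<gamma>) g" for Y g
    using that
  proof (induction Y arbitrary: g rule: C2_induct)
    case (zero M)
    have "hcomp k (hzero M Z) = g"
      by (rule fam_zero_dim[OF _ fam_hcomp[OF fam_hzero is_homD(1)[OF Z(2)]] is_homD(1)[OF zero(4)]]) (use zero in simp)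
    then show ?case using is_hom_hzero[OF C2_wf[OF zero(1)] wZ] unfolding right_factors_def by blast
  next
    case (biprod M \<alpha> N)
    note A = amod_C2[OF biprod(2)]
    note w = C2_wf[OF biprod(1)] C2_wf[OF A] C2_wf[OF biprod(3)]
    have TT: "amod \<alpha> \<in> T" "N \<in> T" using subcat_biprod[OF T biprod(1) A biprod(3,4)] biprod by auto
    have \<alpha>S: "\<alpha> \<in> arcs_of T" using TT(1) biprod(2) by (simp add: arcs_of_def)
    obtain i1 i2 p1 p2 where bb: "biprod_wit M (amod \<alpha>) N i1 i2 p1 p2" using biprod(4) biprod_def by blast
    note bw = biprod_witD[OF bb]
    have ga: "is_hom (amod \<alpha>) (amod \<gamma>) (hcomp g i1)" by (rule is_hom_hcomp[OF w(2,1) G bw(1) biprod(7)])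
    have gn: "is_hom N (amod \<gamma>) (hcomp g i2)" by (rule is_hom_hcomp[OF w(3,1) G bw(2) biprod(7)])
    obtain p q where pq: "hcomp g i1 = hadd (hsm p (hA \<alpha> \<gamma>)) (hsm q (hB \<alpha> \<gamma>))" "p \<noteq> 0 \<Longrightarrow> validA \<alpha> \<gamma>" "q \<noteq> 0 \<Longrightarrow> validB \<alpha> \<gamma>"
      using hom_arcs[OF biprod(2) \<gamma> ga] by blast
    have 1: "right_factors Z k (amod \<alpha>) (hcomp g i1)"
      unfolding pq(1)
      by (rule right_factors_hadd[OF wZ G w(2) Z(2)]; rule right_factors_hsm[OF wZ G w(2) Z(2)])
        (use fam_hAB[OF biprod(2) \<gamma>] fA[OF \<alpha>S] fB[OF \<alpha>S] pq(2,3) in auto)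
    have 2: "right_factors Z k N (hcomp g i2)" by (rule biprod(5)[OF TT(2) gn])
    have pre: "right_factors Z k M (hcomp u v)" if W: "right_factors Z k C u" "is_hom M C v" "wf_gmod C" for C u v
    proof -
      obtain h where h: "is_hom C Z h" "hcomp k h = u" using W(1) unfolding right_factors_def by blast
      have "hcomp k (hcomp h v) = hcomp u v"
        using hcomp_assoc[OF is_homD(1)[OF that(2)] is_homD(1)[OF h(1)] is_homD(1)[OF Z(2)]] h(2) by simp
      then show ?thesis using is_hom_hcomp[OF w(1) that(3) wZ that(2) h(1)] unfolding right_factors_def by blast
    qed
    show ?case
      using right_factors_hadd[OF wZ G w(1) Z(2) pre[OF 1 bw(3) w(2)] pre[OF 2 bw(4) w(3)]]
        hom_from_biprod[OF bb is_homD(1)[OF biprod(7)]] by simp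
  qed
  then show ?thesis using Z subcat_C2[OF T] unfolding right_approx_def by blast
qed

text \<open>Dually, maps out of \<open>\<gamma>\<close> are continued by \<open>hA\<close>, which
  preserves their type, so the two families cover the two types separately.\<close>

lemma left_approx_arc:
  assumes T: "subcat T" and \<gamma>: "is_arc \<gamma>"
    and FA: "finite FA" "FA \<subseteq> arcs_of T" "\<And>\<beta>. \<beta> \<in> FA \<Longrightarrow> validA \<gamma> \<beta>"
    and FB: "finite FB" "FB \<subseteq> arcs_of T" "\<And>\<beta>. \<beta> \<in> FB \<Longrightarrow> validB \<gamma> \<beta>"
    and cA: "\<And>\<delta>. \<delta> \<in> arcs_of T \<Longrightarrow> validA \<gamma> \<delta> \<Longrightarrow> \<exists>\<beta>\<in>FA. validA \<beta> \<delta>"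
    and cB: "\<And>\<delta>. \<delta> \<in> arcs_of T \<Longrightarrow> validB \<gamma> \<delta> \<Longrightarrow> \<exists>\<beta>\<in>FB. validA \<beta> \<delta>"
  shows "left_approx T (amod \<gamma>)"
proof -
  note G = wf_amod[OF \<gamma>]
  have arcs: "is_arc \<beta>" "amod \<beta> \<in> T" if "\<beta> \<in> arcs_of T" for \<beta> using that by (auto simp: arcs_of_def)
  define \<Phi> where "\<Phi> = (\<lambda>\<beta>. (amod \<beta>, hA \<gamma> \<beta>)) ` FA \<union> (\<lambda>\<beta>. (amod \<beta>, hB \<gamma> \<beta>)) ` FB"
  have "finite \<Phi>" using FA(1) FB(1) by (simp add: \<Phi>_def)
  moreover have "X \<in> T \<and> is_hom (amod \<gamma>) X f" if "(X, f) \<in> \<Phi>" for X f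
    using that FA(2,3) FB(2,3) arcs is_hom_hA[OF \<gamma>] is_hom_hB[OF \<gamma>] unfolding \<Phi>_def by auto
  ultimately obtain Z k where Z: "Z \<in> T" "is_hom (amod \<gamma>) Z k" "\<forall>(X, f) \<in> \<Phi>. left_factors Z k X f"
    using left_collect[OF T G] by metis
  note wZ = C2_wf[OF subcat_C2[OF T Z(1)]]
  have thr: "left_factors Z k (amod \<delta>) g"
    if "(amod \<beta>, f) \<in> \<Phi>" "is_arc \<beta>" "is_arc \<delta>" "is_hom (amod \<beta>) (amod \<delta>) h" "hcomp h f = g" for \<beta> \<delta> f g h
  proof (rule left_factors_comp[OF wZ wf_amod[OF that(2)] wf_amod[OF that(3)] Z(2)])
    show "left_factors Z k (amod \<beta>) f" using Z(3) that(1) by blast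
    show "left_factors (amod \<beta>) f (amod \<delta>) g" using that(4,5) unfolding left_factors_def by blast
  qed
  have fA: "left_factors Z k (amod \<delta>) (hA \<gamma> \<delta>)" if d: "\<delta> \<in> arcs_of T" "validA \<gamma> \<delta>" for \<delta>
  proof -
    note b = arcs(1)[OF d(1)]
    obtain \<beta> where \<beta>: "\<beta> \<in> FA" "validA \<beta> \<delta>" using cA[OF d] by blast
    have \<beta>a: "is_arc \<beta>" using \<beta> FA(2) arcs by blast
    show ?thesis
      by (rule thr[OF _ \<beta>a b is_hom_hA[OF \<beta>a b \<beta>(2)] hcomp_hAB(1)[OF \<gamma> \<beta>a b FA(3)[OF \<beta>(1)]]]) (use \<beta>(1) in \<open>simp add: \<Phi>_def\<close>)
  qed
  have fB: "left_factors Z k (amod \<delta>) (hB \<gamma> \<delta>)" if d: "\<delta> \<in> arcs_of T" "validB \<gamma> \<delta>" for \<delta>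
  proof -
    note b = arcs(1)[OF d(1)]
    obtain \<beta> where \<beta>: "\<beta> \<in> FB" "validA \<beta> \<delta>" using cB[OF d] by blast
    have \<beta>a: "is_arc \<beta>" using \<beta> FB(2) arcs by blast
    show ?thesis
      by (rule thr[OF _ \<beta>a b is_hom_hA[OF \<beta>a b \<beta>(2)] hcomp_hAB(2)[OF \<gamma> \<beta>a b FB(3)[OF \<beta>(1)]]]) (use \<beta>(1) in \<open>simp add: \<Phi>_def\<close>)
  qed
  have "left_factors Z k Y g" if "Y \<in> C2" "Y \<in> T" "is_hom (amod \<gamma>) Y g" for Y g
    using that
  proof (induction Y arbitrary: g rule: C2_induct)
    case (zero M)
    have "hcomp (hzero Z M) k = g"
      by (rule fam_zero_dim[OF _ fam_hcomp[OF is_homD(1)[OF Z(2)] fam_hzero] is_homD(1)[OF zero(4)]]) (use zero in simp)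
    then show ?case using is_hom_hzero[OF wZ C2_wf[OF zero(1)]] unfolding left_factors_def by blast
  next
    case (biprod M \<alpha> N)
    note A = amod_C2[OF biprod(2)]
    note w = C2_wf[OF biprod(1)] C2_wf[OF A] C2_wf[OF biprod(3)]
    have TT: "amod \<alpha> \<in> T" "N \<in> T" using subcat_biprod[OF T biprod(1) A biprod(3,4)] biprod by auto
    have \<alpha>S: "\<alpha> \<in> arcs_of T" using TT(1) biprod(2) by (simp add: arcs_of_def)
    obtain i1 i2 p1 p2 where bb: "biprod_wit M (amod \<alpha>) N i1 i2 p1 p2" using biprod(4) biprod_def by blast
    note bw = biprod_witD[OF bb]
    have ga: "is_hom (amod \<gamma>) (amod \<alpha>) (hcomp p1 g)" by (rule is_hom_hcomp[OF G w(1,2) biprod(7) bw(3)])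
    have gn: "is_hom (amod \<gamma>) N (hcomp p2 g)" by (rule is_hom_hcomp[OF G w(1,3) biprod(7) bw(4)])
    obtain p q where pq: "hcomp p1 g = hadd (hsm p (hA \<gamma> \<alpha>)) (hsm q (hB \<gamma> \<alpha>))" "p \<noteq> 0 \<Longrightarrow> validA \<gamma> \<alpha>" "q \<noteq> 0 \<Longrightarrow> validB \<gamma> \<alpha>"
      using hom_arcs[OF \<gamma> biprod(2) ga] by blast
    have 1: "left_factors Z k (amod \<alpha>) (hcomp p1 g)"
      unfolding pq(1)
      by (rule left_factors_hadd[OF wZ G w(2) Z(2)]; rule left_factors_hsm[OF wZ G w(2) Z(2)])
        (use fam_hAB[OF \<gamma> biprod(2)] fA[OF \<alpha>S] fB[OF \<alpha>S] pq(2,3) in auto)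
    have 2: "left_factors Z k N (hcomp p2 g)" by (rule biprod(5)[OF TT(2) gn])
    have post: "left_factors Z k M (hcomp v u)" if W: "left_factors Z k C u" "is_hom C M v" "wf_gmod C" for C u v
    proof -
      obtain h where h: "is_hom Z C h" "hcomp h k = u" using W(1) unfolding left_factors_def by blast
      have "hcomp (hcomp v h) k = hcomp v u"
        using hcomp_assoc[OF is_homD(1)[OF Z(2)] is_homD(1)[OF h(1)] is_homD(1)[OF that(2)]] h(2) by simp
      then show ?thesis using is_hom_hcomp[OF wZ that(3) w(1) h(1) that(2)] unfolding left_factors_def by blast
    qed
    show ?case
      using left_factors_hadd[OF wZ G w(1) Z(2) post[OF 1 bw(1) w(2)] post[OF 2 bw(2) w(3)]]
        hom_to_biprod[OF bb is_homD(1)[OF biprod(7)]] by simp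
  qed
  then show ?thesis using Z subcat_C2[OF T] unfolding left_approx_def by blast
qed

section \<open>Fountains\<close>

text \<open>With \<open>x0\<close> fixed, any \<open>x\<close> not dominated by it has one of its
  two values below that of \<open>x0\<close>. There are finitely many such values, and for each of
  them an element minimising the other value suffices.\<close>

lemma dickson:
  fixes f g :: "'a \<Rightarrow> nat"
  shows "\<exists>F. finite F \<and> F \<subseteq> P \<and> (\<forall>x\<in>P. \<exists>y\<in>F. f y \<le> f x \<and> g y \<le> g x)"
proof (cases "P = {}")
  case False
  then obtain x0 where x0: "x0 \<in> P" by blast
  have "\<forall>i. \<exists>y. (\<exists>x\<in>P. f x = i) \<longrightarrow> y \<in> P \<and> f y = i \<and> (\<forall>x\<in>P. f x = i \<longrightarrow> g y \<le> g x)"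
    using ex_has_least_nat[of "\<lambda>x. x \<in> P \<and> f x = i" _ g for i] by metis
  then obtain u where u: "\<And>i x. x \<in> P \<Longrightarrow> f x = i \<Longrightarrow> u i \<in> P \<and> f (u i) = i \<and> g (u i) \<le> g x" by metis
  have "\<forall>i. \<exists>y. (\<exists>x\<in>P. g x = i) \<longrightarrow> y \<in> P \<and> g y = i \<and> (\<forall>x\<in>P. g x = i \<longrightarrow> f y \<le> f x)"
    using ex_has_least_nat[of "\<lambda>x. x \<in> P \<and> g x = i" _ f for i] by metis
  then obtain v where v: "\<And>i x. x \<in> P \<Longrightarrow> g x = i \<Longrightarrow> v i \<in> P \<and> g (v i) = i \<and> f (v i) \<le> f x" by metis
  define F where "F = ({x0} \<union> u ` {..<f x0} \<union> v ` {..<g x0}) \<inter> P"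
  have "\<exists>y\<in>F. f y \<le> f x \<and> g y \<le> g x" if x: "x \<in> P" for x
  proof -
    consider "f x0 \<le> f x" "g x0 \<le> g x" | "f x < f x0" | "g x < g x0" by linarith
    then show ?thesis
    proof cases
      case 1 then show ?thesis using x0 by (auto simp: F_def)
    next
      case 2 then show ?thesis using u[OF x refl] by (intro bexI[of _ "u (f x)"]) (auto simp: F_def)
    next
      case 3 then show ?thesis using v[OF x refl] by (intro bexI[of _ "v (g x)"]) (auto simp: F_def)
    qed
  qed
  moreover have "finite F" "F \<subseteq> P" by (auto simp: F_def)
  ultimately show ?thesis by blast
qed blast

text \<open>Between finite arcs \<open>validA\<close> is the product order on the ends; measured
  downwards from the bounds \<open>c\<close> and \<open>d\<close> it becomes the order in
  \<open>dickson\<close>.\<close>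

lemma finite_maximal_arcs:
  assumes "\<And>\<delta>. \<delta> \<in> P \<Longrightarrow> \<exists>p q. \<delta> = (Fin p, q) \<and> p \<le> c \<and> q \<le> d"
  shows "\<exists>F. finite F \<and> F \<subseteq> P \<and> (\<forall>\<delta>\<in>P. \<exists>\<beta>\<in>F. validA \<delta> \<beta>)"
proof -
  define f where "f \<delta> = (case fst \<delta> of NegInf \<Rightarrow> 0 | Fin p \<Rightarrow> nat (c - p))" for \<delta> :: arc
  define g where "g \<delta> = nat (d - snd \<delta>)" for \<delta> :: arc
  obtain F where F: "finite F" "F \<subseteq> P" "\<forall>x\<in>P. \<exists>y\<in>F. f y \<le> f x \<and> g y \<le> g x" using dickson[of P f g] by blast
  have "validA \<delta> \<beta>" if m: "\<delta> \<in> P" "\<beta> \<in> P" "f \<beta> \<le> f \<delta>" "g \<beta> \<le> g \<delta>" for \<delta> \<beta>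
    using assms[OF m(1)] assms[OF m(2)] m(3,4) by (auto simp: f_def g_def validA_def)
  then have "\<exists>\<beta>\<in>F. validA \<delta> \<beta>" if "\<delta> \<in> P" for \<delta>
    using F(2,3) that by (metis subsetD)
  then show ?thesis using F(1,2) by blast
qed

lemma finite_minimal_arcs:
  assumes "\<And>\<delta>. \<delta> \<in> P \<Longrightarrow> \<exists>p q. \<delta> = (Fin p, q) \<and> c \<le> p \<and> d \<le> q"
  shows "\<exists>F. finite F \<and> F \<subseteq> P \<and> (\<forall>\<delta>\<in>P. \<exists>\<beta>\<in>F. validA \<beta> \<delta>)"
proof -
  define f where "f \<delta> = (case fst \<delta> of NegInf \<Rightarrow> 0 | Fin p \<Rightarrow> nat (p - c))" for \<delta> :: arc
  define g where "g \<delta> = nat (snd \<delta> - d)" for \<delta> :: arc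
  obtain F where F: "finite F" "F \<subseteq> P" "\<forall>x\<in>P. \<exists>y\<in>F. f y \<le> f x \<and> g y \<le> g x" using dickson[of P f g] by blast
  have "validA \<beta> \<delta>" if m: "\<delta> \<in> P" "\<beta> \<in> P" "f \<beta> \<le> f \<delta>" "g \<beta> \<le> g \<delta>" for \<delta> \<beta>
    using assms[OF m(1)] assms[OF m(2)] m(3,4) by (auto simp: f_def g_def validA_def)
  then have "\<exists>\<beta>\<in>F. validA \<beta> \<delta>" if "\<delta> \<in> P" for \<delta>
    using F(2,3) that by (metis subsetD)
  then show ?thesis using F(1,2) by blast
qed

lemma validA_refl: "validA \<delta> \<delta>"
  by (cases "fst \<delta>") (auto simp: validA_def)

lemma strict_mono_unbounded:
  fixes b :: "nat \<Rightarrow> int"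
  assumes "strict_mono b"
  shows "\<exists>i. x < b i"
proof -
  have "b 0 + int i \<le> b i" for i
  proof (induction i)
    case (Suc i)
    have "b i < b (Suc i)" using assms by (simp add: strict_mono_Suc_iff)
    then show ?case using Suc by simp
  qed simp
  from this[of "nat (x - b 0) + 1"] show ?thesis by (intro exI[of _ "nat (x - b 0) + 1"]) linarith
qed

text \<open>A strictly decreasing sequence of left ends cannot contain \<open>NegInf\<close>, so the
  two sequences say no more than that the other ends are unbounded; conversely, unboundedness allows
  them to be chosen successively.\<close>

lemma fountain_iff:
  "has_fountain_at S a \<longleftrightarrow> (\<forall>x. \<exists>q>x. (Fin a, q) \<in> S) \<and> (\<forall>x. \<exists>p<x. (Fin p, a) \<in> S)"
proof
  assume "has_fountain_at S a"
  then obtain b :: "nat \<Rightarrow> int" and c where b: "strict_mono b" "\<And>i. (Fin a, b i) \<in> S"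
    and c: "\<And>i. ext_less (c (Suc i)) (c i)" "\<And>i. (c i, a) \<in> S" unfolding has_fountain_at_def by blast
  have "c i \<noteq> NegInf" for i using c(1)[of i] by (cases "c (Suc i)") auto
  then have "\<exists>e. c i = Fin e" for i by (cases "c i") auto
  then obtain e where e: "\<And>i. c i = Fin (e i)" by metis
  have "strict_mono (\<lambda>i. - e i)" using c(1) unfolding strict_mono_Suc_iff e by simp
  then have "\<exists>i. e i < x" for x using strict_mono_unbounded[of _ "- x"] by fastforce
  then show "(\<forall>x. \<exists>q>x. (Fin a, q) \<in> S) \<and> (\<forall>x. \<exists>p<x. (Fin p, a) \<in> S)"
    using strict_mono_unbounded[OF b(1)] b(2) c(2) unfolding e by blast
next
  assume R: "(\<forall>x. \<exists>q>x. (Fin a, q) \<in> S) \<and> (\<forall>x. \<exists>p<x. (Fin p, a) \<in> S)"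
  obtain b where b: "\<And>i :: nat. (Fin a, b i) \<in> S \<and> b i < b (Suc i)"
    using dependent_nat_choice[of "\<lambda>_ q. (Fin a, q) \<in> S" "\<lambda>_ q q'. q < q'"] R by metis
  obtain e where e: "\<And>i :: nat. (Fin (e i), a) \<in> S \<and> e (Suc i) < e i"
    using dependent_nat_choice[of "\<lambda>_ p. (Fin p, a) \<in> S" "\<lambda>_ p p'. p' < p"] R by metis
  have "strict_mono b" using b by (simp add: strict_mono_Suc_iff)
  moreover have "ext_less (Fin (e (Suc i))) (Fin (e i))" for i using e by simp
  ultimately show "has_fountain_at S a" unfolding has_fountain_at_def
    using b e by (intro conjI exI[of _ b] exI[of _ "\<lambda>i. Fin (e i)"]) auto
qed

section \<open>Finite covers by arcs in a triangulation with a fountain\<close>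

locale fountain_triangulation =
  fixes S :: "arc set" and a :: int
  assumes arcs: "\<And>\<delta>. \<delta> \<in> S \<Longrightarrow> is_arc \<delta>"
    and noncross: "\<And>\<delta> \<beta>. \<delta> \<in> S \<Longrightarrow> \<beta> \<in> S \<Longrightarrow> \<not> arcs_cross \<delta> \<beta>"
    and maximal: "\<And>\<delta>. is_arc \<delta> \<Longrightarrow> (\<And>\<beta>. \<beta> \<in> S \<Longrightarrow> \<not> arcs_cross \<delta> \<beta>) \<Longrightarrow> \<delta> \<in> S"
    and right: "\<And>x. \<exists>q>x. (Fin a, q) \<in> S" and left: "\<And>x. \<exists>p<x. (Fin p, a) \<in> S"
begin

lemma fin_arc: "(Fin p, q) \<in> S \<Longrightarrow> p < q"
  using arcs[of "(Fin p, q)"] by (simp add: is_arc_def)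

text \<open>An arc passing strictly over \<open>a\<close> would be crossed by a long enough arc of
  the right fountain.\<close>

lemma not_over: "(Fin p, q) \<in> S \<Longrightarrow> q \<le> a \<or> a \<le> p"
proof (rule ccontr)
  assume s: "(Fin p, q) \<in> S" and "\<not> (q \<le> a \<or> a \<le> p)"
  then have pq: "p < a" "a < q" by auto
  obtain r where "r > q" "(Fin a, r) \<in> S" using right by blast
  then show False using noncross[OF s] pq by (fastforce simp: arcs_cross_def)
qed

text \<open>Crossing this arc means passing strictly over \<open>a\<close>, which
  \<open>not_over\<close> excludes; maximality then puts the arc into \<open>S\<close>.\<close>

lemma inf_in: "(NegInf, a) \<in> S"
proof (rule maximal)
  fix \<beta> assume b: "\<beta> \<in> S"
  obtain c d where \<beta>: "\<beta> = (c, d)" by fastforce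
  show "\<not> arcs_cross (NegInf, a) \<beta>"
    using b not_over unfolding \<beta> by (cases c) (fastforce simp: arcs_cross_def)+
qed (simp add: is_arc_def)

text \<open>An infinite arc ending to the right of \<open>a\<close> is crossed by the right
  fountain, one ending to the left by the left fountain.\<close>

lemma inf_unique: "(NegInf, d) \<in> S \<Longrightarrow> d = a"
proof (rule ccontr)
  assume s: "(NegInf, d) \<in> S" and "d \<noteq> a"
  then consider "d > a" | "d < a" by linarith
  then show False
  proof cases
    case 1
    obtain q where "q > d" "(Fin a, q) \<in> S" using right by blast
    then show False using noncross[OF s] 1 by (fastforce simp: arcs_cross_def)
  next
    case 2
    obtain p where "p < d" "(Fin p, a) \<in> S" using left by blast
    then show False using noncross[OF s] 2 by (fastforce simp: arcs_cross_def)
  qed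
qed

lemma not_bad: "\<beta> \<in> S \<Longrightarrow> \<delta> \<in> S \<Longrightarrow> \<not> bad \<beta> \<delta>"
proof -
  assume s: "\<beta> \<in> S" "\<delta> \<in> S"
  have "snd \<beta> = a" if "fst \<beta> = NegInf" "\<beta> \<in> S" for \<beta> using inf_unique[of "snd \<beta>"] that by (cases \<beta>) auto
  then show ?thesis using noncross s unfolding bad_def by (metis less_irrefl)
qed

lemma arc_forms:
  assumes "\<delta> \<in> S"
  obtains "\<delta> = (NegInf, a)" | p q where "\<delta> = (Fin p, q)" "p < q" "q \<le> a \<or> a \<le> p"
proof (cases "fst \<delta>")
  case NegInf
  then show thesis using that(1) inf_unique[of "snd \<delta>"] assms by (cases \<delta>) auto
next
  case (Fin p)
  then have "\<delta> = (Fin p, snd \<delta>)" by (cases \<delta>) auto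
  then show thesis using that(2) fin_arc not_over assms by metis
qed

text \<open>An arc starting strictly between \<open>a\<close> and \<open>N\<close> must stay under
  the fountain arc \<open>(a, N)\<close>, which bounds its right end.\<close>

lemma finite_right: "finite {\<delta> \<in> S. \<exists>p q. \<delta> = (Fin p, q) \<and> a < p \<and> p \<le> d}"
proof -
  obtain N where N: "N > d" "(Fin a, N) \<in> S" using right by blast
  have "\<delta> \<in> (\<lambda>(p, q). (Fin p, q)) ` ({a..d} \<times> {a..N})"
    if s: "\<delta> \<in> S" and f: "\<delta> = (Fin p, q)" "a < p" "p \<le> d" for \<delta> p q
  proof -
    have "\<not> arcs_cross (Fin a, N) (Fin p, q)" using noncross[OF N(2)] s f by simp
    then have "q \<le> N" using f N by (auto simp: arcs_cross_def)
    moreover have "p < q" using fin_arc s f by blast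
    ultimately show ?thesis using f by auto
  qed
  then show ?thesis by (intro finite_subset[OF _ finite_imageI[of "{a..d} \<times> {a..N}" "\<lambda>(p, q). (Fin p, q)"]]) auto
qed

lemma finite_left: "finite {\<delta> \<in> S. \<exists>p q. \<delta> = (Fin p, q) \<and> c \<le> q \<and> q < a}"
proof -
  obtain N where N: "N < c" "(Fin N, a) \<in> S" using left by blast
  have "\<delta> \<in> (\<lambda>(p, q). (Fin p, q)) ` ({N..a} \<times> {c..a})"
    if s: "\<delta> \<in> S" and f: "\<delta> = (Fin p, q)" "c \<le> q" "q < a" for \<delta> p q
  proof -
    have "\<not> arcs_cross (Fin N, a) (Fin p, q)" using noncross[OF N(2)] s f by simp
    then have "N \<le> p" using f N by (auto simp: arcs_cross_def)
    moreover have "p < q" using fin_arc s f by blast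
    ultimately show ?thesis using f by auto
  qed
  then show ?thesis by (intro finite_subset[OF _ finite_imageI[of "{N..a} \<times> {c..a}" "\<lambda>(p, q). (Fin p, q)"]]) auto
qed

text \<open>The finite arcs mapping by \<open>hA\<close> to \<open>\<gamma>\<close> have both ends
  bounded by those of \<open>\<gamma>\<close>, and there are none if \<open>\<gamma>\<close> is
  infinite. The infinite arc, if it maps to \<open>\<gamma>\<close>, is added by hand.\<close>

lemma cover_rightA:
  "\<exists>F. finite F \<and> F \<subseteq> {\<delta> \<in> S. validA \<delta> \<gamma>} \<and> (\<forall>\<delta>\<in>S. validA \<delta> \<gamma> \<longrightarrow> (\<exists>\<beta>\<in>F. validA \<delta> \<beta>))"
proof -
  let ?I = "{\<delta> \<in> S. validA \<delta> \<gamma> \<and> fst \<delta> \<noteq> NegInf}"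
  have "\<exists>F. finite F \<and> F \<subseteq> ?I \<and> (\<forall>\<delta>\<in>?I. \<exists>\<beta>\<in>F. validA \<delta> \<beta>)"
  proof (cases "fst \<gamma>")
    case NegInf
    then have "?I = {}" by (auto simp: validA_def ele.simps split: prod.splits elim!: arc_forms)
    then show ?thesis by blast
  next
    case (Fin c)
    show ?thesis
    proof (rule finite_maximal_arcs[of _ c "snd \<gamma>"])
      fix \<delta> assume d: "\<delta> \<in> ?I"
      then show "\<exists>p q. \<delta> = (Fin p, q) \<and> p \<le> c \<and> q \<le> snd \<gamma>"
        using Fin by (cases \<delta>; cases "fst \<delta>") (auto simp: validA_def)
    qed
  qed
  then obtain F where F: "finite F" "F \<subseteq> ?I" "\<forall>\<delta>\<in>?I. \<exists>\<beta>\<in>F. validA \<delta> \<beta>" by blast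
  let ?F = "F \<union> {\<delta>. \<delta> = (NegInf, a) \<and> validA \<delta> \<gamma>}"
  have "\<exists>\<beta>\<in>?F. validA \<delta> \<beta>" if d: "\<delta> \<in> S" "validA \<delta> \<gamma>" for \<delta>
  proof (cases "fst \<delta> = NegInf")
    case True
    then have "\<delta> = (NegInf, a)" using arc_forms[OF d(1)] by fastforce
    then show ?thesis using d validA_refl by blast
  next
    case False
    then show ?thesis using F(3) d by blast
  qed
  moreover have "finite ?F" using F(1) by simp
  moreover have "?F \<subseteq> {\<delta> \<in> S. validA \<delta> \<gamma>}" using F(2) inf_in by blast
  ultimately show ?thesis by blast
qed

text \<open>The arcs \<open>(p, q)\<close> with \<open>p \<le> d\<close> either map through the infinite arc, or are confined by the
  fountain: to a finite set if \<open>p > a\<close>, and to \<open>q \<le> a\<close> if \<open>d < a\<close>.\<close>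
lemma cover_rightB:
  "\<exists>FA FB. finite FA \<and> FA \<subseteq> {\<delta> \<in> S. validA \<delta> \<gamma>} \<and> finite FB \<and> FB \<subseteq> {\<delta> \<in> S. validB \<delta> \<gamma>}
    \<and> (\<forall>\<delta>\<in>S. validB \<delta> \<gamma> \<longrightarrow> (\<exists>\<beta>\<in>FA. validB \<delta> \<beta>) \<or> (\<exists>\<beta>\<in>FB. validA \<delta> \<beta>))"
proof (cases "a \<le> snd \<gamma>")
  case True
  let ?FA = "{(NegInf, a)}" and ?FB = "{\<delta> \<in> S. \<exists>p q. \<delta> = (Fin p, q) \<and> a < p \<and> p \<le> snd \<gamma>}"
  have "(\<exists>\<beta>\<in>?FA. validB \<delta> \<beta>) \<or> (\<exists>\<beta>\<in>?FB. validA \<delta> \<beta>)" if d: "\<delta> \<in> S" "validB \<delta> \<gamma>" for \<delta>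
  proof -
    obtain p q where pq: "\<delta> = (Fin p, q)" "p \<le> snd \<gamma>" using d(2) by (cases \<delta>) (auto simp: validB_def)
    show ?thesis
    proof (cases "p \<le> a")
      case True then show ?thesis using pq by (simp add: validB_def)
    next
      case False
      then have "\<delta> \<in> ?FB" using d pq by auto
      then show ?thesis using validA_refl by blast
    qed
  qed
  moreover have "?FA \<subseteq> {\<delta> \<in> S. validA \<delta> \<gamma>}" using inf_in True by (auto simp: validA_def)
  moreover have "?FB \<subseteq> {\<delta> \<in> S. validB \<delta> \<gamma>}" by (auto simp: validB_def)
  ultimately show ?thesis using finite_right by (intro exI[of _ ?FA] exI[of _ ?FB]) simp
next
  case False
  let ?I = "{\<delta> \<in> S. validB \<delta> \<gamma>}"
  have "\<exists>F. finite F \<and> F \<subseteq> ?I \<and> (\<forall>\<delta>\<in>?I. \<exists>\<beta>\<in>F. validA \<delta> \<beta>)"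
  proof (rule finite_maximal_arcs[of _ "snd \<gamma>" a])
    fix \<delta> assume d: "\<delta> \<in> ?I"
    then obtain p q where pq: "\<delta> = (Fin p, q)" "p \<le> snd \<gamma>" by (cases \<delta>) (auto simp: validB_def)
    then show "\<exists>p q. \<delta> = (Fin p, q) \<and> p \<le> snd \<gamma> \<and> q \<le> a" using not_over[of p q] d False by auto
  qed
  then obtain F where "finite F" "F \<subseteq> ?I" "\<forall>\<delta>\<in>?I. \<exists>\<beta>\<in>F. validA \<delta> \<beta>" by blast
  then show ?thesis by (intro exI[of _ "{}"] exI[of _ F]) auto
qed

text \<open>The infinite arc maps by \<open>hA\<close> to every arc with right end at least
  \<open>a\<close>. For \<open>c \<le> a\<close> the left fountain leaves finitely many others; for
  \<open>c > a\<close> the arcs in question cannot pass over \<open>a\<close>, so both their ends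
  are bounded below.\<close>

lemma cover_left:
  "\<exists>F. finite F \<and> F \<subseteq> {\<delta> \<in> S. c \<le> snd \<delta>} \<and> (\<forall>\<delta>\<in>S. c \<le> snd \<delta> \<longrightarrow> (\<exists>\<beta>\<in>F. validA \<beta> \<delta>))"
proof (cases "c \<le> a")
  case True
  define F where "F = {(NegInf, a)} \<union> {\<delta> \<in> S. \<exists>p q. \<delta> = (Fin p, q) \<and> c \<le> q \<and> q < a}"
  have "\<exists>\<beta>\<in>F. validA \<beta> \<delta>" if d: "\<delta> \<in> S" "c \<le> snd \<delta>" for \<delta>
  proof (cases "a \<le> snd \<delta>")
    case True then show ?thesis by (simp add: validA_def F_def)
  next
    case False
    then have "\<delta> \<in> F" using d by (cases rule: arc_forms[OF d(1)]) (auto simp: F_def)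
    then show ?thesis using validA_refl by blast
  qed
  moreover have "finite F" using finite_left by (simp add: F_def)
  moreover have "F \<subseteq> {\<delta> \<in> S. c \<le> snd \<delta>}" using True inf_in by (auto simp: F_def)
  ultimately show ?thesis by blast
next
  case False
  let ?I = "{\<delta> \<in> S. c \<le> snd \<delta>}"
  have "\<exists>F. finite F \<and> F \<subseteq> ?I \<and> (\<forall>\<delta>\<in>?I. \<exists>\<beta>\<in>F. validA \<beta> \<delta>)"
  proof (rule finite_minimal_arcs[of _ a c])
    fix \<delta> assume d: "\<delta> \<in> ?I"
    then have "\<delta> \<in> S" by simp
    then show "\<exists>p q. \<delta> = (Fin p, q) \<and> a \<le> p \<and> c \<le> q"
      by (cases rule: arc_forms) (use d False in auto)
  qed
  then obtain F where "finite F" "F \<subseteq> ?I" "\<forall>\<delta>\<in>?I. \<exists>\<beta>\<in>F. validA \<beta> \<delta>" by blast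
  then show ?thesis by (intro exI[of _ F]) auto
qed

text \<open>From a finite \<open>\<gamma>\<close> the map \<open>hA\<close> reaches only finite arcs
  with both ends bounded below; from an infinite one the left end imposes no condition and
  \<open>cover_left\<close> applies.\<close>

lemma cover_leftA:
  "\<exists>F. finite F \<and> F \<subseteq> {\<delta> \<in> S. validA \<gamma> \<delta>} \<and> (\<forall>\<delta>\<in>S. validA \<gamma> \<delta> \<longrightarrow> (\<exists>\<beta>\<in>F. validA \<beta> \<delta>))"
proof (cases "fst \<gamma>")
  case NegInf
  then have "validA \<gamma> \<delta> \<longleftrightarrow> snd \<gamma> \<le> snd \<delta>" for \<delta> by (simp add: validA_def)
  then show ?thesis using cover_left[of "snd \<gamma>"] by simp
next
  case (Fin c)
  let ?I = "{\<delta> \<in> S. validA \<gamma> \<delta>}"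
  have "\<exists>F. finite F \<and> F \<subseteq> ?I \<and> (\<forall>\<delta>\<in>?I. \<exists>\<beta>\<in>F. validA \<beta> \<delta>)"
  proof (rule finite_minimal_arcs[of _ c "snd \<gamma>"])
    fix \<delta> assume "\<delta> \<in> ?I"
    then show "\<exists>p q. \<delta> = (Fin p, q) \<and> c \<le> p \<and> snd \<gamma> \<le> q"
      using Fin by (cases \<delta>; cases "fst \<delta>") (auto simp: validA_def)
  qed
  then obtain F where "finite F" "F \<subseteq> ?I" "\<forall>\<delta>\<in>?I. \<exists>\<beta>\<in>F. validA \<beta> \<delta>" by blast
  then show ?thesis by (intro exI[of _ F]) auto
qed

lemma cover_leftB:
  "\<exists>F. finite F \<and> F \<subseteq> {\<delta> \<in> S. validB \<gamma> \<delta>} \<and> (\<forall>\<delta>\<in>S. validB \<gamma> \<delta> \<longrightarrow> (\<exists>\<beta>\<in>F. validA \<beta> \<delta>))"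
proof (cases "fst \<gamma>")
  case NegInf
  then show ?thesis by (intro exI[of _ "{}"]) (simp add: validB_def)
next
  case (Fin c)
  then have "validB \<gamma> \<delta> \<longleftrightarrow> c \<le> snd \<delta>" for \<delta> by (simp add: validB_def)
  then show ?thesis using cover_left[of c] by simp
qed

end

section \<open>From a fountain triangulation to cluster tilting, and back\<close>

lemma arcs_cross_commute: "arcs_cross \<alpha> \<beta> \<longleftrightarrow> arcs_cross \<beta> \<alpha>"
  by (auto simp: arcs_cross_def split: prod.splits)

text \<open>There is only one infinite arc, so no two members of the triangulation are bad. An arc
  that is bad with no member, on either side, crosses none and belongs to it by maximality; this
  gives both perpendicular conditions.\<close>

lemma fountain_imp_cluster_tilting:
  assumes T: "subcat T" and tri: "triangulation (arcs_of T)" and fo: "has_fountain_at (arcs_of T) a"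
  shows "cluster_tilting T"
proof -
  let ?S = "arcs_of T"
  note t = tri[unfolded triangulation_def] and f = fo[unfolded fountain_iff]
  interpret fountain_triangulation ?S a
  proof
    show "is_arc \<delta>" if "\<delta> \<in> ?S" for \<delta> using t that by blast
    show "\<not> arcs_cross \<delta> \<beta>" if "\<delta> \<in> ?S" "\<beta> \<in> ?S" for \<delta> \<beta> using t that by blast
    show "\<delta> \<in> ?S" if "is_arc \<delta>" "\<And>\<beta>. \<beta> \<in> ?S \<Longrightarrow> \<not> arcs_cross \<delta> \<beta>" for \<delta> using t that by blast
    show "\<exists>q>x. (Fin a, q) \<in> ?S" "\<exists>p<x. (Fin p, a) \<in> ?S" for x using f by blast+
  qed
  have "right_approx T (amod \<gamma>)" if \<gamma>: "is_arc \<gamma>" for \<gamma>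
  proof -
    obtain F where F: "finite F \<and> F \<subseteq> {\<delta> \<in> ?S. validA \<delta> \<gamma>} \<and> (\<forall>\<delta>\<in>?S. validA \<delta> \<gamma> \<longrightarrow> (\<exists>\<beta>\<in>F. validA \<delta> \<beta>))"
      using cover_rightA[of \<gamma>] ..
    obtain FA FB where FB: "finite FA \<and> FA \<subseteq> {\<delta> \<in> ?S. validA \<delta> \<gamma>} \<and> finite FB \<and> FB \<subseteq> {\<delta> \<in> ?S. validB \<delta> \<gamma>}
       \<and> (\<forall>\<delta>\<in>?S. validB \<delta> \<gamma> \<longrightarrow> (\<exists>\<beta>\<in>FA. validB \<delta> \<beta>) \<or> (\<exists>\<beta>\<in>FB. validA \<delta> \<beta>))"
      using cover_rightB[of \<gamma>] by (elim exE)
    show ?thesis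
    proof (rule right_approx_arc[OF T \<gamma>])
      show "finite (F \<union> FA)" "F \<union> FA \<subseteq> ?S" "finite FB" "FB \<subseteq> ?S" using F FB by auto
      show "validA \<beta> \<gamma>" if "\<beta> \<in> F \<union> FA" for \<beta> using F FB that by auto
      show "validB \<beta> \<gamma>" if "\<beta> \<in> FB" for \<beta> using FB that by auto
      show "\<exists>\<beta>\<in>F \<union> FA. validA \<delta> \<beta>" if "\<delta> \<in> ?S" "validA \<delta> \<gamma>" for \<delta>
        using F that by (metis UnI1)
      show "(\<exists>\<beta>\<in>F \<union> FA. validB \<delta> \<beta>) \<or> (\<exists>\<beta>\<in>FB. validA \<delta> \<beta>)" if "\<delta> \<in> ?S" "validB \<delta> \<gamma>" for \<delta>
        using FB that by (metis UnI2)
    qed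
  qed
  then have "contrav_finite T" by (rule contrav_finiteI[OF T])
  moreover have "left_approx T (amod \<gamma>)" if \<gamma>: "is_arc \<gamma>" for \<gamma>
  proof -
    obtain FA where FA: "finite FA \<and> FA \<subseteq> {\<delta> \<in> ?S. validA \<gamma> \<delta>} \<and> (\<forall>\<delta>\<in>?S. validA \<gamma> \<delta> \<longrightarrow> (\<exists>\<beta>\<in>FA. validA \<beta> \<delta>))"
      using cover_leftA[of \<gamma>] ..
    obtain FB where FB: "finite FB \<and> FB \<subseteq> {\<delta> \<in> ?S. validB \<gamma> \<delta>} \<and> (\<forall>\<delta>\<in>?S. validB \<gamma> \<delta> \<longrightarrow> (\<exists>\<beta>\<in>FB. validA \<beta> \<delta>))"
      using cover_leftB[of \<gamma>] ..
    show ?thesis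
    proof (rule left_approx_arc[OF T \<gamma>])
      show "finite FA" "FA \<subseteq> ?S" "finite FB" "FB \<subseteq> ?S" using FA FB by auto
      show "validA \<gamma> \<beta>" if "\<beta> \<in> FA" for \<beta> using FA that by auto
      show "validB \<gamma> \<beta>" if "\<beta> \<in> FB" for \<beta> using FB that by auto
      show "\<exists>\<beta>\<in>FA. validA \<beta> \<delta>" if "\<delta> \<in> ?S" "validA \<gamma> \<delta>" for \<delta> using FA that by metis
      show "\<exists>\<beta>\<in>FB. validA \<beta> \<delta>" if "\<delta> \<in> ?S" "validB \<gamma> \<delta>" for \<delta> using FB that by metis
    qed
  qed
  then have "cov_finite T" by (rule cov_finiteI[OF T])
  moreover have "{M \<in> C2. \<forall>X\<in>T. ext1_zero X M} = T"
    unfolding right_perp_iff[OF T] using not_bad maximal arcs_cross_commute unfolding bad_def by blast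
  moreover have "{M \<in> C2. \<forall>X\<in>T. ext1_zero M X} = T"
    unfolding left_perp_iff[OF T] using not_bad maximal unfolding bad_def by blast
  ultimately show ?thesis unfolding cluster_tilting_def funct_finite_def by blast
qed

text \<open>A composite \<open>\<delta> \<rightarrow> \<alpha> \<rightarrow> (-\<infinity>, d)\<close> with \<open>\<alpha>\<close> finite is zero unless \<open>\<delta> \<rightarrow> \<alpha>\<close> involves \<open>hA\<close>, which
  requires \<open>snd \<delta> \<le> snd \<alpha>\<close>; and \<open>X\<close> has only finitely many summands \<open>\<alpha>\<close>.\<close>
lemma factor_bounded:
  assumes T: "subcat T" and noinf: "\<And>d. (NegInf, d) \<notin> arcs_of T" and X: "X \<in> C2" "X \<in> T"
    and f: "is_hom X (amod (NegInf, d)) f"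
  shows "\<exists>N. \<forall>\<delta> h. is_arc \<delta> \<longrightarrow> is_hom (amod \<delta>) X h \<longrightarrow> hcomp f h \<noteq> hzero (amod \<delta>) (amod (NegInf, d)) \<longrightarrow> snd \<delta> \<le> N"
  using X f
proof (induction X arbitrary: f rule: C2_induct)
  case (zero M)
  have "hcomp f h = hzero (amod \<delta>) (amod (NegInf, d))" if "is_arc \<delta>" "is_hom (amod \<delta>) M h" for \<delta> h
  proof -
    have "h = hzero (amod \<delta>) M" by (rule fam_zero_dim[OF _ is_homD(1)[OF that(2)] fam_hzero]) (simp add: zero)
    then show ?thesis using hcomp_hzero_right[OF is_homD(1)[OF zero(4)]] by simp
  qed
  then show ?case by blast
next
  case (biprod M \<alpha> N')
  let ?\<gamma> = "(NegInf, d)"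
  have \<gamma>: "is_arc ?\<gamma>" by (simp add: is_arc_def)
  note G = wf_amod[OF \<gamma>]
  note A = amod_C2[OF biprod(2)]
  note w = C2_wf[OF biprod(1)] C2_wf[OF A] C2_wf[OF biprod(3)]
  have TT: "amod \<alpha> \<in> T" "N' \<in> T" using subcat_biprod[OF T biprod(1) A biprod(3,4)] biprod by auto
  have "\<alpha> \<in> arcs_of T" using TT(1) biprod(2) by (simp add: arcs_of_def)
  then obtain u where u: "fst \<alpha> = Fin u" using noinf[of "snd \<alpha>"] by (cases \<alpha>; cases "fst \<alpha>") auto
  obtain i1 i2 p1 p2 where bb: "biprod_wit M (amod \<alpha>) N' i1 i2 p1 p2" using biprod(4) biprod_def by blast
  note bw = biprod_witD[OF bb]
  have fa: "is_hom (amod \<alpha>) (amod ?\<gamma>) (hcomp f i1)" by (rule is_hom_hcomp[OF w(2,1) G bw(1) biprod(7)])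
  have fn: "is_hom N' (amod ?\<gamma>) (hcomp f i2)" by (rule is_hom_hcomp[OF w(3,1) G bw(2) biprod(7)])
  obtain N where N: "\<And>\<delta> h. is_arc \<delta> \<Longrightarrow> is_hom (amod \<delta>) N' h \<Longrightarrow> hcomp (hcomp f i2) h \<noteq> hzero (amod \<delta>) (amod ?\<gamma>) \<Longrightarrow> snd \<delta> \<le> N"
    using biprod(5)[OF TT(2) fn] by blast
  have arc: "snd \<delta> \<le> snd \<alpha>"
    if \<delta>: "is_arc \<delta>" and h: "is_hom (amod \<delta>) (amod \<alpha>) h" and nz: "hcomp (hcomp f i1) h \<noteq> hzero (amod \<delta>) (amod ?\<gamma>)" for \<delta> h
  proof (rule ccontr)
    assume n: "\<not> snd \<delta> \<le> snd \<alpha>"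
    obtain p q where pq: "h = hadd (hsm p (hA \<delta> \<alpha>)) (hsm q (hB \<delta> \<alpha>))" "p \<noteq> 0 \<Longrightarrow> validA \<delta> \<alpha>" "q \<noteq> 0 \<Longrightarrow> validB \<delta> \<alpha>"
      using hom_arcs[OF \<delta> biprod(2) h] by blast
    obtain p' q' where pq': "hcomp f i1 = hadd (hsm p' (hA \<alpha> ?\<gamma>)) (hsm q' (hB \<alpha> ?\<gamma>))" "p' \<noteq> 0 \<Longrightarrow> validA \<alpha> ?\<gamma>"
      using hom_arcs[OF biprod(2) \<gamma> fa] by blast
    have "p = 0" using pq(2) n by (auto simp: validA_def)
    \<comment> \<open>A map \<open>hA\<close> from a finite to an infinite arc would need an image
      for \<open>f\<close> along a second generator, which an infinite arc does not have.\<close>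
    moreover have "p' = 0" using pq'(2) u by (auto simp: validA_def)
    ultimately have hh: "h = hsm q (hB \<delta> \<alpha>)" "hcomp f i1 = hsm q' (hB \<alpha> ?\<gamma>)"
      unfolding pq(1) pq'(1)
      using hsm_zero[OF fam_hAB(1)[OF \<delta> biprod(2)]] hadd_hzero_left[OF fam_hsm[OF fam_hAB(2)[OF \<delta> biprod(2)]]]
        hsm_zero[OF fam_hAB(1)[OF biprod(2) \<gamma>]] hadd_hzero_left[OF fam_hsm[OF fam_hAB(2)[OF biprod(2) \<gamma>]]] by simp_all
    have "hcomp (hcomp f i1) h = hzero (amod \<delta>) (amod ?\<gamma>)"
    proof (cases "q = 0")
      case True
      then have "h = hzero (amod \<delta>) (amod \<alpha>)" using hh(1) hsm_zero[OF fam_hAB(2)[OF \<delta> biprod(2)]] by simp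
      then show ?thesis using hcomp_hzero_right[OF is_homD(1)[OF fa]] by simp
    next
      case False
      then have vB: "validB \<delta> \<alpha>" by (rule pq(3))
      note FF = fam_hAB(2)[OF \<delta> biprod(2)] fam_hAB(2)[OF biprod(2) \<gamma>]
      have z: "hcomp (hB \<alpha> ?\<gamma>) (hB \<delta> \<alpha>) = hzero (amod \<delta>) (amod ?\<gamma>)"
      proof (rule fam_eq_on_av[OF \<delta> fam_hcomp[OF FF] fam_hzero])
        fix n s t assume ok: "okv \<delta> n s t"
        show "hcomp (hB \<alpha> ?\<gamma>) (hB \<delta> \<alpha>) n *\<^sub>v av \<delta> n s t = hzero (amod \<delta>) (amod ?\<gamma>) n *\<^sub>v av \<delta> n s t"
          unfolding hcomp_vec[OF FF av_carrier[OF \<delta>]] hB_av[OF \<delta> ok] hB_av[OF biprod(2) okv_validB[OF vB ok]]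
          unfolding hzero_def zero_mat_mult_vec[OF av_carrier[OF \<delta>]] using amod_sel(1)[OF \<gamma>, of n] by simp
      qed
      have "hcomp (hcomp f i1) h = hsm q' (hsm q (hcomp (hB \<alpha> ?\<gamma>) (hB \<delta> \<alpha>)))"
        unfolding hh(2) unfolding hh(1)
        unfolding hcomp_hsm_left[OF fam_hsm[OF FF(1)] FF(2)] hcomp_hsm_right[OF FF] ..
      then show ?thesis unfolding z by (simp add: hsm_def hzero_def)
    qed
    then show False using nz by simp
  qed
  have "snd \<delta> \<le> max N (snd \<alpha>)"
    if \<delta>: "is_arc \<delta>" and h: "is_hom (amod \<delta>) M h" and nz: "hcomp f h \<noteq> hzero (amod \<delta>) (amod ?\<gamma>)" for \<delta> h
  proof (rule ccontr)
    assume n: "\<not> snd \<delta> \<le> max N (snd \<alpha>)"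
    note D = wf_amod[OF \<delta>]
    have h1: "is_hom (amod \<delta>) (amod \<alpha>) (hcomp p1 h)" by (rule is_hom_hcomp[OF D w(1,2) h bw(3)])
    have h2: "is_hom (amod \<delta>) N' (hcomp p2 h)" by (rule is_hom_hcomp[OF D w(1,3) h bw(4)])
    note F = is_homD(1)[OF bw(1)] is_homD(1)[OF bw(2)] is_homD(1)[OF biprod(7)] is_homD(1)[OF h1] is_homD(1)[OF h2] is_homD(1)[OF h]
    have "hcomp f h = hcomp f (hadd (hcomp i1 (hcomp p1 h)) (hcomp i2 (hcomp p2 h)))"
      using hom_to_biprod[OF bb F(6)] by simp
    also have "\<dots> = hadd (hcomp (hcomp f i1) (hcomp p1 h)) (hcomp (hcomp f i2) (hcomp p2 h))"
      unfolding hcomp_hadd_right[OF fam_hcomp[OF F(4,1)] fam_hcomp[OF F(5,2)] F(3)]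
        hcomp_assoc[OF F(4,1,3)] hcomp_assoc[OF F(5,2,3)] ..
    also have "hcomp (hcomp f i1) (hcomp p1 h) = hzero (amod \<delta>) (amod ?\<gamma>)" using arc[OF \<delta> h1] n by linarith
    also have "hcomp (hcomp f i2) (hcomp p2 h) = hzero (amod \<delta>) (amod ?\<gamma>)" using N[OF \<delta> h2] n by linarith
    finally show False using nz hadd_hzero_left[OF fam_hzero] by simp
  qed
  then show ?case by blast
qed

text \<open>Each such arc has the nonzero map \<open>hB\<close> to \<open>(-\<infinity>, d)\<close>.
  It factors through one fixed approximation, and \<open>factor_bounded\<close> then limits the
  right end.\<close>

lemma finite_arcs_bounded:
  assumes T: "subcat T" and noinf: "\<And>d. (NegInf, d) \<notin> arcs_of T" and cf: "contrav_finite T"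
  shows "\<exists>N. \<forall>p q. (Fin p, q) \<in> arcs_of T \<longrightarrow> p \<le> d \<longrightarrow> q \<le> N"
proof -
  let ?\<gamma> = "(NegInf, d)"
  have \<gamma>: "is_arc ?\<gamma>" by (simp add: is_arc_def)
  obtain X f where X: "X \<in> T" "is_hom X (amod ?\<gamma>) f"
    "\<And>Y g. Y \<in> T \<Longrightarrow> is_hom Y (amod ?\<gamma>) g \<Longrightarrow> \<exists>h. is_hom Y X h \<and> hcomp f h = g"
    using cf amod_C2[OF \<gamma>] unfolding contrav_finite_def by metis
  obtain N where N: "\<And>\<delta> h. is_arc \<delta> \<Longrightarrow> is_hom (amod \<delta>) X h \<Longrightarrow> hcomp f h \<noteq> hzero (amod \<delta>) (amod ?\<gamma>) \<Longrightarrow> snd \<delta> \<le> N"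
    using factor_bounded[OF T noinf subcat_C2[OF T X(1)] X(1,2)] by blast
  have "q \<le> N" if s: "(Fin p, q) \<in> arcs_of T" and p: "p \<le> d" for p q
  proof -
    let ?\<delta> = "(Fin p, q)"
    have \<delta>: "is_arc ?\<delta>" "amod ?\<delta> \<in> T" using s by (auto simp: arcs_of_def)
    have v: "validB ?\<delta> ?\<gamma>" using p by (simp add: validB_def)
    obtain h where h: "is_hom (amod ?\<delta>) X h" "hcomp f h = hB ?\<delta> ?\<gamma>" using X(3)[OF \<delta>(2) is_hom_hB[OF \<delta>(1) \<gamma> v]] by blast
    have ok: "okv ?\<delta> p 0 1" "okv ?\<gamma> p 1 0" using p by (auto simp: okv_def)
    have "hB ?\<delta> ?\<gamma> p *\<^sub>v av ?\<delta> p 0 1 \<noteq> hzero (amod ?\<delta>) (amod ?\<gamma>) p *\<^sub>v av ?\<delta> p 0 1"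
      unfolding hB_av[OF \<delta>(1) ok(1)] hzero_def zero_mat_mult_vec[OF av_carrier[OF \<delta>(1)]]
      using av_eq_0_iff[OF \<gamma> ok(2)] amod_sel(1)[OF \<gamma>, of p] by simp
    then have "hcomp f h \<noteq> hzero (amod ?\<delta>) (amod ?\<gamma>)" unfolding h(2) by metis
    then show ?thesis using N[OF \<delta>(1) h(1)] by simp
  qed
  then show ?thesis by blast
qed

lemma cluster_tilting_imp_fountain:
  assumes T: "subcat T" and ct: "cluster_tilting T"
  shows "triangulation (arcs_of T) \<and> (\<exists>a. has_fountain_at (arcs_of T) a)"
proof -
  define S where "S = arcs_of T"
  have "{M \<in> C2. \<forall>X\<in>T. ext1_zero X M} = T" "{M \<in> C2. \<forall>X\<in>T. ext1_zero M X} = T"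
    using ct unfolding cluster_tilting_def by simp_all
  then have R: "\<And>\<gamma>. is_arc \<gamma> \<Longrightarrow> \<gamma> \<in> S \<longleftrightarrow> (\<forall>\<beta>\<in>S. \<not> bad \<beta> \<gamma>)"
    and L: "\<And>\<gamma>. is_arc \<gamma> \<Longrightarrow> \<gamma> \<in> S \<longleftrightarrow> (\<forall>\<beta>\<in>S. \<not> bad \<gamma> \<beta>)"
    unfolding right_perp_iff[OF T] left_perp_iff[OF T] S_def by blast+
  have arc: "is_arc \<delta>" if "\<delta> \<in> S" for \<delta> using that by (simp add: S_def arcs_of_def)
  have nc: "\<not> arcs_cross \<beta> \<gamma>" if "\<beta> \<in> S" "\<gamma> \<in> S" for \<beta> \<gamma>
    using R[OF arc[OF that(2)]] that by (auto simp: bad_def)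
  have infarc: "is_arc (NegInf, d)" for d by (simp add: is_arc_def)
  have uniq: "d = d'" if "(NegInf, d) \<in> S" "(NegInf, d') \<in> S" for d d'
    using R[OF infarc, of d] R[OF infarc, of d'] that by (force simp: bad_def)
  have "\<exists>a. (NegInf, a) \<in> S"
  proof (rule ccontr)
    assume "\<nexists>a. (NegInf, a) \<in> S"
    then have no: "(NegInf, d) \<notin> S" for d by blast
    obtain N where N: "\<And>p q. (Fin p, q) \<in> S \<Longrightarrow> p \<le> 0 \<Longrightarrow> q \<le> N"
      using finite_arcs_bounded[OF T no[unfolded S_def], of 0] ct
      unfolding cluster_tilting_def funct_finite_def S_def by blast
    \<comment> \<open>Without infinite arcs in \<open>S\<close>, what keeps
      \<open>(-\<infinity>, b)\<close> out of \<open>S\<close> must be a finite arc passing over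
      \<open>b\<close>.\<close>
    have over: "\<exists>p q. (Fin p, q) \<in> S \<and> p < b \<and> b < q" for b
    proof -
      obtain \<beta> where \<beta>: "\<beta> \<in> S" "bad \<beta> (NegInf, b)" using R[OF infarc] no by blast
      obtain p where "fst \<beta> = Fin p" using \<beta>(1) no[of "snd \<beta>"] by (cases \<beta>; cases "fst \<beta>") auto
      then show ?thesis using \<beta> by (cases \<beta>) (auto simp: bad_def arcs_cross_def)
    qed
    \<comment> \<open>Among the arcs over 0, whose right ends are bounded by \<open>N\<close>, one
      with the largest right end \<open>q\<close> is taken. Some arc passes over \<open>q\<close>;
      not crossing the first one, it starts no later, so it also passes over 0 and ends further
      right.\<close>
    let ?P = "\<lambda>q. \<exists>p. (Fin p, q) \<in> S \<and> p < 0 \<and> 0 < q"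
    obtain q0 where "?P q0" using over[of 0] by blast
    moreover have "q \<le> N" if "?P q" for q using that N by force
    ultimately obtain q where q: "?P q" "\<And>q'. ?P q' \<Longrightarrow> q' \<le> q" using int_ex_max[of ?P q0 N] by blast
    obtain p where p: "(Fin p, q) \<in> S" "p < 0" "0 < q" using q(1) by blast
    obtain p' q' where pq': "(Fin p', q') \<in> S" "p' < q" "q < q'" using over by blast
    have "p' \<le> p" using nc[OF p(1) pq'(1)] pq'(2,3) by (auto simp: arcs_cross_def)
    then show False using q(2)[of q'] pq' p by fastforce
  qed
  then obtain a where a: "(NegInf, a) \<in> S" by blast
  have fin: "p < q \<and> (q \<le> a \<or> a \<le> p)" if "(Fin p, q) \<in> S" for p q
    using nc[OF that a] arc[OF that] by (auto simp: arcs_cross_def is_arc_def)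
  \<comment> \<open>An arc of length one crosses nothing, so it is always present; at
    \<open>a\<close> these arcs make the sets of ends nonempty whose extremal elements are taken
    below.\<close>
  have short: "(Fin n, n + 1) \<in> S" for n
  proof -
    have "\<not> bad \<beta> (Fin n, n + 1)" for \<beta> by (cases \<beta>; cases "fst \<beta>") (auto simp: bad_def arcs_cross_def)
    then show ?thesis using R[of "(Fin n, n + 1)"] by (simp add: is_arc_def)
  qed
  have right: "\<exists>q>x. (Fin a, q) \<in> S" for x
  proof (rule ccontr)
    assume "\<not> ?thesis"
    then have "q \<le> x" if "(Fin a, q) \<in> S" for q using that by force
    then obtain b where b: "(Fin a, b) \<in> S" "\<And>q. (Fin a, q) \<in> S \<Longrightarrow> q \<le> b"
      using int_ex_max[of "\<lambda>q. (Fin a, q) \<in> S" "a + 1" x] short[of a] by blast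
    have ab: "a < b" using fin[OF b(1)] by simp
    then have "(NegInf, b) \<notin> S" using uniq[OF a] by blast
    \<comment> \<open>The left condition is used because \<open>bad (NegInf, b) (NegInf, a)\<close>
      fails for \<open>a < b\<close>, so the obstruction is a finite arc over \<open>b\<close>.
      Crossing neither \<open>(a, b)\<close> nor \<open>(-\<infinity>, a)\<close>, it must start at
      \<open>a\<close>, against the choice of \<open>b\<close>.\<close>
    then obtain \<beta> where \<beta>: "\<beta> \<in> S" "bad (NegInf, b) \<beta>" using L[OF infarc] by blast
    show False
    proof (cases "fst \<beta>")
      case NegInf
      then have "snd \<beta> = a" using uniq[OF a, of "snd \<beta>"] \<beta>(1) by (cases \<beta>) auto
      then show False using \<beta>(2) NegInf ab by (cases \<beta>) (auto simp: bad_def arcs_cross_def)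
    next
      case (Fin p)
      then obtain q where q: "\<beta> = (Fin p, q)" by (cases \<beta>) auto
      then have pq: "p < b" "b < q" using \<beta>(2) by (auto simp: bad_def arcs_cross_def)
      have "p \<le> a" using nc[OF b(1)] \<beta>(1) pq q by (force simp: arcs_cross_def)
      then have "p = a" using fin \<beta>(1) q pq ab by force
      then show False using b(2) \<beta>(1) q pq by force
    qed
  qed
  have left: "\<exists>p<x. (Fin p, a) \<in> S" for x
  proof (rule ccontr)
    assume "\<not> ?thesis"
    \<comment> \<open>Left ends are negated so that the smallest one is obtained as a
      maximum.\<close>
    then have "- x \<ge> p" if "(Fin (- p), a) \<in> S" for p using that by force
    then obtain m where m: "(Fin (- m), a) \<in> S" "\<And>p. (Fin (- p), a) \<in> S \<Longrightarrow> p \<le> m"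
      using int_ex_max[of "\<lambda>p. (Fin (- p), a) \<in> S" "1 - a" "- x"] short[of "a - 1"] by auto
    define c where "c = - m"
    have c: "(Fin c, a) \<in> S" "\<And>p. (Fin p, a) \<in> S \<Longrightarrow> c \<le> p" using m(1) m(2)[of "- p" for p] by (force simp: c_def)+
    have ca: "c < a" using fin[OF c(1)] by simp
    then have "(NegInf, c) \<notin> S" using uniq[OF a] by blast
    \<comment> \<open>Now the right condition is the useful one, since
      \<open>bad (NegInf, a) (NegInf, c)\<close> fails for \<open>c < a\<close>. The finite arc over
      \<open>c\<close> is forced to end at \<open>a\<close>, against the choice of
      \<open>c\<close>.\<close>
    then obtain \<beta> where \<beta>: "\<beta> \<in> S" "bad \<beta> (NegInf, c)" using R[OF infarc] by blast
    show False
    proof (cases "fst \<beta>")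
      case NegInf
      then have "snd \<beta> = a" using uniq[OF a, of "snd \<beta>"] \<beta>(1) by (cases \<beta>) auto
      then show False using \<beta>(2) NegInf ca by (cases \<beta>) (auto simp: bad_def arcs_cross_def)
    next
      case (Fin p)
      then obtain q where q: "\<beta> = (Fin p, q)" by (cases \<beta>) auto
      then have pq: "p < c" "c < q" using \<beta>(2) by (auto simp: bad_def arcs_cross_def)
      have "a \<le> q" using nc[OF c(1)] \<beta>(1) pq q by (force simp: arcs_cross_def)
      then have "q = a" using fin \<beta>(1) q pq ca by force
      then show False using c(2) \<beta>(1) q pq by force
    qed
  qed
  \<comment> \<open>For a finite arc \<open>bad\<close> is the same as crossing. An infinite arc
    that crosses nothing must be \<open>(-\<infinity>, a)\<close>, because the fountain crosses all
    the others.\<close>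
  have "\<alpha> \<in> S" if \<alpha>: "is_arc \<alpha>" and n: "\<forall>\<beta>\<in>S. \<not> arcs_cross \<alpha> \<beta>" for \<alpha>
  proof (cases "fst \<alpha>")
    case (Fin p)
    then show ?thesis using L[OF \<alpha>] n by (simp add: bad_def)
  next
    case NegInf
    then obtain d where d: "\<alpha> = (NegInf, d)" by (cases \<alpha>) auto
    have "d = a"
    proof (rule ccontr)
      assume "d \<noteq> a"
      then consider "a < d" | "d < a" by linarith
      then show False
      proof cases
        case 1
        obtain q where "q > d" "(Fin a, q) \<in> S" using right by blast
        then show False using n 1 d by (force simp: arcs_cross_def)
      next
        case 2
        obtain p where "p < d" "(Fin p, a) \<in> S" using left by blast
        then show False using n 2 d by (force simp: arcs_cross_def)
      qed
    qed
    then show ?thesis using a d by simp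
  qed
  then have "triangulation S" unfolding triangulation_def using arc nc by blast
  moreover have "has_fountain_at S a" unfolding fountain_iff using right left by blast
  ultimately show ?thesis unfolding S_def by blast
qed

theorem theorem4p11:
  assumes "subcat T"
  shows "cluster_tilting T \<longleftrightarrow>
           (triangulation (arcs_of T) \<and> (\<exists>a::int. has_fountain_at (arcs_of T) a))"
  using cluster_tilting_imp_fountain[OF assms] fountain_imp_cluster_tilting[OF assms] by blast

end
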